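(* Let $X=\mathbf{H}^3$ be three-dimensional hyperbolic space with Riemannian distance $d$ and Riemannian measure $\mu$, and let $H=-\overline{\Delta}$ be the non-negative self-adjoint Laplace–Beltrami operator on $L^2(X,\mu)$ (the closure of $-\Delta$ on $C_c^\infty(X)$). If $\lambda>0$ and $t>0$ then $\mathrm{e}^{-Ht}$ and $(H+\lambda I)^{-1}$ both lie in the standard $C^*$-algebra $\mathcal{A}$ associated with $(X,d,\mu)$.
   Context: In the upper half space model $\mathbf{H}^3=\{x\in\mathbb{R}^3:x_3>0\}$ with Riemannian metric $ds^2=(dx_1^2+dx_2^2+dx_3^2)/x_3^2$, global distance given by $\cosh(d(x,y))=1+\frac{|x-y|^2}{2x_3y_3}$ and volume element $\mu(dx)=dx_1dx_2dx_3/x_3^3$. The standard $C^*$-algebra $\mathcal{A}\subseteq\mathcal{L}(L^2(X,\mu))$: for an open ball $B(a,r)=\{x\in X:d(x,a)<r\}$ let $P_{a,r}$ be multiplication by its characteristic function. For integers $m\ge 0$, $\mathcal{A}_m$ is the set of bounded operators $A$ on $L^2(X,\mu)$ such that, for all $a,b\in X$ and $r,s>0$, $P_{a,r}AP_{b,s}\ne0$ implies $d(a,b)\le r+s+m$. $\mathcal{A}$ is the norm closure of $\bigcup_{m=0}^\infty\mathcal{A}_m$. *)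

theory Defs
  imports "HOL-Analysis.Analysis"
begin

subsection \<open>The upper half space model of hyperbolic 3-space\<close>

definition hyp3 :: "(real ^ 3) set" where
  "hyp3 = {x. 0 < x $ 3}"

definition hyp_dist :: "real ^ 3 \<Rightarrow> real ^ 3 \<Rightarrow> real" where
  "hyp_dist x y = arcosh (1 + (norm (x - y))\<^sup>2 / (2 * x $ 3 * y $ 3))"

definition hyp_ball :: "real ^ 3 \<Rightarrow> real \<Rightarrow> (real ^ 3) set" where
  "hyp_ball a r = {x \<in> hyp3. hyp_dist x a < r}"

definition hyp_measure :: "(real ^ 3) measure" where
  "hyp_measure = density (restrict_space lborel hyp3) (\<lambda>x. ennreal (1 / (x $ 3) ^ 3))"

lemma sets_hyp_measure [measurable_cong]:
  "sets hyp_measure = sets (restrict_space borel hyp3)"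
  unfolding hyp_measure_def by (simp cong: sets_restrict_space_cong)

lemma space_hyp_measure [simp]: "space hyp_measure = hyp3"
  by (simp add: hyp_measure_def space_restrict_space)

lemma hyp_ball_indicator_measurable:
  "(indicator (hyp_ball a r) :: real ^ 3 \<Rightarrow> real) \<in> borel_measurable hyp_measure"
proof -
  have "(\<lambda>x::real^3. hyp_dist x a) \<in> borel_measurable borel"
    unfolding hyp_dist_def arcosh_def by measurable
  then have "{x \<in> space borel. hyp_dist x a < r} \<in> sets borel"
    by measurable
  then have "(indicator {x. hyp_dist x a < r} :: real ^ 3 \<Rightarrow> real) \<in> borel_measurable borel"
    by simp
  then have "(indicator {x. hyp_dist x a < r} :: real ^ 3 \<Rightarrow> real) \<in> borel_measurable hyp_measure"
    by (simp add: measurable_restrict_space1 measurable_cong_sets[OF sets_hyp_measure refl])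
  then show ?thesis
    by (rule measurable_cong[THEN iffD1, rotated])
      (auto simp: hyp_ball_def indicator_def)
qed


subsection \<open>The Hilbert space of square integrable complex functions\<close>

definition square_integrable :: "(real ^ 3 \<Rightarrow> complex) \<Rightarrow> bool" where
  "square_integrable f \<longleftrightarrow>
     f \<in> borel_measurable hyp_measure \<and> integrable hyp_measure (\<lambda>x. (norm (f x))\<^sup>2)"

definition L2_rel :: "(real ^ 3 \<Rightarrow> complex) \<Rightarrow> (real ^ 3 \<Rightarrow> complex) \<Rightarrow> bool" where
  "L2_rel f g \<longleftrightarrow> square_integrable f \<and> square_integrable g \<and> (AE x in hyp_measure. f x = g x)"

lemma square_integrable_zero: "square_integrable (\<lambda>x. 0)"
  by (simp add: square_integrable_def)

quotient_type hyp_L2 = "real ^ 3 \<Rightarrow> complex" / partial: L2_rel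
proof (rule part_equivpI)
  show "\<exists>f. L2_rel f f"
    using square_integrable_zero by (auto simp: L2_rel_def)
  show "symp L2_rel"
    by (auto simp: symp_def L2_rel_def eq_commute)
  show "transp L2_rel"
    unfolding transp_def L2_rel_def by (auto elim: AE_mp)
qed

lemma square_integrable_scale:
  assumes "square_integrable f"
  shows "square_integrable (\<lambda>x. c * f x)"
  using assms by (auto simp: square_integrable_def norm_mult power_mult_distrib)

lemma square_integrable_add:
  assumes "square_integrable f" "square_integrable g"
  shows "square_integrable (\<lambda>x. f x + g x)"
  unfolding square_integrable_def
proof
  have [measurable]: "f \<in> borel_measurable hyp_measure" "g \<in> borel_measurable hyp_measure"
    using assms by (auto simp: square_integrable_def)
  show "(\<lambda>x. f x + g x) \<in> borel_measurable hyp_measure" by measurable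
  have bound: "(norm (u + v))\<^sup>2 \<le> 2 * (norm u)\<^sup>2 + 2 * (norm v)\<^sup>2" for u v :: complex
  proof -
    have "(norm (u + v))\<^sup>2 \<le> (norm u + norm v)\<^sup>2"
      by (intro power_mono norm_triangle_ineq) auto
    also have "\<dots> \<le> 2 * (norm u)\<^sup>2 + 2 * (norm v)\<^sup>2"
      using sum_squares_bound[of "norm u" "norm v"] by (simp add: power2_sum)
    finally show ?thesis .
  qed
  show "integrable hyp_measure (\<lambda>x. (norm (f x + g x))\<^sup>2)"
  proof (rule Bochner_Integration.integrable_bound)
    show "integrable hyp_measure (\<lambda>x. 2 * (norm (f x))\<^sup>2 + 2 * (norm (g x))\<^sup>2)"
      using assms by (auto simp: square_integrable_def)
    show "AE x in hyp_measure. norm ((norm (f x + g x))\<^sup>2)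
            \<le> norm (2 * (norm (f x))\<^sup>2 + 2 * (norm (g x))\<^sup>2)"
      using bound by (intro AE_I2) auto
  qed measurable
qed

lemma integrable_inner_square_integrable:
  assumes "square_integrable f" "square_integrable g"
  shows "integrable hyp_measure (\<lambda>x. f x \<bullet> g x)"
proof (rule Bochner_Integration.integrable_bound)
  have [measurable]: "f \<in> borel_measurable hyp_measure" "g \<in> borel_measurable hyp_measure"
    using assms by (auto simp: square_integrable_def)
  show "(\<lambda>x. f x \<bullet> g x) \<in> borel_measurable hyp_measure" by measurable
  show "integrable hyp_measure (\<lambda>x. (norm (f x))\<^sup>2 + (norm (g x))\<^sup>2)"
    using assms by (auto simp: square_integrable_def)
  have "\<bar>u \<bullet> v\<bar> \<le> (norm u)\<^sup>2 + (norm v)\<^sup>2" for u v :: complex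
  proof -
    have "\<bar>u \<bullet> v\<bar> \<le> norm u * norm v" by (rule Cauchy_Schwarz_ineq2)
    also have "\<dots> \<le> 2 * norm u * norm v"
      using mult_nonneg_nonneg[of "norm u" "norm v"] by simp
    also have "\<dots> \<le> (norm u)\<^sup>2 + (norm v)\<^sup>2" by (rule sum_squares_bound)
    finally show ?thesis .
  qed
  then show "AE x in hyp_measure. norm (f x \<bullet> g x) \<le> norm ((norm (f x))\<^sup>2 + (norm (g x))\<^sup>2)"
    by (intro AE_I2) auto
qed

text \<open>
  The instance below uses the real part of the complex inner product
  (on \<^typ>\<open>complex\<close>, \<open>u \<bullet> v\<close> is the real part of \<open>u * cnj v\<close>);
  its norm is the usual \<open>L\<^sup>2\<close> norm.
\<close>

instantiation hyp_L2 :: real_inner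
begin

lift_definition zero_hyp_L2 :: hyp_L2 is "\<lambda>x. 0"
  by (simp add: L2_rel_def square_integrable_zero)

lift_definition plus_hyp_L2 :: "hyp_L2 \<Rightarrow> hyp_L2 \<Rightarrow> hyp_L2" is "\<lambda>f g x. f x + g x"
  unfolding L2_rel_def by (auto intro: square_integrable_add)

lift_definition uminus_hyp_L2 :: "hyp_L2 \<Rightarrow> hyp_L2" is "\<lambda>f x. - f x"
  unfolding L2_rel_def using square_integrable_scale[where c = "-1"] by auto

lift_definition scaleR_hyp_L2 :: "real \<Rightarrow> hyp_L2 \<Rightarrow> hyp_L2" is "\<lambda>r f x. complex_of_real r * f x"
  unfolding L2_rel_def by (auto intro: square_integrable_scale)

lift_definition inner_hyp_L2 :: "hyp_L2 \<Rightarrow> hyp_L2 \<Rightarrow> real" is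
  "\<lambda>f g. integral\<^sup>L hyp_measure (\<lambda>x. f x \<bullet> g x)"
  by (rule integral_cong_AE) (auto simp: L2_rel_def square_integrable_def)

definition minus_hyp_L2 :: "hyp_L2 \<Rightarrow> hyp_L2 \<Rightarrow> hyp_L2" where
  "f - g = f + - (g :: hyp_L2)"

definition norm_hyp_L2 :: "hyp_L2 \<Rightarrow> real" where
  "norm f = sqrt (f \<bullet> (f :: hyp_L2))"

definition dist_hyp_L2 :: "hyp_L2 \<Rightarrow> hyp_L2 \<Rightarrow> real" where
  "dist f g = norm (f - g :: hyp_L2)"

definition sgn_hyp_L2 :: "hyp_L2 \<Rightarrow> hyp_L2" where
  "sgn f = inverse (norm f) *\<^sub>R (f :: hyp_L2)"

definition uniformity_hyp_L2 :: "(hyp_L2 \<times> hyp_L2) filter" where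
  "uniformity = (INF e\<in>{0<..}. principal {(f, g :: hyp_L2). dist f g < e})"

definition open_hyp_L2 :: "hyp_L2 set \<Rightarrow> bool" where
  "open U \<longleftrightarrow> (\<forall>f\<in>U. eventually (\<lambda>(f', g). f' = f \<longrightarrow> g \<in> U) (uniformity :: (hyp_L2 \<times> hyp_L2) filter))"

instance
proof
  fix f g h :: hyp_L2 and r s :: real
  show "f + g + h = f + (g + h)"
    by transfer (auto simp: L2_rel_def add.assoc intro!: square_integrable_add)
  show "f + g = g + f"
    by transfer (auto simp: L2_rel_def add.commute intro!: square_integrable_add)
  show "0 + f = f"
    by transfer (auto simp: L2_rel_def)
  show "- f + f = 0"
    by transfer (auto simp: L2_rel_def square_integrable_zero)
  show "f - g = f + - g"
    by (rule minus_hyp_L2_def)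
  show "r *\<^sub>R (f + g) = r *\<^sub>R f + r *\<^sub>R g"
    by transfer (auto simp: L2_rel_def distrib_left intro!: square_integrable_add square_integrable_scale)
  show "(r + s) *\<^sub>R f = r *\<^sub>R f + s *\<^sub>R f"
    by transfer (auto simp: L2_rel_def distrib_right intro!: square_integrable_add square_integrable_scale)
  show "r *\<^sub>R s *\<^sub>R f = (r * s) *\<^sub>R f"
    by transfer (auto simp: L2_rel_def mult.assoc intro!: square_integrable_scale)
  show "1 *\<^sub>R f = f"
    by transfer (auto simp: L2_rel_def)
  show "f \<bullet> g = g \<bullet> f"
    by transfer (simp add: inner_commute)
  show "(f + g) \<bullet> h = f \<bullet> h + g \<bullet> h"
    by transfer
      (simp add: L2_rel_def inner_add_left Bochner_Integration.integral_add integrable_inner_square_integrable)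
  show "(r *\<^sub>R f) \<bullet> g = r * (f \<bullet> g)"
    by transfer (simp add: scaleR_conv_of_real[symmetric])
  show "0 \<le> f \<bullet> f"
    by transfer simp
  show "f \<bullet> f = 0 \<longleftrightarrow> f = 0"
  proof transfer
    fix f assume "L2_rel f f"
    then have f: "square_integrable f" by (simp add: L2_rel_def)
    then have "integral\<^sup>L hyp_measure (\<lambda>x. f x \<bullet> f x) = 0 \<longleftrightarrow> (AE x in hyp_measure. f x \<bullet> f x = 0)"
      by (intro integral_nonneg_eq_0_iff_AE integrable_inner_square_integrable) auto
    then show "integral\<^sup>L hyp_measure (\<lambda>x. f x \<bullet> f x) = 0 \<longleftrightarrow> L2_rel f (\<lambda>x. 0)"
      using f by (simp add: L2_rel_def square_integrable_zero)
  qed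
qed (rule norm_hyp_L2_def dist_hyp_L2_def sgn_hyp_L2_def uniformity_hyp_L2_def open_hyp_L2_def)+

end

lift_definition scaleC_L2 :: "complex \<Rightarrow> hyp_L2 \<Rightarrow> hyp_L2" is "\<lambda>c f x. c * f x"
  unfolding L2_rel_def by (auto intro: square_integrable_scale)


subsection \<open>Bounded operators and the standard algebra\<close>

text \<open>
  Elements of \<^typ>\<open>hyp_L2 \<Rightarrow>\<^sub>L hyp_L2\<close> are only real linear, so complex linearity is imposed separately.
  The real and complex operator norms agree.
\<close>

definition bounded_ops :: "(hyp_L2 \<Rightarrow>\<^sub>L hyp_L2) set" where
  "bounded_ops = {A :: hyp_L2 \<Rightarrow>\<^sub>L hyp_L2. \<forall>c f. A (scaleC_L2 c f) = scaleC_L2 c (A f)}"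

lemma square_integrable_indicator:
  assumes "square_integrable f"
  shows "square_integrable (\<lambda>x. of_real (indicator (hyp_ball a r) x) * f x)"
  unfolding square_integrable_def
proof
  have [measurable]: "f \<in> borel_measurable hyp_measure"
    "(indicator (hyp_ball a r) :: real ^ 3 \<Rightarrow> real) \<in> borel_measurable hyp_measure"
    using assms by (auto simp: square_integrable_def hyp_ball_indicator_measurable)
  show "(\<lambda>x. of_real (indicator (hyp_ball a r) x) * f x) \<in> borel_measurable hyp_measure"
    by measurable
  show "integrable hyp_measure (\<lambda>x. (norm (of_real (indicator (hyp_ball a r) x) * f x))\<^sup>2)"
  proof (rule Bochner_Integration.integrable_bound)
    show "integrable hyp_measure (\<lambda>x. (norm (f x))\<^sup>2)"
      using assms by (simp add: square_integrable_def)
    show "AE x in hyp_measure. norm ((norm (of_real (indicator (hyp_ball a r) x) * f x))\<^sup>2)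
            \<le> norm ((norm (f x))\<^sup>2)"
      by (intro AE_I2) (auto simp: indicator_def)
  qed measurable
qed

lift_definition ball_cutoff :: "real ^ 3 \<Rightarrow> real \<Rightarrow> hyp_L2 \<Rightarrow> hyp_L2" is
  "\<lambda>a r f x. of_real (indicator (hyp_ball a r) x) * f x"
  unfolding L2_rel_def by (auto intro: square_integrable_indicator)

lemma bounded_linear_ball_cutoff: "bounded_linear (ball_cutoff a r)"
proof (rule bounded_linear_intro[where K = 1])
  show "ball_cutoff a r (f + g) = ball_cutoff a r f + ball_cutoff a r g" for f g
    by transfer (auto simp: L2_rel_def distrib_left intro!: square_integrable_add square_integrable_indicator)
  show "ball_cutoff a r (c *\<^sub>R f) = c *\<^sub>R ball_cutoff a r f" for c f
    by transfer (auto simp: L2_rel_def mult.left_commute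
        intro!: square_integrable_scale square_integrable_indicator)
  have "ball_cutoff a r f \<bullet> ball_cutoff a r f \<le> f \<bullet> f" for f
  proof transfer
    fix a r f assume "L2_rel f f"
    then have f: "square_integrable f" by (simp add: L2_rel_def)
    show "integral\<^sup>L hyp_measure (\<lambda>x. (of_real (indicator (hyp_ball a r) x) * f x)
            \<bullet> (of_real (indicator (hyp_ball a r) x) * f x))
          \<le> integral\<^sup>L hyp_measure (\<lambda>x. f x \<bullet> f x)"
      by (intro integral_mono integrable_inner_square_integrable square_integrable_indicator f)
        (auto simp: indicator_def)
  qed
  then show "norm (ball_cutoff a r f) \<le> norm f * 1" for f
    by (simp add: norm_eq_sqrt_inner)
qed

lift_definition ball_proj :: "real ^ 3 \<Rightarrow> real \<Rightarrow> hyp_L2 \<Rightarrow>\<^sub>L hyp_L2" is ball_cutoff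
  by (rule bounded_linear_ball_cutoff)

definition std_alg_range :: "nat \<Rightarrow> (hyp_L2 \<Rightarrow>\<^sub>L hyp_L2) set" where
  "std_alg_range m = {A \<in> bounded_ops. \<forall>a\<in>hyp3. \<forall>b\<in>hyp3. \<forall>r>0. \<forall>s>0.
     ball_proj a r o\<^sub>L A o\<^sub>L ball_proj b s \<noteq> 0 \<longrightarrow> hyp_dist a b \<le> r + s + real m}"

definition std_alg :: "(hyp_L2 \<Rightarrow>\<^sub>L hyp_L2) set" where
  "std_alg = closure (\<Union>m. std_alg_range m)"


subsection \<open>The Laplace--Beltrami operator\<close>

definition pderiv_at :: "3 \<Rightarrow> (real ^ 3 \<Rightarrow> complex) \<Rightarrow> real ^ 3 \<Rightarrow> complex" where
  "pderiv_at i f x = frechet_derivative f (at x) (axis i 1)"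

text \<open>
  For open \<open>U\<close> this is \<open>C\<^sup>\<infinity>\<close>: if all iterated partial derivatives are (Frechet)
  differentiable on \<open>U\<close>, then they are also all continuous there.
\<close>

definition smooth_on :: "(real ^ 3) set \<Rightarrow> (real ^ 3 \<Rightarrow> complex) \<Rightarrow> bool" where
  "smooth_on U f \<longleftrightarrow> (\<forall>js. \<forall>x\<in>U. foldr pderiv_at js f differentiable (at x))"

definition test_functions :: "(real ^ 3 \<Rightarrow> complex) set" where
  "test_functions = {f. smooth_on hyp3 f \<and>
     (\<exists>K. compact K \<and> K \<subseteq> hyp3 \<and> (\<forall>x. x \<notin> K \<longrightarrow> f x = 0))}"

text \<open>
  In coordinates the Laplace--Beltrami operator is the sum over \<open>i, j\<close> of
  \<open>(1 / sqrt (det g)) * \<partial>\<^sub>i (sqrt (det g) * g\<^sup>i\<^sup>j * \<partial>\<^sub>j f)\<close>.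
  Here the metric is \<open>g = x\<^sub>3\<^sup>-\<^sup>2 * I\<close>, so that \<open>sqrt (det g) = x\<^sub>3\<^sup>-\<^sup>3\<close>
  and \<open>sqrt (det g) * g\<^sup>i\<^sup>j\<close> is \<open>1 / x\<^sub>3\<close> on the diagonal and zero off it.
\<close>

definition hyp_laplacian :: "(real ^ 3 \<Rightarrow> complex) \<Rightarrow> real ^ 3 \<Rightarrow> complex" where
  "hyp_laplacian f x =
     of_real ((x $ 3) ^ 3) * (\<Sum>i\<in>UNIV. pderiv_at i (\<lambda>y. of_real (1 / y $ 3) * pderiv_at i f y) x)"

text \<open>
  A possibly unbounded operator is represented by its graph, and the closure of an operator is
  the closure of its graph in the product space.
\<close>

type_synonym operator = "(hyp_L2 \<times> hyp_L2) set"

definition neg_laplacian_graph :: operator where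
  "neg_laplacian_graph =
     {(abs_hyp_L2 f, abs_hyp_L2 (\<lambda>x. - hyp_laplacian f x)) | f. f \<in> test_functions}"

definition hyp_H :: operator where
  "hyp_H = closure neg_laplacian_graph"


subsection \<open>Resolvents and semigroups\<close>

definition op_graph :: "(hyp_L2 \<Rightarrow>\<^sub>L hyp_L2) \<Rightarrow> operator" where
  "op_graph A = {(f, A f) | f. True}"

definition op_shift :: "operator \<Rightarrow> real \<Rightarrow> operator" where
  "op_shift G c = {(f, g + c *\<^sub>R f) | f g. (f, g) \<in> G}"

definition op_uminus :: "operator \<Rightarrow> operator" where
  "op_uminus G = {(f, - g) | f g. (f, g) \<in> G}"

text \<open>
  The inverse of an operator as an everywhere defined bounded operator: its graph is the converse
  graph.  There is at most one such \<open>R\<close>, and there is none unless \<open>G\<close> is a bijection from its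
  domain onto the whole space with bounded inverse.
\<close>

definition op_inverse :: "operator \<Rightarrow> hyp_L2 \<Rightarrow>\<^sub>L hyp_L2" where
  "op_inverse G = (THE R. R \<in> bounded_ops \<and> op_graph R = G\<inverse>)"

definition c0_semigroup :: "(real \<Rightarrow> hyp_L2 \<Rightarrow>\<^sub>L hyp_L2) \<Rightarrow> bool" where
  "c0_semigroup T \<longleftrightarrow>
     (\<forall>t\<ge>0. T t \<in> bounded_ops) \<and> T 0 = id_blinfun \<and>
     (\<forall>s\<ge>0. \<forall>t\<ge>0. T (s + t) = T s o\<^sub>L T t) \<and>
     (\<forall>f. ((\<lambda>t. T t f) \<longlongrightarrow> f) (at_right 0))"

definition generator :: "(real \<Rightarrow> hyp_L2 \<Rightarrow>\<^sub>L hyp_L2) \<Rightarrow> operator" where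
  "generator T = {(f, g). ((\<lambda>t. (1 / t) *\<^sub>R (T t f - f)) \<longlongrightarrow> g) (at_right 0)}"

text \<open>
  \<open>op_exp_neg G t\<close> is \<open>exp (- G t)\<close>, the value at \<open>t \<ge> 0\<close> of the strongly continuous
  semigroup generated by \<open>- G\<close>.  The description is of the value at \<open>t\<close> rather than of
  \<open>T\<close>, because the values of \<open>T\<close> at negative times are not determined.
\<close>

definition op_exp_neg :: "operator \<Rightarrow> real \<Rightarrow> hyp_L2 \<Rightarrow>\<^sub>L hyp_L2" where
  "op_exp_neg G t = (THE A. \<exists>T. c0_semigroup T \<and> generator T = op_uminus G \<and> A = T t)"

end

theory Submission
  imports Defs "HOL-Probability.Distributions"
begin

text \<open>
  Both operators are integral operators whose kernel depends on the distance alone.  Write \<open>c\<close> for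
  \<open>cosh d\<close>.  The distribution of \<open>c(a, x)\<close> under \<open>\<mu>(dx)\<close> is the same measure
  \<open>4 \<pi> sqrt (c\<^sup>2 - 1) dc\<close> for every centre \<open>a\<close> (\<open>distr_hyp_cosh\<close>).  By Schur's test a
  kernel \<open>q (c(x, y))\<close> therefore defines a bounded operator whose norm is at most the integral of
  \<open>\<bar>q\<bar>\<close> against this measure.  If \<open>q\<close> vanishes for \<open>c > cosh m\<close>, the triangle inequality puts the
  operator into \<open>\<A>\<^sub>m\<close>, and a general integrable \<open>q\<close> is approximated by its truncations.  So every
  integrable radial kernel gives an element of \<open>\<A>\<close> (\<open>radial_op_std_alg\<close>), and what remains is to
  identify the resolvent and the semigroup of \<open>H\<close> as such operators.

  For the resolvent at \<open>- \<lambda>\<close> put \<open>\<kappa> = sqrt (1 + \<lambda>)\<close>.  The candidate kernel is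
  \<open>exp (- \<kappa> d) / (4 \<pi> sinh d)\<close>.  As a function of \<open>c\<close> it is regularised by the shift
  \<open>c \<mapsto> c + e\<close>.  The operator \<open>\<lambda> - \<Delta>\<close> turns the shifted kernel into a nonnegative kernel \<open>rho\<close>
  that concentrates at the diagonal as \<open>e\<close> tends to 0, which yields the reproducing formula
  \<open>green_representation\<close> for test functions.  The range of \<open>\<lambda> - \<Delta>\<close> on test functions is dense
  (\<open>helmholtz_range_dense\<close>): a vector orthogonal to it is annihilated by every \<open>rho\<close>, hence is
  orthogonal to all test functions.  Together these facts describe the closure \<open>H\<close> completely
  (\<open>hyp_H_iff\<close>) and identify the resolvent (\<open>op_inverse_hyp_H\<close>).

  For the semigroup the candidate is the heat kernel
  \<open>(4 \<pi> t)\<^sup>-\<^sup>3\<^sup>/\<^sup>2 (d / sinh d) exp (- t - d\<^sup>2 / 4t)\<close>.  It has mass 1, and its Laplace transform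
  in \<open>t\<close> is the Green function.  Injectivity of the Laplace transform turns the resolvent
  identity into the semigroup law and identifies the generator with \<open>- H\<close> (locale
  \<open>laplace_family\<close>).  An energy estimate shows that a strongly continuous semigroup with this
  generator is unique (\<open>contraction_semigroup_unique\<close>), so the heat operators are
  \<open>exp (- H t)\<close> (\<open>op_exp_neg_hyp_H\<close>).
\<close>

section \<open>Hilbert space preliminaries\<close>

text \<open>
  The witness is \<open>x - p\<close>, where \<open>p\<close> is the point of \<open>M\<close> nearest to some \<open>x\<close> outside \<open>M\<close>; the
  parallelogram identity makes every minimising sequence Cauchy.
\<close>

lemma closed_subspace_orthogonal_witness:
  fixes M :: "'a::{real_inner,complete_space} set"
  assumes sub: "subspace M" and clo: "closed M" and ne: "M \<noteq> UNIV"
  obtains u where "u \<noteq> 0" "\<And>m. m \<in> M \<Longrightarrow> u \<bullet> m = 0"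
proof -
  obtain x where x: "x \<notin> M" using ne by auto
  have M0: "M \<noteq> {}" using subspace_0[OF sub] by auto
  define d where "d = infdist x M"
  have lo: "d \<le> norm (x - m)" if "m \<in> M" for m
    using infdist_le[OF that, of x] by (simp add: d_def dist_norm)
  have d0: "0 \<le> d" by (simp add: d_def infdist_nonneg)
  have "\<exists>m\<in>M. norm (x - m) < d + 1 / real (Suc n)" for n
  proof (rule ccontr)
    assume "\<not> ?thesis"
    then have "d + 1 / real (Suc n) \<le> dist x m" if "m \<in> M" for m
      using that by (auto simp: dist_norm not_less)
    then have "d + 1 / real (Suc n) \<le> infdist x M"
      unfolding infdist_def using M0 by (auto intro!: cINF_greatest)
    moreover have "0 < 1 / real (Suc n)" by simp
    ultimately show False unfolding d_def by linarith
  qed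
  then obtain m where m: "\<And>n. m n \<in> M" "\<And>n. norm (x - m n) < d + 1 / real (Suc n)"
    by metis
  \<comment> \<open>The midpoint of \<open>m i\<close> and \<open>m j\<close> lies in \<open>M\<close>, so it has distance at least \<open>d\<close> from \<open>x\<close>.\<close>
  have par: "(norm (m i - m j))\<^sup>2 \<le> 4 * ((d + e)\<^sup>2 - d\<^sup>2)"
    if "norm (x - m i) \<le> d + e" "norm (x - m j) \<le> d + e" for i j e
  proof -
    have "(1/2) *\<^sub>R (m i + m j) \<in> M" using sub m(1) by (simp add: subspace_add subspace_scale)
    then have "d \<le> norm (x - (1/2) *\<^sub>R (m i + m j))" by (rule lo)
    then have "d\<^sup>2 \<le> (norm (x - (1/2) *\<^sub>R (m i + m j)))\<^sup>2" using d0 by (intro power_mono) auto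
    moreover have "(norm (m i - m j))\<^sup>2 + 4 * (norm (x - (1/2) *\<^sub>R (m i + m j)))\<^sup>2
        = 2 * (norm (x - m i))\<^sup>2 + 2 * (norm (x - m j))\<^sup>2"
      unfolding power2_norm_eq_inner
      by (simp add: inner_diff_left inner_diff_right inner_add_left inner_add_right inner_commute algebra_simps)
    moreover have "(norm (x - m i))\<^sup>2 \<le> (d + e)\<^sup>2" "(norm (x - m j))\<^sup>2 \<le> (d + e)\<^sup>2"
      using that by (auto intro!: power_mono)
    moreover have "A \<le> 4 * (D - d2)" if "d2 \<le> c" "A + 4 * c = 2 * a + 2 * b" "a \<le> D" "b \<le> D"
      for A D d2 a b c :: real using that by (simp add: algebra_simps)
    ultimately show ?thesis by blast
  qed
  have "Cauchy m"
  proof (rule metric_CauchyI)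
    fix e :: real assume e: "0 < e"
    have "(\<lambda>n. 4 * ((d + 1 / real (Suc n))\<^sup>2 - d\<^sup>2)) \<longlonglongrightarrow> 4 * ((d + 0)\<^sup>2 - d\<^sup>2)"
      by (intro tendsto_intros LIMSEQ_Suc[OF lim_1_over_n])
    then have "eventually (\<lambda>n. 4 * ((d + 1 / real (Suc n))\<^sup>2 - d\<^sup>2) < e\<^sup>2) sequentially"
      using e by (intro order_tendstoD(2)[of _ 0]) auto
    then obtain N where N: "4 * ((d + 1 / real (Suc N))\<^sup>2 - d\<^sup>2) < e\<^sup>2"
      by (auto simp: eventually_sequentially)
    have near: "norm (x - m n) \<le> d + 1 / real (Suc N)" if "N \<le> n" for n
    proof -
      have "1 / real (Suc n) \<le> 1 / real (Suc N)" using that by (intro divide_left_mono) auto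
      then show ?thesis using m(2)[of n] by linarith
    qed
    have "dist (m i) (m j) < e" if "N \<le> i" "N \<le> j" for i j
    proof -
      have "(norm (m i - m j))\<^sup>2 < e\<^sup>2" using par[OF near near, OF that] N by linarith
      then show ?thesis using e by (simp add: dist_norm power2_less_imp_less)
    qed
    then show "\<exists>M. \<forall>i\<ge>M. \<forall>j\<ge>M. dist (m i) (m j) < e" by blast
  qed
  then obtain y where y: "m \<longlonglongrightarrow> y" using Cauchy_convergent convergent_def by blast
  have yM: "y \<in> M" using clo y m(1) closed_sequentially by blast
  have nle: "norm (x - y) \<le> d"
  proof (rule LIMSEQ_le)
    show "(\<lambda>n. norm (x - m n)) \<longlonglongrightarrow> norm (x - y)" by (intro tendsto_intros y)
    show "(\<lambda>n. d + 1 / real (Suc n)) \<longlonglongrightarrow> d"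
      using tendsto_add[OF tendsto_const LIMSEQ_Suc[OF lim_1_over_n], of d] by simp
    show "\<exists>N. \<forall>n\<ge>N. norm (x - m n) \<le> d + 1 / real (Suc n)" using m(2) less_imp_le by blast
  qed
  show ?thesis
  proof (rule that)
    show "x - y \<noteq> 0" using x yM by auto
    fix v assume v: "v \<in> M"
    show "(x - y) \<bullet> v = 0"
    proof (cases "v = 0")
      case False
      define t where "t = ((x - y) \<bullet> v) / (v \<bullet> v)"
      have "y + t *\<^sub>R v \<in> M" using sub yM v by (simp add: subspace_add subspace_scale)
      then have "norm (x - y) \<le> norm (x - (y + t *\<^sub>R v))" using lo nle by fastforce
      then have "(norm (x - y))\<^sup>2 \<le> (norm ((x - y) - t *\<^sub>R v))\<^sup>2"
        by (intro power_mono) (auto simp: algebra_simps)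
      also have "\<dots> = (norm (x - y))\<^sup>2 - 2 * t * ((x - y) \<bullet> v) + t\<^sup>2 * (v \<bullet> v)"
        unfolding power2_norm_eq_inner
        by (simp add: inner_diff_left inner_diff_right inner_commute algebra_simps power2_eq_square)
      also have "\<dots> = (norm (x - y))\<^sup>2 - ((x - y) \<bullet> v)\<^sup>2 / (v \<bullet> v)"
        using False by (simp add: t_def power2_eq_square field_simps)
      finally have "((x - y) \<bullet> v)\<^sup>2 / (v \<bullet> v) \<le> 0" by simp
      moreover have "0 < v \<bullet> v" using False by simp
      ultimately have "((x - y) \<bullet> v)\<^sup>2 \<le> 0" by (simp add: divide_le_0_iff)
      then show ?thesis by simp
    qed simp
  qed
qed

lemma subspace_closure:
  fixes M :: "'a::real_normed_vector set"
  assumes "subspace M" shows "subspace (closure M)"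
  unfolding subspace_def
proof (intro conjI ballI allI)
  show "0 \<in> closure M" using subspace_0[OF assms] closure_subset by blast
  fix x y assume "x \<in> closure M" "y \<in> closure M"
  then obtain a b where "\<And>n. a n \<in> M" "a \<longlonglongrightarrow> x" "\<And>n. b n \<in> M" "b \<longlonglongrightarrow> y"
    unfolding closure_sequential by blast
  then have "\<And>n. a n + b n \<in> M" "(\<lambda>n. a n + b n) \<longlonglongrightarrow> x + y"
    using assms by (auto intro: tendsto_intros simp: subspace_add)
  then show "x + y \<in> closure M" unfolding closure_sequential by (intro exI[of _ "\<lambda>n. a n + b n"]) blast
next
  fix c x assume "x \<in> closure M"
  then obtain a where "\<And>n. a n \<in> M" "a \<longlonglongrightarrow> x" unfolding closure_sequential by blast
  then have "\<And>n. c *\<^sub>R a n \<in> M" "(\<lambda>n. c *\<^sub>R a n) \<longlonglongrightarrow> c *\<^sub>R x"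
    using assms by (auto intro: tendsto_intros simp: subspace_scale)
  then show "c *\<^sub>R x \<in> closure M" unfolding closure_sequential by (intro exI[of _ "\<lambda>n. c *\<^sub>R a n"]) blast
qed

lemma dense_subspace_if_no_orthogonal:
  fixes M :: "'a::{real_inner,complete_space} set"
  assumes sub: "subspace M" and orth: "\<And>u. (\<And>m. m \<in> M \<Longrightarrow> u \<bullet> m = 0) \<Longrightarrow> u = 0"
  shows "closure M = UNIV"
proof (rule ccontr)
  assume "closure M \<noteq> UNIV"
  then obtain u where "u \<noteq> 0" "\<And>m. m \<in> closure M \<Longrightarrow> u \<bullet> m = 0"
    using closed_subspace_orthogonal_witness[of "closure M"] sub by (metis closed_closure subspace_closure)
  then show False using orth closure_subset by blast
qed

text \<open>
  The sets where all \<open>A n\<close> are bounded by \<open>k\<close> are closed and cover the space, so by Baire one of them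
  contains a ball, and linearity spreads the bound from this ball to the unit ball.
\<close>

lemma uniform_boundedness:
  fixes A :: "nat \<Rightarrow> 'a::banach \<Rightarrow>\<^sub>L 'b::real_normed_vector"
  assumes bnd: "\<And>x. bounded (range (\<lambda>n. A n x))"
  shows "bounded (range A)"
proof -
  define F where "F k = {x. \<forall>n. norm (A n x) \<le> real k}" for k :: nat
  have clo: "closed (F k)" for k
  proof -
    have "F k = (\<Inter>n. {x. norm (A n x) \<le> real k})" by (auto simp: F_def)
    then show ?thesis
      by (simp only:) (intro closed_INT ballI closed_Collect_le continuous_intros)
  qed
  have cov: "(\<Union>k. F k) = UNIV"
  proof -
    have "\<exists>k. x \<in> F k" for x
    proof -
      obtain B where B: "\<And>n. norm (A n x) \<le> B" using bnd[of x] by (auto simp: bounded_iff)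
      obtain k where "B \<le> real k" using real_arch_simple by blast
      then show ?thesis using B by (auto simp: F_def intro: order_trans)
    qed
    then show ?thesis by auto
  qed
  have "\<exists>k. interior (F k) \<noteq> {}"
  proof (rule ccontr)
    assume "\<not> ?thesis"
    then have "Met_TC.mtopology interior_of \<Union>(range F) = {}"
      by (intro Met_TC.metric_Baire_category_alt) (auto simp: clo complete_UNIV)
    then show False using cov by simp
  qed
  then obtain k x where "x \<in> interior (F k)" by blast
  then obtain e where e: "0 < e" "cball x e \<subseteq> F k"
    using mem_interior_cball by blast
  have "norm (A n) \<le> 2 * real k / e" for n
  proof (rule norm_blinfun_bound)
    show "0 \<le> 2 * real k / e" using e by simp
    fix y
    show "norm (A n y) \<le> 2 * real k / e * norm y"
    proof (cases "y = 0")
      case False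
      define c where "c = e / norm y"
      have c: "0 < c" "norm (c *\<^sub>R y) = e" using e False by (auto simp: c_def)
      have "x + c *\<^sub>R y \<in> F k" "x \<in> F k" using e c by (auto simp: dist_norm)
      then have "norm (A n (x + c *\<^sub>R y)) \<le> real k" "norm (A n x) \<le> real k" by (auto simp: F_def)
      moreover have "A n (x + c *\<^sub>R y) - A n x = c *\<^sub>R A n y"
        by (simp add: blinfun.add_right blinfun.scaleR_right)
      ultimately have "norm (c *\<^sub>R A n y) \<le> 2 * real k"
        by (metis norm_triangle_ineq4[of "A n (x + c *\<^sub>R y)" "A n x"] add_mono mult_2 order_trans)
      then have "c * norm (A n y) \<le> 2 * real k" using c by simp
      then have "norm (A n y) \<le> 2 * real k / c" using c by (simp add: field_simps)
      then show ?thesis by (simp add: c_def field_simps)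
    qed simp
  qed
  then show ?thesis by (auto simp: bounded_iff)
qed

section \<open>Strongly continuous semigroups\<close>

locale strong_semigroup =
  fixes T :: "real \<Rightarrow> 'a::banach \<Rightarrow>\<^sub>L 'a"
  assumes zero: "T 0 = id_blinfun"
    and add: "\<And>s t. 0 \<le> s \<Longrightarrow> 0 \<le> t \<Longrightarrow> T (s + t) = T s o\<^sub>L T t"
    and strong: "\<And>f. ((\<lambda>t. T t f) \<longlongrightarrow> f) (at_right 0)"
begin

definition gen :: "'a \<Rightarrow> 'a \<Rightarrow> bool" where
  "gen f g \<longleftrightarrow> ((\<lambda>t. (1 / t) *\<^sub>R (T t f - f)) \<longlongrightarrow> g) (at_right 0)"

lemma T_0 [simp]: "T 0 f = f" by (simp add: zero)

lemma T_add: "0 \<le> s \<Longrightarrow> 0 \<le> t \<Longrightarrow> T (s + t) f = T s (T t f)"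
  by (simp add: add)

text \<open>
  If the norms were unbounded near 0, some \<open>\<tau> n\<close> tending to 0 would have \<open>norm (T (\<tau> n))\<close> unbounded
  although \<open>T (\<tau> n) f\<close> converges for every \<open>f\<close>; this contradicts uniform boundedness.
\<close>

lemma bounded_near_0: "\<exists>\<delta>>0. \<exists>M. \<forall>t\<in>{0..\<delta>}. norm (T t) \<le> M"
proof (rule ccontr)
  assume *: "\<not> ?thesis"
  have "\<exists>t. 0 \<le> t \<and> t \<le> 1 / real (Suc n) \<and> norm (T t) > real n" for n
  proof (rule ccontr)
    assume "\<not> ?thesis"
    then have "\<forall>t\<in>{0..1 / real (Suc n)}. norm (T t) \<le> real n" by (auto simp: not_less)
    moreover have "0 < 1 / real (Suc n)" by simp
    ultimately show False using * by blast
  qed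
  then obtain \<tau> where \<tau>: "\<And>n. 0 \<le> \<tau> n" "\<And>n. \<tau> n \<le> 1 / real (Suc n)" "\<And>n. norm (T (\<tau> n)) > real n"
    by metis
  have "\<tau> \<longlonglongrightarrow> 0"
    by (rule tendsto_sandwich[OF _ _ tendsto_const LIMSEQ_Suc[OF lim_1_over_n]])
       (use \<tau> in \<open>auto intro!: always_eventually\<close>)
  have "(\<lambda>n. T (\<tau> n) f) \<longlonglongrightarrow> f" for f
  proof -
    have "((\<lambda>t. T t f) \<longlongrightarrow> T 0 f) (at 0 within {0..})"
      using strong[of f] by (simp add: at_within_Ici_at_right)
    then have "continuous (at 0 within {0..}) (\<lambda>t. T t f)" by (simp add: continuous_within)
    then show ?thesis
      unfolding continuous_within_sequentially using \<tau>(1) \<open>\<tau> \<longlonglongrightarrow> 0\<close> by (auto simp: o_def)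
  qed
  then have "bounded (range (\<lambda>n. T (\<tau> n)))"
    by (intro uniform_boundedness) (meson convergentI convergent_imp_bounded)
  then obtain B where B: "\<And>n. norm (T (\<tau> n)) \<le> B" by (auto simp: bounded_iff)
  obtain n where "B \<le> real n" using real_arch_simple by blast
  then show False using B[of n] \<tau>(3)[of n] by linarith
qed

lemma bounded_on_compacts: "\<exists>M. \<forall>t\<in>{0..b}. norm (T t) \<le> M"
proof -
  obtain \<delta> M where \<delta>: "0 < \<delta>" and M: "\<And>t. 0 \<le> t \<Longrightarrow> t \<le> \<delta> \<Longrightarrow> norm (T t) \<le> M"
    using bounded_near_0 by (metis atLeastAtMost_iff)
  have M0: "0 \<le> M" using M[of 0] \<delta> norm_ge_zero order_trans by (metis less_imp_le order_refl)
  have "\<exists>K. \<forall>t\<in>{0..real n * \<delta>}. norm (T t) \<le> K" for n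
  proof (induction n)
    case 0 show ?case by auto
  next
    case (Suc n)
    then obtain K where K: "\<And>t. 0 \<le> t \<Longrightarrow> t \<le> real n * \<delta> \<Longrightarrow> norm (T t) \<le> K" by (metis atLeastAtMost_iff)
    have "norm (T t) \<le> max K (K * M)" if t: "0 \<le> t" "t \<le> real (Suc n) * \<delta>" for t
    proof (cases "t \<le> real n * \<delta>")
      case True then show ?thesis using K[of t] t by simp
    next
      case False
      then have t': "0 \<le> t - real n * \<delta>" "t - real n * \<delta> \<le> \<delta>" "0 \<le> real n * \<delta>"
        using t \<delta> by (auto simp: algebra_simps)
      have "T t = T (real n * \<delta>) o\<^sub>L T (t - real n * \<delta>)"
        using add[of "real n * \<delta>" "t - real n * \<delta>"] t' by simp
      then have "norm (T t) \<le> norm (T (real n * \<delta>)) * norm (T (t - real n * \<delta>))"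
        by (simp add: norm_blinfun_compose)
      also have "\<dots> \<le> K * M"
      proof (rule mult_mono)
        show "norm (T (real n * \<delta>)) \<le> K" using K[of "real n * \<delta>"] t' by simp
        then show "0 \<le> K" using norm_ge_zero order_trans by blast
      qed (use M t' in auto)
      finally show ?thesis by simp
    qed
    then show ?case by (intro exI[of _ "max K (K * M)"]) auto
  qed
  moreover obtain n where "b \<le> real n * \<delta>" using real_arch_simple[of "b / \<delta>"] \<delta> by (auto simp: field_simps)
  ultimately show ?thesis by (meson atLeastAtMost_iff order_trans)
qed

lemma orbit_continuous: "continuous_on {0..} (\<lambda>t. T t f)"
  unfolding continuous_on_iff
proof (intro ballI allI impI)
  fix t e :: real assume t: "t \<in> {0..}" and e: "0 < e"
  obtain M where M: "\<And>s. 0 \<le> s \<Longrightarrow> s \<le> t + 1 \<Longrightarrow> norm (T s) \<le> M"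
    using bounded_on_compacts[of "t + 1"] by (metis atLeastAtMost_iff)
  have M0: "0 \<le> M" using M[of 0] t order_trans[OF norm_ge_zero] by simp
  have "eventually (\<lambda>h. dist (T h f) f < e / (M + 1)) (at_right 0)"
    using strong[of f] e M0 by (intro tendstoD) auto
  then obtain b where b: "0 < b" "\<And>h. 0 < h \<Longrightarrow> h < b \<Longrightarrow> dist (T h f) f < e / (M + 1)"
    unfolding eventually_at_right_field by auto
  have key: "dist (T (s + h) f) (T s f) < e" if "0 \<le> s" "s \<le> t + 1" "0 \<le> h" "h < b" for s h
  proof (cases "h = 0")
    case False
    have "T (s + h) f - T s f = T s (T h f - f)"
      using that T_add[of s h f] by (simp add: blinfun.diff_right)
    then have "dist (T (s + h) f) (T s f) \<le> norm (T s) * norm (T h f - f)"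
      by (simp add: dist_norm norm_blinfun)
    also have "\<dots> \<le> M * (e / (M + 1))"
      using M[of s] b(2)[of h] that False M0 by (intro mult_mono) (auto simp: dist_norm)
    also have "\<dots> < e" using M0 e by (simp add: field_simps)
    finally show ?thesis .
  qed (use e in simp)
  show "\<exists>d>0. \<forall>x'\<in>{0..}. dist x' t < d \<longrightarrow> dist (T x' f) (T t f) < e"
  proof (intro exI conjI ballI impI)
    show "0 < min 1 b" using b by simp
    fix x assume x: "x \<in> {0..}" "dist x t < min 1 b"
    show "dist (T x f) (T t f) < e"
    proof (cases "t \<le> x")
      case True then show ?thesis using key[of t "x - t"] t x by (simp add: dist_real_def)
    next
      case False then show ?thesis using key[of x "t - x"] t x
        by (auto simp: dist_real_def dist_commute)
    qed
  qed
qed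

lemma gen_orbit: assumes "gen f g" "0 \<le> s" shows "gen (T s f) (T s g)"
proof -
  have "((\<lambda>t. T s ((1 / t) *\<^sub>R (T t f - f))) \<longlongrightarrow> T s g) (at_right 0)"
    using assms(1) unfolding gen_def by (intro tendsto_intros)
  moreover have "eventually (\<lambda>t. T s ((1 / t) *\<^sub>R (T t f - f)) = (1 / t) *\<^sub>R (T t (T s f) - T s f)) (at_right 0)"
    unfolding eventually_at_right_field
  proof (intro exI[of _ 1] conjI allI impI)
    fix t :: real assume "0 < t"
    then show "T s ((1 / t) *\<^sub>R (T t f - f)) = (1 / t) *\<^sub>R (T t (T s f) - T s f)"
      using T_add[of s t f] T_add[of t s f] assms(2)
      by (simp add: blinfun.diff_right blinfun.scaleR_right add.commute)
  qed simp
  ultimately show ?thesis unfolding gen_def by (rule Lim_transform_eventually)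
qed

text \<open>
  The right derivative is immediate from the semigroup law.  For the left derivative the
  difference quotient is \<open>T (t - h)\<close> applied to the quotient at 0, and the local bound on
  \<open>norm (T (t - h))\<close> lets both factors pass to the limit.
\<close>

lemma orbit_derivative:
  assumes g: "gen f g" and t: "0 < t"
  shows "((\<lambda>t. T t f) has_vector_derivative T t g) (at t)"
proof -
  have r: "((\<lambda>h. (1 / h) *\<^sub>R (T (t + h) f - T t f)) \<longlongrightarrow> T t g) (at_right 0)"
  proof -
    have "((\<lambda>h. (1 / h) *\<^sub>R (T h (T t f) - T t f)) \<longlongrightarrow> T t g) (at_right 0)"
      using gen_orbit[OF g, of t] t by (simp add: gen_def)
    moreover have "eventually (\<lambda>h. (1 / h) *\<^sub>R (T h (T t f) - T t f) = (1 / h) *\<^sub>R (T (t + h) f - T t f)) (at_right 0)"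
      unfolding eventually_at_right_field using T_add[of _ t f] t
      by (intro exI[of _ 1]) (auto simp: add.commute)
    ultimately show ?thesis by (rule Lim_transform_eventually)
  qed
  have l: "((\<lambda>h. (1 / h) *\<^sub>R (T (t - h) f - T t f)) \<longlongrightarrow> - T t g) (at_right 0)"
  proof -
    obtain M where M: "\<And>s. 0 \<le> s \<Longrightarrow> s \<le> t \<Longrightarrow> norm (T s) \<le> M"
      using bounded_on_compacts[of t] by (metis atLeastAtMost_iff)
    have 1: "((\<lambda>h. T (t - h) g) \<longlongrightarrow> T t g) (at_right 0)"
    proof -
      have "continuous (at t) (\<lambda>t. T t g)"
        using orbit_continuous[of g] t by (simp add: continuous_on_interior)
      then have "((\<lambda>s. T s g) \<longlongrightarrow> T t g) (at t)" by (simp add: isCont_def)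
      moreover have "filterlim (\<lambda>h. t - h) (at t) (at_right 0)"
        by (rule filterlim_atI)
           (auto intro!: tendsto_eq_intros simp: eventually_at_filter)
      ultimately show ?thesis by (rule filterlim_compose)
    qed
    have 2: "((\<lambda>h. T (t - h) ((1 / h) *\<^sub>R (T h f - f) - g)) \<longlongrightarrow> 0) (at_right 0)"
    proof (rule Lim_null_comparison)
      have "((\<lambda>h. (1 / h) *\<^sub>R (T h f - f) - g) \<longlongrightarrow> g - g) (at_right 0)"
        using g unfolding gen_def by (intro tendsto_intros)
      then show "((\<lambda>h. M * norm ((1 / h) *\<^sub>R (T h f - f) - g)) \<longlongrightarrow> 0) (at_right 0)"
        by (intro tendsto_mult_right_zero tendsto_norm_zero) simp
      show "eventually (\<lambda>h. norm (T (t - h) ((1 / h) *\<^sub>R (T h f - f) - g)) \<le> M * norm ((1 / h) *\<^sub>R (T h f - f) - g)) (at_right 0)"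
        unfolding eventually_at_right_field
      proof (intro exI[of _ t] conjI allI impI t)
        fix h assume h: "0 < h" "h < t"
        have "norm (T (t - h) v) \<le> M * norm v" for v
          using norm_blinfun[of "T (t - h)" v] M[of "t - h"] h
          by (smt (verit) mult_right_mono norm_ge_zero)
        then show "norm (T (t - h) ((1 / h) *\<^sub>R (T h f - f) - g)) \<le> M * norm ((1 / h) *\<^sub>R (T h f - f) - g)" .
      qed
    qed
    have "((\<lambda>h. - (T (t - h) ((1 / h) *\<^sub>R (T h f - f) - g) + T (t - h) g)) \<longlongrightarrow> - (0 + T t g)) (at_right 0)"
      by (intro tendsto_intros 1 2)
    moreover have "eventually (\<lambda>h. - (T (t - h) ((1 / h) *\<^sub>R (T h f - f) - g) + T (t - h) g)
        = (1 / h) *\<^sub>R (T (t - h) f - T t f)) (at_right 0)"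
      unfolding eventually_at_right_field
    proof (intro exI[of _ t] conjI allI impI t)
      fix h assume h: "0 < h" "h < t"
      then have "T t f = T (t - h) (T h f)" using T_add[of "t - h" h f] by simp
      then show "- (T (t - h) ((1 / h) *\<^sub>R (T h f - f) - g) + T (t - h) g)
        = (1 / h) *\<^sub>R (T (t - h) f - T t f)"
        by (simp add: blinfun.diff_right blinfun.scaleR_right scaleR_right_diff_distrib)
    qed
    ultimately show ?thesis unfolding add_0 by (rule Lim_transform_eventually)
  qed
  have "((\<lambda>h. (1 / h) *\<^sub>R (T (t + h) f - T t f)) \<longlongrightarrow> T t g) (at 0)"
  proof (rule filterlim_split_at[OF _ r])
    have "((\<lambda>h. - ((1 / h) *\<^sub>R (T (t - h) f - T t f))) \<longlongrightarrow> - (- T t g)) (at_right 0)"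
      by (intro tendsto_intros l)
    then show "((\<lambda>h. (1 / h) *\<^sub>R (T (t + h) f - T t f)) \<longlongrightarrow> T t g) (at_left 0)"
      by (subst filterlim_at_left_to_right) simp
  qed
  then show ?thesis
    unfolding has_vector_derivative_def has_derivative_at
  proof (intro conjI)
    assume "((\<lambda>h. (1 / h) *\<^sub>R (T (t + h) f - T t f)) \<longlongrightarrow> T t g) (at 0)"
    then have "((\<lambda>h. norm ((1 / h) *\<^sub>R (T (t + h) f - T t f) - T t g)) \<longlongrightarrow> 0) (at 0)"
      by (simp add: LIM_zero_iff tendsto_norm_zero)
    moreover have "eventually (\<lambda>h. norm ((1 / h) *\<^sub>R (T (t + h) f - T t f) - T t g)
       = norm (T (t + h) f - T t f - h *\<^sub>R T t g) / norm h) (at 0)"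
    proof (rule eventually_at_filter[THEN iffD2], rule always_eventually, intro allI impI)
      fix h :: real assume "h \<noteq> 0"
      then have "(1 / h) *\<^sub>R (T (t + h) f - T t f) - T t g = (1 / h) *\<^sub>R (T (t + h) f - T t f - h *\<^sub>R T t g)"
        by (simp add: scaleR_right_diff_distrib)
      then show "norm ((1 / h) *\<^sub>R (T (t + h) f - T t f) - T t g)
       = norm (T (t + h) f - T t f - h *\<^sub>R T t g) / norm h" by (simp add: divide_inverse mult.commute)
    qed
    ultimately show "((\<lambda>h. norm (T (t + h) f - T t f - h *\<^sub>R T t g) / norm h) \<longlongrightarrow> 0) (at 0)"
      by (rule Lim_transform_eventually)
  qed (rule bounded_linear_scaleR_left)
qed

end

lemma (in strong_semigroup) gen_diff:
  assumes "gen f g" "gen f' g'" shows "gen (f - f') (g - g')"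
proof -
  have "((\<lambda>t. (1 / t) *\<^sub>R (T t f - f) - (1 / t) *\<^sub>R (T t f' - f')) \<longlongrightarrow> g - g') (at_right 0)"
    using assms unfolding gen_def by (intro tendsto_intros)
  moreover have "(1 / t) *\<^sub>R (T t f - f) - (1 / t) *\<^sub>R (T t f' - f') = (1 / t) *\<^sub>R (T t (f - f') - (f - f'))" for t
    by (simp add: blinfun.diff_right algebra_simps)
  ultimately show ?thesis by (simp add: gen_def)
qed

text \<open>
  By contractivity \<open>T t f \<bullet> f \<le> f \<bullet> f\<close>, so the difference quotients at 0 have nonpositive
  inner product with \<open>f\<close>.
\<close>

lemma contraction_gen_dissipative:
  fixes T :: "real \<Rightarrow> 'a::{real_inner,banach} \<Rightarrow>\<^sub>L 'a"
  assumes "strong_semigroup T" and contr: "\<And>t f. 0 \<le> t \<Longrightarrow> norm (T t f) \<le> norm f"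
    and g: "strong_semigroup.gen T f g"
  shows "g \<bullet> f \<le> 0"
proof -
  interpret strong_semigroup T by fact
  have "((\<lambda>t. ((1 / t) *\<^sub>R (T t f - f)) \<bullet> f) \<longlongrightarrow> g \<bullet> f) (at_right 0)"
    using g unfolding gen_def by (intro tendsto_intros)
  moreover have "eventually (\<lambda>t. ((1 / t) *\<^sub>R (T t f - f)) \<bullet> f \<le> 0) (at_right 0)"
    unfolding eventually_at_right_field
  proof (intro exI[of _ 1] conjI allI impI)
    fix t :: real assume t: "0 < t"
    have "T t f \<bullet> f \<le> norm (T t f) * norm f" by (rule norm_cauchy_schwarz)
    also have "\<dots> \<le> norm f * norm f" using contr[of t f] t by (intro mult_right_mono) auto
    also have "\<dots> = f \<bullet> f" by (simp add: power2_norm_eq_inner flip: power2_eq_square)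
    finally show "((1 / t) *\<^sub>R (T t f - f)) \<bullet> f \<le> 0"
      using t by (simp add: inner_diff_left mult_nonneg_nonpos divide_nonpos_pos)
  qed simp
  ultimately show ?thesis
    by (intro tendsto_upperbound) auto
qed

text \<open>
  An energy argument: for \<open>f\<close> in the common domain the difference \<open>w s = T s f - S s f\<close> solves the
  evolution equation of \<open>S\<close> with \<open>w 0 = 0\<close>, and dissipativity makes its norm decrease.
\<close>

theorem contraction_semigroup_unique:
  fixes T S :: "real \<Rightarrow> 'a::{real_inner,banach} \<Rightarrow>\<^sub>L 'a"
  assumes T: "strong_semigroup T" and S: "strong_semigroup S"
    and gen: "\<And>f g. strong_semigroup.gen T f g \<longleftrightarrow> strong_semigroup.gen S f g"
    and contr: "\<And>t f. 0 \<le> t \<Longrightarrow> norm (S t f) \<le> norm f"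
    and dense: "closure {f. \<exists>g. strong_semigroup.gen S f g} = UNIV"
    and t: "0 \<le> t"
  shows "T t = S t"
proof -
  interpret T: strong_semigroup T by fact
  interpret S: strong_semigroup S by fact
  have eq: "T t f = S t f" if g: "S.gen f g" for f g
  proof (cases "t = 0")
    case False
    define w where "w s = T s f - S s f" for s
    have Tg: "T.gen f g" using g gen by simp
    have "w t \<bullet> w t \<le> w 0 \<bullet> w 0"
    proof (rule DERIV_nonpos_imp_decreasing_open[where f = "\<lambda>s. w s \<bullet> w s" and a = 0 and b = t])
      show "0 \<le> t" by fact
      show "continuous_on {0..t} (\<lambda>s. w s \<bullet> w s)"
        unfolding w_def
        by (intro continuous_intros continuous_on_subset[OF T.orbit_continuous] continuous_on_subset[OF S.orbit_continuous]) auto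
      fix s assume s: "0 < s" "s < t"
      define v where "v = T s g - S s g"
      have "(w has_vector_derivative v) (at s)"
        unfolding w_def v_def using T.orbit_derivative[OF Tg s(1)] S.orbit_derivative[OF g s(1)]
        by (intro derivative_intros)
      then have "((\<lambda>s. w s \<bullet> w s) has_derivative (\<lambda>h. w s \<bullet> (h *\<^sub>R v) + (h *\<^sub>R v) \<bullet> w s)) (at s)"
        unfolding has_vector_derivative_def by (intro derivative_intros)
      then have "((\<lambda>s. w s \<bullet> w s) has_real_derivative 2 * (v \<bullet> w s)) (at s)"
        unfolding has_field_derivative_def by (rule has_derivative_eq_rhs) (auto simp: inner_commute)
      moreover have "S.gen (w s) v"
        unfolding w_def v_def
        using T.gen_orbit[OF Tg, of s] S.gen_orbit[OF g, of s] s by (intro S.gen_diff) (auto simp: gen)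
      then have "v \<bullet> w s \<le> 0" using contraction_gen_dissipative[OF S contr] by blast
      ultimately show "\<exists>y. ((\<lambda>s. w s \<bullet> w s) has_real_derivative y) (at s) \<and> y \<le> 0" by auto
    qed
    then have "w t \<bullet> w t \<le> 0" by (simp add: w_def)
    then have "w t = 0" by (metis antisym inner_ge_zero inner_eq_zero_iff)
    then show ?thesis by (simp add: w_def)
  qed simp
  have "closed {f. T t f = S t f}" by (intro closed_Collect_eq continuous_intros)
  moreover have "{f. \<exists>g. S.gen f g} \<subseteq> {f. T t f = S t f}" using eq by blast
  ultimately have "{f. T t f = S t f} = UNIV" using dense closure_minimal by blast
  then show ?thesis by (intro blinfun_eqI) auto
qed

section \<open>Laplace transforms\<close>

lemma exp_decay_integral:
  assumes "0 < (s::real)"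
  shows "set_integrable lborel {0<..} (\<lambda>t. exp (- s * t))"
    and "(LBINT t:{0<..}. exp (- s * t)) = 1 / s"
proof -
  let ?F = "\<lambda>t. - exp (- s * t) / s"
  have D: "DERIV ?F t :> exp (- s * t)" for t
    using assms by (auto intro!: derivative_eq_intros)
  have A: "((?F \<circ> real_of_ereal) \<longlongrightarrow> - 1 / s) (at_right (ereal 0))"
    unfolding ereal_tendsto_simps using assms by (auto intro!: tendsto_eq_intros)
  have B: "((?F \<circ> real_of_ereal) \<longlongrightarrow> 0) (at_left \<infinity>)"
  proof -
    have "filterlim (\<lambda>t. s * t) at_top at_top"
      by (rule filterlim_tendsto_pos_mult_at_top[OF tendsto_const assms filterlim_ident])
    then have "filterlim (\<lambda>t. - s * t) at_bot at_top" by (simp add: filterlim_uminus_at_bot)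
    then have "((\<lambda>t. exp (- s * t)) \<longlongrightarrow> 0) at_top" by (rule filterlim_compose[OF exp_at_bot])
    then have "(?F \<longlongrightarrow> - 0 / s) at_top" using assms by (intro tendsto_intros) auto
    then show ?thesis unfolding ereal_tendsto_simps by simp
  qed
  have e: "einterval (ereal 0) \<infinity> = {0<..}" by (auto simp: einterval_def)
  show "set_integrable lborel {0<..} (\<lambda>t. exp (- s * t))"
    using interval_integral_FTC_nonneg(1)[of "ereal 0" \<infinity> ?F "\<lambda>t. exp (- s * t)", OF _ D _ _ A B]
    by (simp add: e)
  show "(LBINT t:{0<..}. exp (- s * t)) = 1 / s"
    using interval_integral_FTC_nonneg(2)[of "ereal 0" \<infinity> ?F "\<lambda>t. exp (- s * t)", OF _ D _ _ A B]
    by (simp add: interval_lebesgue_integral_def e)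
qed

lemma set_integrable_exp_bounded:
  fixes \<phi> :: "real \<Rightarrow> real"
  assumes "0 < s" and [measurable]: "(\<lambda>t. indicator {0<..} t * \<phi> t) \<in> borel_measurable borel"
    and "\<And>t. 0 < t \<Longrightarrow> \<bar>\<phi> t\<bar> \<le> C"
  shows "set_integrable lborel {0<..} (\<lambda>t. exp (- s * t) * \<phi> t)"
proof -
  have "integrable lborel (\<lambda>t. C * (indicator {0<..} t * exp (- s * t)))"
    using exp_decay_integral(1)[OF assms(1)] by (simp add: set_integrable_def)
  then have "integrable lborel (\<lambda>t. exp (- s * t) * (indicator {0<..} t * \<phi> t))"
  proof (rule Bochner_Integration.integrable_bound)
    show "AE t in lborel. norm (exp (- s * t) * (indicator {0<..} t * \<phi> t)) \<le> norm (C * (indicator {0<..} t * exp (- s * t)))"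
      using assms(3) by (intro AE_I2) (auto simp: abs_mult indicator_def intro: order_trans[OF _ abs_ge_self])
  qed measurable
  then show ?thesis by (simp add: set_integrable_def ac_simps)
qed

lemma indicator_mult_measurable_continuous:
  fixes \<phi> :: "real \<Rightarrow> real"
  assumes "continuous_on {0<..} \<phi>"
  shows "(\<lambda>t. indicator {0<..} t * \<phi> t) \<in> borel_measurable borel"
  using borel_measurable_continuous_on_indicator[OF _ assms] by simp

text \<open>
  In the variable \<open>x = exp (- t)\<close> the hypothesis at \<open>s = a + n\<close> says that all moments of a fixed
  density vanish.  By Weierstrass the density is then orthogonal to every continuous function on
  \<open>[0, 1]\<close>; the test function \<open>g\<close> below is chosen so that the pairing is the integral of
  \<open>\<phi>\<^sup>2\<close> against a positive weight.
\<close>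

theorem laplace_unique:
  fixes \<phi> :: "real \<Rightarrow> real"
  assumes cont: "continuous_on {0<..} \<phi>" and bnd: "\<And>t. 0 < t \<Longrightarrow> \<bar>\<phi> t\<bar> \<le> C"
    and a: "0 < a" and zero: "\<And>s. a \<le> s \<Longrightarrow> (LBINT t:{0<..}. exp (- s * t) * \<phi> t) = 0"
    and t: "0 < t"
  shows "\<phi> t = 0"
proof -
  have C0: "0 \<le> C" using bnd[of 1] by simp
  note [measurable] = indicator_mult_measurable_continuous[OF cont]
  have int: "set_integrable lborel {0<..} (\<lambda>t. exp (- s * t) * \<phi> t)" if "0 < s" for s
    using that bnd by (intro set_integrable_exp_bounded) auto
  have poly: "(LBINT t:{0<..}. p (exp (- t)) * (exp (- a * t) * \<phi> t)) = 0"
    and polyint: "set_integrable lborel {0<..} (\<lambda>t. p (exp (- t)) * (exp (- a * t) * \<phi> t))"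
    if p: "real_polynomial_function p" for p
  proof -
    obtain c n where pc: "p = (\<lambda>x. \<Sum>i\<le>n. c i * x ^ i)"
      using p unfolding real_polynomial_function_iff_sum by blast
    have e: "p (exp (- t)) * (exp (- a * t) * \<phi> t) = (\<Sum>i\<le>n. c i * (exp (- (a + real i) * t) * \<phi> t))" for t
      unfolding pc sum_distrib_right
      by (intro sum.cong refl) (simp add: exp_of_nat_mult[symmetric] exp_add[symmetric] algebra_simps)
    have I: "integrable lborel (\<lambda>t. c i * (indicator {0<..} t * (exp (- (a + real i) * t) * \<phi> t)))" for i
      using int[of "a + real i"] a by (simp add: set_integrable_def)
    have e': "indicator {0<..} t * (p (exp (- t)) * (exp (- a * t) * \<phi> t))
        = (\<Sum>i\<le>n. c i * (indicator {0<..} t * (exp (- (a + real i) * t) * \<phi> t)))" for t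
      unfolding e by (simp add: sum_distrib_left mult.left_commute)
    show "set_integrable lborel {0<..} (\<lambda>t. p (exp (- t)) * (exp (- a * t) * \<phi> t))"
      unfolding set_integrable_def real_scaleR_def e' using I by (rule Bochner_Integration.integrable_sum)
    have "(LINT t|lborel. indicator {0<..} t * (exp (- (a + real i) * t) * \<phi> t)) = 0" for i
      using zero[of "a + real i"] by (simp add: set_lebesgue_integral_def)
    then show "(LBINT t:{0<..}. p (exp (- t)) * (exp (- a * t) * \<phi> t)) = 0"
      unfolding set_lebesgue_integral_def real_scaleR_def e' Bochner_Integration.integral_sum[OF I]
      by (simp only: integral_mult_right_zero mult_zero_right sum.neutral_const)
  qed
  \<comment> \<open>The factor \<open>x * (1 - x)\<close> forces continuity at the end points, where \<open>\<phi> (- ln x)\<close> may oscillate.\<close>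
  define g where "g x = (if 0 < x \<and> x < 1 then x * (1 - x) * \<phi> (- ln x) else 0)" for x
  have gb: "\<bar>g x\<bar> \<le> C * \<bar>x\<bar>" "\<bar>g x\<bar> \<le> C * \<bar>1 - x\<bar>" for x
  proof -
    have "\<bar>x * (1 - x) * \<phi> (- ln x)\<bar> \<le> C * \<bar>x\<bar> \<and> \<bar>x * (1 - x) * \<phi> (- ln x)\<bar> \<le> C * \<bar>1 - x\<bar>" if x: "0 < x" "x < 1"
    proof -
      have "\<bar>\<phi> (- ln x)\<bar> \<le> C" using x by (intro bnd) simp
      moreover have "x * (1 - x) \<le> x" "x * (1 - x) \<le> 1 - x"
        using x mult_left_le[of "1 - x" x] mult_left_le_one_le[of "1 - x" x] by auto
      ultimately have 1: "(x * (1 - x)) * \<bar>\<phi> (- ln x)\<bar> \<le> x * C" and 2: "(x * (1 - x)) * \<bar>\<phi> (- ln x)\<bar> \<le> (1 - x) * C"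
        by (intro mult_mono; use x in simp)+
      from 1 2 show ?thesis using x by (simp add: abs_mult mult.commute)
    qed
    then show "\<bar>g x\<bar> \<le> C * \<bar>x\<bar>" "\<bar>g x\<bar> \<le> C * \<bar>1 - x\<bar>" using C0 by (auto simp: g_def)
  qed
  have gcont: "continuous_on {0..1} g"
    unfolding continuous_on_eq_continuous_within
  proof
    fix x :: real assume "x \<in> {0..1}"
    then consider "x = 0" | "x = 1" | "0 < x" "x < 1" by fastforce
    then show "continuous (at x within {0..1}) g"
    proof cases
      case 1
      have "(g \<longlongrightarrow> 0) (at 0)"
        by (rule Lim_null_comparison[where g = "\<lambda>x. C * \<bar>x\<bar>"])
           (use gb in \<open>auto intro!: always_eventually tendsto_eq_intros\<close>)
      then have "continuous (at 0) g" by (simp add: isCont_def g_def)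
      then show ?thesis using 1 continuous_at_imp_continuous_at_within by blast
    next
      case 2
      have "(g \<longlongrightarrow> 0) (at 1)"
        by (rule Lim_null_comparison[where g = "\<lambda>x. C * \<bar>1 - x\<bar>"])
           (use gb in \<open>auto intro!: always_eventually tendsto_eq_intros\<close>)
      then have "continuous (at 1) g" by (simp add: isCont_def g_def)
      then show ?thesis using 2 continuous_at_imp_continuous_at_within by blast
    next
      case 3
      have "continuous_on {0<..<1} (\<lambda>x. x * (1 - x) * \<phi> (- ln x))"
        by (intro continuous_intros continuous_on_compose2[OF cont]) auto
      then have "continuous_on {0<..<1} g"
        by (rule continuous_on_cong[THEN iffD1, rotated 2]) (auto simp: g_def)
      then have "continuous (at x) g" using 3 by (simp add: continuous_on_eq_continuous_at)
      then show ?thesis using continuous_at_imp_continuous_at_within by blast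
    qed
  qed
  define h where "h t = g (exp (- t)) * (exp (- a * t) * \<phi> t)" for t
  have gexp: "g (exp (- t)) = exp (- t) * (1 - exp (- t)) * \<phi> t" if "0 < t" for t
    using that by (simp add: g_def)
  have hnn: "0 \<le> indicator {0<..} t * h t" for t
    by (auto simp: h_def gexp indicator_def zero_le_mult_iff mult_le_0_iff)
  have hint: "integrable lborel (\<lambda>t. indicator {0<..} t * h t)"
  proof -
    have "integrable lborel (\<lambda>t. (exp (- t) * (1 - exp (- t)) * (indicator {0<..} t * \<phi> t)) * (indicator {0<..} t * (exp (- a * t) * \<phi> t)))"
    proof (rule Bochner_Integration.integrable_bound)
      show "integrable lborel (\<lambda>t. C * (indicator {0<..} t * (exp (- a * t) * \<phi> t)))"
        using int[OF a] by (simp add: set_integrable_def)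
      have [measurable]: "(\<lambda>t. indicator {0<..} t * (exp (- a * t) * \<phi> t)) \<in> borel_measurable lborel"
        using int[OF a] by (auto simp: set_integrable_def)
      show "(\<lambda>t. (exp (- t) * (1 - exp (- t)) * (indicator {0<..} t * \<phi> t)) * (indicator {0<..} t * (exp (- a * t) * \<phi> t))) \<in> borel_measurable lborel"
        by measurable
      have "\<bar>g (exp (- t))\<bar> \<le> C" if "0 < t" for t
        using gb(1)[of "exp (- t)"] that mult_left_mono[of "exp (- t)" 1 C] C0 by auto
      then show "AE t in lborel. norm ((exp (- t) * (1 - exp (- t)) * (indicator {0<..} t * \<phi> t)) * (indicator {0<..} t * (exp (- a * t) * \<phi> t)))
          \<le> norm (C * (indicator {0<..} t * (exp (- a * t) * \<phi> t)))"
        using C0 by (intro AE_I2) (auto simp: indicator_def abs_mult gexp intro!: mult_right_mono simp flip: mult.assoc)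
    qed
    then show ?thesis
      by (rule Bochner_Integration.integrable_cong[THEN iffD1, rotated 2]) (auto simp: h_def gexp indicator_def)
  qed
  have small: "\<bar>LBINT t:{0<..}. h t\<bar> \<le> e * (C / a)" if e: "0 < e" for e
  proof -
    obtain p where p: "real_polynomial_function p" "\<And>x. x \<in> {0..1} \<Longrightarrow> \<bar>g x - p x\<bar> < e"
      using Stone_Weierstrass_real_polynomial_function[OF compact_Icc gcont e] by metis
    have hs: "set_integrable lborel {0<..} h" using hint by (simp add: set_integrable_def)
    have "(LBINT t:{0<..}. h t) = (LBINT t:{0<..}. h t - p (exp (- t)) * (exp (- a * t) * \<phi> t))"
      using poly[OF p(1)] set_integral_diff(2)[OF hs polyint[OF p(1)]] by simp
    also have "\<bar>\<dots>\<bar> \<le> (LBINT t:{0<..}. e * C * exp (- a * t))"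
      unfolding set_lebesgue_integral_def real_norm_def[symmetric]
    proof (rule Bochner_Integration.integral_norm_bound_integral)
      show "integrable lborel (\<lambda>t. indicator {0<..} t *\<^sub>R (h t - p (exp (- t)) * (exp (- a * t) * \<phi> t)))"
        using set_integral_diff(1)[OF hs polyint[OF p(1)]] by (simp add: set_integrable_def)
      show "integrable lborel (\<lambda>t. indicator {0<..} t *\<^sub>R (e * C * exp (- a * t)))"
        using set_integrable_mult_right[OF exp_decay_integral(1)[OF a], of "e * C"] by (simp add: set_integrable_def)
      fix t :: real
      show "norm (indicator {0<..} t *\<^sub>R (h t - p (exp (- t)) * (exp (- a * t) * \<phi> t))) \<le> indicator {0<..} t *\<^sub>R (e * C * exp (- a * t))"
      proof (cases "0 < t")
        case True
        have "\<bar>g (exp (- t)) - p (exp (- t))\<bar> * (exp (- a * t) * \<bar>\<phi> t\<bar>) \<le> e * (exp (- a * t) * C)"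
          using p(2)[of "exp (- t)"] True bnd[OF True] e by (intro mult_mono) auto
        moreover have "h t - p (exp (- t)) * (exp (- a * t) * \<phi> t) = (g (exp (- t)) - p (exp (- t))) * (exp (- a * t) * \<phi> t)"
          by (simp only: h_def left_diff_distrib)
        ultimately show ?thesis using True by (simp only: abs_mult real_norm_def) (simp add: mult_ac abs_mult)
      qed simp
    qed
    also have "\<dots> = e * (C / a)" using exp_decay_integral(2)[OF a] by simp
    finally show ?thesis .
  qed
  have "(LBINT t:{0<..}. h t) = 0"
  proof (rule ccontr)
    assume ne: "(LBINT t:{0<..}. h t) \<noteq> 0"
    define e where "e = \<bar>LBINT t:{0<..}. h t\<bar> / (2 * (C / a + 1))"
    have pos: "0 < C / a + 1" using C0 a by (simp add: add_nonneg_pos)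
    then have "0 < e" using ne by (simp add: e_def)
    then have e: "0 < e" .
    have 1: "\<bar>LBINT t:{0<..}. h t\<bar> \<le> e * (C / a)" by (rule small[OF e])
    have 2: "e * (C / a) < e * (C / a + 1)" using e by (simp only: mult_less_cancel_left_pos less_add_one)
    have "X / (2 * c) * c = X / 2" if "0 < c" for X c :: real using that by simp
    then have 3: "e * (C / a + 1) = \<bar>LBINT t:{0<..}. h t\<bar> / 2" unfolding e_def using pos by blast
    have "\<bar>LBINT t:{0<..}. h t\<bar> < \<bar>LBINT t:{0<..}. h t\<bar> / 2"
      using order_le_less_trans[OF 1 2] unfolding 3 .
    then show False by simp
  qed
  then have "AE t in lborel. indicator {0<..} t * h t = 0"
    using integral_nonneg_eq_0_iff_AE[OF hint AE_I2[OF hnn]] by (simp add: set_lebesgue_integral_def)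
  then have ae: "AE t in lborel. \<not> (0 < t \<and> \<phi> t \<noteq> 0)"
    by (rule AE_mp) (auto intro!: AE_I2 simp: h_def gexp indicator_def)
  have op: "open {t\<in>{0<..}. \<phi> t \<noteq> 0}"
    using continuous_open_preimage[OF cont, of "- {0}"] open_Compl[OF closed_singleton, of "0::real"]
    by (simp add: vimage_def Int_def)
  have "{t\<in>{0<..}. \<phi> t \<noteq> 0} \<in> null_sets lborel"
    using ae op by (auto simp: AE_iff_null)
  then have "negligible {t\<in>{0<..}. \<phi> t \<noteq> 0}"
    by (simp add: negligible_iff_null_sets null_sets_completionI)
  then have "{t\<in>{0<..}. \<phi> t \<noteq> 0} = {}" using open_not_negligible[OF op] by blast
  then show ?thesis using t by auto
qed

section \<open>Semigroups recovered from their Laplace transforms\<close>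

text \<open>
  A symmetric contraction family \<open>T\<close> whose Laplace transform \<open>R\<close> satisfies the resolvent identity is
  a strongly continuous semigroup, and \<open>R\<close> determines its generator.  For the heat operators this
  avoids a direct proof of the semigroup law, which would require the convolution of two heat
  kernels over hyperbolic space.
\<close>

locale laplace_family =
  fixes T R :: "real \<Rightarrow> 'a::{real_inner,banach} \<Rightarrow>\<^sub>L 'a"
  assumes contr: "\<And>t f. 0 < t \<Longrightarrow> norm (T t f) \<le> norm f"
    and symm: "\<And>t f g. 0 < t \<Longrightarrow> T t f \<bullet> g = f \<bullet> T t g"
    and cont: "\<And>f g. continuous_on {0<..} (\<lambda>t. T t f \<bullet> g)"
    and laplace: "\<And>l f g. 0 < l \<Longrightarrow> R l f \<bullet> g = (LBINT t:{0<..}. exp (- l * t) * (T t f \<bullet> g))"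
    and resolvent: "\<And>l m f. 0 < l \<Longrightarrow> 0 < m \<Longrightarrow> R l f - R m f = (m - l) *\<^sub>R R l (R m f)"
    and dense: "closure (range (R 1)) = UNIV"
begin

lemma pairing_bound: "0 < t \<Longrightarrow> \<bar>T t f \<bullet> g\<bar> \<le> norm f * norm g"
  using Cauchy_Schwarz_ineq2[of "T t f" g] contr[of t f] mult_right_mono[of "norm (T t f)" "norm f" "norm g"]
  by (meson norm_ge_zero order_trans)

lemma pairing_measurable [measurable]:
  "(\<lambda>t. indicator {0<..} t * (T t f \<bullet> g)) \<in> borel_measurable borel"
  by (rule indicator_mult_measurable_continuous[OF cont])

lemma pairing_integrable: "0 < l \<Longrightarrow> set_integrable lborel {0<..} (\<lambda>t. exp (- l * t) * (T t f \<bullet> g))"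
  by (rule set_integrable_exp_bounded[OF _ pairing_measurable pairing_bound])

text \<open>
  The function \<open>exp (m t)\<close> times the integral of \<open>exp (- m u) (T u f \<bullet> g)\<close> over \<open>u > t\<close>: the value
  that \<open>T t (R m f) \<bullet> g\<close> must have if \<open>T\<close> is a semigroup.
\<close>

definition tail :: "'a \<Rightarrow> 'a \<Rightarrow> real \<Rightarrow> real \<Rightarrow> real" where
  "tail f g m t = (LBINT u. indicator {t<..} u * (exp (- m * (u - t)) * (indicator {0<..} u * (T u f \<bullet> g))))"

lemma tail_shift: "0 \<le> t \<Longrightarrow> tail f g m t = (LBINT s:{0<..}. exp (- m * s) * (T (t + s) f \<bullet> g))"
  unfolding tail_def set_lebesgue_integral_def
  by (subst lborel_integral_real_affine[of 1 _ t])
     (auto intro!: Bochner_Integration.integral_cong simp: indicator_def)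

lemma tail_bound:
  assumes "0 < m" "0 \<le> t" shows "\<bar>tail f g m t\<bar> \<le> norm f * norm g / m"
proof -
  have "norm (tail f g m t) \<le> (LBINT s:{0<..}. norm f * norm g * exp (- m * s))"
    unfolding tail_shift[OF assms(2)] set_lebesgue_integral_def
  proof (rule Bochner_Integration.integral_norm_bound_integral)
    have "continuous_on {0<..} (\<lambda>s. T (t + s) f \<bullet> g)"
      by (rule continuous_on_compose2[OF cont]) (use assms in \<open>auto intro!: continuous_intros\<close>)
    then show "integrable lborel (\<lambda>s. indicator {0<..} s *\<^sub>R (exp (- m * s) * (T (t + s) f \<bullet> g)))"
      unfolding set_integrable_def[symmetric] using assms
      by (intro set_integrable_exp_bounded[where C = "norm f * norm g"] indicator_mult_measurable_continuous)
         (auto intro: pairing_bound)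
    show "integrable lborel (\<lambda>s. indicator {0<..} s *\<^sub>R (norm f * norm g * exp (- m * s)))"
      using set_integrable_mult_right[OF exp_decay_integral(1)[OF assms(1)], of "norm f * norm g"] by (simp add: set_integrable_def)
    fix s :: real
    show "norm (indicator {0<..} s *\<^sub>R (exp (- m * s) * (T (t + s) f \<bullet> g))) \<le> indicator {0<..} s *\<^sub>R (norm f * norm g * exp (- m * s))"
      using pairing_bound[of "t + s" f g] assms by (auto simp: indicator_def abs_mult mult.commute intro!: mult_left_mono)
  qed
  also have "\<dots> = norm f * norm g / m" using exp_decay_integral(2)[OF assms(1)] by simp
  finally show ?thesis by simp
qed

lemma tail_continuous: assumes m: "0 < m" shows "continuous_on {0<..} (tail f g m)"
  unfolding continuous_on_sequentially o_def
proof (intro ballI allI impI, elim conjE)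
  fix x :: "nat \<Rightarrow> real" and t assume t: "t \<in> {0<..}" and x: "\<forall>n. x n \<in> {0<..}" "x \<longlonglongrightarrow> t"
  have x0: "0 < x n" for n using x by auto
  have "(\<lambda>n. LBINT s. indicator {0<..} s *\<^sub>R (exp (- m * s) * (T (x n + s) f \<bullet> g)))
     \<longlonglongrightarrow> (LBINT s. indicator {0<..} s *\<^sub>R (exp (- m * s) * (T (t + s) f \<bullet> g)))"
  proof (rule integral_dominated_convergence)
    have meas: "(\<lambda>s. indicator {0<..} s *\<^sub>R (exp (- m * s) * (T (y + s) f \<bullet> g))) \<in> borel_measurable lborel" if "0 < y" for y
    proof -
      have "continuous_on {0<..} (\<lambda>s. exp (- m * s) * (T (y + s) f \<bullet> g))"
        by (intro continuous_intros continuous_on_compose2[OF cont]) (use that in auto)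
      then show ?thesis using indicator_mult_measurable_continuous by simp
    qed
    show "(\<lambda>s. indicator {0<..} s *\<^sub>R (exp (- m * s) * (T (t + s) f \<bullet> g))) \<in> borel_measurable lborel"
      using t by (intro meas) auto
    show "\<And>n. (\<lambda>s. indicator {0<..} s *\<^sub>R (exp (- m * s) * (T (x n + s) f \<bullet> g))) \<in> borel_measurable lborel"
      using x0 by (intro meas) auto
    show "integrable lborel (\<lambda>s. indicator {0<..} s *\<^sub>R (norm f * norm g * exp (- m * s)))"
      using set_integrable_mult_right[OF exp_decay_integral(1)[OF m], of "norm f * norm g"] by (simp add: set_integrable_def)
    show "AE s in lborel. (\<lambda>n. indicator {0<..} s *\<^sub>R (exp (- m * s) * (T (x n + s) f \<bullet> g)))
       \<longlonglongrightarrow> indicator {0<..} s *\<^sub>R (exp (- m * s) * (T (t + s) f \<bullet> g))"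
    proof (intro AE_I2)
      fix s :: real
      show "(\<lambda>n. indicator {0<..} s *\<^sub>R (exp (- m * s) * (T (x n + s) f \<bullet> g)))
       \<longlonglongrightarrow> indicator {0<..} s *\<^sub>R (exp (- m * s) * (T (t + s) f \<bullet> g))"
      proof (cases "0 < s")
        case True
        have lim: "(\<lambda>n. T (x n + s) f \<bullet> g) \<longlonglongrightarrow> T (t + s) f \<bullet> g"
        proof (rule continuous_on_tendsto_compose[OF cont])
          show "(\<lambda>n. x n + s) \<longlonglongrightarrow> t + s" by (intro tendsto_intros x)
          show "t + s \<in> {0<..}" using t True by simp
          show "eventually (\<lambda>n. x n + s \<in> {0<..}) sequentially" using x0 True by (simp add: add_pos_pos)
        qed
        show ?thesis by (intro tendsto_scaleR tendsto_mult tendsto_const lim)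
      qed simp
    qed
    show "AE s in lborel. norm (indicator {0<..} s *\<^sub>R (exp (- m * s) * (T (x n + s) f \<bullet> g))) \<le> indicator {0<..} s *\<^sub>R (norm f * norm g * exp (- m * s))" for n
    proof (intro AE_I2)
      fix s :: real
      show "norm (indicator {0<..} s *\<^sub>R (exp (- m * s) * (T (x n + s) f \<bullet> g))) \<le> indicator {0<..} s *\<^sub>R (norm f * norm g * exp (- m * s))"
        using pairing_bound[of "x n + s" f g] x0[of n]
        by (auto simp: indicator_def abs_mult mult.commute intro!: mult_left_mono)
    qed
  qed
  then show "(\<lambda>n. tail f g m (x n)) \<longlonglongrightarrow> tail f g m t"
    using t x0 less_imp_le[OF x0] by (simp add: tail_shift set_lebesgue_integral_def)
qed

text \<open>
  Exchanging the integrations over \<open>0 < t < u\<close> leaves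
  \<open>(exp (- m u) - exp (- l u)) / (l - m)\<close> as the weight of \<open>T u f \<bullet> g\<close>.
\<close>

lemma tail_laplace:
  assumes m: "0 < m" and lm: "m < l"
  shows "(LBINT t:{0<..}. exp (- l * t) * tail f g m t) = (R m f \<bullet> g - R l f \<bullet> g) / (l - m)"
proof -
  define B where "B u = indicator {0<..} u * (T u f \<bullet> g)" for u :: real
  have [measurable]: "B \<in> borel_measurable borel" unfolding B_def by measurable
  have Bb: "\<bar>B u\<bar> \<le> norm f * norm g * indicator {0<..} u" for u
    using pairing_bound[of u f g] by (auto simp: B_def indicator_def)
  define F where "F = (\<lambda>(t, u). indicator {0<..} t * (indicator {t<..} u * (exp (- l * t) * (exp (- m * (u - t)) * B u))))"
  have Fm [measurable]: "F \<in> borel_measurable (lborel \<Otimes>\<^sub>M lborel)"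
  proof -
    have "F = (\<lambda>p. (if 0 < fst p \<and> fst p < snd p then exp (- l * fst p) * (exp (- m * (snd p - fst p)) * B (snd p)) else 0))"
      by (auto simp: F_def fun_eq_iff indicator_def)
    also have "\<dots> \<in> borel_measurable (lborel \<Otimes>\<^sub>M lborel)" by measurable
    finally show ?thesis .
  qed
  have Fbound: "\<bar>F (t, u)\<bar> \<le> norm f * norm g * ((indicator {0<..} t * exp (- (l - m) * t)) * (indicator {0<..} u * exp (- m * u)))" for t u
  proof (cases "0 < t \<and> t < u")
    case True
    have "\<bar>F (t, u)\<bar> = exp (- (l - m) * t) * exp (- m * u) * \<bar>B u\<bar>"
      using True by (simp add: F_def abs_mult exp_add[symmetric] algebra_simps)
    also have "\<dots> \<le> exp (- (l - m) * t) * exp (- m * u) * (norm f * norm g)"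
      using Bb[of u] True by (intro mult_left_mono) auto
    finally show ?thesis using True by (simp add: mult_ac)
  qed (auto simp: F_def indicator_def)
  have prod: "integrable (lborel \<Otimes>\<^sub>M lborel) (\<lambda>(t, u). (indicator {0<..} t * exp (- (l - m) * t)) * (indicator {0<..} u * exp (- m * u)))"
  proof (rule lborel_pair.Fubini_integrable)
    have e1: "integrable lborel (\<lambda>t. indicator {0<..} t * exp (- (l - m) * t))"
      using exp_decay_integral(1)[of "l - m"] lm by (simp add: set_integrable_def)
    have e2: "integrable lborel (\<lambda>t. indicator {0<..} t * exp (- m * t))"
      using exp_decay_integral(1)[of m] m by (simp add: set_integrable_def)
    show "(\<lambda>(t, u). (indicator {0<..} t * exp (- (l - m) * t)) * (indicator {0<..} u * exp (- m * u))) \<in> borel_measurable (lborel \<Otimes>\<^sub>M lborel)"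
      by measurable
    show "AE t in lborel. integrable lborel (\<lambda>u. case (t, u) of (t, u) \<Rightarrow> (indicator {0<..} t * exp (- (l - m) * t)) * (indicator {0<..} u * exp (- m * u)))"
      using e2 by simp
    show "integrable lborel (\<lambda>t. LBINT u. norm (case (t, u) of (t, u) \<Rightarrow> (indicator {0<..} t * exp (- (l - m) * t)) * (indicator {0<..} u * exp (- m * u))))"
      using e1 by (simp add: abs_mult)
  qed
  have Fint: "integrable (lborel \<Otimes>\<^sub>M lborel) F"
    by (rule Bochner_Integration.integrable_bound[OF integrable_mult_right[OF prod, of "norm f * norm g"] Fm])
       (use Fbound in \<open>auto intro!: AE_I2 order_trans[OF _ abs_ge_self]\<close>)
  have "(LBINT t:{0<..}. exp (- l * t) * tail f g m t) = (LBINT t. (LBINT u. F (t, u)))"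
    unfolding set_lebesgue_integral_def
    by (intro Bochner_Integration.integral_cong)
       (auto simp: F_def tail_def B_def indicator_def mult_ac simp flip: integral_mult_right_zero)
  also have "\<dots> = (LBINT u. (LBINT t. F (t, u)))"
    using lborel_pair.Fubini_integral[of "\<lambda>t u. F (t, u)"] Fint by (simp add: case_prod_beta')
  also have "\<dots> = (LBINT u. (1 / (l - m)) * ((indicator {0<..} u * (exp (- m * u) * (T u f \<bullet> g))) - (indicator {0<..} u * (exp (- l * u) * (T u f \<bullet> g)))))"
  proof (intro Bochner_Integration.integral_cong refl)
    fix u :: real
    show "(LBINT t. F (t, u)) = (1 / (l - m)) * ((indicator {0<..} u * (exp (- m * u) * (T u f \<bullet> g))) - (indicator {0<..} u * (exp (- l * u) * (T u f \<bullet> g))))"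
    proof (cases "0 < u")
      case True
      have "(LBINT t. F (t, u)) = (LBINT t. (exp (- m * u) * B u) * (indicator {0<..<u} t * exp (- (l - m) * t)))"
        by (intro Bochner_Integration.integral_cong refl)
           (auto simp: F_def indicator_def exp_add[symmetric] algebra_simps)
      also have "\<dots> = (exp (- m * u) * B u) * (LBINT t. indicator {0<..<u} t * exp (- (l - m) * t))"
        by simp
      also have "(LBINT t. indicator {0<..<u} t * exp (- (l - m) * t)) = (LBINT t=0..u. exp (- (l - m) * t))"
        using True by (simp add: interval_lebesgue_integral_def set_lebesgue_integral_def zero_ereal_def)
      also have "\<dots> = exp (- (l - m) * u) / (m - l) - exp (- (l - m) * 0) / (m - l)"
        unfolding zero_ereal_def
      proof (rule interval_integral_FTC_finite)
        show "continuous_on {min 0 u..max 0 u} (\<lambda>t. exp (- (l - m) * t))" by (intro continuous_intros)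
        fix x
        have "((\<lambda>x. exp (- (l - m) * x) / (m - l)) has_real_derivative exp (- (l - m) * x)) (at x within {min 0 u..max 0 u})"
          using lm by (auto intro!: derivative_eq_intros)
        then show "((\<lambda>x. exp (- (l - m) * x) / (m - l)) has_vector_derivative exp (- (l - m) * x)) (at x within {min 0 u..max 0 u})"
          by (simp add: has_real_derivative_iff_has_vector_derivative)
      qed
      finally have "(LBINT t. F (t, u)) = (exp (- m * u) * B u) * (exp (- (l - m) * u) / (m - l) - 1 / (m - l))" by simp
      also have "\<dots> = 1 / (l - m) * (exp (- m * u) * B u - (exp (- m * u) * exp (- (l - m) * u)) * B u)"
      proof -
        have "p * b * (q / (m - l) - 1 / (m - l)) = 1 / (l - m) * (p * b - (p * q) * b)" for p q b
        proof -
          have "1 / (m - l) = - (1 / (l - m))" "q / (m - l) = - (q / (l - m))"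
            by (simp_all add: minus_divide_right)
          then show ?thesis by (simp add: algebra_simps)
        qed
        then show ?thesis .
      qed
      also have "exp (- m * u) * exp (- (l - m) * u) = exp (- l * u)" by (simp add: exp_add[symmetric] algebra_simps)
      finally show ?thesis using True by (simp add: B_def)
    qed (auto simp: F_def B_def indicator_def intro!: integral_eq_zero_AE)
  qed
  also have "\<dots> = (1 / (l - m)) * (R m f \<bullet> g - R l f \<bullet> g)"
    using pairing_integrable[of m f g] pairing_integrable[of l f g] m lm
    by (simp add: laplace set_lebesgue_integral_def set_integrable_def)
  finally show ?thesis by simp
qed

text \<open>
  By the resolvent identity both sides have the same Laplace transform in \<open>t\<close>.
\<close>

theorem semigroup_resolvent:
  assumes m: "0 < m" and t: "0 < t"
  shows "T t (R m f) \<bullet> g = tail f g m t"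
proof -
  define \<phi> where "\<phi> t = T t (R m f) \<bullet> g - tail f g m t" for t
  have "\<phi> t = 0"
  proof (rule laplace_unique[OF _ _ _ _ t])
    show "continuous_on {0<..} \<phi>" unfolding \<phi>_def by (intro continuous_intros cont tail_continuous m)
    show "\<bar>\<phi> t\<bar> \<le> norm (R m f) * norm g + norm f * norm g / m" if "0 < t" for t
      using pairing_bound[OF that, of "R m f" g] tail_bound[OF m, of t f g] that
      unfolding \<phi>_def by linarith
    show "0 < m + 1" using m by simp
    fix l assume l: "m + 1 \<le> l"
    have [simp]: "l \<noteq> m" "m \<noteq> l" "0 < l" using l m by auto
    have i1: "set_integrable lborel {0<..} (\<lambda>t. exp (- l * t) * (T t (R m f) \<bullet> g))"
      by (rule pairing_integrable) simp
    have i2: "set_integrable lborel {0<..} (\<lambda>t. exp (- l * t) * tail f g m t)"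
      using m by (intro set_integrable_exp_bounded[where C = "norm f * norm g / m"] indicator_mult_measurable_continuous tail_continuous)
        (auto intro!: tail_bound)
    have "(LBINT t:{0<..}. exp (- l * t) * \<phi> t) = R l (R m f) \<bullet> g - (R m f \<bullet> g - R l f \<bullet> g) / (l - m)"
    proof -
      have "(LBINT t:{0<..}. exp (- l * t) * (T t (R m f) \<bullet> g)) = R l (R m f) \<bullet> g"
        by (rule laplace[symmetric]) simp
      moreover have "(LBINT t:{0<..}. exp (- l * t) * tail f g m t) = (R m f \<bullet> g - R l f \<bullet> g) / (l - m)"
        using m l by (intro tail_laplace) auto
      ultimately show ?thesis
        unfolding \<phi>_def right_diff_distrib set_integral_diff(2)[OF i1 i2] by simp
    qed
    also have "R l (R m f) = (1 / (m - l)) *\<^sub>R (R l f - R m f)"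
      using resolvent[of l m f] m by simp
    finally have "(LBINT t:{0<..}. exp (- l * t) * \<phi> t)
        = (R l f \<bullet> g - R m f \<bullet> g) / (m - l) - (R m f \<bullet> g - R l f \<bullet> g) / (l - m)"
      by (simp add: inner_diff_left)
    then show "(LBINT t:{0<..}. exp (- l * t) * \<phi> t) = 0"
      using minus_divide_divide[of "R l f \<bullet> g - R m f \<bullet> g" "m - l"] by simp
  qed
  then show ?thesis by (simp add: \<phi>_def)
qed

text \<open>
  For fixed \<open>s\<close> both sides have the same Laplace transform in \<open>t\<close>, by the preceding theorem.
\<close>

lemma T_add_pos:
  assumes s: "0 < s" and t: "0 < t" shows "T (s + t) f = T s (T t f)"
proof -
  have "T (s + t) f \<bullet> g = T s (T t f) \<bullet> g" for g
  proof -
    define \<phi> where "\<phi> t = T s (T t f) \<bullet> g - T (s + t) f \<bullet> g" for t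
    have c: "continuous_on {0<..} (\<lambda>t. T s (T t f) \<bullet> g)" "continuous_on {0<..} (\<lambda>t. T (s + t) f \<bullet> g)"
    proof -
      show "continuous_on {0<..} (\<lambda>t. T s (T t f) \<bullet> g)" using cont[of f "T s g"] by (simp add: symm[OF s])
      show "continuous_on {0<..} (\<lambda>t. T (s + t) f \<bullet> g)"
        by (rule continuous_on_compose2[OF cont[of f g]]) (use s in \<open>auto intro!: continuous_intros\<close>)
    qed
    have b: "\<bar>T s (T t f) \<bullet> g\<bar> \<le> norm f * norm g" "\<bar>T (s + t) f \<bullet> g\<bar> \<le> norm f * norm g" if "0 < t" for t
    proof -
      show "\<bar>T (s + t) f \<bullet> g\<bar> \<le> norm f * norm g" using s that by (intro pairing_bound) simp
      show "\<bar>T s (T t f) \<bullet> g\<bar> \<le> norm f * norm g"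
        using pairing_bound[OF s, of "T t f" g] contr[OF that, of f]
        by (meson mult_right_mono norm_ge_zero order_trans)
    qed
    have "\<phi> t = 0"
    proof (rule laplace_unique[where a = 1, OF _ _ _ _ t])
      show "continuous_on {0<..} \<phi>" unfolding \<phi>_def by (intro continuous_intros c)
      show "\<bar>\<phi> t\<bar> \<le> norm f * norm g + norm f * norm g" if "0 < t" for t
        using b[OF that] unfolding \<phi>_def by linarith
      fix m :: real assume "1 \<le> m"
      then have m: "0 < m" by simp
      have i1: "set_integrable lborel {0<..} (\<lambda>t. exp (- m * t) * (T s (T t f) \<bullet> g))"
        by (intro set_integrable_exp_bounded[where C = "norm f * norm g"] indicator_mult_measurable_continuous c m b)
      have i2: "set_integrable lborel {0<..} (\<lambda>t. exp (- m * t) * (T (s + t) f \<bullet> g))"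
        by (intro set_integrable_exp_bounded[where C = "norm f * norm g"] indicator_mult_measurable_continuous c m b)
      have "(LBINT t:{0<..}. exp (- m * t) * (T s (T t f) \<bullet> g)) = T s (R m f) \<bullet> g"
        by (simp add: symm[OF s] laplace[OF m])
      also have "\<dots> = (LBINT t:{0<..}. exp (- m * t) * (T (s + t) f \<bullet> g))"
        using semigroup_resolvent[OF m s, of f g] tail_shift[of s f g m] s by simp
      finally show "(LBINT t:{0<..}. exp (- m * t) * \<phi> t) = 0"
        unfolding \<phi>_def right_diff_distrib using set_integral_diff(2)[OF i1 i2] by simp
    qed simp
    then show ?thesis by (simp add: \<phi>_def)
  qed
  then have "(T (s + t) f - T s (T t f)) \<bullet> (T (s + t) f - T s (T t f)) = 0"
    by (simp add: inner_diff_left)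
  then show ?thesis by simp
qed

lemma integrable_Ioc_const: "integrable lborel (\<lambda>u. indicat_real {0<..t::real} u *\<^sub>R (c::real))"
  using emeasure_lborel_Ioc[of 0 t] by (cases "0 \<le> t") (auto intro!: integrable_mult_left integrable_real_indicator)

lemma integral_Ioc_const: "0 \<le> t \<Longrightarrow> (LBINT u:{0<..t::real}. (c::real)) = t * c"
  by (simp add: set_lebesgue_integral_def measure_def)

lemma norm_le_by_pairing:
  assumes "0 \<le> C" "\<And>g. \<bar>x \<bullet> g\<bar> \<le> C * norm g" shows "norm (x :: 'a) \<le> C"
proof (cases "x = 0")
  case False
  have "norm x * norm x \<le> C * norm x"
    using assms(2)[of x] by (simp add: power2_norm_eq_inner[symmetric] power2_eq_square)
  then show ?thesis using False by simp
qed (use assms in simp)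

text \<open>
  Split \<open>R 1 h\<close> as an integral over \<open>u > t\<close>, which \<open>T t\<close> multiplies by \<open>exp t\<close>, and an integral over
  \<open>u \<le> t\<close>, which is of order \<open>t\<close>.
\<close>

lemma orbit_increment:
  assumes t: "0 < t"
  obtains I J where "R 1 h \<bullet> g = J + I" "T t (R 1 h) \<bullet> g = exp t * J"
    "\<bar>J\<bar> \<le> norm h * norm g"
    "I = (LBINT u:{0<..t}. exp (- u) * (T u h \<bullet> g))"
    "set_integrable lborel {0<..t} (\<lambda>u. exp (- u) * (T u h \<bullet> g))"
    "\<bar>I\<bar> \<le> t * (norm h * norm g)"
proof
  let ?b = "\<lambda>u. exp (- u) * (T u h \<bullet> g)"
  define J where "J = (LBINT u:{t<..}. ?b u)"
  define I where "I = (LBINT u:{0<..t}. ?b u)"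
  have b: "set_integrable lborel {0<..} ?b" using pairing_integrable[of 1 h g] by simp
  have bI: "set_integrable lborel {0<..t} ?b" by (rule set_integrable_subset[OF b]) auto
  have bJ: "set_integrable lborel {t<..} ?b" by (rule set_integrable_subset[OF b]) (use t in auto)
  show "I = (LBINT u:{0<..t}. ?b u)" by (fact I_def)
  show "set_integrable lborel {0<..t} ?b" by (fact bI)
  have "(LBINT u:{t<..} \<union> {0<..t}. ?b u) = J + I"
    unfolding J_def I_def by (rule set_integral_Un[OF _ bJ bI]) auto
  moreover have "{t<..} \<union> {0<..t} = {0<..}" using t by auto
  ultimately show "R 1 h \<bullet> g = J + I" using laplace[of 1 h g] by simp
  have tl: "tail h g 1 t = exp t * J"
    unfolding J_def tail_def set_lebesgue_integral_def integral_mult_right_zero[symmetric]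
    using t by (intro Bochner_Integration.integral_cong refl)
               (auto simp: indicator_def exp_add[symmetric] exp_diff exp_minus field_simps)
  then show "T t (R 1 h) \<bullet> g = exp t * J" using semigroup_resolvent[of 1 t h g] t by simp
  have "exp t * \<bar>J\<bar> \<le> norm h * norm g"
    using tail_bound[of 1 t h g] t unfolding tl by (simp add: abs_mult)
  moreover have "1 * \<bar>J\<bar> \<le> exp t * \<bar>J\<bar>" using t by (intro mult_right_mono) auto
  ultimately show "\<bar>J\<bar> \<le> norm h * norm g" by linarith
  have "norm I \<le> (LBINT u:{0<..t}. norm h * norm g)"
    unfolding I_def set_lebesgue_integral_def
  proof (rule Bochner_Integration.integral_norm_bound_integral)
    show "integrable lborel (\<lambda>u. indicator {0<..t} u *\<^sub>R ?b u)" using bI by (simp add: set_integrable_def)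
    show "integrable lborel (\<lambda>u. indicat_real {0<..t} u *\<^sub>R (norm h * norm g))" by (rule integrable_Ioc_const)
    fix u :: real
    show "norm (indicator {0<..t} u *\<^sub>R ?b u) \<le> indicator {0<..t} u *\<^sub>R (norm h * norm g)"
      using pairing_bound[of u h g] mult_mono[of "exp (- u)" 1 "\<bar>T u h \<bullet> g\<bar>" "norm h * norm g"]
      by (auto simp: indicator_def abs_mult)
  qed
  also have "\<dots> = t * (norm h * norm g)" using t by (simp only: integral_Ioc_const less_imp_le)
  finally show "\<bar>I\<bar> \<le> t * (norm h * norm g)" by simp
qed

lemma orbit_range_estimate:
  assumes t: "0 < t" shows "norm (T t (R 1 h) - R 1 h) \<le> ((exp t - 1) + t) * norm h"
proof (rule norm_le_by_pairing)
  show "0 \<le> ((exp t - 1) + t) * norm h" using t by simp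
  fix g
  obtain I J where IJ: "R 1 h \<bullet> g = J + I" "T t (R 1 h) \<bullet> g = exp t * J"
    "\<bar>J\<bar> \<le> norm h * norm g"
    "I = (LBINT u:{0<..t}. exp (- u) * (T u h \<bullet> g))"
    "set_integrable lborel {0<..t} (\<lambda>u. exp (- u) * (T u h \<bullet> g))"
    "\<bar>I\<bar> \<le> t * (norm h * norm g)"
    by (rule orbit_increment[OF t, of h g])
  have "(T t (R 1 h) - R 1 h) \<bullet> g = (exp t - 1) * J - I"
    using IJ(1,2) by (simp add: inner_diff_left algebra_simps)
  then have "\<bar>(T t (R 1 h) - R 1 h) \<bullet> g\<bar> \<le> (exp t - 1) * \<bar>J\<bar> + \<bar>I\<bar>"
    using t by (metis abs_mult abs_of_nonneg abs_triangle_ineq4 diff_ge_0_iff_ge less_imp_le one_le_exp_iff)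
  also have "\<dots> \<le> (exp t - 1) * (norm h * norm g) + t * (norm h * norm g)"
    using IJ(3,6) t by (intro add_mono mult_left_mono) auto
  finally show "\<bar>(T t (R 1 h) - R 1 h) \<bullet> g\<bar> \<le> ((exp t - 1) + t) * norm h * norm g"
    by (simp add: algebra_simps)
qed

text \<open>
  The preceding estimate gives convergence on the range of \<open>R 1\<close>, which is dense; contractivity
  extends it to all vectors.
\<close>

lemma strongly_continuous: "((\<lambda>t. T t f) \<longlongrightarrow> f) (at_right 0)"
proof (rule tendstoI)
  fix e :: real assume e: "0 < e"
  have "f \<in> closure (range (R 1))" using dense by simp
  then obtain h where h: "dist (R 1 h) f < e / 4"
    unfolding closure_approachable using e by (metis (no_types, lifting) rangeE zero_less_divide_iff zero_less_numeral)
  have "((\<lambda>t::real. ((exp t - 1) + t) * norm h) \<longlongrightarrow> ((exp 0 - 1) + 0) * norm h) (at_right 0)"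
    by (intro tendsto_intros)
  then have "eventually (\<lambda>t::real. ((exp t - 1) + t) * norm h < e / 4) (at_right 0)"
    using e by (intro order_tendstoD(2)) auto
  moreover have "eventually (\<lambda>t::real. 0 < t) (at_right 0)" by (simp add: eventually_at_right_less)
  ultimately show "eventually (\<lambda>t. dist (T t f) f < e) (at_right 0)"
  proof eventually_elim
    case (elim t)
    have "T t f - f = T t (f - R 1 h) + ((T t (R 1 h) - R 1 h) + (R 1 h - f))"
      by (simp add: blinfun.diff_right)
    moreover have "norm (a + (b + c)) \<le> norm a + (norm b + norm c)" for a b c :: 'a
      using norm_triangle_ineq[of a "b + c"] norm_triangle_ineq[of b c] by linarith
    ultimately have "norm (T t f - f) \<le> norm (T t (f - R 1 h)) + (norm (T t (R 1 h) - R 1 h) + norm (R 1 h - f))"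
      by metis
    moreover have "norm (T t (f - R 1 h)) \<le> norm (f - R 1 h)" using elim by (intro contr)
    moreover have "norm (f - R 1 h) < e / 4" "norm (R 1 h - f) < e / 4"
      using h by (simp_all add: dist_norm norm_minus_commute)
    moreover have "norm (T t (R 1 h) - R 1 h) < e / 4"
      using orbit_range_estimate[of t h] elim by linarith
    ultimately show ?case unfolding dist_norm using e by linarith
  qed
qed

text \<open>
  The hypotheses leave \<open>T t\<close> arbitrary for \<open>t \<le> 0\<close>, so the value at 0 is set separately.
\<close>

definition sg :: "real \<Rightarrow> 'a \<Rightarrow>\<^sub>L 'a" where
  "sg t = (if t \<le> 0 then id_blinfun else T t)"

lemma sg_contraction: "norm (sg t f) \<le> norm f"
  by (simp add: sg_def contr)

sublocale sg: strong_semigroup sg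
proof
  show "sg 0 = id_blinfun" by (simp add: sg_def)
  show "sg (s + t) = sg s o\<^sub>L sg t" if "0 \<le> s" "0 \<le> t" for s t
    using that T_add_pos[of s t] by (cases "s = 0"; cases "t = 0") (auto simp: sg_def intro!: blinfun_eqI)
  show "((\<lambda>t. sg t f) \<longlongrightarrow> f) (at_right 0)" for f
  proof (rule Lim_transform_eventually[OF strongly_continuous])
    show "eventually (\<lambda>t. T t f = sg t f) (at_right 0)"
      unfolding eventually_at_right_field by (auto simp: sg_def intro!: exI[of _ 1])
  qed
qed

text \<open>
  The difference quotient is \<open>((exp t - 1) / t) J - I / t\<close> in the notation of \<open>orbit_increment\<close>;
  as \<open>t\<close> tends to 0, \<open>J\<close> tends to \<open>R 1 h\<close> and \<open>I / t\<close> to \<open>h\<close>.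
\<close>

lemma gen_resolvent: "sg.gen (R 1 h) (R 1 h - h)"
proof -
  define D where "D t = (1 / t) *\<^sub>R (T t (R 1 h) - R 1 h) - (R 1 h - h)" for t
  have "(D \<longlongrightarrow> 0) (at_right 0)"
  proof (rule tendstoI)
    fix e :: real assume e: "0 < e"
    have expl: "((\<lambda>t::real. (exp t - 1) / t) \<longlongrightarrow> 1) (at_right 0)"
    proof -
      have "((\<lambda>t::real. (exp (0 + t) - exp 0) / t) \<longlongrightarrow> exp 0) (at 0)"
        using DERIV_exp[of "0::real"] unfolding DERIV_def .
      then show ?thesis by (simp add: filterlim_at_split)
    qed
    have "((\<lambda>t::real. (\<bar>(exp t - 1) / t - 1\<bar> + t) * norm h) \<longlongrightarrow> (\<bar>1 - 1\<bar> + 0) * norm h) (at_right 0)"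
      by (intro tendsto_intros expl)
    then have ev1: "eventually (\<lambda>t::real. (\<bar>(exp t - 1) / t - 1\<bar> + t) * norm h < e / 2) (at_right 0)"
      using e by (intro order_tendstoD(2)) auto
    have "((\<lambda>u::real. exp (- u) *\<^sub>R T u h) \<longlongrightarrow> exp (- 0) *\<^sub>R h) (at_right 0)"
      by (intro tendsto_intros strongly_continuous)
    then have "eventually (\<lambda>u. dist (exp (- u) *\<^sub>R T u h) h < e / 4) (at_right 0)"
      using e by (intro tendstoD) auto
    then obtain b where b: "0 < b" "\<And>u. 0 < u \<Longrightarrow> u < b \<Longrightarrow> dist (exp (- u) *\<^sub>R T u h) h < e / 4"
      unfolding eventually_at_right_field by auto
    have ev2: "eventually (\<lambda>t. 0 < t \<and> t < b) (at_right 0)"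
      using b(1) by (auto simp: eventually_at_right_field)
    show "eventually (\<lambda>t. dist (D t) 0 < e) (at_right 0)"
      using ev1 ev2
    proof eventually_elim
      case (elim t)
      then have t: "0 < t" "t < b" by auto
      have "norm (D t) \<le> (\<bar>(exp t - 1) / t - 1\<bar> + t) * norm h + e / 4"
      proof (rule norm_le_by_pairing)
        show "0 \<le> (\<bar>(exp t - 1) / t - 1\<bar> + t) * norm h + e / 4" using e t by simp
        fix g
        obtain I J where IJ: "R 1 h \<bullet> g = J + I" "T t (R 1 h) \<bullet> g = exp t * J" "\<bar>J\<bar> \<le> norm h * norm g"
          "I = (LBINT u:{0<..t}. exp (- u) * (T u h \<bullet> g))"
          "set_integrable lborel {0<..t} (\<lambda>u. exp (- u) * (T u h \<bullet> g))"
          "\<bar>I\<bar> \<le> t * (norm h * norm g)"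
          by (rule orbit_increment[OF t(1), of h g])
        have c: "set_integrable lborel {0<..t} (\<lambda>u. h \<bullet> g)" unfolding set_integrable_def by (rule integrable_Ioc_const)
        have "I - t * (h \<bullet> g) = (LBINT u:{0<..t}. exp (- u) * (T u h \<bullet> g) - h \<bullet> g)"
          unfolding set_integral_diff(2)[OF IJ(5) c] IJ(4) using t by (simp add: integral_Ioc_const)
        also have "norm \<dots> \<le> (LBINT u:{0<..t}. e / 4 * norm g)"
          unfolding set_lebesgue_integral_def
        proof (rule Bochner_Integration.integral_norm_bound_integral)
          show "integrable lborel (\<lambda>u. indicator {0<..t} u *\<^sub>R (exp (- u) * (T u h \<bullet> g) - h \<bullet> g))"
            using set_integral_diff(1)[OF IJ(5) c] by (simp add: set_integrable_def)
          show "integrable lborel (\<lambda>u. indicat_real {0<..t} u *\<^sub>R (e / 4 * norm g))" by (rule integrable_Ioc_const)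
          fix u :: real
          show "norm (indicator {0<..t} u *\<^sub>R (exp (- u) * (T u h \<bullet> g) - h \<bullet> g)) \<le> indicator {0<..t} u *\<^sub>R (e / 4 * norm g)"
          proof (cases "u \<in> {0<..t}")
            case True
            have "\<bar>(exp (- u) *\<^sub>R T u h - h) \<bullet> g\<bar> \<le> norm (exp (- u) *\<^sub>R T u h - h) * norm g"
              by (rule Cauchy_Schwarz_ineq2)
            also have "\<dots> \<le> e / 4 * norm g"
              using b(2)[of u] True t by (intro mult_right_mono) (auto simp: dist_norm)
            finally show ?thesis using True by (simp add: inner_diff_left)
          qed simp
        qed
        also have "(LBINT u:{0<..t}. e / 4 * norm g) = t * (e / 4 * norm g)" using t by (simp only: integral_Ioc_const less_imp_le)
        finally have est: "\<bar>I - t * (h \<bullet> g)\<bar> \<le> t * (e / 4 * norm g)" by simp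
        have "D t \<bullet> g = ((exp t - 1) / t - 1) * J - I - (I - t * (h \<bullet> g)) / t"
        proof -
          have "D t \<bullet> g = (exp t * J - (J + I)) / t - ((J + I) - h \<bullet> g)"
            using IJ(1,2) by (simp add: D_def inner_diff_left inner_scaleR_left)
          then show ?thesis using t by (simp add: diff_divide_distrib add_divide_distrib algebra_simps)
        qed
        then have "\<bar>D t \<bullet> g\<bar> \<le> \<bar>(exp t - 1) / t - 1\<bar> * \<bar>J\<bar> + \<bar>I\<bar> + \<bar>I - t * (h \<bullet> g)\<bar> / t"
          using t abs_triangle_ineq4[of "((exp t - 1) / t - 1) * J - I" "(I - t * (h \<bullet> g)) / t"]
            abs_triangle_ineq4[of "((exp t - 1) / t - 1) * J" I] by (simp add: abs_mult)
        also have "\<dots> \<le> \<bar>(exp t - 1) / t - 1\<bar> * (norm h * norm g) + t * (norm h * norm g) + e / 4 * norm g"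
        proof (intro add_mono mult_left_mono IJ)
          show "\<bar>I - t * (h \<bullet> g)\<bar> / t \<le> e / 4 * norm g"
            using est t by (simp add: pos_divide_le_eq mult.commute)
        qed simp
        finally show "\<bar>D t \<bullet> g\<bar> \<le> ((\<bar>(exp t - 1) / t - 1\<bar> + t) * norm h + e / 4) * norm g"
          by (simp add: algebra_simps)
      qed
      then show ?case using elim e by simp
    qed
  qed
  then have "((\<lambda>t. D t + (R 1 h - h)) \<longlongrightarrow> 0 + (R 1 h - h)) (at_right 0)"
    by (intro tendsto_intros)
  moreover have "eventually (\<lambda>t. D t + (R 1 h - h) = (1 / t) *\<^sub>R (sg t (R 1 h) - R 1 h)) (at_right 0)"
    unfolding eventually_at_right_field by (auto simp: sg_def D_def intro!: exI[of _ 1])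
  ultimately show ?thesis unfolding sg.gen_def by (simp add: Lim_transform_eventually)
qed

text \<open>
  If \<open>f\<close> is in the domain with image \<open>g\<close>, then \<open>w = f - R 1 (f - g)\<close> is an eigenvector of the
  generator for the eigenvalue 1, and dissipativity forces \<open>w = 0\<close>.
\<close>

theorem gen_iff: "sg.gen f g \<longleftrightarrow> R 1 (f - g) = f"
proof
  assume "R 1 (f - g) = f"
  then show "sg.gen f g" using gen_resolvent[of "f - g"] by simp
next
  assume g: "sg.gen f g"
  define w where "w = f - R 1 (f - g)"
  have "sg.gen w (g - (R 1 (f - g) - (f - g)))"
    unfolding w_def by (intro sg.gen_diff g gen_resolvent)
  then have "sg.gen w w" by (simp add: w_def algebra_simps)
  then have "w \<bullet> w \<le> 0"
    by (intro contraction_gen_dissipative[OF sg.strong_semigroup_axioms sg_contraction])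
  then have "w = 0" by (metis antisym inner_ge_zero inner_eq_zero_iff)
  then show "R 1 (f - g) = f" by (simp add: w_def)
qed

end

section \<open>Completeness of the Hilbert space\<close>

lemma rep_square_integrable: "square_integrable (rep_hyp_L2 u)"
  using Quotient3_rep_reflp[OF Quotient3_hyp_L2, of u] by (simp add: L2_rel_def)

lemma abs_rep_hyp_L2 [simp]: "abs_hyp_L2 (rep_hyp_L2 u) = u"
  by (rule Quotient3_abs_rep[OF Quotient3_hyp_L2])

lemma hyp_L2_cases [case_names abs, cases type: hyp_L2]:
  obtains f where "u = abs_hyp_L2 f" "square_integrable f"
  using rep_square_integrable abs_rep_hyp_L2 by metis

lemma L2_rel_refl: "square_integrable f \<Longrightarrow> L2_rel f f"
  by (simp add: L2_rel_def)

lemma abs_eq_iff: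
  assumes "square_integrable f" "square_integrable g"
  shows "abs_hyp_L2 f = abs_hyp_L2 g \<longleftrightarrow> (AE x in hyp_measure. f x = g x)"
  using Quotient3_rel[OF Quotient3_hyp_L2, of f g] assms by (auto simp: L2_rel_def)

lemma rep_abs_AE:
  assumes "square_integrable f"
  shows "AE x in hyp_measure. rep_hyp_L2 (abs_hyp_L2 f) x = f x"
  using abs_eq_iff[OF rep_square_integrable assms, of "abs_hyp_L2 f"] by simp

lemma abs_zero: "abs_hyp_L2 (\<lambda>x. 0) = 0"
  by (simp add: zero_hyp_L2_def)

lemma abs_add:
  "square_integrable f \<Longrightarrow> square_integrable g \<Longrightarrow> abs_hyp_L2 f + abs_hyp_L2 g = abs_hyp_L2 (\<lambda>x. f x + g x)"
  by (rule plus_hyp_L2.abs_eq) (auto intro: L2_rel_refl)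

lemma abs_uminus: "square_integrable f \<Longrightarrow> - abs_hyp_L2 f = abs_hyp_L2 (\<lambda>x. - f x)"
  by (rule uminus_hyp_L2.abs_eq) (auto intro: L2_rel_refl)

lemma square_integrable_uminus: "square_integrable f \<Longrightarrow> square_integrable (\<lambda>x. - f x)"
  by (simp add: square_integrable_def)

lemma square_integrable_diff:
  "square_integrable f \<Longrightarrow> square_integrable g \<Longrightarrow> square_integrable (\<lambda>x. f x - g x)"
  using square_integrable_add[of f "\<lambda>x. - g x"] square_integrable_uminus[of g] by simp

lemma abs_diff:
  "square_integrable f \<Longrightarrow> square_integrable g \<Longrightarrow> abs_hyp_L2 f - abs_hyp_L2 g = abs_hyp_L2 (\<lambda>x. f x - g x)"
  by (simp add: minus_hyp_L2_def abs_uminus abs_add square_integrable_uminus)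

lemma abs_scaleR: "square_integrable f \<Longrightarrow> r *\<^sub>R abs_hyp_L2 f = abs_hyp_L2 (\<lambda>x. complex_of_real r * f x)"
  by (rule scaleR_hyp_L2.abs_eq) (auto intro: L2_rel_refl)

lemma abs_scaleC: "square_integrable f \<Longrightarrow> scaleC_L2 c (abs_hyp_L2 f) = abs_hyp_L2 (\<lambda>x. c * f x)"
  by (rule scaleC_L2.abs_eq) (auto intro: L2_rel_refl)

lemma abs_inner:
  "square_integrable f \<Longrightarrow> square_integrable g \<Longrightarrow> abs_hyp_L2 f \<bullet> abs_hyp_L2 g = (LINT x|hyp_measure. f x \<bullet> g x)"
  by (rule inner_hyp_L2.abs_eq) (auto intro: L2_rel_refl)

lemma abs_norm:
  assumes "square_integrable f"
  shows "(norm (abs_hyp_L2 f))\<^sup>2 = (LINT x|hyp_measure. (norm (f x))\<^sup>2)"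
  unfolding power2_norm_eq_inner by (rule abs_inner[OF assms assms])

lemma abs_norm_nn:
  assumes "square_integrable f"
  shows "ennreal ((norm (abs_hyp_L2 f))\<^sup>2) = (\<integral>\<^sup>+x. ennreal ((norm (f x))\<^sup>2) \<partial>hyp_measure)"
  unfolding abs_norm[OF assms]
  using assms by (intro nn_integral_eq_integral[symmetric]) (auto simp: square_integrable_def)

lemma square_integrable_measurable: "square_integrable f \<Longrightarrow> f \<in> borel_measurable hyp_measure"
  by (simp add: square_integrable_def)

lemma term_le_enn2real_suminf:
  fixes a :: "nat \<Rightarrow> real"
  assumes "(\<Sum>k. ennreal (a k)) \<noteq> \<infinity>"
  shows "a k \<le> enn2real (\<Sum>k. ennreal (a k))"
proof -
  have "ennreal (a k) \<le> (\<Sum>k. ennreal (a k))"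
    using sum_le_suminf[of "\<lambda>k. ennreal (a k)" "{k}"] by (simp add: summableI)
  also have "\<dots> = ennreal (enn2real (\<Sum>k. ennreal (a k)))"
    using assms by (simp add: less_top)
  finally show ?thesis by (simp add: ennreal_le_iff)
qed

text \<open>
  The Riesz--Fischer argument: a subsequence with summable increments converges almost everywhere,
  and Fatou's lemma shows that it also converges in norm to its pointwise limit.
\<close>

lemma hyp_L2_complete:
  assumes "Cauchy (u :: nat \<Rightarrow> hyp_L2)"
  shows "convergent u"
proof -
  have "\<exists>N. \<forall>m\<ge>N. \<forall>n\<ge>N. dist (u m) (u n) < (1/2) ^ k" for k :: nat
    using metric_CauchyD[OF assms, of "(1/2) ^ k"] by auto
  then obtain N where N: "\<And>k m n. N k \<le> m \<Longrightarrow> N k \<le> n \<Longrightarrow> dist (u m) (u n) < (1/2) ^ k"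
    by metis
  define r where "r k = (\<Sum>i\<le>k. N i + 1)" for k
  have r: "strict_mono r" by (rule strict_mono_Suc_iff[THEN iffD2]) (simp add: r_def)
  have Nr: "N k \<le> r j" if "k \<le> j" for k j
  proof -
    have "N k + 1 \<le> r j" unfolding r_def by (rule member_le_sum) (use that in auto)
    then show ?thesis by simp
  qed
  have close: "dist (u (r i)) (u (r j)) < (1/2) ^ k" if "k \<le> i" "k \<le> j" for i j k
    by (rule N) (use Nr that in auto)
  define f where "f k = rep_hyp_L2 (u (r k))" for k
  have sq: "square_integrable (f k)" for k by (simp add: f_def rep_square_integrable)
  have uf: "u (r k) = abs_hyp_L2 (f k)" for k by (simp add: f_def)
  have [measurable]: "f k \<in> borel_measurable hyp_measure" for k
    using sq by (rule square_integrable_measurable)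
  have L2: "(\<integral>\<^sup>+x. ennreal ((norm (f i x - f j x))\<^sup>2) \<partial>hyp_measure) \<le> ennreal ((1/4) ^ k)"
    if "k \<le> i" "k \<le> j" for i j k
  proof -
    have "(norm (abs_hyp_L2 (\<lambda>x. f i x - f j x)))\<^sup>2 \<le> ((1/2) ^ k)\<^sup>2"
      using close[OF that] by (intro power_mono) (auto simp: dist_norm uf abs_diff sq)
    also have "\<dots> = (1/4) ^ k" by (simp add: power2_eq_square flip: power_mult_distrib)
    finally show ?thesis
      unfolding abs_norm_nn[OF square_integrable_diff[OF sq sq], symmetric] by (rule ennreal_leI)
  qed
  have finite_sum: "(\<integral>\<^sup>+x. (\<Sum>k. ennreal (2 ^ k * (norm (f (Suc k) x - f k x))\<^sup>2)) \<partial>hyp_measure) < \<infinity>"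
  proof -
    have "(\<integral>\<^sup>+x. (\<Sum>k. ennreal (2 ^ k * (norm (f (Suc k) x - f k x))\<^sup>2)) \<partial>hyp_measure)
        = (\<Sum>k. \<integral>\<^sup>+x. ennreal (2 ^ k * (norm (f (Suc k) x - f k x))\<^sup>2) \<partial>hyp_measure)"
      by (rule nn_integral_suminf) measurable
    also have "\<dots> \<le> (\<Sum>k. ennreal ((1/2) ^ k))"
    proof (intro suminf_le summableI)
      fix k
      have "(\<integral>\<^sup>+x. ennreal (2 ^ k * (norm (f (Suc k) x - f k x))\<^sup>2) \<partial>hyp_measure)
         = ennreal (2 ^ k) * (\<integral>\<^sup>+x. ennreal ((norm (f (Suc k) x - f k x))\<^sup>2) \<partial>hyp_measure)"
        by (simp add: ennreal_mult' nn_integral_cmult)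
      also have "\<dots> \<le> ennreal (2 ^ k) * ennreal ((1/4) ^ k)" by (intro mult_left_mono L2) auto
      also have "\<dots> = ennreal ((1/2) ^ k)"
        by (simp add: ennreal_mult'[symmetric] power_mult_distrib[symmetric])
      finally show "(\<integral>\<^sup>+x. ennreal (2 ^ k * (norm (f (Suc k) x - f k x))\<^sup>2) \<partial>hyp_measure) \<le> ennreal ((1/2) ^ k)" .
    qed
    also have "\<dots> = ennreal (\<Sum>k. (1/2) ^ k)" by (intro suminf_ennreal2) (auto intro: summable_geometric)
    also have "\<dots> < \<infinity>" by simp
    finally show ?thesis .
  qed
  have "AE x in hyp_measure. (\<Sum>k. ennreal (2 ^ k * (norm (f (Suc k) x - f k x))\<^sup>2)) \<noteq> \<infinity>"
    by (rule nn_integral_PInf_AE[OF _ less_imp_neq[OF finite_sum]]) measurable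
  then have conv: "AE x in hyp_measure. convergent (\<lambda>k. f k x)"
  proof (rule AE_mp, intro AE_I2 impI)
    fix x assume fin: "(\<Sum>k. ennreal (2 ^ k * (norm (f (Suc k) x - f k x))\<^sup>2)) \<noteq> \<infinity>"
    define S where "S = enn2real (\<Sum>k. ennreal (2 ^ k * (norm (f (Suc k) x - f k x))\<^sup>2))"
    have S: "2 ^ k * (norm (f (Suc k) x - f k x))\<^sup>2 \<le> S" for k
      unfolding S_def by (rule term_le_enn2real_suminf[OF fin])
    have le: "norm (f (Suc k) x - f k x) \<le> sqrt S * sqrt (1/2) ^ k" for k
    proof -
      have "(norm (f (Suc k) x - f k x))\<^sup>2 \<le> S * (1/2) ^ k" using S[of k] by (simp add: field_simps power_one_over)
      then have "norm (f (Suc k) x - f k x) \<le> sqrt (S * (1/2) ^ k)" by (rule real_le_rsqrt)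
      then show ?thesis by (simp only: real_sqrt_mult real_sqrt_power)
    qed
    have "sqrt (1/2) < 1" by simp
    then have "summable (\<lambda>k. sqrt S * sqrt (1/2) ^ k)"
      by (intro summable_mult summable_geometric) (simp only: real_norm_def abs_of_nonneg real_sqrt_ge_0_iff)
    then have "summable (\<lambda>k. f (Suc k) x - f k x)"
      by (rule summable_comparison_test'[where N = 0]) (rule le)
    then have "convergent (\<lambda>n. \<Sum>k<n. f (Suc k) x - f k x)" by (simp add: summable_iff_convergent)
    then have "convergent (\<lambda>n. f n x - f 0 x)" by (simp only: sum_lessThan_telescope[of "\<lambda>k. f k x"])
    then have "convergent (\<lambda>n. (f n x - f 0 x) + f 0 x)" by (intro convergent_add convergent_const)
    then show "convergent (\<lambda>k. f k x)" by simp
  qed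
  define g where "g x = lim (\<lambda>k. f k x)" for x
  have [measurable]: "g \<in> borel_measurable hyp_measure" unfolding g_def by measurable
  have tail: "(\<integral>\<^sup>+x. ennreal ((norm (g x - f k x))\<^sup>2) \<partial>hyp_measure) \<le> ennreal ((1/4) ^ k)" for k
  proof -
    have "(\<integral>\<^sup>+x. ennreal ((norm (g x - f k x))\<^sup>2) \<partial>hyp_measure)
        = (\<integral>\<^sup>+x. liminf (\<lambda>j. ennreal ((norm (f j x - f k x))\<^sup>2)) \<partial>hyp_measure)"
    proof (rule nn_integral_cong_AE)
      show "AE x in hyp_measure. ennreal ((norm (g x - f k x))\<^sup>2) = liminf (\<lambda>j. ennreal ((norm (f j x - f k x))\<^sup>2))"
        using conv
      proof (rule AE_mp, intro AE_I2 impI)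
        fix x assume "convergent (\<lambda>k. f k x)"
        then have "(\<lambda>j. f j x) \<longlonglongrightarrow> g x" by (simp add: g_def convergent_LIMSEQ_iff)
        then have "(\<lambda>j. ennreal ((norm (f j x - f k x))\<^sup>2)) \<longlonglongrightarrow> ennreal ((norm (g x - f k x))\<^sup>2)"
          by (intro tendsto_intros tendsto_ennrealI)
        then show "ennreal ((norm (g x - f k x))\<^sup>2) = liminf (\<lambda>j. ennreal ((norm (f j x - f k x))\<^sup>2))"
          using lim_imp_Liminf[OF trivial_limit_sequentially] by metis
      qed
    qed
    also have "\<dots> \<le> liminf (\<lambda>j. \<integral>\<^sup>+x. ennreal ((norm (f j x - f k x))\<^sup>2) \<partial>hyp_measure)"
      by (rule nn_integral_liminf) measurable
    also have "\<dots> \<le> liminf (\<lambda>j. ennreal ((1/4) ^ k))"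
      by (rule Liminf_mono) (auto simp: eventually_sequentially intro!: exI[of _ k] L2)
    finally show ?thesis by (simp add: Liminf_const)
  qed
  have "square_integrable (\<lambda>x. g x - f 0 x)"
    unfolding square_integrable_def
  proof
    show "integrable hyp_measure (\<lambda>x. (norm (g x - f 0 x))\<^sup>2)"
      by (rule integrableI_bounded) (use tail[of 0] in \<open>auto simp: le_less_trans\<close>)
  qed measurable
  then have gsq: "square_integrable g" using square_integrable_add[OF _ sq[of 0]] by fastforce
  have "(\<lambda>k. u (r k)) \<longlonglongrightarrow> abs_hyp_L2 g"
  proof (rule metric_LIMSEQ_I)
    fix e :: real assume e: "0 < e"
    obtain n where n: "(1/2) ^ n < e" using real_arch_pow_inv[OF e, of "1/2"] by auto
    have "dist (u (r k)) (abs_hyp_L2 g) < e" if "n \<le> k" for k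
    proof -
      have "ennreal ((norm (abs_hyp_L2 (\<lambda>x. g x - f k x)))\<^sup>2) \<le> ennreal ((1/4) ^ k)"
        using tail[of k] by (simp add: abs_norm_nn[OF square_integrable_diff[OF gsq sq]])
      then have "(norm (abs_hyp_L2 (\<lambda>x. g x - f k x)))\<^sup>2 \<le> (1/4) ^ k" by simp
      also have "(1/4::real) ^ k = ((1/2) ^ k)\<^sup>2"
        by (simp add: power2_eq_square flip: power_mult_distrib)
      finally have "norm (abs_hyp_L2 (\<lambda>x. g x - f k x)) \<le> (1/2) ^ k" by (rule power2_le_imp_le) simp
      also have "\<dots> \<le> (1/2) ^ n" using that by (intro power_decreasing) auto
      finally show ?thesis using n by (simp add: dist_commute[of "u (r k)"]) (simp add: dist_norm uf abs_diff gsq sq)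
    qed
    then show "\<exists>no. \<forall>k\<ge>no. dist (u (r k)) (abs_hyp_L2 g) < e" by blast
  qed
  then have "u \<longlonglongrightarrow> abs_hyp_L2 g"
    using Cauchy_converges_subseq[OF assms r] by (simp add: o_def)
  then show ?thesis by (rule convergentI)
qed

instance hyp_L2 :: banach
  by standard (rule hyp_L2_complete)

section \<open>Hyperbolic geometry\<close>

text \<open>
  The hyperbolic cosine of the distance.  It is a rational function of the coordinates, and all
  kernels below are expressed through it.
\<close>

definition hyp_cosh :: "real ^ 3 \<Rightarrow> real ^ 3 \<Rightarrow> real" where
  "hyp_cosh x y = 1 + (norm (x - y))\<^sup>2 / (2 * x $ 3 * y $ 3)"

lemma hyp_dist_eq_arcosh: "hyp_dist x y = arcosh (hyp_cosh x y)"
  by (simp add: hyp_dist_def hyp_cosh_def)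

lemma norm_real3: "(norm (x :: real ^ 3))\<^sup>2 = (x $ 1)\<^sup>2 + (x $ 2)\<^sup>2 + (x $ 3)\<^sup>2"
  unfolding power2_norm_eq_inner by (simp add: inner_vec_def sum_3 power2_eq_square)

lemma hyp_cosh_coordinates:
  "hyp_cosh x y = 1 + ((x $ 1 - y $ 1)\<^sup>2 + (x $ 2 - y $ 2)\<^sup>2 + (x $ 3 - y $ 3)\<^sup>2) / (2 * x $ 3 * y $ 3)"
  by (simp add: hyp_cosh_def norm_real3)

lemma hyp_cosh_ge_1: "x \<in> hyp3 \<Longrightarrow> y \<in> hyp3 \<Longrightarrow> 1 \<le> hyp_cosh x y"
  by (simp add: hyp_cosh_def hyp3_def)

lemma hyp_cosh_commute: "hyp_cosh x y = hyp_cosh y x"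
  by (simp add: hyp_cosh_def norm_minus_commute mult_ac)

lemma vec_nth_measurable [measurable]:
  fixes f :: "'a \<Rightarrow> real ^ 3"
  assumes [measurable]: "f \<in> borel_measurable M"
  shows "(\<lambda>x. f x $ i) \<in> borel_measurable M"
proof -
  have "(\<lambda>x. f x \<bullet> axis i 1) \<in> borel_measurable M" by measurable
  then show ?thesis by (simp add: inner_axis)
qed

lemma hyp_cosh_measurable [measurable]:
  assumes [measurable]: "f \<in> borel_measurable M" "g \<in> borel_measurable M"
  shows "(\<lambda>x. hyp_cosh (f x) (g x)) \<in> borel_measurable M"
  unfolding hyp_cosh_def by measurable

lemma cauchy_schwarz_3:
  "(u1 * v1 + u2 * v2 + u3 * v3)\<^sup>2 \<le> (u1\<^sup>2 + u2\<^sup>2 + u3\<^sup>2) * (v1\<^sup>2 + v2\<^sup>2 + v3\<^sup>2)" for u1 :: real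
proof -
  have "(u1\<^sup>2 + u2\<^sup>2 + u3\<^sup>2) * (v1\<^sup>2 + v2\<^sup>2 + v3\<^sup>2) - (u1 * v1 + u2 * v2 + u3 * v3)\<^sup>2
      = (u1 * v2 - u2 * v1)\<^sup>2 + (u1 * v3 - u3 * v1)\<^sup>2 + (u2 * v3 - u3 * v2)\<^sup>2"
    by (simp add: power2_eq_square algebra_simps)
  also have "\<dots> \<ge> 0" by simp
  finally show ?thesis by simp
qed

text \<open>
  Attach to \<open>x\<close> the vector \<open>V x\<close> with components \<open>(x\<^sub>i - y\<^sub>i) / x\<^sub>3\<close> for \<open>i = 1, 2\<close> and
  \<open>((x\<^sub>1 - y\<^sub>1)\<^sup>2 + (x\<^sub>2 - y\<^sub>2)\<^sup>2 + x\<^sub>3\<^sup>2 - y\<^sub>3\<^sup>2) / (2 x\<^sub>3 y\<^sub>3)\<close>.  Its squared length is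
  \<open>c(x, y)\<^sup>2 - 1\<close>, and \<open>V x \<bullet> V z = c(x, y) c(y, z) - c(x, z)\<close> (the hyperbolic law of cosines), so the
  claim is the Cauchy--Schwarz inequality.
\<close>

lemma hyp_cosh_triangle:
  assumes "x \<in> hyp3" "y \<in> hyp3" "z \<in> hyp3"
  shows "(hyp_cosh x y * hyp_cosh y z - hyp_cosh x z)\<^sup>2 \<le> ((hyp_cosh x y)\<^sup>2 - 1) * ((hyp_cosh y z)\<^sup>2 - 1)"
proof -
  have pos: "0 < x $ 3" "0 < y $ 3" "0 < z $ 3" using assms by (auto simp: hyp3_def)
  define a1 a2 b1 b2 p q r where "a1 = x $ 1 - y $ 1" "a2 = x $ 2 - y $ 2" "b1 = z $ 1 - y $ 1" "b2 = z $ 2 - y $ 2"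
    "p = x $ 3" "q = y $ 3" "r = z $ 3"
  note defs = this
  have pqr: "p \<noteq> 0" "q \<noteq> 0" "r \<noteq> 0" using pos by (auto simp: defs)
  have cxy: "hyp_cosh x y = (a1\<^sup>2 + a2\<^sup>2 + p\<^sup>2 + q\<^sup>2) / (2 * p * q)"
    using pqr by (simp add: hyp_cosh_coordinates flip: defs) (simp add: field_simps power2_eq_square)
  have cyz: "hyp_cosh y z = (b1\<^sup>2 + b2\<^sup>2 + r\<^sup>2 + q\<^sup>2) / (2 * r * q)"
    unfolding hyp_cosh_commute[of y z]
    using pqr by (simp add: hyp_cosh_coordinates flip: defs) (simp add: field_simps power2_eq_square)
  have cxz: "hyp_cosh x z = ((a1 - b1)\<^sup>2 + (a2 - b2)\<^sup>2 + p\<^sup>2 + r\<^sup>2) / (2 * p * r)"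
  proof -
    have "x $ 1 - z $ 1 = a1 - b1" "x $ 2 - z $ 2 = a2 - b2" by (auto simp: defs)
    then show ?thesis
      using pqr by (simp add: hyp_cosh_coordinates flip: defs(5-7)) (simp add: field_simps power2_eq_square)
  qed
  \<comment> \<open>The inner product and the two squared lengths.\<close>
  have id1: "hyp_cosh x y * hyp_cosh y z - hyp_cosh x z
      = (a1 / p) * (b1 / r) + (a2 / p) * (b2 / r) + ((a1\<^sup>2 + a2\<^sup>2 + p\<^sup>2 - q\<^sup>2) / (2 * p * q)) * ((b1\<^sup>2 + b2\<^sup>2 + r\<^sup>2 - q\<^sup>2) / (2 * r * q))"
    unfolding cxy cyz cxz using pqr by (simp add: divide_simps) (simp add: power2_eq_square algebra_simps)
  have id2: "(hyp_cosh x y)\<^sup>2 - 1 = (a1 / p)\<^sup>2 + (a2 / p)\<^sup>2 + ((a1\<^sup>2 + a2\<^sup>2 + p\<^sup>2 - q\<^sup>2) / (2 * p * q))\<^sup>2"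
    unfolding cxy using pqr by (simp add: divide_simps power2_eq_square) (simp add: algebra_simps)
  have id3: "(hyp_cosh y z)\<^sup>2 - 1 = (b1 / r)\<^sup>2 + (b2 / r)\<^sup>2 + ((b1\<^sup>2 + b2\<^sup>2 + r\<^sup>2 - q\<^sup>2) / (2 * r * q))\<^sup>2"
    unfolding cyz using pqr by (simp add: divide_simps power2_eq_square) (simp add: algebra_simps)
  show ?thesis unfolding id1 id2 id3 by (rule cauchy_schwarz_3)
qed

lemma hyp_dist_triangle:
  assumes "x \<in> hyp3" "y \<in> hyp3" "z \<in> hyp3"
  shows "hyp_dist x z \<le> hyp_dist x y + hyp_dist y z"
proof -
  let ?a = "hyp_cosh x y" and ?b = "hyp_cosh y z" and ?c = "hyp_cosh x z"
  have ge: "1 \<le> ?a" "1 \<le> ?b" "1 \<le> ?c" using assms by (auto intro: hyp_cosh_ge_1)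
  have "\<bar>?a * ?b - ?c\<bar> \<le> sqrt ((?a\<^sup>2 - 1) * (?b\<^sup>2 - 1))"
    using hyp_cosh_triangle[OF assms] by (intro real_le_rsqrt) simp
  then have "?c \<le> ?a * ?b + sqrt (?a\<^sup>2 - 1) * sqrt (?b\<^sup>2 - 1)"
    by (simp add: real_sqrt_mult abs_le_iff)
  also have "\<dots> = cosh (arcosh ?a + arcosh ?b)"
    using ge by (simp add: cosh_add cosh_arcosh_real sinh_arcosh_real)
  finally have "cosh (arcosh ?c) \<le> cosh (arcosh ?a + arcosh ?b)" using ge by (simp add: cosh_arcosh_real)
  then have "arcosh ?c \<le> arcosh ?a + arcosh ?b"
    using ge by (subst (asm) cosh_real_nonneg_le_iff) (auto intro!: add_nonneg_nonneg)
  then show ?thesis by (simp add: hyp_dist_eq_arcosh)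
qed

lemma hyp_dist_commute: "hyp_dist x y = hyp_dist y x"
  by (simp add: hyp_dist_eq_arcosh hyp_cosh_commute)

section \<open>The distribution of the distance to a point\<close>

text \<open>
  The height comes first, so that Fubini integrates over horizontal planes.
\<close>

definition real3_of :: "real \<times> real \<times> real \<Rightarrow> real ^ 3" where
  "real3_of = (\<lambda>(h, a, b). vector [a, b, h])"

lemma real3_of_nth [simp]: "real3_of (h, a, b) $ 1 = a" "real3_of (h, a, b) $ 2 = b" "real3_of (h, a, b) $ 3 = h"
  by (simp_all add: real3_of_def)

lemma real3_of_measurable [measurable]:
  assumes "f \<in> M \<rightarrow>\<^sub>M (borel \<Otimes>\<^sub>M borel)"
  shows "(\<lambda>x. real3_of (f x)) \<in> borel_measurable M"
proof -
  have e: "real3_of = (\<lambda>p. \<chi> i. if i = 1 then fst (snd p) else if i = 2 then snd (snd p) else fst p)"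
    by (auto simp: fun_eq_iff vec_eq_iff forall_3)
  have "continuous_on UNIV (\<lambda>p::real \<times> real \<times> real. if i = (1::3) then fst (snd p) else if i = 2 then snd (snd p) else fst p)" for i
    by (cases "i = 1"; cases "i = 2") (auto intro!: continuous_intros)
  then have "continuous_on UNIV real3_of" unfolding e by (intro continuous_on_vec_lambda)
  then have "real3_of \<in> borel_measurable borel" by (rule borel_measurable_continuous_onI)
  then have "real3_of \<in> borel_measurable (borel \<Otimes>\<^sub>M borel)" by (simp add: borel_prod)
  with assms show ?thesis by (rule measurable_compose)
qed

lemma lborel_real3: "lborel = distr (lborel \<Otimes>\<^sub>M lborel) borel real3_of"
proof (rule lborel_eqI)
  fix l u :: "real ^ 3" assume lu: "\<And>b. b \<in> Basis \<Longrightarrow> l \<bullet> b \<le> u \<bullet> b"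
  have le: "l $ i \<le> u $ i" for i using lu[of "axis i 1"] by (simp add: inner_axis axis_in_Basis_iff)
  have "real3_of -` box l u \<inter> space (lborel \<Otimes>\<^sub>M lborel)
      = {l $ 3<..<u $ 3} \<times> ({l $ 1<..<u $ 1} \<times> {l $ 2<..<u $ 2})"
    by (auto simp: mem_box_cart forall_3 space_pair_measure)
  then have "emeasure (distr (lborel \<Otimes>\<^sub>M lborel) borel real3_of) (box l u)
      = emeasure (lborel \<Otimes>\<^sub>M lborel) ({l $ 3<..<u $ 3} \<times> ({l $ 1<..<u $ 1} \<times> {l $ 2<..<u $ 2}))"
    by (simp add: emeasure_distr)
  also have "\<dots> = emeasure lborel {l $ 3<..<u $ 3} * emeasure (lborel \<Otimes>\<^sub>M lborel) ({l $ 1<..<u $ 1} \<times> {l $ 2<..<u $ 2})"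
    by (subst lborel.emeasure_pair_measure_Times) (auto simp: lborel_prod intro!: borel_open open_Times)
  also have "\<dots> = ennreal (u $ 3 - l $ 3) * (ennreal (u $ 1 - l $ 1) * ennreal (u $ 2 - l $ 2))"
    using le by (subst lborel.emeasure_pair_measure_Times) simp_all
  also have "\<dots> = ennreal ((u $ 3 - l $ 3) * ((u $ 1 - l $ 1) * (u $ 2 - l $ 2)))"
    using le by (simp only: ennreal_mult mult_nonneg_nonneg diff_ge_0_iff_ge)
  also have "(u $ 3 - l $ 3) * ((u $ 1 - l $ 1) * (u $ 2 - l $ 2)) = (\<Prod>i\<in>UNIV. (u - l) $ i)"
  proof -
    have "(\<Prod>i\<in>{1, 2, 3}. (u - l) $ i) = (u - l) $ 1 * ((u - l) $ 2 * (u - l) $ 3)" by simp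
    then show ?thesis unfolding UNIV_3 by (simp add: mult_ac)
  qed
  also have "\<dots> = (\<Prod>b\<in>(\<lambda>i. axis i 1) ` UNIV. (u - l) \<bullet> b)"
    by (subst prod.reindex) (auto simp: inj_on_def axis_eq_axis inner_axis)
  also have "(\<lambda>i. axis i (1::real)) ` UNIV = (Basis :: (real ^ 3) set)"
    by (auto simp: Basis_vec_def)
  finally show "emeasure (distr (lborel \<Otimes>\<^sub>M lborel) borel real3_of) (box l u) = ennreal (\<Prod>b\<in>Basis. (u - l) \<bullet> b)" .
qed simp

text \<open>
  The disc of squared radius \<open>u\<close> has area \<open>\<pi> u\<close>, so the squared distance to the origin is distributed
  uniformly with density \<open>\<pi>\<close>.
\<close>

lemma lborel_radial_plane:
  assumes [measurable]: "G \<in> borel_measurable borel"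
  shows "(\<integral>\<^sup>+p. G ((fst p)\<^sup>2 + (snd p)\<^sup>2) \<partial>(lborel :: (real \<times> real) measure)) = (\<integral>\<^sup>+u. ennreal (pi * indicator {0..} u) * G u \<partial>lborel)"
proof -
  \<comment> \<open>The sign makes the sets \<open>{x<..}\<close>, which determine the measure, pull back to discs of finite area.\<close>
  define q where "q p = - ((fst p)\<^sup>2 + (snd p)\<^sup>2)" for p :: "real \<times> real"
  let ?M = "distr (lborel :: (real \<times> real) measure) borel q"
  let ?N = "density lborel (\<lambda>u. ennreal (pi * indicator {..0} u))"
  have [measurable]: "q \<in> borel_measurable borel"
    unfolding q_def by (intro borel_measurable_continuous_onI continuous_intros)
  have eq: "emeasure ?M {x<..} = ennreal (pi * max 0 (- x)) \<and> emeasure ?N {x<..} = ennreal (pi * max 0 (- x))" for x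
  proof (cases "x < 0")
    case True
    have "q -` {x<..} = ball 0 (sqrt (- x))"
    proof -
      have "(q p > x) = (norm p < sqrt (- x))" for p
        using True by (auto simp: q_def norm_prod_def)
      then show ?thesis by (auto simp: ball_def dist_norm)
    qed
    then have "emeasure ?M {x<..} = emeasure lborel (ball (0::real\<times>real) (sqrt (- x)))"
      by (subst emeasure_distr) auto
    also have "\<dots> = ennreal (pi * (- x))"
      using True by (subst emeasure_ball) (auto simp: unit_ball_vol_2)
    finally have 1: "emeasure ?M {x<..} = ennreal (pi * (- x))" .
    have "emeasure ?N {x<..} = (\<integral>\<^sup>+u. ennreal pi * indicator {x<..0} u \<partial>lborel)"
      by (subst emeasure_density) (auto intro!: nn_integral_cong simp: indicator_def)
    also have "\<dots> = ennreal pi * ennreal (- x)" using True by (simp add: nn_integral_cmult_indicator)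
    finally have 2: "emeasure ?N {x<..} = ennreal (pi * (- x))" using True by (subst ennreal_mult) auto
    show ?thesis using 1 2 True by (simp add: max_def)
  next
    case False
    have "q -` {x<..} = {}"
    proof -
      have "\<not> x < q p" for p using False sum_power2_ge_zero[of "fst p" "snd p"] unfolding q_def by linarith
      then show ?thesis by auto
    qed
    then have 1: "emeasure ?M {x<..} = 0" by (subst emeasure_distr) auto
    have "emeasure ?N {x<..} = (\<integral>\<^sup>+u. ennreal (pi * indicator {..0} u) * indicator {x<..} u \<partial>lborel)"
      by (rule emeasure_density) auto
    also have "\<dots> = (\<integral>\<^sup>+u. 0 \<partial>(lborel :: real measure))"
      using False by (intro nn_integral_cong) (simp split: split_indicator)
    finally have "emeasure ?N {x<..} = 0" by simp
    then show ?thesis using 1 False by (simp add: max_def)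
  qed
  have "?M = ?N"
    by (rule measure_eqI_lessThan) (auto simp: eq)
  then have "(\<integral>\<^sup>+u. G (- u) \<partial>?M) = (\<integral>\<^sup>+u. G (- u) \<partial>?N)" by simp
  then have "(\<integral>\<^sup>+p. G ((fst p)\<^sup>2 + (snd p)\<^sup>2) \<partial>(lborel :: (real \<times> real) measure))
     = (\<integral>\<^sup>+u. ennreal (pi * indicator {..0} u) * G (- u) \<partial>lborel)"
    by (subst (asm) nn_integral_distr, measurable) (simp add: nn_integral_density q_def add.commute)
  also have "\<dots> = (\<integral>\<^sup>+u. ennreal (pi * indicator {0..} u) * G u \<partial>lborel)"
    by (subst nn_integral_real_affine[where c = "-1" and t = 0]) (auto intro!: nn_integral_cong simp: indicator_def)
  finally show ?thesis .
qed

lemma nn_integral_hyp_measure: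
  assumes [measurable]: "f \<in> borel_measurable borel"
  shows "(\<integral>\<^sup>+x. f x \<partial>hyp_measure) = (\<integral>\<^sup>+x. ennreal (1 / (x $ 3) ^ 3) * f x * indicator hyp3 x \<partial>lborel)"
proof -
  have [measurable]: "hyp3 \<in> sets borel"
    unfolding hyp3_def by (intro borel_open open_Collect_less continuous_intros)
  show ?thesis unfolding hyp_measure_def
    by (subst nn_integral_density) (auto simp: nn_integral_restrict_space intro!: measurable_restrict_space1)
qed

text \<open>
  The heights \<open>h\<close> that the ball \<open>hyp_cosh \<le> c\<close> around a point at height \<open>a\<close> meets form the interval
  from \<open>a (c - s)\<close> to \<open>a (c + s)\<close> with \<open>s = sqrt (c\<^sup>2 - 1)\<close>, and an antiderivative of the weight is
  \<open>- 2 \<pi> a / h\<close>.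
\<close>

lemma height_integral:
  assumes a: "0 < (a::real)"
  shows "(\<integral>\<^sup>+h. ennreal (2 * pi * a / h\<^sup>2) * indicator {h. 0 < h \<and> (h - a)\<^sup>2 \<le> 2 * h * a * (c - 1)} h \<partial>lborel)
     = ennreal (4 * pi * sqrt (c\<^sup>2 - 1) * indicator {1..} c)"
proof (cases "1 \<le> c")
  case True
  define s where "s = sqrt (c\<^sup>2 - 1)"
  have c2: "0 \<le> c\<^sup>2 - 1" using True by simp
  have s: "s\<^sup>2 = c\<^sup>2 - 1" "0 \<le> s" using c2 by (auto simp: s_def)
  have sc: "s < c" by (rule power2_less_imp_less) (use s True in auto)
  define l u where "l = a * (c - s)" "u = a * (c + s)"
  have lu: "0 < l" "l \<le> u" using a sc s True by (auto simp: l_u_def intro!: mult_left_mono)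
  have set_eq: "{h. 0 < h \<and> (h - a)\<^sup>2 \<le> 2 * h * a * (c - 1)} = {l..u}"
  proof -
    have A: "((h - a)\<^sup>2 \<le> 2 * h * a * (c - 1)) \<longleftrightarrow> (h - a * c)\<^sup>2 \<le> (a * s)\<^sup>2" for h
      unfolding power_mult_distrib s by (simp add: power2_eq_square algebra_simps)
    have B: "(h - a * c)\<^sup>2 \<le> (a * s)\<^sup>2 \<longleftrightarrow> \<bar>h - a * c\<bar> \<le> a * s" for h
      using a s abs_le_square_iff[of "h - a * c" "a * s"] by simp
    have "((h - a)\<^sup>2 \<le> 2 * h * a * (c - 1)) \<longleftrightarrow> l \<le> h \<and> h \<le> u" for h
      unfolding A B l_u_def by (auto simp: algebra_simps abs_le_iff)
    then have "h \<in> {h. 0 < h \<and> (h - a)\<^sup>2 \<le> 2 * h * a * (c - 1)} \<longleftrightarrow> h \<in> {l..u}" for h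
      using lu(1) by (simp add: conj_commute) linarith
    then show ?thesis by (rule set_eqI)
  qed
  have "(\<integral>\<^sup>+h. ennreal (2 * pi * a / h\<^sup>2) * indicator {l..u} h \<partial>lborel) = ennreal (- (2 * pi * a / u) - (- (2 * pi * a / l)))"
  proof (rule nn_integral_FTC_Icc[where F = "\<lambda>h. - (2 * pi * a / h)" and f = "\<lambda>h. 2 * pi * a / h\<^sup>2"])
    show "((\<lambda>h. - (2 * pi * a / h)) has_real_derivative 2 * pi * a / h\<^sup>2) (at h)" if "h \<in> {l..u}" for h
      using lu that by (auto intro!: derivative_eq_intros simp: power2_eq_square)
    show "0 \<le> 2 * pi * a / h\<^sup>2" if "h \<in> {l..u}" for h using a by simp
    show "l \<le> u" by (fact lu)
  qed measurable
  also have "- (2 * pi * a / u) - (- (2 * pi * a / l)) = 4 * pi * s"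
  proof -
    have "l * u = a\<^sup>2 * (c\<^sup>2 - s\<^sup>2)" by (simp add: l_u_def power2_eq_square algebra_simps)
    then have "l * u = a\<^sup>2" unfolding s by simp
    moreover have "- (2 * pi * a / u) - (- (2 * pi * a / l)) = 2 * pi * a * (u - l) / (l * u)"
      using lu by (simp add: field_simps)
    ultimately show ?thesis using a by (simp add: l_u_def power2_eq_square field_simps)
  qed
  finally show ?thesis unfolding set_eq using True by (simp add: s_def)
next
  case False
  have "{h. 0 < h \<and> (h - a)\<^sup>2 \<le> 2 * h * a * (c - 1)} = {}"
  proof -
    have "\<not> (h - a)\<^sup>2 \<le> 2 * h * a * (c - 1)" if "0 < h" for h
    proof -
      have "2 * h * a * (c - 1) < 0" using that a False by (simp add: mult_pos_neg)
      then show ?thesis by (smt (verit) zero_le_power2)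
    qed
    then show ?thesis by auto
  qed
  then show ?thesis using False by simp
qed

text \<open>
  The area of the sphere of radius \<open>r\<close> is \<open>4 \<pi> (sinh r)\<^sup>2\<close>, which in the variable \<open>c = cosh r\<close> is the
  density \<open>4 \<pi> sinh r\<close>.
\<close>

definition radial_measure :: "real measure" where
  "radial_measure = density lborel (\<lambda>c. ennreal (4 * pi * sqrt (c\<^sup>2 - 1) * indicator {1..} c))"

lemma sets_radial_measure [measurable_cong, simp]: "sets radial_measure = sets borel"
  by (simp add: radial_measure_def)

lemma height_integral_cmult:
  assumes b: "0 < (b::real)"
  shows "(\<integral>\<^sup>+h. y * (ennreal (2 * pi * b / h\<^sup>2) * indicator {h. 0 < h \<and> (h - b)\<^sup>2 \<le> 2 * h * b * (c - 1)} h) \<partial>lborel)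
     = y * ennreal (4 * pi * sqrt (c\<^sup>2 - 1) * indicator {1..} c)"
proof -
  have [measurable]: "{h. 0 < h \<and> (h - b)\<^sup>2 \<le> 2 * h * b * (c - 1)} \<in> sets borel" by measurable
  show ?thesis unfolding height_integral[OF b, symmetric] by (rule nn_integral_cmult) measurable
qed

lemma height_swap:
  fixes b :: real
  assumes [measurable]: "F \<in> borel_measurable borel"
  shows "(\<integral>\<^sup>+h. (\<integral>\<^sup>+c. F c * (ennreal (2 * pi * b / h\<^sup>2) * indicator {h. 0 < h \<and> (h - b)\<^sup>2 \<le> 2 * h * b * (c - 1)} h) \<partial>lborel) \<partial>lborel)
    = (\<integral>\<^sup>+c. (\<integral>\<^sup>+h. F c * (ennreal (2 * pi * b / h\<^sup>2) * indicator {h. 0 < h \<and> (h - b)\<^sup>2 \<le> 2 * h * b * (c - 1)} h) \<partial>lborel) \<partial>lborel)"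
proof -
  define W :: "real \<Rightarrow> real \<Rightarrow> ennreal" where
    "W h c = (if 0 < h \<and> (h - b)\<^sup>2 \<le> 2 * h * b * (c - 1) then F c * ennreal (2 * pi * b / h\<^sup>2) else 0)" for h c
  have "case_prod W \<in> borel_measurable (lborel \<Otimes>\<^sub>M lborel)" unfolding W_def by measurable
  then have "(\<integral>\<^sup>+h. (\<integral>\<^sup>+c. W h c \<partial>lborel) \<partial>lborel) = (\<integral>\<^sup>+c. (\<integral>\<^sup>+h. W h c \<partial>lborel) \<partial>lborel)"
    by (rule lborel_pair.Fubini'[symmetric])
  moreover have "F c * (ennreal (2 * pi * b / h\<^sup>2) * indicator {h. 0 < h \<and> (h - b)\<^sup>2 \<le> 2 * h * b * (c - 1)} h) = W h c" for h c
    by (simp add: W_def)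
  ultimately show ?thesis by simp
qed

text \<open>
  On the plane at height \<open>h\<close> the function \<open>hyp_cosh a\<close> is affine in the squared horizontal distance,
  so the integral over the plane becomes an integral over \<open>c\<close>; the integration over \<open>h\<close> then falls on
  the weight alone.
\<close>

lemma nn_integral_radial:
  assumes a: "a \<in> hyp3" and [measurable]: "F \<in> borel_measurable borel"
  shows "(\<integral>\<^sup>+x. F (hyp_cosh a x) \<partial>hyp_measure) = (\<integral>\<^sup>+c. F c \<partial>radial_measure)"
proof -
  have a3: "0 < a $ 3" using a by (simp add: hyp3_def)
  have "(\<integral>\<^sup>+x. F (hyp_cosh a x) \<partial>hyp_measure)
      = (\<integral>\<^sup>+x. ennreal (1 / (x $ 3) ^ 3) * F (hyp_cosh a x) * indicator {x. 0 < x $ 3} x \<partial>distr (lborel \<Otimes>\<^sub>M lborel) borel real3_of)"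
    by (subst nn_integral_hyp_measure) (auto simp: hyp3_def lborel_real3[symmetric])
  also have "\<dots> = (\<integral>\<^sup>+p. ennreal (1 / (real3_of p $ 3) ^ 3) * F (hyp_cosh a (real3_of p)) * indicator {x. 0 < x $ 3} (real3_of p) \<partial>(lborel \<Otimes>\<^sub>M lborel))"
    by (subst nn_integral_distr) auto
  also have "\<dots> = (\<integral>\<^sup>+h. (\<integral>\<^sup>+p. ennreal (1 / h ^ 3) * F (hyp_cosh a (real3_of (h, p))) * indicator {0<..} h \<partial>lborel) \<partial>lborel)"
    by (subst lborel.nn_integral_fst[symmetric], measurable)
       (auto intro!: nn_integral_cong simp: indicator_def)
  also have "\<dots> = (\<integral>\<^sup>+h. (\<integral>\<^sup>+c. F c * (ennreal (2 * pi * a $ 3 / h\<^sup>2) * indicator {h. 0 < h \<and> (h - a $ 3)\<^sup>2 \<le> 2 * h * a $ 3 * (c - 1)} h) \<partial>lborel) \<partial>lborel)"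
  proof (intro nn_integral_cong)
    fix h :: real
    show "(\<integral>\<^sup>+p. ennreal (1 / h ^ 3) * F (hyp_cosh a (real3_of (h, p))) * indicator {0<..} h \<partial>lborel)
       = (\<integral>\<^sup>+c. F c * (ennreal (2 * pi * a $ 3 / h\<^sup>2) * indicator {h. 0 < h \<and> (h - a $ 3)\<^sup>2 \<le> 2 * h * a $ 3 * (c - 1)} h) \<partial>lborel)"
    proof (cases "0 < h")
      case True
      define k where "k = 2 * h * a $ 3"
      have k: "0 < k" using True a3 by (simp add: k_def)
      define G where "G u = F (1 + (u + (h - a $ 3)\<^sup>2) / k)" for u
      have [measurable]: "G \<in> borel_measurable borel" unfolding G_def by measurable
      have Gm: "(\<lambda>p::real \<times> real. G ((fst p - b)\<^sup>2 + (snd p - d)\<^sup>2)) \<in> borel_measurable borel" for b d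
        by (rule measurable_compose[OF borel_measurable_continuous_onI \<open>G \<in> _\<close>]) (intro continuous_intros)
      have "(\<integral>\<^sup>+p. F (hyp_cosh a (real3_of (h, p))) \<partial>lborel)
          = (\<integral>\<^sup>+p. G ((fst p - a $ 1)\<^sup>2 + (snd p - a $ 2)\<^sup>2) \<partial>lborel)"
        by (intro nn_integral_cong)
           (auto simp: G_def hyp_cosh_coordinates k_def power2_commute mult_ac add_ac split: prod.splits)
      also have "\<dots> = (\<integral>\<^sup>+p. G ((fst p - a $ 1)\<^sup>2 + (snd p - a $ 2)\<^sup>2) \<partial>distr lborel borel ((+) (a $ 1, a $ 2)))"
        by (simp add: lborel_distr_plus)
      also have "\<dots> = (\<integral>\<^sup>+p. G ((fst p)\<^sup>2 + (snd p)\<^sup>2) \<partial>lborel)"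
        by (subst nn_integral_distr) (auto simp: Gm)
      also have "\<dots> = (\<integral>\<^sup>+u. ennreal (pi * indicator {0..} u) * G u \<partial>lborel)"
        by (rule lborel_radial_plane) measurable
      also have "\<dots> = ennreal \<bar>k\<bar> * (\<integral>\<^sup>+c. ennreal (pi * indicator {0..} ((- k - (h - a $ 3)\<^sup>2) + k * c)) * G ((- k - (h - a $ 3)\<^sup>2) + k * c) \<partial>lborel)"
        using k by (intro nn_integral_real_affine) auto
      also have "\<dots> = (\<integral>\<^sup>+c. ennreal k * (ennreal (pi * indicator {0..} ((- k - (h - a $ 3)\<^sup>2) + k * c)) * F c) \<partial>lborel)"
        using k by (subst nn_integral_cmult[symmetric]) (auto intro!: nn_integral_cong simp: G_def field_simps)
      finally have eq: "(\<integral>\<^sup>+p. F (hyp_cosh a (real3_of (h, p))) \<partial>lborel) = \<dots>" .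
      have [measurable]: "(\<lambda>p. real3_of (h, p)) \<in> borel_measurable lborel"
        by (rule real3_of_measurable, rule measurable_Pair) (auto intro: measurable_ident_sets)
      have "(\<integral>\<^sup>+p. ennreal (1 / h ^ 3) * F (hyp_cosh a (real3_of (h, p))) * indicator {0<..} h \<partial>lborel)
          = ennreal (1 / h ^ 3) * (\<integral>\<^sup>+p. F (hyp_cosh a (real3_of (h, p))) \<partial>lborel)"
        using True by (simp add: nn_integral_cmult)
      also have "\<dots> = (\<integral>\<^sup>+c. ennreal (1 / h ^ 3) * (ennreal k * (ennreal (pi * indicator {0..} ((- k - (h - a $ 3)\<^sup>2) + k * c)) * F c)) \<partial>lborel)"
        unfolding eq by (subst nn_integral_cmult[symmetric]) auto
      also have "\<dots> = (\<integral>\<^sup>+c. F c * (ennreal (2 * pi * a $ 3 / h\<^sup>2) * indicator {h. 0 < h \<and> (h - a $ 3)\<^sup>2 \<le> 2 * h * a $ 3 * (c - 1)} h) \<partial>lborel)"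
      proof (intro nn_integral_cong)
        fix c
        have "0 \<le> (- k - (h - a $ 3)\<^sup>2) + k * c \<longleftrightarrow> (h - a $ 3)\<^sup>2 \<le> 2 * h * a $ 3 * (c - 1)"
          by (simp add: k_def algebra_simps)
        moreover have "ennreal (1 / h ^ 3) * (ennreal k * (ennreal pi * y)) = y * ennreal (2 * pi * a $ 3 / h\<^sup>2)" for y
        proof -
          have "1 / h ^ 3 * k * pi = 2 * pi * a $ 3 / h\<^sup>2"
            using True by (simp add: k_def power2_eq_square power3_eq_cube)
          moreover have "ennreal (1 / h ^ 3 * k * pi) = ennreal (1 / h ^ 3) * ennreal k * ennreal pi"
            using True k by (simp only: ennreal_mult[symmetric] mult_nonneg_nonneg less_imp_le zero_less_divide_1_iff zero_less_power pi_gt_zero)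
          ultimately show ?thesis by (simp add: mult_ac)
        qed
        ultimately show "ennreal (1 / h ^ 3) * (ennreal k * (ennreal (pi * indicator {0..} ((- k - (h - a $ 3)\<^sup>2) + k * c)) * F c))
          = F c * (ennreal (2 * pi * a $ 3 / h\<^sup>2) * indicator {h. 0 < h \<and> (h - a $ 3)\<^sup>2 \<le> 2 * h * a $ 3 * (c - 1)} h)"
          using True by (simp add: indicator_def)
      qed
      finally show ?thesis .
    qed simp
  qed
  also have "\<dots> = (\<integral>\<^sup>+c. (\<integral>\<^sup>+h. F c * (ennreal (2 * pi * a $ 3 / h\<^sup>2) * indicator {h. 0 < h \<and> (h - a $ 3)\<^sup>2 \<le> 2 * h * a $ 3 * (c - 1)} h) \<partial>lborel) \<partial>lborel)"
    by (rule height_swap) measurable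
  also have "\<dots> = (\<integral>\<^sup>+c. F c * ennreal (4 * pi * sqrt (c\<^sup>2 - 1) * indicator {1..} c) \<partial>lborel)"
    by (intro nn_integral_cong height_integral_cmult a3)
  also have "\<dots> = (\<integral>\<^sup>+c. F c \<partial>radial_measure)"
    unfolding radial_measure_def by (subst nn_integral_density) (auto simp: mult.commute)
  finally show ?thesis .
qed

theorem distr_hyp_cosh:
  assumes a: "a \<in> hyp3"
  shows "distr hyp_measure borel (hyp_cosh a) = radial_measure"
proof (rule measure_eqI)
  fix A assume "A \<in> sets (distr hyp_measure borel (hyp_cosh a))"
  then have [measurable]: "A \<in> sets borel" by simp
  have [measurable]: "hyp_cosh a \<in> borel_measurable hyp_measure"
    by (simp add: measurable_restrict_space1 measurable_cong_sets[OF sets_hyp_measure refl])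
  have "emeasure (distr hyp_measure borel (hyp_cosh a)) A = (\<integral>\<^sup>+c. indicator A c \<partial>distr hyp_measure borel (hyp_cosh a))"
    by simp
  also have "\<dots> = (\<integral>\<^sup>+x. indicator A (hyp_cosh a x) \<partial>hyp_measure)"
    by (rule nn_integral_distr) auto
  also have "\<dots> = emeasure radial_measure A"
    by (subst nn_integral_radial[OF a]) auto
  finally show "emeasure (distr hyp_measure borel (hyp_cosh a)) A = emeasure radial_measure A" .
qed simp

section \<open>Radial kernel operators\<close>

lemma hyp3_measurable [measurable]: "hyp3 \<in> sets borel"
  unfolding hyp3_def by (intro borel_open open_Collect_less continuous_intros)

lemma measurable_hyp_measure_borel:
  "f \<in> borel_measurable borel \<Longrightarrow> f \<in> borel_measurable hyp_measure"
  by (simp add: measurable_restrict_space1 measurable_cong_sets[OF sets_hyp_measure refl])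

lemma ident_measurable_hyp [measurable]: "(\<lambda>x. x) \<in> borel_measurable hyp_measure"
  by (rule measurable_hyp_measure_borel) simp

lemma vec_nth_measurable_hyp [measurable]: "(\<lambda>x. x $ i) \<in> borel_measurable hyp_measure"
  by (rule measurable_hyp_measure_borel) simp

interpretation hyp: sigma_finite_measure hyp_measure
proof -
  have "sigma_finite_measure (restrict_space lborel hyp3)"
    by (rule sigma_finite_measure_restrict_space[OF lborel.sigma_finite_measure_axioms]) simp
  moreover have "(\<lambda>x::real^3. ennreal (1 / (x $ 3) ^ 3)) \<in> borel_measurable (restrict_space lborel hyp3)"
    by (intro measurable_restrict_space1) simp
  ultimately show "sigma_finite_measure hyp_measure"
    unfolding hyp_measure_def by (subst sigma_finite_measure.sigma_finite_iff_density_finite) auto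
qed

interpretation hyp2: pair_sigma_finite hyp_measure hyp_measure ..

lemma hyp_cosh_measurable_hyp [measurable]: "hyp_cosh a \<in> borel_measurable hyp_measure"
  by (rule measurable_hyp_measure_borel) simp

lemma integrable_radial_iff:
  fixes F :: "real \<Rightarrow> 'b::{banach, second_countable_topology}"
  assumes "a \<in> hyp3" "F \<in> borel_measurable borel"
  shows "integrable hyp_measure (\<lambda>x. F (hyp_cosh a x)) \<longleftrightarrow> integrable radial_measure F"
  using integrable_distr_eq[of "hyp_cosh a" hyp_measure borel F] assms by (simp add: distr_hyp_cosh)

lemma integral_radial:
  fixes F :: "real \<Rightarrow> 'b::{banach, second_countable_topology}"
  assumes "a \<in> hyp3" "F \<in> borel_measurable borel"
  shows "(LINT x|hyp_measure. F (hyp_cosh a x)) = (LINT c|radial_measure. F c)"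
  using integral_distr[of "hyp_cosh a" hyp_measure borel F] assms by (simp add: distr_hyp_cosh)

lemma AE_hyp_measure_in: "AE x in hyp_measure. x \<in> hyp3"
  by (rule AE_I2) simp

definition radial_apply :: "(real \<Rightarrow> real) \<Rightarrow> (real ^ 3 \<Rightarrow> complex) \<Rightarrow> real ^ 3 \<Rightarrow> complex" where
  "radial_apply q f x = (LINT y|hyp_measure. q (hyp_cosh x y) *\<^sub>R f y)"

abbreviation radial_mass :: "(real \<Rightarrow> real) \<Rightarrow> real" where
  "radial_mass q \<equiv> (LINT c|radial_measure. \<bar>q c\<bar>)"

lemma radial_borel: "integrable radial_measure q \<Longrightarrow> q \<in> borel_measurable borel"
  by (auto simp: integrable_iff_bounded measurable_cong_sets[OF sets_radial_measure refl])

context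
  fixes q :: "real \<Rightarrow> real"
  assumes q: "integrable radial_measure q"
begin

lemma nn_radial_mass:
  assumes "x \<in> hyp3"
  shows "(\<integral>\<^sup>+y. ennreal \<bar>q (hyp_cosh x y)\<bar> \<partial>hyp_measure) = ennreal (radial_mass q)"
proof -
  note [measurable] = radial_borel[OF q]
  have "(\<integral>\<^sup>+y. ennreal \<bar>q (hyp_cosh x y)\<bar> \<partial>hyp_measure) = (\<integral>\<^sup>+c. ennreal \<bar>q c\<bar> \<partial>radial_measure)"
    by (rule nn_integral_radial[OF assms]) measurable
  then show ?thesis using q by (simp add: nn_integral_eq_integral)
qed

text \<open>
  Integrate over \<open>x\<close> first: by symmetry of the kernel the inner integral is the radial mass of \<open>q\<close>,
  whatever \<open>y\<close> is.
\<close>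

lemma schur_finite:
  assumes f: "square_integrable f"
  shows "(\<integral>\<^sup>+x. (\<integral>\<^sup>+y. ennreal \<bar>q (hyp_cosh x y)\<bar> * ennreal ((norm (f y))\<^sup>2) \<partial>hyp_measure) \<partial>hyp_measure)
     = ennreal (radial_mass q * (norm (abs_hyp_L2 f))\<^sup>2)"
proof -
  note [measurable] = radial_borel[OF q]
  have [measurable]: "f \<in> borel_measurable hyp_measure" using f by (rule square_integrable_measurable)
  have "(\<integral>\<^sup>+x. (\<integral>\<^sup>+y. ennreal \<bar>q (hyp_cosh x y)\<bar> * ennreal ((norm (f y))\<^sup>2) \<partial>hyp_measure) \<partial>hyp_measure)
      = (\<integral>\<^sup>+y. (\<integral>\<^sup>+x. ennreal \<bar>q (hyp_cosh x y)\<bar> * ennreal ((norm (f y))\<^sup>2) \<partial>hyp_measure) \<partial>hyp_measure)"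
    by (rule hyp2.Fubini'[symmetric]) measurable
  also have "\<dots> = (\<integral>\<^sup>+y. ennreal (radial_mass q) * ennreal ((norm (f y))\<^sup>2) \<partial>hyp_measure)"
  proof (intro nn_integral_cong)
    fix y assume "y \<in> space hyp_measure"
    then have "(\<integral>\<^sup>+x. ennreal \<bar>q (hyp_cosh x y)\<bar> \<partial>hyp_measure) = ennreal (radial_mass q)"
      using nn_radial_mass[of y] by (simp add: hyp_cosh_commute[of _ y])
    then show "(\<integral>\<^sup>+x. ennreal \<bar>q (hyp_cosh x y)\<bar> * ennreal ((norm (f y))\<^sup>2) \<partial>hyp_measure)
        = ennreal (radial_mass q) * ennreal ((norm (f y))\<^sup>2)"
      by (subst nn_integral_multc) auto
  qed
  also have "\<dots> = ennreal (radial_mass q * (norm (abs_hyp_L2 f))\<^sup>2)"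
    by (subst nn_integral_cmult) (auto simp: abs_norm_nn[OF f, symmetric] ennreal_mult)
  finally show ?thesis .
qed

text \<open>
  Cauchy--Schwarz applied to the product of \<open>sqrt \<bar>q\<bar>\<close> and \<open>sqrt \<bar>q\<bar> * norm f\<close>.
\<close>

lemma schur_pointwise:
  assumes f: "square_integrable f" and x: "x \<in> hyp3"
  shows "(\<integral>\<^sup>+y. ennreal (norm (q (hyp_cosh x y) *\<^sub>R f y)) \<partial>hyp_measure)\<^sup>2
     \<le> ennreal (radial_mass q) * (\<integral>\<^sup>+y. ennreal \<bar>q (hyp_cosh x y)\<bar> * ennreal ((norm (f y))\<^sup>2) \<partial>hyp_measure)"
proof -
  note [measurable] = radial_borel[OF q]
  have [measurable]: "f \<in> borel_measurable hyp_measure" using f by (rule square_integrable_measurable)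
  let ?r = "\<lambda>y. ennreal (sqrt \<bar>q (hyp_cosh x y)\<bar>)"
  have "(\<integral>\<^sup>+y. ?r y * (?r y * ennreal (norm (f y))) \<partial>hyp_measure)\<^sup>2
      \<le> (\<integral>\<^sup>+y. (?r y)\<^sup>2 \<partial>hyp_measure) * (\<integral>\<^sup>+y. (?r y * ennreal (norm (f y)))\<^sup>2 \<partial>hyp_measure)"
    by (rule Cauchy_Schwarz_nn_integral) measurable
  moreover have "?r y * (?r y * ennreal (norm (f y))) = ennreal (norm (q (hyp_cosh x y) *\<^sub>R f y))" for y
    by (simp add: ennreal_mult[symmetric] mult.assoc[symmetric])
  moreover have "(?r y)\<^sup>2 = ennreal \<bar>q (hyp_cosh x y)\<bar>" for y
    by (simp add: ennreal_power)
  moreover have "(?r y * ennreal (norm (f y)))\<^sup>2 = ennreal \<bar>q (hyp_cosh x y)\<bar> * ennreal ((norm (f y))\<^sup>2)" for y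
    by (simp add: power_mult_distrib ennreal_power)
  ultimately show ?thesis using nn_radial_mass[OF x] by simp
qed

lemma schur_AE_integrable:
  assumes f: "square_integrable f"
  shows "AE x in hyp_measure. integrable hyp_measure (\<lambda>y. q (hyp_cosh x y) *\<^sub>R f y)"
proof -
  note [measurable] = radial_borel[OF q]
  have [measurable]: "f \<in> borel_measurable hyp_measure" using f by (rule square_integrable_measurable)
  have "AE x in hyp_measure. (\<integral>\<^sup>+y. ennreal \<bar>q (hyp_cosh x y)\<bar> * ennreal ((norm (f y))\<^sup>2) \<partial>hyp_measure) \<noteq> \<infinity>"
    by (rule nn_integral_PInf_AE) (auto simp: schur_finite[OF f])
  with AE_hyp_measure_in show ?thesis
  proof eventually_elim
    case (elim x)
    let ?X = "\<integral>\<^sup>+y. ennreal (norm (q (hyp_cosh x y) *\<^sub>R f y)) \<partial>hyp_measure"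
    note schur_pointwise[OF f elim(1)]
    also have "ennreal (radial_mass q) * (\<integral>\<^sup>+y. ennreal \<bar>q (hyp_cosh x y)\<bar> * ennreal ((norm (f y))\<^sup>2) \<partial>hyp_measure) < \<infinity>"
      using elim(2) by (simp add: ennreal_mult_less_top less_top)
    finally have fin: "?X\<^sup>2 < \<infinity>" .
    have "?X \<noteq> top"
    proof
      assume "?X = top"
      then show False using fin unfolding power2_eq_square by simp
    qed
    then have "?X < \<infinity>" by (simp add: less_top)
    then show ?case by (intro integrableI_bounded) auto
  qed
qed

lemma radial_apply_measurable:
  assumes f: "square_integrable f"
  shows "radial_apply q f \<in> borel_measurable hyp_measure"
proof -
  note [measurable] = radial_borel[OF q]
  have [measurable]: "f \<in> borel_measurable hyp_measure" using f by (rule square_integrable_measurable)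
  show ?thesis unfolding radial_apply_def[abs_def]
    by (rule hyp.borel_measurable_lebesgue_integral) measurable
qed

lemma schur_nn_bound:
  assumes f: "square_integrable f"
  shows "(\<integral>\<^sup>+x. ennreal ((norm (radial_apply q f x))\<^sup>2) \<partial>hyp_measure) \<le> ennreal ((radial_mass q)\<^sup>2 * (norm (abs_hyp_L2 f))\<^sup>2)"
proof -
  note [measurable] = radial_borel[OF q]
  have [measurable]: "f \<in> borel_measurable hyp_measure" using f by (rule square_integrable_measurable)
  have "(\<integral>\<^sup>+x. ennreal ((norm (radial_apply q f x))\<^sup>2) \<partial>hyp_measure)
     \<le> (\<integral>\<^sup>+x. ennreal (radial_mass q) * (\<integral>\<^sup>+y. ennreal \<bar>q (hyp_cosh x y)\<bar> * ennreal ((norm (f y))\<^sup>2) \<partial>hyp_measure) \<partial>hyp_measure)"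
  proof (rule nn_integral_mono_AE)
    show "AE x in hyp_measure. ennreal ((norm (radial_apply q f x))\<^sup>2)
       \<le> ennreal (radial_mass q) * (\<integral>\<^sup>+y. ennreal \<bar>q (hyp_cosh x y)\<bar> * ennreal ((norm (f y))\<^sup>2) \<partial>hyp_measure)"
      using AE_hyp_measure_in schur_AE_integrable[OF f]
    proof eventually_elim
      case (elim x)
      have "ennreal (norm (radial_apply q f x)) \<le> (\<integral>\<^sup>+y. ennreal (norm (q (hyp_cosh x y) *\<^sub>R f y)) \<partial>hyp_measure)"
        unfolding radial_apply_def by (rule integral_norm_bound_ennreal[OF elim(2)])
      then have "(ennreal (norm (radial_apply q f x)))\<^sup>2 \<le> (\<integral>\<^sup>+y. ennreal (norm (q (hyp_cosh x y) *\<^sub>R f y)) \<partial>hyp_measure)\<^sup>2"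
        by (rule power_mono) simp
      also note schur_pointwise[OF f elim(1)]
      finally show ?case by (simp add: ennreal_power)
    qed
  qed
  also have "\<dots> = ennreal (radial_mass q) * ennreal (radial_mass q * (norm (abs_hyp_L2 f))\<^sup>2)"
    by (subst nn_integral_cmult) (auto simp: schur_finite[OF f])
  also have "\<dots> = ennreal ((radial_mass q)\<^sup>2 * (norm (abs_hyp_L2 f))\<^sup>2)"
    by (simp add: ennreal_mult[symmetric] power2_eq_square mult.assoc)
  finally show ?thesis .
qed

lemma radial_apply_square_integrable:
  assumes f: "square_integrable f"
  shows "square_integrable (radial_apply q f)"
  unfolding square_integrable_def
proof
  note [measurable] = radial_apply_measurable[OF f]
  show "radial_apply q f \<in> borel_measurable hyp_measure" by measurable
  show "integrable hyp_measure (\<lambda>x. (norm (radial_apply q f x))\<^sup>2)"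
    by (rule integrableI_bounded) (use schur_nn_bound[OF f] in \<open>auto intro: le_less_trans\<close>)
qed

lemma radial_apply_norm:
  assumes f: "square_integrable f"
  shows "norm (abs_hyp_L2 (radial_apply q f)) \<le> radial_mass q * norm (abs_hyp_L2 f)"
proof -
  have "ennreal ((norm (abs_hyp_L2 (radial_apply q f)))\<^sup>2) \<le> ennreal ((radial_mass q)\<^sup>2 * (norm (abs_hyp_L2 f))\<^sup>2)"
    using schur_nn_bound[OF f] by (simp add: abs_norm_nn radial_apply_square_integrable f)
  then have "(norm (abs_hyp_L2 (radial_apply q f)))\<^sup>2 \<le> (radial_mass q * norm (abs_hyp_L2 f))\<^sup>2"
    by (simp add: power_mult_distrib)
  then show ?thesis by (rule power2_le_imp_le) simp
qed

lemma radial_apply_add: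
  assumes "square_integrable f" "square_integrable g"
  shows "abs_hyp_L2 (radial_apply q (\<lambda>x. f x + g x)) = abs_hyp_L2 (radial_apply q f) + abs_hyp_L2 (radial_apply q g)"
proof -
  have "AE x in hyp_measure. radial_apply q (\<lambda>x. f x + g x) x = radial_apply q f x + radial_apply q g x"
    using schur_AE_integrable[OF assms(1)] schur_AE_integrable[OF assms(2)]
    by eventually_elim (simp add: radial_apply_def scaleR_add_right)
  then show ?thesis
    by (simp add: abs_add abs_eq_iff square_integrable_add radial_apply_square_integrable assms)
qed

lemma radial_apply_scale: "radial_apply q (\<lambda>x. c * f x) = (\<lambda>x. c * radial_apply q f x)"
  by (simp add: radial_apply_def fun_eq_iff flip: mult_scaleR_right)

lemma radial_apply_cong:
  assumes "square_integrable f" "square_integrable g" "AE x in hyp_measure. f x = g x"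
  shows "radial_apply q f x = radial_apply q g x"
proof -
  note [measurable] = radial_borel[OF q]
  have [measurable]: "f \<in> borel_measurable hyp_measure" "g \<in> borel_measurable hyp_measure"
    using assms by (auto intro: square_integrable_measurable)
  show ?thesis unfolding radial_apply_def using assms(3) by (intro integral_cong_AE) auto
qed

lemma radial_bounded_linear: "bounded_linear (\<lambda>u. abs_hyp_L2 (radial_apply q (rep_hyp_L2 u)))"
proof (rule bounded_linear_intro[where K = "radial_mass q"])
  note sq = rep_square_integrable
  fix u v :: hyp_L2 and r :: real
  show "abs_hyp_L2 (radial_apply q (rep_hyp_L2 (u + v))) = abs_hyp_L2 (radial_apply q (rep_hyp_L2 u)) + abs_hyp_L2 (radial_apply q (rep_hyp_L2 v))"
  proof -
    have "radial_apply q (rep_hyp_L2 (u + v)) = radial_apply q (\<lambda>x. rep_hyp_L2 u x + rep_hyp_L2 v x)"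
      using rep_abs_AE[OF square_integrable_add[OF sq[of u] sq[of v]]]
      by (intro ext radial_apply_cong sq square_integrable_add) (simp add: abs_add[symmetric] sq)
    then show ?thesis by (simp add: radial_apply_add sq)
  qed
  show "abs_hyp_L2 (radial_apply q (rep_hyp_L2 (r *\<^sub>R u))) = r *\<^sub>R abs_hyp_L2 (radial_apply q (rep_hyp_L2 u))"
  proof -
    have "radial_apply q (rep_hyp_L2 (r *\<^sub>R u)) = radial_apply q (\<lambda>x. complex_of_real r * rep_hyp_L2 u x)"
      using rep_abs_AE[OF square_integrable_scale[OF sq[of u], of "complex_of_real r"]]
      by (intro ext radial_apply_cong sq square_integrable_scale) (simp add: abs_scaleR[symmetric] sq)
    then show ?thesis by (simp add: radial_apply_scale abs_scaleR radial_apply_square_integrable sq)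
  qed
  show "norm (abs_hyp_L2 (radial_apply q (rep_hyp_L2 u))) \<le> norm u * radial_mass q"
    using radial_apply_norm[OF sq, of u] by (simp add: mult.commute)
qed

end

definition radial_op :: "(real \<Rightarrow> real) \<Rightarrow> hyp_L2 \<Rightarrow>\<^sub>L hyp_L2" where
  "radial_op q = Blinfun (\<lambda>u. abs_hyp_L2 (radial_apply q (rep_hyp_L2 u)))"

lemma radial_op_abs:
  assumes q: "integrable radial_measure q" and f: "square_integrable f"
  shows "radial_op q (abs_hyp_L2 f) = abs_hyp_L2 (radial_apply q f)"
proof -
  have "radial_op q (abs_hyp_L2 f) = abs_hyp_L2 (radial_apply q (rep_hyp_L2 (abs_hyp_L2 f)))"
    unfolding radial_op_def by (simp add: bounded_linear_Blinfun_apply radial_bounded_linear[OF q])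
  also have "radial_apply q (rep_hyp_L2 (abs_hyp_L2 f)) = radial_apply q f"
    by (intro ext radial_apply_cong[OF q] rep_square_integrable f rep_abs_AE)
  finally show ?thesis .
qed

lemma norm_radial_op: assumes q: "integrable radial_measure q" shows "norm (radial_op q) \<le> radial_mass q"
proof (rule norm_blinfun_bound)
  show "norm (radial_op q u) \<le> radial_mass q * norm u" for u
    by (cases u) (simp add: radial_op_abs[OF q] radial_apply_norm[OF q])
qed simp

lemma radial_op_diff:
  assumes p: "integrable radial_measure p" and q: "integrable radial_measure q"
  shows "radial_op p - radial_op q = radial_op (\<lambda>c. p c - q c)"
proof (rule blinfun_eqI)
  fix u
  have pq: "integrable radial_measure (\<lambda>c. p c - q c)" using p q by simp
  show "(radial_op p - radial_op q) u = radial_op (\<lambda>c. p c - q c) u"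
  proof (cases u)
    case (abs f)
    have "AE x in hyp_measure. radial_apply p f x - radial_apply q f x = radial_apply (\<lambda>c. p c - q c) f x"
      using schur_AE_integrable[OF p abs(2)] schur_AE_integrable[OF q abs(2)]
      by eventually_elim (simp add: radial_apply_def scaleR_diff_left)
    then show ?thesis
      using abs(2) p q pq by (simp add: abs(1) blinfun.diff_left radial_op_abs abs_diff abs_eq_iff radial_apply_square_integrable square_integrable_diff)
  qed
qed

lemma radial_op_scaleR:
  assumes q: "integrable radial_measure q"
  shows "radial_op (\<lambda>c. r * q c) = r *\<^sub>R radial_op q"
proof (rule blinfun_eqI)
  fix u
  have rq: "integrable radial_measure (\<lambda>c. r * q c)" using q by simp
  show "radial_op (\<lambda>c. r * q c) u = (r *\<^sub>R radial_op q) u"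
  proof (cases u)
    case (abs f)
    have "radial_apply (\<lambda>c. r * q c) f = (\<lambda>x. complex_of_real r * radial_apply q f x)"
      by (simp add: radial_apply_def fun_eq_iff scaleR_conv_of_real mult.assoc flip: integral_mult_right_zero)
    then show ?thesis
      using abs(2) q rq by (simp add: abs(1) blinfun.scaleR_left radial_op_abs abs_scaleR radial_apply_square_integrable)
  qed
qed

text \<open>
  Since \<open>\<bar>f y \<bullet> g x\<bar> \<le> (norm (f y))\<^sup>2 + (norm (g x))\<^sup>2\<close>, each half is integrable by \<open>schur_finite\<close>.
\<close>

lemma radial_kernel_pair_integrable:
  assumes q: "integrable radial_measure q" and f: "square_integrable f" and g: "square_integrable g"
  shows "integrable (hyp_measure \<Otimes>\<^sub>M hyp_measure) (\<lambda>(x, y). q (hyp_cosh x y) * (f y \<bullet> g x))"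
proof -
  have [measurable]: "f \<in> borel_measurable hyp_measure" "g \<in> borel_measurable hyp_measure"
    using f g by (auto intro: square_integrable_measurable)
  have [measurable]: "q \<in> borel_measurable borel" by (rule radial_borel[OF q])
  have fin: "(\<integral>\<^sup>+p. ennreal (\<bar>q (hyp_cosh (fst p) (snd p))\<bar> * (norm (h (snd p)))\<^sup>2) \<partial>(hyp_measure \<Otimes>\<^sub>M hyp_measure)) < \<infinity>"
    if h: "square_integrable h" for h
  proof -
    have [measurable]: "h \<in> borel_measurable hyp_measure" using h by (rule square_integrable_measurable)
    show ?thesis
      using schur_finite[OF q h] by (subst hyp.nn_integral_fst[symmetric]) (auto simp: ennreal_mult ennreal_mult_less_top)
  qed
  have i1: "integrable (hyp_measure \<Otimes>\<^sub>M hyp_measure) (\<lambda>p. \<bar>q (hyp_cosh (fst p) (snd p))\<bar> * (norm (f (snd p)))\<^sup>2)"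
    by (rule integrableI_bounded) (use fin[OF f] in \<open>auto simp: abs_mult\<close>)
  have "integrable (hyp_measure \<Otimes>\<^sub>M hyp_measure) (\<lambda>(x, y). \<bar>q (hyp_cosh x y)\<bar> * (norm (g y))\<^sup>2)"
    by (rule integrableI_bounded) (use fin[OF g] in \<open>auto simp: abs_mult split_beta\<close>)
  from hyp2.integrable_product_swap[OF this]
  have i2: "integrable (hyp_measure \<Otimes>\<^sub>M hyp_measure) (\<lambda>p. \<bar>q (hyp_cosh (fst p) (snd p))\<bar> * (norm (g (fst p)))\<^sup>2)"
  proof (rule back_subst[of "integrable (hyp_measure \<Otimes>\<^sub>M hyp_measure)"], intro ext)
    fix p :: "(real ^ 3) \<times> (real ^ 3)"
    show "(case p of (x, y) \<Rightarrow> case (y, x) of (x, y) \<Rightarrow> \<bar>q (hyp_cosh x y)\<bar> * (norm (g y))\<^sup>2)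
        = \<bar>q (hyp_cosh (fst p) (snd p))\<bar> * (norm (g (fst p)))\<^sup>2"
      using hyp_cosh_commute[of "fst p" "snd p"] by (cases p) simp
  qed
  show ?thesis
  proof (rule Bochner_Integration.integrable_bound[OF Bochner_Integration.integrable_add[OF i1 i2]])
    show "(\<lambda>(x, y). q (hyp_cosh x y) * (f y \<bullet> g x)) \<in> borel_measurable (hyp_measure \<Otimes>\<^sub>M hyp_measure)" by measurable
    show "AE p in hyp_measure \<Otimes>\<^sub>M hyp_measure. norm (case p of (x, y) \<Rightarrow> q (hyp_cosh x y) * (f y \<bullet> g x))
       \<le> norm (\<bar>q (hyp_cosh (fst p) (snd p))\<bar> * (norm (f (snd p)))\<^sup>2 + \<bar>q (hyp_cosh (fst p) (snd p))\<bar> * (norm (g (fst p)))\<^sup>2)"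
    proof (intro AE_I2, clarify)
      fix x y
      have "\<bar>f y \<bullet> g x\<bar> \<le> norm (f y) * norm (g x)" by (rule Cauchy_Schwarz_ineq2)
      also have "\<dots> \<le> 2 * norm (f y) * norm (g x)" by simp
      also have "\<dots> \<le> (norm (f y))\<^sup>2 + (norm (g x))\<^sup>2" by (rule sum_squares_bound)
      finally have "\<bar>q (hyp_cosh x y)\<bar> * \<bar>f y \<bullet> g x\<bar> \<le> \<bar>q (hyp_cosh x y)\<bar> * ((norm (f y))\<^sup>2 + (norm (g x))\<^sup>2)"
        by (rule mult_left_mono) simp
      then show "norm (q (hyp_cosh x y) * (f y \<bullet> g x))
         \<le> norm (\<bar>q (hyp_cosh (fst (x, y)) (snd (x, y)))\<bar> * (norm (f (snd (x, y))))\<^sup>2 + \<bar>q (hyp_cosh (fst (x, y)) (snd (x, y)))\<bar> * (norm (g (fst (x, y))))\<^sup>2)"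
        by (simp add: abs_mult distrib_left)
    qed
  qed
qed

lemma radial_op_inner:
  assumes q: "integrable radial_measure q" and f: "square_integrable f" and g: "square_integrable g"
  shows "radial_op q (abs_hyp_L2 f) \<bullet> abs_hyp_L2 g
     = (LINT x|hyp_measure. LINT y|hyp_measure. q (hyp_cosh x y) * (f y \<bullet> g x))"
proof -
  have [measurable]: "f \<in> borel_measurable hyp_measure" "g \<in> borel_measurable hyp_measure"
    using f g by (auto intro: square_integrable_measurable)
  have [measurable]: "q \<in> borel_measurable borel" by (rule radial_borel[OF q])
  note [measurable] = radial_apply_measurable[OF q f]
  have "radial_op q (abs_hyp_L2 f) \<bullet> abs_hyp_L2 g = (LINT x|hyp_measure. radial_apply q f x \<bullet> g x)"
    by (simp add: radial_op_abs q f g abs_inner radial_apply_square_integrable)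
  also have "\<dots> = (LINT x|hyp_measure. LINT y|hyp_measure. q (hyp_cosh x y) * (f y \<bullet> g x))"
  proof (rule integral_cong_AE)
    show "AE x in hyp_measure. radial_apply q f x \<bullet> g x = (LINT y|hyp_measure. q (hyp_cosh x y) * (f y \<bullet> g x))"
      using schur_AE_integrable[OF q f]
    proof eventually_elim
      case (elim x)
      then show ?case unfolding radial_apply_def by (subst integral_inner_left[symmetric]) auto
    qed
  qed measurable
  finally show ?thesis .
qed

lemma radial_op_symmetric:
  assumes q: "integrable radial_measure q"
  shows "radial_op q u \<bullet> v = u \<bullet> radial_op q v"
proof (cases u)
  case f: (abs f)
  show ?thesis
  proof (cases v)
    case g: (abs g)
    have "radial_op q u \<bullet> v = (LINT x|hyp_measure. LINT y|hyp_measure. q (hyp_cosh x y) * (f y \<bullet> g x))"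
      using f g by (simp add: radial_op_inner q)
    also have "\<dots> = (LINT y|hyp_measure. LINT x|hyp_measure. q (hyp_cosh x y) * (f y \<bullet> g x))"
      using radial_kernel_pair_integrable[OF q f(2) g(2)] by (rule hyp2.Fubini_integral[symmetric])
    also have "\<dots> = radial_op q v \<bullet> u"
      unfolding f(1) g(1) radial_op_inner[OF q g(2) f(2)]
      by (simp add: hyp_cosh_commute inner_commute[of "f _"])
    finally show ?thesis by (simp add: inner_commute)
  qed
qed

lemma radial_op_bounded_ops: assumes q: "integrable radial_measure q" shows "radial_op q \<in> bounded_ops"
  unfolding bounded_ops_def
proof (intro CollectI allI)
  fix c u
  show "radial_op q (scaleC_L2 c u) = scaleC_L2 c (radial_op q u)"
    by (cases u) (simp add: abs_scaleC radial_op_abs[OF q] square_integrable_scale radial_apply_scale[OF q] radial_apply_square_integrable[OF q])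
qed

section \<open>Finite propagation\<close>

lemma ball_proj_abs:
  assumes "square_integrable f"
  shows "ball_proj a r (abs_hyp_L2 f) = abs_hyp_L2 (\<lambda>x. of_real (indicator (hyp_ball a r) x) * f x)"
  using ball_cutoff.abs_eq[OF L2_rel_refl[OF assms]] by (simp add: ball_proj.rep_eq)

text \<open>
  If the balls around \<open>a\<close> and \<open>b\<close> are more than \<open>m\<close> apart, then \<open>d(x, y) > m\<close> for all \<open>x\<close> and \<open>y\<close> in them,
  and the kernel vanishes there.
\<close>

lemma radial_op_std_alg_range:
  assumes q: "integrable radial_measure q" and supp: "\<And>c. cosh (real m) < c \<Longrightarrow> q c = 0"
  shows "radial_op q \<in> std_alg_range m"
  unfolding std_alg_range_def
proof (intro CollectI conjI ballI allI impI radial_op_bounded_ops[OF q])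
  fix a b r s assume ab: "a \<in> hyp3" "b \<in> hyp3" and ne: "ball_proj a r o\<^sub>L radial_op q o\<^sub>L ball_proj b s \<noteq> 0"
  show "hyp_dist a b \<le> r + s + real m"
  proof (rule ccontr)
    assume far: "\<not> hyp_dist a b \<le> r + s + real m"
    have "(ball_proj a r o\<^sub>L radial_op q o\<^sub>L ball_proj b s) u = 0" for u
    proof (cases u)
      case (abs f)
      let ?f = "\<lambda>x. of_real (indicator (hyp_ball b s) x) * f x"
      have f': "square_integrable ?f" by (rule square_integrable_indicator[OF abs(2)])
      have z2: "of_real (indicator (hyp_ball a r) x) * radial_apply q ?f x = 0" for x
      proof (cases "x \<in> hyp_ball a r")
        case True
        then have x: "x \<in> hyp3" "hyp_dist x a < r" by (auto simp: hyp_ball_def)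
        have z: "q (hyp_cosh x y) *\<^sub>R ?f y = 0" for y
        proof (cases "y \<in> hyp_ball b s")
          case True
          then have y: "y \<in> hyp3" "hyp_dist y b < s" by (auto simp: hyp_ball_def)
          have "hyp_dist a b \<le> hyp_dist x a + (hyp_dist x y + hyp_dist y b)"
            using hyp_dist_triangle[of a x b] hyp_dist_triangle[of x y b] x y ab hyp_dist_commute[of a x] by linarith
          then have "real m < arcosh (hyp_cosh x y)" using far x y by (simp add: hyp_dist_eq_arcosh)
          then have "cosh (real m) < cosh (arcosh (hyp_cosh x y))"
            by (subst cosh_real_nonneg_less_iff) auto
          then have "cosh (real m) < hyp_cosh x y" using x y hyp_cosh_ge_1 by (simp add: cosh_arcosh_real)
          then show ?thesis by (simp add: supp)
        qed simp
        have "radial_apply q ?f x = 0" unfolding radial_apply_def z by simp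
        then show ?thesis by simp
      qed simp
      have "(ball_proj a r o\<^sub>L radial_op q o\<^sub>L ball_proj b s) u
          = abs_hyp_L2 (\<lambda>x. of_real (indicator (hyp_ball a r) x) * radial_apply q ?f x)"
        using f' by (simp add: abs(1) ball_proj_abs abs(2) radial_op_abs[OF q] radial_apply_square_integrable[OF q])
      then show ?thesis unfolding z2 abs_zero .
    qed
    then have "ball_proj a r o\<^sub>L radial_op q o\<^sub>L ball_proj b s = 0" by (intro blinfun_eqI) simp
    then show False using ne by simp
  qed
qed

text \<open>
  The truncations of \<open>q\<close> to \<open>c \<le> cosh m\<close> converge to \<open>q\<close> in the norm of \<open>L\<^sup>1\<close>, hence the operators
  converge in norm by Schur's test.
\<close>

theorem radial_op_std_alg:
  assumes q: "integrable radial_measure q"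
  shows "radial_op q \<in> std_alg"
  unfolding std_alg_def closure_sequential
proof (intro exI conjI allI)
  define p where "p m c = indicator {..cosh (real m)} c * q c" for m c
  have [measurable]: "q \<in> borel_measurable borel" by (rule radial_borel[OF q])
  have pm: "p m \<in> borel_measurable borel" for m unfolding p_def by measurable
  have p: "integrable radial_measure (p m)" for m
  proof (rule Bochner_Integration.integrable_bound[OF q])
    show "p m \<in> borel_measurable radial_measure"
      using pm by (simp add: measurable_cong_sets[OF sets_radial_measure refl])
    show "AE c in radial_measure. norm (p m c) \<le> norm (q c)" by (intro AE_I2) (simp add: p_def indicator_def)
  qed
  show "radial_op (p m) \<in> (\<Union>m. std_alg_range m)" for m
    using radial_op_std_alg_range[OF p, of m m] by (auto simp: p_def)
  have "(\<lambda>m. radial_mass (\<lambda>c. p m c - q c)) \<longlonglongrightarrow> (LINT c|radial_measure. 0)"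
  proof (rule integral_dominated_convergence)
    show "integrable radial_measure (\<lambda>c. \<bar>q c\<bar>)" using q by simp
    show "AE c in radial_measure. norm \<bar>p m c - q c\<bar> \<le> \<bar>q c\<bar>" for m
      by (intro AE_I2) (auto simp: p_def indicator_def)
    show "AE c in radial_measure. (\<lambda>m. \<bar>p m c - q c\<bar>) \<longlonglongrightarrow> 0"
    proof (intro AE_I2)
      fix c
      obtain N where N: "c \<le> real N" using real_arch_simple by blast
      have "\<bar>p m c - q c\<bar> = 0" if "N \<le> m" for m
      proof -
        have "c \<le> real m" using N that by linarith
        also have "\<dots> \<le> cosh (real m)"
          using exp_ge_add_one_self[of "real m"] sinh_le_cosh_real[of "real m"] real_le_x_sinh[of "real m"]
          by (simp add: sinh_def exp_minus)
        finally show ?thesis by (simp add: p_def)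
      qed
      then show "(\<lambda>m. \<bar>p m c - q c\<bar>) \<longlonglongrightarrow> 0"
        by (intro tendsto_eventually) (auto simp: eventually_sequentially)
    qed
    show "(\<lambda>c. \<bar>p m c - q c\<bar>) \<in> borel_measurable radial_measure" for m
      by (intro borel_measurable_abs borel_measurable_diff borel_measurable_integrable p q)
  qed simp
  then have lim: "(\<lambda>m. radial_mass (\<lambda>c. p m c - q c)) \<longlonglongrightarrow> 0" by simp
  have "norm (radial_op (p m) - radial_op q) \<le> radial_mass (\<lambda>c. p m c - q c)" for m
    unfolding radial_op_diff[OF p q] using p q by (intro norm_radial_op) simp
  then have "eventually (\<lambda>m. norm (radial_op (p m) - radial_op q) \<le> radial_mass (\<lambda>c. p m c - q c)) sequentially"
    by (intro always_eventually allI)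
  from Lim_null_comparison[OF this lim] have "(\<lambda>m. radial_op (p m) - radial_op q) \<longlonglongrightarrow> 0" .
  then show "(\<lambda>m. radial_op (p m)) \<longlonglongrightarrow> radial_op q" by (simp add: LIM_zero_iff)
qed

section \<open>Elementary smooth functions\<close>

text \<open>
  For \<open>p = 1\<close> the standard smooth function vanishing on the left half line.  The polynomial factor
  makes the family closed under differentiation.
\<close>

definition bump :: "real poly \<Rightarrow> real \<Rightarrow> real" where
  "bump p x = (if 0 < x then poly p (1 / x) * exp (- (1 / x)) else 0)"

lemma poly_exp_decay: "((\<lambda>y. poly p y * exp (- y)) \<longlongrightarrow> 0) (at_top :: real filter)"
proof -
  have "((\<lambda>y. \<Sum>i\<le>degree p. coeff p i * (y ^ i / exp y)) \<longlongrightarrow> (\<Sum>i\<le>degree p. coeff p i * 0)) (at_top :: real filter)"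
    by (intro tendsto_sum tendsto_mult_left tendsto_power_div_exp_0)
  then show ?thesis by (simp add: poly_altdef sum_distrib_right exp_minus divide_inverse mult.assoc)
qed

text \<open>
  With \<open>y = 1 / x\<close> the derivative of \<open>p(y) exp (- y)\<close> in \<open>x\<close> is \<open>y\<^sup>2 (p(y) - p'(y)) exp (- y)\<close>.
\<close>

lemma bump_DERIV: "DERIV (bump p) x :> bump ([:0, 0, 1:] * (p - pderiv p)) x"
proof -
  consider "0 < x" | "x < 0" | "x = 0" by linarith
  then show ?thesis
  proof cases
    case 1
    have "DERIV (\<lambda>x. poly p (1 / x) * exp (- (1 / x))) x :> bump ([:0, 0, 1:] * (p - pderiv p)) x"
      using 1 by (auto intro!: derivative_eq_intros DERIV_chain2[OF poly_DERIV]
          simp: bump_def power2_eq_square algebra_simps divide_inverse)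
    then show ?thesis
      by (rule has_field_derivative_transform_within_open[of _ _ _ "{0<..}"]) (use 1 in \<open>auto simp: bump_def\<close>)
  next
    case 2
    have "DERIV (\<lambda>x. 0) x :> bump ([:0, 0, 1:] * (p - pderiv p)) x"
      using 2 by (simp add: bump_def)
    then show ?thesis
      by (rule has_field_derivative_transform_within_open[of _ _ _ "{..<0}"]) (use 2 in \<open>auto simp: bump_def\<close>)
  next
    case 3
    have "((\<lambda>h. bump p h / h) \<longlongrightarrow> 0) (at_right 0)"
    proof (rule Lim_transform_eventually)
      show "((\<lambda>h::real. poly (pCons 0 p) (inverse h) * exp (- inverse h)) \<longlongrightarrow> 0) (at_right 0)"
        by (rule filterlim_compose[OF poly_exp_decay filterlim_inverse_at_top_right])
      show "eventually (\<lambda>h. poly (pCons 0 p) (inverse h) * exp (- inverse h) = bump p h / h) (at_right 0)"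
        unfolding eventually_at_right_field by (auto simp: bump_def divide_inverse intro!: exI[of _ 1])
    qed
    moreover have "((\<lambda>h. bump p h / h) \<longlongrightarrow> 0) (at_left 0)"
      by (rule tendsto_eventually) (auto simp: eventually_at_left_field bump_def intro!: exI[of _ "-1"])
    ultimately have "((\<lambda>h. bump p h / h) \<longlongrightarrow> 0) (at 0)" by (simp add: filterlim_split_at)
    then show ?thesis using 3 by (simp add: DERIV_def bump_def)
  qed
qed

lemma bump_continuous: "continuous_on S (bump p)"
  by (intro continuous_at_imp_continuous_on ballI DERIV_isCont[OF bump_DERIV])

lemma bump_bounded_below: "\<exists>B. \<forall>x\<le>b. \<bar>bump p x\<bar> \<le> B"
proof -
  have "bounded (bump p ` {0..b})"
    by (intro compact_imp_bounded compact_continuous_image bump_continuous) simp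
  then obtain B where B: "\<And>x. 0 \<le> x \<Longrightarrow> x \<le> b \<Longrightarrow> \<bar>bump p x\<bar> \<le> B"
    unfolding bounded_iff real_norm_def by (metis atLeastAtMost_iff imageI)
  have "\<bar>bump p x\<bar> \<le> max B 0" if "x \<le> b" for x
    using B[of x] that by (cases "0 \<le> x") (auto simp: bump_def max_def)
  then show ?thesis by blast
qed

text \<open>
  A syntactic supply of smooth real functions: the class is closed under partial derivatives
  (\<open>elem_gradient\<close>), so its members have derivatives of all orders.  The rule \<open>cong\<close> allows for
  expressions that are meaningful on \<open>U\<close> only.
\<close>

inductive_set elem :: "(real ^ 3) set \<Rightarrow> (real ^ 3 \<Rightarrow> real) set" for U where
  const: "(\<lambda>x. c) \<in> elem U"
| coord: "(\<lambda>x. x $ i) \<in> elem U"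
| add: "f \<in> elem U \<Longrightarrow> g \<in> elem U \<Longrightarrow> (\<lambda>x. f x + g x) \<in> elem U"
| mult: "f \<in> elem U \<Longrightarrow> g \<in> elem U \<Longrightarrow> (\<lambda>x. f x * g x) \<in> elem U"
| powr: "f \<in> elem U \<Longrightarrow> (\<And>x. x \<in> U \<Longrightarrow> 0 < f x) \<Longrightarrow> (\<lambda>x. f x powr a) \<in> elem U"
| bump: "f \<in> elem U \<Longrightarrow> (\<lambda>x. bump p (f x)) \<in> elem U"
| cong: "f \<in> elem U \<Longrightarrow> (\<And>x. x \<in> U \<Longrightarrow> g x = f x) \<Longrightarrow> g \<in> elem U"

lemma elem_diff: "f \<in> elem U \<Longrightarrow> g \<in> elem U \<Longrightarrow> (\<lambda>x. f x - g x) \<in> elem U"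
  using elem.add[OF _ elem.mult[OF elem.const[of "-1"]], of f U g] by simp

lemma elem_power: "f \<in> elem U \<Longrightarrow> (\<lambda>x. f x ^ n) \<in> elem U"
  by (induction n) (auto intro: elem.const elem.mult)

lemma elem_inverse: "f \<in> elem U \<Longrightarrow> (\<And>x. x \<in> U \<Longrightarrow> 0 < f x) \<Longrightarrow> (\<lambda>x. inverse (f x)) \<in> elem U"
  by (rule elem.cong[OF elem.powr[where a = "-1"]]) (auto simp: powr_minus less_imp_le)

lemma elem_divide: "f \<in> elem U \<Longrightarrow> g \<in> elem U \<Longrightarrow> (\<And>x. x \<in> U \<Longrightarrow> 0 < g x) \<Longrightarrow> (\<lambda>x. f x / g x) \<in> elem U"
  unfolding divide_inverse by (intro elem.mult elem_inverse)

lemma elem_gradient: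
  assumes "open U" "f \<in> elem U"
  shows "\<exists>d. (\<forall>i. d i \<in> elem U) \<and> (\<forall>x\<in>U. (f has_derivative (\<lambda>h. \<Sum>i\<in>UNIV. d i x * h $ i)) (at x))"
  using assms(2)
proof induction
  case (const c)
  show ?case by (intro exI[of _ "\<lambda>i x. 0"]) (auto intro: elem.const)
next
  case (coord i)
  have "((\<lambda>x. x $ i) has_derivative (\<lambda>h. \<Sum>j\<in>UNIV. (if j = i then 1 else 0) * h $ j)) (at x)" for x :: "real ^ 3"
  proof -
    have "(\<Sum>j\<in>UNIV. (if j = i then 1 else 0) * h $ j) = h $ i" for h :: "real ^ 3"
      by (simp add: if_distrib[of "\<lambda>a. a * _"] cong: if_cong)
    then show ?thesis by (simp add: bounded_linear_imp_has_derivative bounded_linear_vec_nth)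
  qed
  then show ?case by (intro exI[of _ "\<lambda>j x. if j = i then 1 else 0"]) (auto intro: elem.const)
next
  case (add f g)
  then obtain d e where d: "\<And>i. d i \<in> elem U" "\<And>x. x \<in> U \<Longrightarrow> (f has_derivative (\<lambda>h. \<Sum>i\<in>UNIV. d i x * h $ i)) (at x)"
    and e: "\<And>i. e i \<in> elem U" "\<And>x. x \<in> U \<Longrightarrow> (g has_derivative (\<lambda>h. \<Sum>i\<in>UNIV. e i x * h $ i)) (at x)"
    by blast
  have "((\<lambda>x. f x + g x) has_derivative (\<lambda>h. \<Sum>i\<in>UNIV. (d i x + e i x) * h $ i)) (at x)" if "x \<in> U" for x
    by (rule has_derivative_eq_rhs[OF has_derivative_add[OF d(2)[OF that] e(2)[OF that]]])
       (simp add: fun_eq_iff sum.distrib distrib_right)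
  then show ?case by (intro exI[of _ "\<lambda>i x. d i x + e i x"]) (auto intro: elem.add d e)
next
  case (mult f g)
  then obtain d e where d: "\<And>i. d i \<in> elem U" "\<And>x. x \<in> U \<Longrightarrow> (f has_derivative (\<lambda>h. \<Sum>i\<in>UNIV. d i x * h $ i)) (at x)"
    and e: "\<And>i. e i \<in> elem U" "\<And>x. x \<in> U \<Longrightarrow> (g has_derivative (\<lambda>h. \<Sum>i\<in>UNIV. e i x * h $ i)) (at x)"
    by blast
  have "((\<lambda>x. f x * g x) has_derivative (\<lambda>h. \<Sum>i\<in>UNIV. (f x * e i x + d i x * g x) * h $ i)) (at x)" if "x \<in> U" for x
    by (rule has_derivative_eq_rhs[OF has_derivative_mult[OF d(2)[OF that] e(2)[OF that]]])
       (simp add: fun_eq_iff sum.distrib[symmetric] distrib_left sum_distrib_left sum_distrib_right mult_ac)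
  moreover have "(\<lambda>x. f x * e i x + d i x * g x) \<in> elem U" for i
    by (intro elem.add elem.mult d e mult.hyps)
  ultimately show ?case by (intro exI[of _ "\<lambda>i x. f x * e i x + d i x * g x"]) blast
next
  case (powr f a)
  then obtain d where d: "\<And>i. d i \<in> elem U" "\<And>x. x \<in> U \<Longrightarrow> (f has_derivative (\<lambda>h. \<Sum>i\<in>UNIV. d i x * h $ i)) (at x)"
    by blast
  have "((\<lambda>x. f x powr a) has_derivative (\<lambda>h. \<Sum>i\<in>UNIV. (a * f x powr (a - 1) * d i x) * h $ i)) (at x)" if "x \<in> U" for x
    by (rule has_derivative_eq_rhs[OF DERIV_compose_FDERIV[OF has_real_derivative_powr d(2)[OF that]]])
       (use powr.hyps that in \<open>auto simp: fun_eq_iff sum_distrib_left sum_distrib_right mult_ac\<close>)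
  then show ?case using powr.hyps
    by (intro exI[of _ "\<lambda>i x. a * f x powr (a - 1) * d i x"]) (auto intro!: elem.mult elem.const elem.powr d)
next
  case (bump f p)
  then obtain d where d: "\<And>i. d i \<in> elem U" "\<And>x. x \<in> U \<Longrightarrow> (f has_derivative (\<lambda>h. \<Sum>i\<in>UNIV. d i x * h $ i)) (at x)"
    by blast
  have "((\<lambda>x. bump p (f x)) has_derivative (\<lambda>h. \<Sum>i\<in>UNIV. (bump ([:0, 0, 1:] * (p - pderiv p)) (f x) * d i x) * h $ i)) (at x)" if "x \<in> U" for x
    by (rule has_derivative_eq_rhs[OF DERIV_compose_FDERIV[OF bump_DERIV d(2)[OF that]]])
       (auto simp: fun_eq_iff sum_distrib_left sum_distrib_right mult_ac)
  then show ?case using bump.hyps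
    by (intro exI[of _ "\<lambda>i x. bump ([:0, 0, 1:] * (p - pderiv p)) (f x) * d i x"]) (auto intro!: elem.mult elem.bump d)
next
  case (cong f g)
  then obtain d where d: "\<And>i. d i \<in> elem U" "\<And>x. x \<in> U \<Longrightarrow> (f has_derivative (\<lambda>h. \<Sum>i\<in>UNIV. d i x * h $ i)) (at x)"
    by blast
  have "(g has_derivative (\<lambda>h. \<Sum>i\<in>UNIV. d i x * h $ i)) (at x)" if "x \<in> U" for x
    by (rule has_derivative_transform_within_open[OF d(2)[OF that] \<open>open U\<close> that]) (simp add: cong.hyps)
  then show ?case using d(1) by blast
qed

lemma pderiv_at_eqI:
  assumes "(f has_derivative D) (at x)" shows "pderiv_at i f x = D (axis i 1)"
  unfolding pderiv_at_def using frechet_derivative_at[OF assms] by simp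

lemma pderiv_at_cong:
  assumes "open U" "x \<in> U" "\<And>y. y \<in> U \<Longrightarrow> f y = g y"
  shows "pderiv_at i f x = pderiv_at i g x"
proof -
  have "(f has_derivative D) (at x) \<longleftrightarrow> (g has_derivative D) (at x)" for D
    using assms by (auto intro: has_derivative_transform_within_open[of _ _ x UNIV U])
  then show ?thesis by (simp add: pderiv_at_def frechet_derivative_def)
qed

lemma differentiable_cong_open:
  assumes "open U" "x \<in> U" "\<And>y. y \<in> U \<Longrightarrow> f y = g y" "f differentiable (at x)"
  shows "g differentiable (at x)"
  using assms unfolding differentiable_def by (auto intro: has_derivative_transform_within_open[of _ _ x UNIV U])

lemma has_derivative_of_real_gradient:
  assumes "(f has_derivative (\<lambda>h. \<Sum>i\<in>UNIV. d i * h $ i)) (at x)"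
  shows "((\<lambda>x. complex_of_real (f x)) has_derivative (\<lambda>h. complex_of_real (\<Sum>i\<in>UNIV. d i * h $ i))) (at x)"
  by (rule bounded_linear.has_derivative[OF bounded_linear_of_real assms])

lemma pderiv_at_of_real_gradient:
  assumes "(f has_derivative (\<lambda>h. \<Sum>i\<in>UNIV. d i * h $ i)) (at x)"
  shows "pderiv_at j (\<lambda>x. complex_of_real (f x)) x = complex_of_real (d j)"
proof -
  have "(\<Sum>i\<in>UNIV. d i * axis j 1 $ i) = d j"
    by (simp add: axis_def if_distrib cong: if_cong)
  then show ?thesis using pderiv_at_eqI[OF has_derivative_of_real_gradient[OF assms], of j] by simp
qed

lemma elem_iterated_derivative:
  assumes U: "open U" and f: "f \<in> elem U"
  shows "\<exists>g\<in>elem U. \<forall>x\<in>U. foldr pderiv_at js (\<lambda>x. complex_of_real (f x)) x = complex_of_real (g x)"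
proof (induction js)
  case Nil
  show ?case using f by auto
next
  case (Cons j js)
  then obtain g where g: "g \<in> elem U" "\<And>x. x \<in> U \<Longrightarrow> foldr pderiv_at js (\<lambda>x. complex_of_real (f x)) x = complex_of_real (g x)"
    by blast
  obtain d where d: "\<And>i. d i \<in> elem U" "\<And>x. x \<in> U \<Longrightarrow> (g has_derivative (\<lambda>h. \<Sum>i\<in>UNIV. d i x * h $ i)) (at x)"
    using elem_gradient[OF U g(1)] by blast
  have "foldr pderiv_at (j # js) (\<lambda>x. complex_of_real (f x)) x = complex_of_real (d j x)" if x: "x \<in> U" for x
    using pderiv_at_cong[OF U x g(2), where i = j] pderiv_at_of_real_gradient[OF d(2)[OF x], where j = j] by simp
  then show ?case using d(1) by blast
qed

theorem elem_smooth:
  assumes U: "open U" and f: "f \<in> elem U"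
  shows "smooth_on U (\<lambda>x. complex_of_real (f x))"
  unfolding smooth_on_def
proof (intro allI ballI)
  fix js x assume x: "x \<in> U"
  obtain g where g: "g \<in> elem U" "\<And>x. x \<in> U \<Longrightarrow> foldr pderiv_at js (\<lambda>x. complex_of_real (f x)) x = complex_of_real (g x)"
    using elem_iterated_derivative[OF U f] by blast
  obtain d where "\<And>x. x \<in> U \<Longrightarrow> (g has_derivative (\<lambda>h. \<Sum>i\<in>UNIV. d i x * h $ i)) (at x)"
    using elem_gradient[OF U g(1)] by blast
  then have "(\<lambda>x. complex_of_real (g x)) differentiable (at x)"
    using has_derivative_of_real_gradient[of g "\<lambda>i. d i x" x] x unfolding differentiable_def by blast
  then show "foldr pderiv_at js (\<lambda>x. complex_of_real (f x)) differentiable (at x)"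
    by (rule differentiable_cong_open[OF U x, rotated]) (simp add: g(2))
qed

lemma smooth_on_differentiable: "smooth_on U f \<Longrightarrow> x \<in> U \<Longrightarrow> f differentiable (at x)"
  unfolding smooth_on_def by (metis foldr.simps(1) id_apply)

lemma smooth_on_pderiv: "smooth_on U f \<Longrightarrow> smooth_on U (pderiv_at i f)"
  unfolding smooth_on_def
proof (intro allI ballI)
  fix js x assume "\<forall>js. \<forall>x\<in>U. foldr pderiv_at js f differentiable (at x)" "x \<in> U"
  then have "foldr pderiv_at (js @ [i]) f differentiable (at x)" by blast
  then show "foldr pderiv_at js (pderiv_at i f) differentiable (at x)" by simp
qed

lemma smooth_on_continuous: "smooth_on U f \<Longrightarrow> continuous_on U f"
  by (auto intro!: continuous_at_imp_continuous_on differentiable_imp_continuous_within smooth_on_differentiable)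

lemma pderiv_at_mult:
  assumes "f differentiable (at x)" "g differentiable (at x)"
  shows "pderiv_at i (\<lambda>y. f y * g y) x = f x * pderiv_at i g x + pderiv_at i f x * (g x :: complex)"
proof -
  obtain f' g' where d: "(f has_derivative f') (at x)" "(g has_derivative g') (at x)"
    using assms unfolding differentiable_def by blast
  show ?thesis
    unfolding pderiv_at_eqI[OF has_derivative_mult[OF d]] pderiv_at_eqI[OF d(1)] pderiv_at_eqI[OF d(2)] by simp
qed

lemma pderiv_at_diff:
  assumes "f differentiable (at x)" "g differentiable (at x)"
  shows "pderiv_at i (\<lambda>y. f y - g y) x = pderiv_at i f x - pderiv_at i (g :: _ \<Rightarrow> complex) x"
proof -
  obtain f' g' where d: "(f has_derivative f') (at x)" "(g has_derivative g') (at x)"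
    using assms unfolding differentiable_def by blast
  show ?thesis
    unfolding pderiv_at_eqI[OF has_derivative_diff[OF d]] pderiv_at_eqI[OF d(1)] pderiv_at_eqI[OF d(2)] by simp
qed

lemma pderiv_at_zero_open:
  assumes "open U" "x \<in> U" "\<And>y. y \<in> U \<Longrightarrow> f y = 0" shows "pderiv_at i f x = 0"
  using pderiv_at_cong[OF assms(1,2), of f "\<lambda>_. 0" i] assms(3) pderiv_at_eqI[OF has_derivative_const, of i 0 x] by simp

lemma open_hyp3: "open hyp3"
  unfolding hyp3_def by (intro open_Collect_less continuous_intros)

section \<open>Integration by parts\<close>

lemma integrable_lborel_compact_support:
  fixes w :: "'a::euclidean_space \<Rightarrow> 'b::{banach, second_countable_topology}"
  assumes "compact K" "continuous_on K w" "\<And>x. x \<notin> K \<Longrightarrow> w x = 0"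
  shows "integrable lborel w"
proof -
  have "integrable lborel (\<lambda>x. indicator K x *\<^sub>R w x)"
    by (rule borel_integrable_compact[OF assms(1,2)])
  moreover have "(\<lambda>x. indicator K x *\<^sub>R w x) = w"
    using assms(3) by (auto simp: fun_eq_iff indicator_def)
  ultimately show ?thesis by simp
qed

lemma integral_translate:
  fixes w :: "'a::euclidean_space \<Rightarrow> 'b::{banach, second_countable_topology}"
  assumes "integrable lborel w"
  shows "integrable lborel (\<lambda>x. w (a + x))" "(LINT x|lborel. w (a + x)) = (LINT x|lborel. w x)"
proof -
  have [measurable]: "w \<in> borel_measurable borel" using borel_measurable_integrable[OF assms] by simp
  have "integrable (distr lborel borel ((+) a)) w" using assms by (simp add: lborel_distr_plus)
  then show "integrable lborel (\<lambda>x. w (a + x))" by (subst (asm) integrable_distr_eq) auto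
  have "(LINT x|lborel. w x) = (LINT x|distr lborel borel ((+) a). w x)" by (simp add: lborel_distr_plus)
  also have "\<dots> = (LINT x|lborel. w (a + x))" using assms by (subst integral_distr) auto
  finally show "(LINT x|lborel. w (a + x)) = (LINT x|lborel. w x)" by simp
qed

lemma pderiv_at_line:
  assumes "w differentiable (at (x + t *\<^sub>R axis i 1))"
  shows "((\<lambda>t. w (x + t *\<^sub>R axis i 1)) has_vector_derivative pderiv_at i w (x + t *\<^sub>R axis i 1)) (at t)"
proof -
  have "(w has_derivative frechet_derivative w (at (x + t *\<^sub>R axis i 1))) (at (x + t *\<^sub>R axis i 1))"
    using assms frechet_derivative_works by blast
  moreover have "((\<lambda>t. x + t *\<^sub>R axis i (1::real)) has_derivative (\<lambda>s. s *\<^sub>R axis i 1)) (at t)"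
    by (auto intro!: derivative_eq_intros)
  ultimately have "((\<lambda>t. w (x + t *\<^sub>R axis i 1)) has_derivative
      (\<lambda>s. frechet_derivative w (at (x + t *\<^sub>R axis i 1)) (s *\<^sub>R axis i 1))) (at t)"
    using has_derivative_compose by blast
  then show ?thesis
    unfolding has_vector_derivative_def pderiv_at_def
    using linear_frechet_derivative[OF assms] by (simp add: linear_scale)
qed

text \<open>
  The integral of \<open>w (x + t e\<^sub>i)\<close> does not depend on \<open>t\<close>, and its derivative at \<open>t = 0\<close> is the
  integral of the partial derivative.
\<close>

lemma integral_partial_zero:
  assumes K: "compact K" and supp: "\<And>x. x \<notin> K \<Longrightarrow> w x = 0"
    and diff: "\<And>x. w differentiable (at x)" and cont: "continuous_on UNIV (pderiv_at i w)"
  shows "integrable lborel (pderiv_at i w)" "(LINT x|lborel. pderiv_at i w x) = 0"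
proof -
  let ?e = "axis i 1 :: real ^ 3"
  have supp': "pderiv_at i w x = 0" if "x \<notin> K" for x
    by (rule pderiv_at_zero_open[of "- K"]) (use that K supp in \<open>auto simp: compact_imp_closed open_Compl\<close>)
  show int: "integrable lborel (pderiv_at i w)"
    using K supp' by (intro integrable_lborel_compact_support[OF K]) (auto intro: continuous_on_subset[OF cont])
  have wc: "continuous_on UNIV w"
    using diff by (auto intro!: continuous_at_imp_continuous_on differentiable_imp_continuous_within)
  have wint: "integrable lborel w"
    by (rule integrable_lborel_compact_support[OF K]) (auto intro: continuous_on_subset[OF wc] supp)
  have "bounded (pderiv_at i w ` K)"
    by (intro compact_imp_bounded compact_continuous_image continuous_on_subset[OF cont] K) auto
  then obtain B where B: "\<And>x. x \<in> K \<Longrightarrow> norm (pderiv_at i w x) \<le> B" unfolding bounded_iff by auto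
  have Bd: "norm (pderiv_at i w x) \<le> max B 0" for x
    using order_trans[OF B[of x] max.cobounded1[of B 0]] supp'[of x] by (cases "x \<in> K") auto
  have lip: "norm (w (x + t *\<^sub>R ?e) - w x) \<le> max B 0 * \<bar>t\<bar>" for x t
  proof -
    have "norm (w (x + t *\<^sub>R ?e) - w (x + 0 *\<^sub>R ?e)) \<le> max B 0 * norm (t - 0)"
    proof (rule differentiable_bound[of UNIV "\<lambda>t. w (x + t *\<^sub>R ?e)" "\<lambda>t h. h *\<^sub>R pderiv_at i w (x + t *\<^sub>R ?e)"])
      show "((\<lambda>t. w (x + t *\<^sub>R ?e)) has_derivative (\<lambda>h. h *\<^sub>R pderiv_at i w (x + t *\<^sub>R ?e))) (at t within UNIV)" for t
        using pderiv_at_line[OF diff] by (simp add: has_vector_derivative_def)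
      show "onorm (\<lambda>h. h *\<^sub>R pderiv_at i w (x + t *\<^sub>R ?e)) \<le> max B 0" for t
        using Bd by (simp add: onorm_scaleR_left[OF bounded_linear_ident] onorm_id)
    qed auto
    then show ?thesis by simp
  qed
  define K' where "K' = {x - y | x y. x \<in> K \<and> y \<in> cball 0 1}"
  have K': "compact K'" unfolding K'_def by (rule compact_differences[OF K]) simp
  define F where "F n x = real (Suc n) *\<^sub>R (w ((1 / real (Suc n)) *\<^sub>R ?e + x) - w x)" for n x
  have sm: "(1 / real (Suc n)) *\<^sub>R ?e \<in> cball 0 1" for n
    by (simp add: norm_axis_1 divide_le_eq)
  have Fsupp: "F n x = 0" if "x \<notin> K'" for n x
  proof -
    have "x \<notin> K"
    proof
      assume "x \<in> K"
      then have "x - 0 \<in> K'" unfolding K'_def by (intro CollectI exI[of _ x] exI[of _ 0]) auto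
      then show False using that by simp
    qed
    moreover have "(1 / real (Suc n)) *\<^sub>R ?e + x \<notin> K"
    proof
      assume "(1 / real (Suc n)) *\<^sub>R ?e + x \<in> K"
      then have "((1 / real (Suc n)) *\<^sub>R ?e + x) - (1 / real (Suc n)) *\<^sub>R ?e \<in> K'"
        unfolding K'_def using sm[of n] by blast
      then show False using that by simp
    qed
    ultimately show ?thesis by (simp add: F_def supp)
  qed
  have Fint: "integrable lborel (F n)" "(LINT x|lborel. F n x) = 0" for n
    unfolding F_def using integral_translate[OF wint] wint by auto
  have "(\<lambda>n. LINT x|lborel. F n x) \<longlonglongrightarrow> (LINT x|lborel. pderiv_at i w x)"
  proof (rule integral_dominated_convergence)
    show "pderiv_at i w \<in> borel_measurable lborel" using int by simp
    show "F n \<in> borel_measurable lborel" for n using Fint(1) by (rule borel_measurable_integrable)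
    show "integrable lborel (\<lambda>x. indicator K' x *\<^sub>R max B 0)"
      by (rule borel_integrable_compact[OF K']) auto
    show "AE x in lborel. norm (F n x) \<le> indicator K' x *\<^sub>R max B 0" for n
    proof (intro AE_I2)
      fix x
      show "norm (F n x) \<le> indicator K' x *\<^sub>R max B 0"
      proof (cases "x \<in> K'")
        case True
        have "norm (F n x) = real (Suc n) * norm (w (x + (1 / real (Suc n)) *\<^sub>R ?e) - w x)"
          by (simp add: F_def add.commute)
        also have "\<dots> \<le> real (Suc n) * (max B 0 * \<bar>1 / real (Suc n)\<bar>)" by (intro mult_left_mono lip) simp
        also have "\<dots> = max B 0" by simp
        finally show ?thesis using True by simp
      qed (simp add: Fsupp)
    qed
    show "AE x in lborel. (\<lambda>n. F n x) \<longlonglongrightarrow> pderiv_at i w x"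
    proof (intro AE_I2)
      fix x
      have "((\<lambda>t. w (x + t *\<^sub>R ?e)) has_vector_derivative pderiv_at i w x) (at 0)"
        using pderiv_at_line[OF diff, where x = x and t = 0 and i = i] by simp
      then have "((\<lambda>h. norm (w (x + h *\<^sub>R ?e) - w x - h *\<^sub>R pderiv_at i w x) / norm h) \<longlongrightarrow> 0) (at 0)"
        by (simp add: has_vector_derivative_def has_derivative_at)
      moreover have "filterlim (\<lambda>n. 1 / real (Suc n)) (at 0) sequentially"
        by (rule filterlim_atI[OF LIMSEQ_Suc[OF lim_1_over_n]]) simp
      ultimately have "(\<lambda>n. norm (w (x + (1 / real (Suc n)) *\<^sub>R ?e) - w x - (1 / real (Suc n)) *\<^sub>R pderiv_at i w x) / norm (1 / real (Suc n))) \<longlonglongrightarrow> 0"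
        by (rule filterlim_compose)
      moreover have "norm (w (x + (1 / real (Suc n)) *\<^sub>R ?e) - w x - (1 / real (Suc n)) *\<^sub>R pderiv_at i w x) / norm (1 / real (Suc n))
          = norm (F n x - pderiv_at i w x)" for n
      proof -
        have "F n x - pderiv_at i w x = real (Suc n) *\<^sub>R (w (x + (1 / real (Suc n)) *\<^sub>R ?e) - w x - (1 / real (Suc n)) *\<^sub>R pderiv_at i w x)"
          by (simp add: F_def scaleR_diff_right add.commute)
        then show ?thesis by simp
      qed
      ultimately have "(\<lambda>n. norm (F n x - pderiv_at i w x)) \<longlonglongrightarrow> 0" by simp
      then show "(\<lambda>n. F n x) \<longlonglongrightarrow> pderiv_at i w x" by (simp add: tendsto_norm_zero_iff LIM_zero_iff)
    qed
  qed
  then show "(LINT x|lborel. pderiv_at i w x) = 0"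
    by (simp add: Fint(2) LIMSEQ_const_iff)
qed

lemma integral_hyp_measure:
  fixes f :: "real ^ 3 \<Rightarrow> complex"
  assumes [measurable]: "f \<in> borel_measurable hyp_measure"
  shows "(LINT x|hyp_measure. f x) = (LINT x|lborel. indicator hyp3 x *\<^sub>R ((1 / (x $ 3) ^ 3) *\<^sub>R f x))"
proof -
  have [measurable]: "f \<in> borel_measurable (restrict_space lborel hyp3)"
    using assms unfolding hyp_measure_def by simp
  have "(LINT x|hyp_measure. f x) = (LINT x|restrict_space lborel hyp3. (1 / (x $ 3) ^ 3) *\<^sub>R f x)"
    unfolding hyp_measure_def
  proof (rule integral_density)
    show "(\<lambda>x::real^3. 1 / (x $ 3) ^ 3) \<in> borel_measurable (restrict_space lborel hyp3)"
      by (intro measurable_restrict_space1) simp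
    show "AE x in restrict_space lborel hyp3. 0 \<le> 1 / (x $ 3) ^ 3"
      by (intro AE_I2) (simp add: space_restrict_space hyp3_def)
  qed measurable
  also have "\<dots> = (LINT x|lborel. indicator hyp3 x *\<^sub>R ((1 / (x $ 3) ^ 3) *\<^sub>R f x))"
    by (rule integral_restrict_space) simp
  finally show ?thesis .
qed

lemma integrable_hyp_measure_iff:
  fixes f :: "real ^ 3 \<Rightarrow> 'b::{banach, second_countable_topology}"
  assumes [measurable]: "f \<in> borel_measurable hyp_measure"
  shows "integrable hyp_measure f \<longleftrightarrow> integrable lborel (\<lambda>x. indicator hyp3 x *\<^sub>R ((1 / (x $ 3) ^ 3) *\<^sub>R f x))"
proof -
  have [measurable]: "f \<in> borel_measurable (restrict_space lborel hyp3)"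
    using assms unfolding hyp_measure_def by simp
  have "integrable hyp_measure f \<longleftrightarrow> integrable (restrict_space lborel hyp3) (\<lambda>x. (1 / (x $ 3) ^ 3) *\<^sub>R f x)"
    unfolding hyp_measure_def
  proof (rule integrable_density)
    show "(\<lambda>x::real^3. 1 / (x $ 3) ^ 3) \<in> borel_measurable (restrict_space lborel hyp3)"
      by (intro measurable_restrict_space1) simp
    show "AE x in restrict_space lborel hyp3. 0 \<le> 1 / (x $ 3) ^ 3"
      by (intro AE_I2) (simp add: space_restrict_space hyp3_def)
  qed measurable
  also have "\<dots> \<longleftrightarrow> integrable lborel (\<lambda>x. indicator hyp3 x *\<^sub>R ((1 / (x $ 3) ^ 3) *\<^sub>R f x))"
    by (rule integrable_restrict_space) simp
  finally show ?thesis .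
qed

lemma borel_measurable_continuous_hyp3:
  fixes f :: "real ^ 3 \<Rightarrow> 'b::{banach, second_countable_topology}"
  assumes "continuous_on hyp3 f" shows "f \<in> borel_measurable hyp_measure"
  using borel_measurable_continuous_on_restrict[OF assms]
  by (simp add: measurable_cong_sets[OF sets_hyp_measure refl])

lemma integrable_hyp_compact_support:
  fixes f :: "real ^ 3 \<Rightarrow> 'b::{banach, second_countable_topology}"
  assumes "continuous_on hyp3 f" "compact K" "K \<subseteq> hyp3" "\<And>x. x \<notin> K \<Longrightarrow> f x = 0"
  shows "integrable hyp_measure f"
  unfolding integrable_hyp_measure_iff[OF borel_measurable_continuous_hyp3[OF assms(1)]]
proof (rule integrable_lborel_compact_support[OF assms(2)])
  have "continuous_on K (\<lambda>x. (1 / (x $ 3) ^ 3) *\<^sub>R f x)"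
    using assms(3) by (intro continuous_intros continuous_on_subset[OF assms(1)]) (auto simp: hyp3_def)
  then show "continuous_on K (\<lambda>x. indicator hyp3 x *\<^sub>R ((1 / (x $ 3) ^ 3) *\<^sub>R f x))"
    by (rule continuous_on_cong[THEN iffD1, rotated 2]) (use assms(3) in auto)
  show "indicator hyp3 x *\<^sub>R ((1 / (x $ 3) ^ 3) *\<^sub>R f x) = 0" if "x \<notin> K" for x
    using assms(4)[OF that] by simp
qed

lemma height_smooth: "(\<lambda>y. 1 / y $ 3) \<in> elem hyp3"
  by (intro elem_divide elem.const elem.coord) (simp add: hyp3_def)

lemma smooth_on_of_real: "v \<in> elem hyp3 \<Longrightarrow> smooth_on hyp3 (\<lambda>x. complex_of_real (v x))"
  by (rule elem_smooth[OF open_hyp3])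

lemma laplacian_term:
  assumes "smooth_on hyp3 f" "x \<in> hyp3"
  shows "pderiv_at i (\<lambda>y. of_real (1 / y $ 3) * pderiv_at i f y) x
    = of_real (1 / x $ 3) * pderiv_at i (pderiv_at i f) x + pderiv_at i (\<lambda>y. of_real (1 / y $ 3)) x * pderiv_at i f x"
  using assms by (intro pderiv_at_mult smooth_on_differentiable[of hyp3] smooth_on_pderiv smooth_on_of_real height_smooth)

lemma laplacian_term_continuous:
  assumes "smooth_on hyp3 f"
  shows "continuous_on hyp3 (pderiv_at i (\<lambda>y. of_real (1 / y $ 3) * pderiv_at i f y))"
proof -
  have "continuous_on hyp3 (\<lambda>x. of_real (1 / x $ 3) * pderiv_at i (pderiv_at i f) x + pderiv_at i (\<lambda>y. of_real (1 / y $ 3)) x * pderiv_at i f x)"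
    by (intro continuous_intros smooth_on_continuous smooth_on_pderiv assms smooth_on_of_real height_smooth)
       (auto simp: hyp3_def)
  then show ?thesis by (rule continuous_on_cong[THEN iffD2, rotated 2]) (simp_all only: laplacian_term[OF assms])
qed

lemma laplacian_continuous:
  assumes "smooth_on hyp3 f" shows "continuous_on hyp3 (hyp_laplacian f)"
  unfolding hyp_laplacian_def[abs_def]
  by (intro continuous_intros laplacian_term_continuous assms)

lemma laplacian_zero_outside:
  assumes K: "compact K" and supp: "\<And>x. x \<notin> K \<Longrightarrow> f x = 0" and x: "x \<notin> K"
  shows "hyp_laplacian f x = 0"
proof -
  have o: "open (- K)" using K by (simp add: compact_imp_closed open_Compl)
  have "pderiv_at i f y = 0" if "y \<in> - K" for i y
    by (rule pderiv_at_zero_open[OF o that]) (simp add: supp)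
  then have "pderiv_at i (\<lambda>y. of_real (1 / y $ 3) * pderiv_at i f y) x = 0" for i
    by (intro pderiv_at_zero_open[OF o]) (use x in auto)
  then show ?thesis by (simp add: hyp_laplacian_def)
qed

lemma square_integrable_continuous_compact:
  assumes "continuous_on hyp3 f" "compact K" "K \<subseteq> hyp3" "\<And>x. x \<notin> K \<Longrightarrow> f x = 0"
  shows "square_integrable f"
  unfolding square_integrable_def
proof
  show "f \<in> borel_measurable hyp_measure" by (rule borel_measurable_continuous_hyp3[OF assms(1)])
  show "integrable hyp_measure (\<lambda>x. (norm (f x))\<^sup>2)"
    by (rule integrable_hyp_compact_support[OF _ assms(2,3)]) (auto intro!: continuous_intros assms)
qed

lemma test_function_square_integrable: "f \<in> test_functions \<Longrightarrow> square_integrable f"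
  unfolding test_functions_def using square_integrable_continuous_compact smooth_on_continuous by blast

lemma test_function_laplacian_square_integrable: "f \<in> test_functions \<Longrightarrow> square_integrable (hyp_laplacian f)"
  unfolding test_functions_def
  using square_integrable_continuous_compact[OF laplacian_continuous] laplacian_zero_outside by blast

text \<open>
  In the coordinates the measure cancels the factor \<open>x\<^sub>3\<^sup>3\<close> of the Laplacian, and
  \<open>v \<partial>\<^sub>i (\<partial>\<^sub>i f / x\<^sub>3) - f \<partial>\<^sub>i (\<partial>\<^sub>i v / x\<^sub>3)\<close> is the partial derivative of
  \<open>(v \<partial>\<^sub>i f - f \<partial>\<^sub>i v) / x\<^sub>3\<close>, which has compact support.
\<close>

theorem laplacian_symmetric:
  assumes f: "f \<in> test_functions" and v: "v \<in> elem hyp3"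
  shows "(LINT x|hyp_measure. complex_of_real (v x) * hyp_laplacian f x)
      = (LINT x|hyp_measure. hyp_laplacian (\<lambda>x. complex_of_real (v x)) x * f x)"
proof -
  obtain K where sf: "smooth_on hyp3 f" and K: "compact K" "K \<subseteq> hyp3" and supp: "\<And>x. x \<notin> K \<Longrightarrow> f x = 0"
    using f unfolding test_functions_def by blast
  let ?v = "\<lambda>x. complex_of_real (v x)" and ?h = "\<lambda>y::real^3. complex_of_real (1 / y $ 3)"
  have sv: "smooth_on hyp3 ?v" by (rule smooth_on_of_real[OF v])
  have sh: "smooth_on hyp3 ?h" by (rule smooth_on_of_real[OF height_smooth])
  have oK: "open (- K)" using K by (simp add: compact_imp_closed open_Compl)
  define w where "w i x = (if x \<in> hyp3 then ?v x * (?h x * pderiv_at i f x) - f x * (?h x * pderiv_at i ?v x) else 0)" for i x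
  have fd: "pderiv_at i f x = 0" if "x \<notin> K" for i x
    by (rule pderiv_at_zero_open[OF oK]) (use that supp in auto)
  have w0: "w i x = 0" if "x \<notin> K" for i x using that by (simp add: w_def supp fd)
  define D where "D i x = ?v x * pderiv_at i (\<lambda>y. ?h y * pderiv_at i f y) x - f x * pderiv_at i (\<lambda>y. ?h y * pderiv_at i ?v y) x" for i x
  note diffs = smooth_on_differentiable[OF sf] smooth_on_differentiable[OF sv] smooth_on_differentiable[OF sh]
    smooth_on_differentiable[OF smooth_on_pderiv[OF sf]] smooth_on_differentiable[OF smooth_on_pderiv[OF sv]]
  have wdiff0: "(\<lambda>x. ?v x * (?h x * pderiv_at i f x) - f x * (?h x * pderiv_at i ?v x)) differentiable (at x)"
    if "x \<in> hyp3" for i x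
    using that by (intro differentiable_diff differentiable_mult diffs)
  have wdiff: "w i differentiable (at x)" for i x
  proof (cases "x \<in> hyp3")
    case True
    show ?thesis
      by (rule differentiable_cong_open[OF open_hyp3 True _ wdiff0[OF True, of i]]) (simp add: w_def)
  next
    case False
    then have "x \<in> - K" using K by auto
    then show ?thesis
      by (rule differentiable_cong_open[OF oK, of x "\<lambda>_. 0"]) (simp_all add: w0)
  qed
  have wD: "pderiv_at i (w i) x = D i x" if x: "x \<in> hyp3" for i x
  proof -
    have "pderiv_at i (w i) x = pderiv_at i (\<lambda>x. ?v x * (?h x * pderiv_at i f x) - f x * (?h x * pderiv_at i ?v x)) x"
      by (rule pderiv_at_cong[OF open_hyp3 x]) (simp add: w_def)
    also have "\<dots> = pderiv_at i (\<lambda>x. ?v x * (?h x * pderiv_at i f x)) x - pderiv_at i (\<lambda>x. f x * (?h x * pderiv_at i ?v x)) x"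
      using x by (intro pderiv_at_diff differentiable_mult diffs)
    also have "pderiv_at i (\<lambda>x. ?v x * (?h x * pderiv_at i f x)) x
        = ?v x * pderiv_at i (\<lambda>x. ?h x * pderiv_at i f x) x + pderiv_at i ?v x * (?h x * pderiv_at i f x)"
      using x by (intro pderiv_at_mult differentiable_mult diffs)
    also have "pderiv_at i (\<lambda>x. f x * (?h x * pderiv_at i ?v x)) x
        = f x * pderiv_at i (\<lambda>x. ?h x * pderiv_at i ?v x) x + pderiv_at i f x * (?h x * pderiv_at i ?v x)"
      using x by (intro pderiv_at_mult differentiable_mult diffs)
    finally show ?thesis by (simp add: D_def algebra_simps)
  qed
  have Dcont: "continuous_on hyp3 (D i)" for i
    unfolding D_def by (intro continuous_intros laplacian_term_continuous smooth_on_continuous sf sv)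
  have wcont: "continuous_on UNIV (pderiv_at i (w i))" for i
  proof -
    have "continuous_on hyp3 (pderiv_at i (w i))"
      by (rule continuous_on_cong[THEN iffD2, OF refl _ Dcont]) (simp add: wD)
    moreover have "continuous_on (- K) (pderiv_at i (w i))"
    proof (rule continuous_on_cong[THEN iffD2, OF refl _ continuous_on_const[of _ 0]])
      fix x assume "x \<in> - K"
      then show "pderiv_at i (w i) x = 0" by (intro pderiv_at_zero_open[OF oK]) (auto simp: w0)
    qed
    ultimately have "continuous_on (hyp3 \<union> - K) (pderiv_at i (w i))"
      by (rule continuous_on_open_Un[OF open_hyp3 oK])
    moreover have "hyp3 \<union> - K = UNIV" using K by auto
    ultimately show ?thesis by simp
  qed
  have zero: "integrable lborel (pderiv_at i (w i))" "(LINT x|lborel. pderiv_at i (w i) x) = 0" for i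
    using integral_partial_zero[OF K(1) w0 wdiff wcont] by auto
  have c1: "continuous_on hyp3 (\<lambda>x. ?v x * hyp_laplacian f x)" and c2: "continuous_on hyp3 (\<lambda>x. hyp_laplacian ?v x * f x)"
    by (intro continuous_intros laplacian_continuous smooth_on_continuous sf sv)+
  have i1: "integrable hyp_measure (\<lambda>x. ?v x * hyp_laplacian f x)" and i2: "integrable hyp_measure (\<lambda>x. hyp_laplacian ?v x * f x)"
    by (rule integrable_hyp_compact_support[OF _ K]; use c1 c2 laplacian_zero_outside[OF K(1) supp] supp in simp)+
  have "(LINT x|hyp_measure. ?v x * hyp_laplacian f x) - (LINT x|hyp_measure. hyp_laplacian ?v x * f x)
      = (LINT x|hyp_measure. ?v x * hyp_laplacian f x - hyp_laplacian ?v x * f x)"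
    using i1 i2 by simp
  also have "\<dots> = (LINT x|lborel. indicator hyp3 x *\<^sub>R ((1 / (x $ 3) ^ 3) *\<^sub>R (?v x * hyp_laplacian f x - hyp_laplacian ?v x * f x)))"
    by (rule integral_hyp_measure) (intro borel_measurable_diff borel_measurable_integrable i1 i2)
  also have "\<dots> = (LINT x|lborel. (\<Sum>i\<in>UNIV. pderiv_at i (w i) x))"
  proof (rule Bochner_Integration.integral_cong[OF refl])
    fix x
    show "indicator hyp3 x *\<^sub>R ((1 / (x $ 3) ^ 3) *\<^sub>R (?v x * hyp_laplacian f x - hyp_laplacian ?v x * f x))
        = (\<Sum>i\<in>UNIV. pderiv_at i (w i) x)"
    proof (cases "x \<in> hyp3")
      case True
      have "?v x * hyp_laplacian f x - hyp_laplacian ?v x * f x = complex_of_real ((x $ 3) ^ 3) * (\<Sum>i\<in>UNIV. D i x)"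
        by (simp add: hyp_laplacian_def D_def sum_subtractf sum_distrib_left sum_distrib_right right_diff_distrib mult_ac)
      then show ?thesis using True wD[OF True] by (simp add: hyp3_def scaleR_conv_of_real)
    next
      case False
      then have "x \<in> - K" using K by auto
      then have "pderiv_at i (w i) x = 0" for i by (intro pderiv_at_zero_open[OF oK]) (auto simp: w0)
      then show ?thesis using False by simp
    qed
  qed
  also have "\<dots> = 0" using zero by (simp add: Bochner_Integration.integral_sum)
  finally show ?thesis by simp
qed

section \<open>Radial test functions\<close>

lemma hyp3_iff: "x \<in> hyp3 \<longleftrightarrow> 0 < x $ 3" by (simp add: hyp3_def)

lemma hyp_cosh_elem: "a \<in> hyp3 \<Longrightarrow> hyp_cosh a \<in> elem hyp3"
  unfolding hyp_cosh_coordinates[abs_def]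
  by (intro elem.add elem.const elem_divide elem_power elem_diff elem.mult elem.coord) (simp add: hyp3_iff)

lemma elem_has_gradient:
  assumes U: "open U" and f: "f \<in> elem U" and x: "x \<in> U"
    and D: "\<And>i. DERIV (\<lambda>t. f (x + t *\<^sub>R axis i 1)) 0 :> D i"
  shows "(f has_derivative (\<lambda>h. \<Sum>i\<in>UNIV. D i * h $ i)) (at x)"
proof -
  obtain d where d: "(f has_derivative (\<lambda>h. \<Sum>i\<in>UNIV. d i x * h $ i)) (at x)"
    using elem_gradient[OF U f] x by blast
  have "d i x = D i" for i
  proof -
    have "((\<lambda>t. x + t *\<^sub>R axis i (1::real)) has_derivative (\<lambda>s. s *\<^sub>R axis i 1)) (at 0)"
      by (auto intro!: derivative_eq_intros)
    from has_derivative_compose[OF this, of f "\<lambda>h. \<Sum>i\<in>UNIV. d i x * h $ i"] d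
    have "((\<lambda>t. f (x + t *\<^sub>R axis i 1)) has_derivative (\<lambda>s. \<Sum>j\<in>UNIV. d j x * (s *\<^sub>R axis i 1) $ j)) (at 0)"
      by simp
    moreover have "(\<Sum>j\<in>UNIV. d j x * (s *\<^sub>R axis i 1) $ j) = d i x * s" for s :: real
      by (simp add: axis_def if_distrib cong: if_cong)
    ultimately have "DERIV (\<lambda>t. f (x + t *\<^sub>R axis i 1)) 0 :> d i x"
      by (simp add: has_field_derivative_def)
    then show ?thesis using D DERIV_unique by blast
  qed
  then show ?thesis using d by simp
qed

lemma pderiv_at_elem:
  assumes f: "f \<in> elem hyp3" and x: "x \<in> hyp3" and D: "DERIV (\<lambda>t. f (x + t *\<^sub>R axis i 1)) 0 :> D"
  shows "pderiv_at i (\<lambda>x. complex_of_real (f x)) x = complex_of_real D"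
proof -
  have "((\<lambda>t. complex_of_real (f (x + t *\<^sub>R axis i 1))) has_vector_derivative pderiv_at i (\<lambda>x. complex_of_real (f x)) x) (at 0)"
    using pderiv_at_line[OF smooth_on_differentiable[OF smooth_on_of_real[OF f]], where x = x and t = 0 and i = i] x by simp
  moreover have "((\<lambda>t. complex_of_real (f (x + t *\<^sub>R axis i 1))) has_vector_derivative complex_of_real D) (at 0)"
    using D by (intro has_vector_derivative_of_real) (simp add: has_real_derivative_iff_has_vector_derivative)
  ultimately show ?thesis by (rule vector_derivative_unique_at)
qed

definition cosh_grad :: "real ^ 3 \<Rightarrow> 3 \<Rightarrow> real ^ 3 \<Rightarrow> real" where
  "cosh_grad a i x = (if i = 3 then ((x $ 3)\<^sup>2 - ((x $ 1 - a $ 1)\<^sup>2 + (x $ 2 - a $ 2)\<^sup>2 + (a $ 3)\<^sup>2)) / (2 * (x $ 3)\<^sup>2 * a $ 3)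
    else (x $ i - a $ i) / (x $ 3 * a $ 3))"

lemma cosh_grad_elem: "a \<in> hyp3 \<Longrightarrow> cosh_grad a i \<in> elem hyp3"
  unfolding cosh_grad_def[abs_def]
  by (cases "i = 3")
     (simp_all, (intro elem_diff elem_divide elem.add elem_power elem.mult elem.coord elem.const; simp add: hyp3_iff)+)

lemma hyp_cosh_gradient:
  assumes a: "a \<in> hyp3" and x: "x \<in> hyp3"
  shows "(hyp_cosh a has_derivative (\<lambda>h. \<Sum>i\<in>UNIV. cosh_grad a i x * h $ i)) (at x)"
proof (rule elem_has_gradient[OF open_hyp3 hyp_cosh_elem[OF a] x])
  fix i :: 3
  have pos: "x $ 3 \<noteq> 0" "a $ 3 \<noteq> 0" using a x by (auto simp: hyp3_iff)
  show "DERIV (\<lambda>t. hyp_cosh a (x + t *\<^sub>R axis i 1)) 0 :> cosh_grad a i x"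
    using exhaust_3[of i]
  proof (elim disjE)
    assume i: "i = 3"
    have "DERIV (\<lambda>t. 1 + ((a $ 1 - x $ 1)\<^sup>2 + (a $ 2 - x $ 2)\<^sup>2 + (a $ 3 - (x $ 3 + t))\<^sup>2) / (2 * a $ 3 * (x $ 3 + t))) 0 :> cosh_grad a 3 x"
      using pos by (auto intro!: derivative_eq_intros simp: cosh_grad_def field_simps power2_eq_square)
    then show ?thesis by (simp add: i hyp_cosh_coordinates axis_def)
  next
    assume i: "i = 1"
    have "DERIV (\<lambda>t. 1 + ((a $ 1 - (x $ 1 + t))\<^sup>2 + (a $ 2 - x $ 2)\<^sup>2 + (a $ 3 - x $ 3)\<^sup>2) / (2 * a $ 3 * x $ 3)) 0 :> cosh_grad a 1 x"
      using pos by (auto intro!: derivative_eq_intros simp: cosh_grad_def field_simps power2_eq_square)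
    then show ?thesis by (simp add: i hyp_cosh_coordinates axis_def)
  next
    assume i: "i = 2"
    have "DERIV (\<lambda>t. 1 + ((a $ 1 - x $ 1)\<^sup>2 + (a $ 2 - (x $ 2 + t))\<^sup>2 + (a $ 3 - x $ 3)\<^sup>2) / (2 * a $ 3 * x $ 3)) 0 :> cosh_grad a 2 x"
      using pos by (auto intro!: derivative_eq_intros simp: cosh_grad_def field_simps power2_eq_square)
    then show ?thesis by (simp add: i hyp_cosh_coordinates axis_def)
  qed
qed

lemma cosh_grad_weighted_derivative:
  assumes a: "a \<in> hyp3" and x: "x \<in> hyp3"
  shows "DERIV (\<lambda>t. 1 / (x + t *\<^sub>R axis i 1) $ 3 * cosh_grad a i (x + t *\<^sub>R axis i 1)) 0 :>
    (if i = 3 then 3 * ((x $ 1 - a $ 1)\<^sup>2 + (x $ 2 - a $ 2)\<^sup>2 + (a $ 3)\<^sup>2) / (2 * (x $ 3) ^ 4 * a $ 3)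
        - 1 / (2 * (x $ 3)\<^sup>2 * a $ 3)
      else 1 / ((x $ 3)\<^sup>2 * a $ 3))"
proof -
  have pos: "x $ 3 \<noteq> 0" "a $ 3 \<noteq> 0" using a x by (auto simp: hyp3_iff)
  show ?thesis
    using exhaust_3[of i]
  proof (elim disjE)
    assume i: "i = 3"
    have "DERIV (\<lambda>t. 1 / (p + t) * (((p + t)\<^sup>2 - A) / (2 * (p + t)\<^sup>2 * q))) 0 :> 3 * A / (2 * p ^ 4 * q) - 1 / (2 * p\<^sup>2 * q)"
      if "p \<noteq> 0" "q \<noteq> 0" for p q A :: real
    proof -
      have "DERIV (\<lambda>s. 1 / (2 * q) * inverse s - A / (2 * q) * inverse (s ^ 3)) p :> 3 * A / (2 * p ^ 4 * q) - 1 / (2 * p\<^sup>2 * q)"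
        using that by (auto intro!: derivative_eq_intros simp: field_simps power2_eq_square power3_eq_cube power4_eq_xxxx)
      moreover have "1 / (2 * q) * inverse s - A / (2 * q) * inverse (s ^ 3) = 1 / s * ((s\<^sup>2 - A) / (2 * s\<^sup>2 * q))" if "s \<noteq> 0" for s
        using that \<open>q \<noteq> 0\<close> by (simp add: field_simps power2_eq_square power3_eq_cube)
      ultimately have "DERIV (\<lambda>s. 1 / s * ((s\<^sup>2 - A) / (2 * s\<^sup>2 * q))) p :> 3 * A / (2 * p ^ 4 * q) - 1 / (2 * p\<^sup>2 * q)"
        using that by (auto intro: has_field_derivative_transform_within_open[of _ _ _ "- {0}"])
      then show ?thesis using DERIV_shift[of "\<lambda>s. 1 / s * ((s\<^sup>2 - A) / (2 * s\<^sup>2 * q))" _ 0 p] by (simp add: add.commute)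
    qed
    from this[OF pos, of "(x $ 1 - a $ 1)\<^sup>2 + (x $ 2 - a $ 2)\<^sup>2 + (a $ 3)\<^sup>2"] show ?thesis by (simp add: i cosh_grad_def axis_def)
  next
    assume i: "i = 1"
    have "DERIV (\<lambda>t. 1 / x $ 3 * ((x $ 1 + t - a $ 1) / (x $ 3 * a $ 3))) 0 :> 1 / ((x $ 3)\<^sup>2 * a $ 3)"
      using pos by (auto intro!: derivative_eq_intros simp: field_simps power2_eq_square)
    then show ?thesis by (simp add: i cosh_grad_def axis_def)
  next
    assume i: "i = 2"
    have "DERIV (\<lambda>t. 1 / x $ 3 * ((x $ 2 + t - a $ 2) / (x $ 3 * a $ 3))) 0 :> 1 / ((x $ 3)\<^sup>2 * a $ 3)"
      using pos by (auto intro!: derivative_eq_intros simp: field_simps power2_eq_square)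
    then show ?thesis by (simp add: i cosh_grad_def axis_def)
  qed
qed

lemma radial_gradient:
  assumes a: "a \<in> hyp3" and x: "x \<in> hyp3" and \<phi>: "DERIV \<phi> (hyp_cosh a x) :> \<phi>'"
  shows "((\<lambda>x. \<phi> (hyp_cosh a x)) has_derivative (\<lambda>h. \<Sum>i\<in>UNIV. (\<phi>' * cosh_grad a i x) * h $ i)) (at x)"
  by (rule has_derivative_eq_rhs[OF DERIV_compose_FDERIV[OF \<phi> hyp_cosh_gradient[OF a x]]])
     (simp add: fun_eq_iff sum_distrib_left sum_distrib_right mult_ac)

text \<open>
  The chain rule, with \<open>\<bar>grad c\<bar>\<^sup>2 = c\<^sup>2 - 1\<close> and \<open>\<Delta> c = 3 c\<close> in the hyperbolic metric.
\<close>

theorem hyp_laplacian_radial: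
  assumes a: "a \<in> hyp3" and x: "x \<in> hyp3"
    and \<phi>: "\<And>c. 1 \<le> c \<Longrightarrow> DERIV \<phi> c :> \<phi>1 c" and \<phi>1: "\<And>c. 1 \<le> c \<Longrightarrow> DERIV \<phi>1 c :> \<phi>2 c"
  shows "hyp_laplacian (\<lambda>x. complex_of_real (\<phi> (hyp_cosh a x))) x
    = complex_of_real (((hyp_cosh a x)\<^sup>2 - 1) * \<phi>2 (hyp_cosh a x) + 3 * hyp_cosh a x * \<phi>1 (hyp_cosh a x))"
proof -
  have pos: "0 < x $ 3" "0 < a $ 3" using a x by (auto simp: hyp3_iff)
  define c where "c = hyp_cosh a x"
  have c1: "1 \<le> c" unfolding c_def by (rule hyp_cosh_ge_1[OF a x])
  define e where "e i = (if i = 3 then 3 * ((x $ 1 - a $ 1)\<^sup>2 + (x $ 2 - a $ 2)\<^sup>2 + (a $ 3)\<^sup>2) / (2 * (x $ 3) ^ 4 * a $ 3)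
        - 1 / (2 * (x $ 3)\<^sup>2 * a $ 3)
      else 1 / ((x $ 3)\<^sup>2 * a $ 3))" for i :: 3
  have summand: "pderiv_at i (\<lambda>y. of_real (1 / y $ 3) * pderiv_at i (\<lambda>x. complex_of_real (\<phi> (hyp_cosh a x))) y) x
     = complex_of_real (\<phi>2 c * (cosh_grad a i x)\<^sup>2 / x $ 3 + e i * \<phi>1 c)" for i
  proof -
    let ?g = "\<lambda>y. 1 / y $ 3 * cosh_grad a i y"
    have ge: "?g \<in> elem hyp3" by (intro elem.mult height_smooth cosh_grad_elem a)
    have d1: "((\<lambda>x. complex_of_real (\<phi>1 (hyp_cosh a x))) has_derivative
        (\<lambda>h. complex_of_real (\<Sum>i\<in>UNIV. (\<phi>2 c * cosh_grad a i x) * h $ i))) (at x)"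
      unfolding c_def by (intro has_derivative_of_real_gradient radial_gradient a x \<phi>1 hyp_cosh_ge_1)
    have "pderiv_at i (\<lambda>y. of_real (1 / y $ 3) * pderiv_at i (\<lambda>x. complex_of_real (\<phi> (hyp_cosh a x))) y) x
        = pderiv_at i (\<lambda>y. complex_of_real (?g y) * complex_of_real (\<phi>1 (hyp_cosh a y))) x"
    proof (rule pderiv_at_cong[OF open_hyp3 x])
      fix y assume y: "y \<in> hyp3"
      have "pderiv_at i (\<lambda>x. complex_of_real (\<phi> (hyp_cosh a x))) y = complex_of_real (\<phi>1 (hyp_cosh a y) * cosh_grad a i y)"
        by (rule pderiv_at_of_real_gradient[OF radial_gradient[OF a y \<phi>[OF hyp_cosh_ge_1[OF a y]]]])
      then show "of_real (1 / y $ 3) * pderiv_at i (\<lambda>x. complex_of_real (\<phi> (hyp_cosh a x))) y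
          = complex_of_real (?g y) * complex_of_real (\<phi>1 (hyp_cosh a y))" by simp
    qed
    also have "\<dots> = complex_of_real (?g x) * pderiv_at i (\<lambda>x. complex_of_real (\<phi>1 (hyp_cosh a x))) x
        + pderiv_at i (\<lambda>y. complex_of_real (?g y)) x * complex_of_real (\<phi>1 (hyp_cosh a x))"
      using d1 smooth_on_differentiable[OF smooth_on_of_real[OF ge] x]
      by (intro pderiv_at_mult) (auto simp: differentiable_def)
    also have "pderiv_at i (\<lambda>x. complex_of_real (\<phi>1 (hyp_cosh a x))) x = complex_of_real (\<phi>2 c * cosh_grad a i x)"
      unfolding c_def by (rule pderiv_at_of_real_gradient[OF radial_gradient[OF a x \<phi>1[OF hyp_cosh_ge_1[OF a x]]]])
    also have "pderiv_at i (\<lambda>y. complex_of_real (?g y)) x = complex_of_real (e i)"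
      using pderiv_at_elem[OF ge x cosh_grad_weighted_derivative[OF a x]] by (simp add: e_def)
    finally show ?thesis by (simp add: c_def power2_eq_square)
  qed
  define p q u v where "p = x $ 3" "q = a $ 3" "u = x $ 1 - a $ 1" "v = x $ 2 - a $ 2"
  note defs = this
  have pq: "p \<noteq> 0" "q \<noteq> 0" using pos by (auto simp: defs)
  have c_eq: "c = (p\<^sup>2 + u\<^sup>2 + v\<^sup>2 + q\<^sup>2) / (2 * p * q)"
  proof -
    have "c = 1 + (u\<^sup>2 + v\<^sup>2 + (q - p)\<^sup>2) / (2 * q * p)"
      by (simp add: c_def hyp_cosh_coordinates defs power2_commute)
    then show ?thesis using pq by (simp add: field_simps power2_eq_square)
  qed
  have s1: "(x $ 3)\<^sup>2 * (\<Sum>i\<in>UNIV. (cosh_grad a i x)\<^sup>2) = c\<^sup>2 - 1"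
  proof -
    have "(\<Sum>i\<in>UNIV. (cosh_grad a i x)\<^sup>2) = (u / (p * q))\<^sup>2 + (v / (p * q))\<^sup>2 + ((p\<^sup>2 - (u\<^sup>2 + v\<^sup>2 + q\<^sup>2)) / (2 * p\<^sup>2 * q))\<^sup>2"
      by (simp add: sum_3 cosh_grad_def defs)
    moreover have "p\<^sup>2 * ((u / (p * q))\<^sup>2 + (v / (p * q))\<^sup>2 + ((p\<^sup>2 - (u\<^sup>2 + v\<^sup>2 + q\<^sup>2)) / (2 * p\<^sup>2 * q))\<^sup>2) = c\<^sup>2 - 1"
      unfolding c_eq using pq by (simp add: divide_simps) (simp add: power2_eq_square power4_eq_xxxx algebra_simps)
    ultimately show ?thesis by (simp add: defs(1))
  qed
  have s2: "(x $ 3) ^ 3 * (\<Sum>i\<in>UNIV. e i) = 3 * c"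
  proof -
    have "(\<Sum>i\<in>UNIV. e i) = 2 / (p\<^sup>2 * q) + (3 * (u\<^sup>2 + v\<^sup>2 + q\<^sup>2) / (2 * p ^ 4 * q) - 1 / (2 * p\<^sup>2 * q))"
      by (simp add: sum_3 e_def defs)
    moreover have "p ^ 3 * (2 / (p\<^sup>2 * q) + (3 * (u\<^sup>2 + v\<^sup>2 + q\<^sup>2) / (2 * p ^ 4 * q) - 1 / (2 * p\<^sup>2 * q))) = 3 * c"
      unfolding c_eq using pq by (simp add: divide_simps) (simp add: eval_nat_numeral algebra_simps)
    ultimately show ?thesis by (simp add: defs(1))
  qed
  have "hyp_laplacian (\<lambda>x. complex_of_real (\<phi> (hyp_cosh a x))) x
      = complex_of_real ((x $ 3) ^ 3 * (\<Sum>i\<in>UNIV. \<phi>2 c * (cosh_grad a i x)\<^sup>2 / x $ 3 + e i * \<phi>1 c))"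
    unfolding hyp_laplacian_def summand by simp
  also have "(x $ 3) ^ 3 * (\<Sum>i\<in>UNIV. \<phi>2 c * (cosh_grad a i x)\<^sup>2 / x $ 3 + e i * \<phi>1 c)
      = \<phi>2 c * ((x $ 3)\<^sup>2 * (\<Sum>i\<in>UNIV. (cosh_grad a i x)\<^sup>2)) + \<phi>1 c * ((x $ 3) ^ 3 * (\<Sum>i\<in>UNIV. e i))"
    using pos by (simp add: sum.distrib sum_distrib_left sum_distrib_right distrib_left power2_eq_square power3_eq_cube mult_ac sum_divide_distrib)
  finally show ?thesis unfolding s1 s2 by (simp add: c_def algebra_simps)
qed

lemma compact_hyp_cball:
  assumes a: "a \<in> hyp3" shows "compact {x \<in> hyp3. hyp_cosh a x \<le> N}"
proof -
  have a3: "0 < a $ 3" using a by (simp add: hyp3_iff)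
  have eq: "{x \<in> hyp3. hyp_cosh a x \<le> N} = {x. (norm (a - x))\<^sup>2 \<le> 2 * a $ 3 * x $ 3 * (N - 1)} \<inter> {x. 0 \<le> x $ 3}"
  proof (intro set_eqI iffI)
    fix x assume "x \<in> {x \<in> hyp3. hyp_cosh a x \<le> N}"
    then show "x \<in> {x. (norm (a - x))\<^sup>2 \<le> 2 * a $ 3 * x $ 3 * (N - 1)} \<inter> {x. 0 \<le> x $ 3}"
      using a3 by (auto simp: hyp3_iff hyp_cosh_def field_simps)
  next
    fix x assume x: "x \<in> {x. (norm (a - x))\<^sup>2 \<le> 2 * a $ 3 * x $ 3 * (N - 1)} \<inter> {x. 0 \<le> x $ 3}"
    have "x $ 3 \<noteq> 0"
    proof
      assume 0: "x $ 3 = 0"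
      then have "(norm (a - x))\<^sup>2 \<le> 0" using x by simp
      then have "a = x" by simp
      then show False using 0 a3 by simp
    qed
    then have "0 < x $ 3" using x by simp
    then show "x \<in> {x \<in> hyp3. hyp_cosh a x \<le> N}"
      using a3 x by (auto simp: hyp3_iff hyp_cosh_def field_simps)
  qed
  have "closed {x \<in> hyp3. hyp_cosh a x \<le> N}"
    unfolding eq by (intro closed_Int closed_Collect_le continuous_intros)
  moreover have "bounded {x \<in> hyp3. hyp_cosh a x \<le> N}"
  proof -
    define M where "M = 2 * a $ 3 * \<bar>N - 1\<bar>"
    have M: "0 \<le> M" using a3 by (simp add: M_def)
    have "norm (a - x) \<le> M + a $ 3" if x: "x \<in> {x \<in> hyp3. hyp_cosh a x \<le> N}" for x
    proof (rule ccontr)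
      assume n: "\<not> norm (a - x) \<le> M + a $ 3"
      have "x $ 3 \<le> a $ 3 + norm (a - x)"
        using component_le_norm_cart[of "a - x" 3] by simp
      moreover have "0 \<le> x $ 3" "(norm (a - x))\<^sup>2 \<le> 2 * a $ 3 * x $ 3 * (N - 1)" using x unfolding eq by auto
      moreover have "2 * a $ 3 * x $ 3 * (N - 1) \<le> 2 * a $ 3 * x $ 3 * \<bar>N - 1\<bar>"
        using a3 calculation(2) by (intro mult_left_mono) auto
      ultimately have "(norm (a - x))\<^sup>2 \<le> M * (a $ 3 + norm (a - x))"
        using M mult_left_mono[of "x $ 3" "a $ 3 + norm (a - x)" M] by (simp add: M_def mult_ac)
      also have "\<dots> = M * a $ 3 + M * norm (a - x)" by (simp add: distrib_left)
      also have "\<dots> \<le> norm (a - x) * a $ 3 + M * norm (a - x)"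
        using n a3 M by (intro add_right_mono mult_right_mono) auto
      also have "\<dots> = (M + a $ 3) * norm (a - x)" by (simp add: algebra_simps)
      also have "\<dots> < norm (a - x) * norm (a - x)"
        using n a3 M by (intro mult_strict_right_mono) auto
      finally show False by (simp add: power2_eq_square)
    qed
    then have "{x \<in> hyp3. hyp_cosh a x \<le> N} \<subseteq> cball a (M + a $ 3)" by (auto simp: dist_norm)
    then show ?thesis using bounded_cball bounded_subset by blast
  qed
  ultimately show ?thesis by (simp add: compact_eq_bounded_closed)
qed

lemma elem_test_function:
  assumes f: "f \<in> elem hyp3" and K: "compact K" "K \<subseteq> hyp3" "\<And>x. x \<notin> K \<Longrightarrow> f x = 0"
  shows "(\<lambda>x. complex_of_real (f x)) \<in> test_functions"
  unfolding test_functions_def using smooth_on_of_real[OF f] K by auto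

section \<open>Linear combinations of test functions\<close>

lemma foldr_pderiv_lincomb:
  assumes f: "smooth_on U f" and g: "smooth_on U g" and U: "open U"
  shows "x \<in> U \<Longrightarrow> foldr pderiv_at js (\<lambda>x. a * f x + b * g x) x = a * foldr pderiv_at js f x + b * foldr pderiv_at js g x"
proof (induction js arbitrary: x)
  case (Cons j js)
  have d: "foldr pderiv_at js f differentiable (at x)" "foldr pderiv_at js g differentiable (at x)"
    using f g Cons.prems by (auto simp: smooth_on_def)
  then obtain f' g' where d': "(foldr pderiv_at js f has_derivative f') (at x)" "(foldr pderiv_at js g has_derivative g') (at x)"
    unfolding differentiable_def by blast
  have "foldr pderiv_at (j # js) (\<lambda>x. a * f x + b * g x) x
      = pderiv_at j (\<lambda>x. a * foldr pderiv_at js f x + b * foldr pderiv_at js g x) x"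
    using pderiv_at_cong[OF U Cons.prems, where i = j, OF Cons.IH] by simp
  also have "\<dots> = a * f' (axis j 1) + b * g' (axis j 1)"
    by (rule pderiv_at_eqI) (intro has_derivative_add has_derivative_mult_right d')
  finally show ?case using pderiv_at_eqI[OF d'(1), of j] pderiv_at_eqI[OF d'(2), of j] by simp
qed simp

lemma smooth_on_lincomb:
  assumes f: "smooth_on U f" and g: "smooth_on U g" and U: "open U"
  shows "smooth_on U (\<lambda>x. a * f x + b * g x)"
  unfolding smooth_on_def
proof (intro allI ballI)
  fix js x assume x: "x \<in> U"
  have "(\<lambda>x. a * foldr pderiv_at js f x + b * foldr pderiv_at js g x) differentiable (at x)"
    using f g x by (intro differentiable_add differentiable_mult differentiable_const) (auto simp: smooth_on_def)
  then show "foldr pderiv_at js (\<lambda>x. a * f x + b * g x) differentiable (at x)"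
    by (rule differentiable_cong_open[OF U x, rotated]) (simp add: foldr_pderiv_lincomb[OF f g U])
qed

lemma test_functions_lincomb:
  assumes "f \<in> test_functions" "g \<in> test_functions"
  shows "(\<lambda>x. a * f x + b * g x) \<in> test_functions"
proof -
  obtain K L where "smooth_on hyp3 f" "compact K" "K \<subseteq> hyp3" "\<And>x. x \<notin> K \<Longrightarrow> f x = 0"
    and "smooth_on hyp3 g" "compact L" "L \<subseteq> hyp3" "\<And>x. x \<notin> L \<Longrightarrow> g x = 0"
    using assms unfolding test_functions_def by blast
  then show ?thesis unfolding test_functions_def
    by (intro CollectI conjI smooth_on_lincomb open_hyp3 exI[of _ "K \<union> L"]) auto
qed

lemma hyp_laplacian_lincomb:
  assumes f: "smooth_on hyp3 f" and g: "smooth_on hyp3 g" and x: "x \<in> hyp3"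
  shows "hyp_laplacian (\<lambda>x. a * f x + b * g x) x = a * hyp_laplacian f x + b * hyp_laplacian g x"
proof -
  let ?h = "\<lambda>y::real^3. complex_of_real (1 / y $ 3)"
  have l: "smooth_on hyp3 (\<lambda>x. a * f x + b * g x)" by (intro smooth_on_lincomb f g open_hyp3)
  have 1: "pderiv_at i (\<lambda>x. a * f x + b * g x) x = a * pderiv_at i f x + b * pderiv_at i g x" for i
    using foldr_pderiv_lincomb[OF f g open_hyp3 x, of "[i]"] by simp
  have 2: "pderiv_at i (pderiv_at i (\<lambda>x. a * f x + b * g x)) x = a * pderiv_at i (pderiv_at i f) x + b * pderiv_at i (pderiv_at i g) x" for i
    using foldr_pderiv_lincomb[OF f g open_hyp3 x, of "[i, i]"] by simp
  have "pderiv_at i (\<lambda>y. ?h y * pderiv_at i (\<lambda>x. a * f x + b * g x) y) x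
      = a * pderiv_at i (\<lambda>y. ?h y * pderiv_at i f y) x + b * pderiv_at i (\<lambda>y. ?h y * pderiv_at i g y) x" for i
    unfolding laplacian_term[OF l x] laplacian_term[OF f x] laplacian_term[OF g x] 1 2 by (simp only: algebra_simps)
  then show ?thesis
    unfolding hyp_laplacian_def by (simp only: sum.distrib distrib_left flip: sum_distrib_left) (simp only: mult.left_commute)
qed

section \<open>Test functions separate points of the Hilbert space\<close>

text \<open>
  The positive and the negative part of \<open>h\<close> are densities of two measures that agree on boxes, hence
  on all Borel sets.
\<close>

lemma AE_zero_if_box_integrals_zero:
  fixes h :: "'a::euclidean_space \<Rightarrow> real"
  assumes h: "integrable lborel h" and zero: "\<And>l u. (LINT x|lborel. indicator (box l u) x * h x) = 0"
  shows "AE x in lborel. h x = 0"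
proof -
  have [measurable]: "h \<in> borel_measurable borel" using borel_measurable_integrable[OF h] by simp
  let ?p = "\<lambda>x. max 0 (h x)" and ?n = "\<lambda>x. max 0 (- h x)"
  have ip: "integrable lborel ?p" and ineg: "integrable lborel ?n"
    using h by (auto intro: integrable_max)
  have pn: "?p x - ?n x = h x" for x by (simp add: max_def)
  have fin: "(\<integral>\<^sup>+x. ennreal (g x) * indicator A x \<partial>lborel) = ennreal (LINT x|lborel. indicator A x * g x)"
    if "integrable lborel g" "\<And>x. 0 \<le> g x" "A \<in> sets borel" for g A
  proof -
    have "integrable lborel (\<lambda>x. indicator A x * g x)"
      using integrable_mult_indicator[of A lborel g] that by simp
    then have "(\<integral>\<^sup>+x. ennreal (indicator A x * g x) \<partial>lborel) = ennreal (LINT x|lborel. indicator A x * g x)"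
      by (rule nn_integral_eq_integral) (simp add: that)
    moreover have "ennreal (indicator A x * g x) = ennreal (g x) * indicator A x" for x by (simp split: split_indicator)
    ultimately show ?thesis by simp
  qed
  have "density lborel (\<lambda>x. ennreal (?p x)) = density lborel (\<lambda>x. ennreal (?n x))"
  proof (rule measure_eqI_generator_eq[where E = "range (\<lambda>(a, b). box a b)" and \<Omega> = UNIV and A = "\<lambda>n::nat. box (- (real n *\<^sub>R One)) (real n *\<^sub>R One)"])
    show "Int_stable (range (\<lambda>(a::'a, b). box a b))" by (auto simp: Int_stable_def box_Int_box)
    show "range (\<lambda>(a::'a, b). box a b) \<subseteq> Pow UNIV" by simp
    show "sets (density lborel (\<lambda>x. ennreal (?p x))) = sigma_sets UNIV (range (\<lambda>(a, b). box a b))"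
      "sets (density lborel (\<lambda>x. ennreal (?n x))) = sigma_sets UNIV (range (\<lambda>(a, b). box a b))"
      by (simp_all add: borel_eq_box)
    show "range (\<lambda>n::nat. box (- (real n *\<^sub>R One)) (real n *\<^sub>R One)) \<subseteq> range (\<lambda>(a::'a, b). box a b)" by auto
    show "(\<Union>n::nat. box (- (real n *\<^sub>R One)) (real n *\<^sub>R One)) = (UNIV :: 'a set)"
      by (rule UN_box_eq_UNIV)
    fix n :: nat
    show "emeasure (density lborel (\<lambda>x. ennreal (?p x))) (box (- (real n *\<^sub>R One)) (real n *\<^sub>R One)) \<noteq> \<infinity>"
      by (subst emeasure_density) (auto simp: fin[OF ip])
  next
    fix X :: "'a set" assume "X \<in> range (\<lambda>(a, b). box a b)"
    then obtain l u where X: "X = box l u" by auto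
    have "(LINT x|lborel. indicator X x * ?p x) - (LINT x|lborel. indicator X x * ?n x)
        = (LINT x|lborel. indicator X x * ?p x - indicator X x * ?n x)"
      using integrable_mult_indicator[of X lborel ?p] integrable_mult_indicator[of X lborel ?n] ip ineg X by simp
    also have "\<dots> = 0" using zero[of l u] unfolding X right_diff_distrib[symmetric] pn .
    finally have "(LINT x|lborel. indicator X x * ?p x) = (LINT x|lborel. indicator X x * ?n x)" by simp
    then show "emeasure (density lborel (\<lambda>x. ennreal (?p x))) X = emeasure (density lborel (\<lambda>x. ennreal (?n x))) X"
      using X by (simp add: emeasure_density fin[OF ip] fin[OF ineg])
  qed
  then have "AE x in lborel. ennreal (?p x) = ennreal (?n x)"
    by (intro finite_density_unique[THEN iffD1]) (use fin[OF ip, of UNIV] in auto)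
  then show ?thesis by eventually_elim (auto simp: max_def split: if_splits)
qed

text \<open>
  As \<open>n\<close> grows these test functions increase to the indicator of the box with corners \<open>p\<close> and \<open>q\<close>.
\<close>

definition box_bump :: "nat \<Rightarrow> real ^ 3 \<Rightarrow> real ^ 3 \<Rightarrow> real ^ 3 \<Rightarrow> real" where
  "box_bump n p q x = (\<Prod>i\<in>UNIV. bump 1 (real n * (x $ i - p $ i)) * bump 1 (real n * (q $ i - x $ i)))"

lemma bump_1_bounds: "0 \<le> bump 1 x" "bump 1 x \<le> 1"
  by (auto simp: bump_def)

lemma box_bump_bounds: "0 \<le> box_bump n p q x" "box_bump n p q x \<le> 1"
  unfolding box_bump_def by (auto intro!: prod_nonneg prod_le_1 mult_le_one simp: bump_1_bounds)

lemma box_bump_zero: "x \<notin> box p q \<Longrightarrow> box_bump n p q x = 0"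
proof -
  assume "x \<notin> box p q"
  then obtain i where "\<not> (p $ i < x $ i \<and> x $ i < q $ i)" by (auto simp: mem_box_cart)
  then have "bump 1 (real n * (x $ i - p $ i)) * bump 1 (real n * (q $ i - x $ i)) = 0"
    by (auto simp: bump_def zero_less_mult_iff)
  then show ?thesis unfolding box_bump_def by (intro prod_zero) auto
qed

lemma bump_1_limit: "0 < x \<Longrightarrow> (\<lambda>n. bump 1 (real n * x)) \<longlonglongrightarrow> 1"
proof -
  assume x: "0 < x"
  have "(\<lambda>n. exp (- (1 / x * (1 / real n)))) \<longlonglongrightarrow> exp (- (1 / x * 0))"
    by (intro tendsto_intros lim_1_over_n)
  moreover have "eventually (\<lambda>n. exp (- (1 / x * (1 / real n))) = bump 1 (real n * x)) sequentially"
    using x by (auto simp: bump_def eventually_sequentially intro!: exI[of _ 1])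
  ultimately show ?thesis by (simp add: Lim_transform_eventually)
qed

lemma box_bump_limit: "(\<lambda>n. box_bump n p q x) \<longlonglongrightarrow> indicator (box p q) x"
proof (cases "x \<in> box p q")
  case True
  then have "(\<lambda>n. box_bump n p q x) \<longlonglongrightarrow> (\<Prod>i\<in>(UNIV::3 set). 1 * 1)"
    unfolding box_bump_def by (intro tendsto_prod tendsto_mult bump_1_limit) (auto simp: mem_box_cart)
  then show ?thesis using True by simp
qed (simp add: box_bump_zero)

lemma box_bump_elem: "box_bump n p q \<in> elem U"
  unfolding box_bump_def[abs_def]
proof -
  have "(\<lambda>x. \<Prod>i\<in>I. bump 1 (real n * (x $ i - p $ i)) * bump 1 (real n * (q $ i - x $ i))) \<in> elem U"
    if "finite I" for I :: "3 set"
    using that by (induction I rule: finite_induct) (auto intro!: elem.const elem.mult elem.bump elem_diff elem.coord)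
  then show "(\<lambda>x. \<Prod>i\<in>UNIV. bump 1 (real n * (x $ i - p $ i)) * bump 1 (real n * (q $ i - x $ i))) \<in> elem U" by simp
qed

lemma cbox_subset_hyp3: "0 < p $ 3 \<Longrightarrow> cbox p q \<subseteq> hyp3"
  by (auto simp: mem_box_cart hyp3_iff) (metis less_le_trans)

lemma box_bump_test_function:
  assumes "0 < p $ 3" shows "(\<lambda>x. complex_of_real (box_bump n p q x)) \<in> test_functions"
  by (rule elem_test_function[OF box_bump_elem compact_cbox cbox_subset_hyp3[OF assms]])
     (use box_subset_cbox box_bump_zero in blast)

lemma square_integrable_integrable_on_box:
  assumes f: "square_integrable f" and p: "0 < p $ 3"
  shows "integrable hyp_measure (\<lambda>x. indicator (box p q) x * norm (f x))"
proof (rule Bochner_Integration.integrable_bound)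
  have [measurable]: "f \<in> borel_measurable hyp_measure" using f by (rule square_integrable_measurable)
  have bm: "indicator A \<in> borel_measurable hyp_measure" if "A \<in> sets borel" for A :: "(real ^ 3) set"
    using that by (intro measurable_hyp_measure_borel) simp
  have "integrable lborel (\<lambda>x. indicator (cbox p q) x *\<^sub>R (1 / (x $ 3) ^ 3))"
    using cbox_subset_hyp3[OF p, of q]
    by (intro borel_integrable_compact compact_cbox continuous_intros) (auto simp: hyp3_iff)
  then have "integrable lborel (\<lambda>x. indicator hyp3 x *\<^sub>R ((1 / (x $ 3) ^ 3) *\<^sub>R indicat_real (cbox p q) x))"
    by (rule Bochner_Integration.integrable_cong[THEN iffD1, rotated 2])
       (use cbox_subset_hyp3[OF p, of q] in \<open>auto simp: indicator_def\<close>)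
  then have "integrable hyp_measure (indicat_real (cbox p q))"
    by (subst integrable_hyp_measure_iff) (auto intro: bm)
  then show "integrable hyp_measure (\<lambda>x. indicat_real (cbox p q) x + (norm (f x))\<^sup>2)"
    using f by (simp add: square_integrable_def)
  note [measurable] = bm[of "box p q"]
  show "(\<lambda>x. indicator (box p q) x * norm (f x)) \<in> borel_measurable hyp_measure" by measurable
  show "AE x in hyp_measure. norm (indicator (box p q) x * norm (f x)) \<le> norm (indicat_real (cbox p q) x + (norm (f x))\<^sup>2)"
  proof (intro AE_I2)
    fix x
    have "t \<le> 1 + t\<^sup>2" if "0 \<le> t" for t :: real
    proof -
      have "2 * t \<le> 1 + t\<^sup>2" using sum_squares_bound[of 1 t] by simp
      then show ?thesis using that by linarith
    qed
    then have "norm (f x) \<le> 1 + (norm (f x))\<^sup>2" by simp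
    then show "norm (indicator (box p q) x * norm (f x)) \<le> norm (indicat_real (cbox p q) x + (norm (f x))\<^sup>2)"
      using box_subset_cbox by (auto simp: indicator_def)
  qed
qed

lemma inner_test_zero:
  assumes g: "square_integrable g" and f: "f \<in> elem hyp3" and t: "(\<lambda>x. complex_of_real (f x)) \<in> test_functions"
    and i1: "abs_hyp_L2 g \<bullet> abs_hyp_L2 (\<lambda>x. 1 * complex_of_real (f x) + 0 * complex_of_real (f x)) = 0"
    and i2: "abs_hyp_L2 g \<bullet> abs_hyp_L2 (\<lambda>x. \<i> * complex_of_real (f x) + 0 * complex_of_real (f x)) = 0"
  shows "(LINT x|hyp_measure. f x * Re (g x)) = 0" "(LINT x|hyp_measure. f x * Im (g x)) = 0"
proof -
  have "square_integrable (\<lambda>x. a * complex_of_real (f x) + 0 * complex_of_real (f x))" for a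
    by (intro test_function_square_integrable test_functions_lincomb t)
  then have "(LINT x|hyp_measure. g x \<bullet> (a * complex_of_real (f x) + 0 * complex_of_real (f x))) = abs_hyp_L2 g \<bullet> abs_hyp_L2 (\<lambda>x. a * complex_of_real (f x) + 0 * complex_of_real (f x))" for a
    using abs_inner[OF g] by simp
  from this[of 1] this[of \<i>] i1 i2
  show "(LINT x|hyp_measure. f x * Re (g x)) = 0" "(LINT x|hyp_measure. f x * Im (g x)) = 0"
    by (simp_all add: inner_complex_def mult.commute)
qed

text \<open>
  Test functions approximate indicators of boxes, so the real and imaginary parts of \<open>u\<close>, multiplied
  by the density of the measure, have vanishing integral over every box inside the half space.
\<close>

theorem test_functions_separate:
  assumes u: "\<And>f. f \<in> test_functions \<Longrightarrow> u \<bullet> abs_hyp_L2 f = 0"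
  shows "u = 0"
proof (cases u)
  case (abs g)
  have gm [measurable]: "g \<in> borel_measurable hyp_measure" using abs(2) by (rule square_integrable_measurable)
  have box0: "(LINT x|hyp_measure. indicator (box p q) x * r (g x)) = 0"
    if p: "0 < p $ 3" and r: "r = Re \<or> r = Im" for p q r
  proof -
    have [measurable]: "r \<in> borel_measurable borel" using r by auto
    have rb: "\<bar>r z\<bar> \<le> norm z" for z using r abs_Re_le_cmod abs_Im_le_cmod by auto
    have [measurable]: "box_bump n p q \<in> borel_measurable hyp_measure" for n
    proof -
      have "continuous_on hyp3 (box_bump n p q)"
        using elem_gradient[OF open_hyp3 box_bump_elem] by (meson continuous_at_imp_continuous_on has_derivative_continuous)
      then show ?thesis by (rule borel_measurable_continuous_hyp3)
    qed
    have [measurable]: "indicat_real (box p q) \<in> borel_measurable hyp_measure" by (rule measurable_hyp_measure_borel) simp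
    have "(\<lambda>n. LINT x|hyp_measure. box_bump n p q x * r (g x)) \<longlonglongrightarrow> (LINT x|hyp_measure. indicator (box p q) x * r (g x))"
    proof (rule integral_dominated_convergence)
      show "integrable hyp_measure (\<lambda>x. indicator (box p q) x * norm (g x))"
        by (rule square_integrable_integrable_on_box[OF abs(2) p])
      show "AE x in hyp_measure. (\<lambda>n. box_bump n p q x * r (g x)) \<longlonglongrightarrow> indicator (box p q) x * r (g x)"
        by (intro AE_I2 tendsto_intros box_bump_limit)
      show "AE x in hyp_measure. norm (box_bump n p q x * r (g x)) \<le> indicator (box p q) x * norm (g x)" for n
      proof (intro AE_I2)
        fix x
        show "norm (box_bump n p q x * r (g x)) \<le> indicator (box p q) x * norm (g x)"
        proof (cases "x \<in> box p q")
          case True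
          then show ?thesis using mult_mono[OF box_bump_bounds(2)[of n p q x] rb[of "g x"]] box_bump_bounds[of n p q x]
            by (simp add: abs_mult)
        qed (simp add: box_bump_zero)
      qed
    qed measurable
    moreover have "(LINT x|hyp_measure. box_bump n p q x * r (g x)) = 0" for n
    proof -
      have "(LINT x|hyp_measure. box_bump n p q x * Re (g x)) = 0" "(LINT x|hyp_measure. box_bump n p q x * Im (g x)) = 0"
        using inner_test_zero[OF abs(2) box_bump_elem box_bump_test_function[OF p]]
          u[OF test_functions_lincomb[OF box_bump_test_function[OF p] box_bump_test_function[OF p]]] abs(1) by metis+
      then show ?thesis using r by auto
    qed
    ultimately show ?thesis by (simp add: LIMSEQ_const_iff)
  qed
  have zero: "AE x in hyp_measure. r (g x) = 0" if r: "r = Re \<or> r = Im" for r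
  proof -
    have [measurable]: "r \<in> borel_measurable borel" using r by auto
    have rb: "\<bar>r z\<bar> \<le> norm z" for z using r abs_Re_le_cmod abs_Im_le_cmod by auto
    \<comment> \<open>Boxes that exhaust the half space and keep a positive distance from its boundary.\<close>
    define P :: "nat \<Rightarrow> real ^ 3" where "P N = (\<chi> i. if i = 3 then 1 / real (Suc N) else - real (Suc N))" for N
    define Q :: "nat \<Rightarrow> real ^ 3" where "Q N = (\<chi> i. real (Suc N))" for N
    define B where "B N = box (P N) (Q N)" for N
    have P3: "0 < P N $ 3" for N by (simp add: P_def)
    have cover: "\<exists>N. x \<in> B N" if x: "x \<in> hyp3" for x
    proof -
      have "0 < x $ 3" using x by (simp add: hyp3_iff)
      then obtain M where M: "1 / real (Suc M) < x $ 3" using reals_Archimedean by (metis inverse_eq_divide)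
      obtain L where L: "norm x < real L" using reals_Archimedean2 by blast
      define N where "N = max M L"
      have "1 / real (Suc N) \<le> 1 / real (Suc M)" by (intro divide_left_mono) (auto simp: N_def)
      moreover have "\<bar>x $ i\<bar> < real (Suc N)" for i
        using component_le_norm_cart[of x i] L by (simp add: N_def)
      ultimately have "x \<in> B N" using M
        by (auto simp: B_def P_def Q_def mem_box_cart abs_less_iff) (smt (verit) minus_less_iff)+
      then show ?thesis by blast
    qed
    have "AE x in lborel. x \<in> hyp3 \<longrightarrow> x \<in> B N \<longrightarrow> r (g x) = 0" for N
    proof -
      define h where "h x = indicator hyp3 x *\<^sub>R ((1 / (x $ 3) ^ 3) *\<^sub>R (indicator (B N) x * r (g x)))" for x
      have [measurable]: "indicat_real A \<in> borel_measurable hyp_measure" if "A \<in> sets borel" for A :: "(real ^ 3) set"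
        using that by (intro measurable_hyp_measure_borel) simp
      have ibox: "integrable hyp_measure (\<lambda>x. indicator (B N) x * r (g x))"
      proof (rule Bochner_Integration.integrable_bound[OF square_integrable_integrable_on_box[OF abs(2) P3, of N "Q N"]])
        have "indicat_real (B N) \<in> borel_measurable hyp_measure" unfolding B_def by (rule measurable_hyp_measure_borel) simp
        then show "(\<lambda>x. indicator (B N) x * r (g x)) \<in> borel_measurable hyp_measure" by measurable
        show "AE x in hyp_measure. norm (indicator (B N) x * r (g x)) \<le> norm (indicator (box (P N) (Q N)) x * norm (g x))"
          by (intro AE_I2) (auto simp: B_def indicator_def rb)
      qed
      have hint: "integrable lborel h"
        unfolding h_def using ibox by (subst integrable_hyp_measure_iff[symmetric]) auto
      have hbox: "(LINT x|lborel. indicator (box l v) x * h x) = 0" for l v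
      proof -
        obtain l' v' where lv: "box l v \<inter> B N = box l' v'" "box l' v' \<noteq> {} \<Longrightarrow> 0 < l' $ 3"
        proof -
          define l' v' where "l' = (\<chi> i. max (l $ i) (P N $ i))" and "v' = (\<chi> i. min (v $ i) (Q N $ i))"
          have "box l v \<inter> B N = box l' v'" by (auto simp: B_def mem_box_cart l'_def v'_def)
          moreover have "0 < l' $ 3" using P3[of N] by (simp add: l'_def less_max_iff_disj)
          ultimately show ?thesis using that by blast
        qed
        show ?thesis
        proof (cases "box l' v' = {}")
          case True
          then have z: "indicator (box l v) x * h x = 0" for x using lv(1) by (auto simp: h_def indicator_def)
          show ?thesis unfolding z by simp
        next
          case False
          have m: "indicat_real (box l' v') \<in> borel_measurable hyp_measure" by (rule measurable_hyp_measure_borel) simp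
          have "(LINT x|lborel. indicator (box l v) x * h x)
             = (LINT x|lborel. indicator hyp3 x *\<^sub>R ((1 / (x $ 3) ^ 3) *\<^sub>R (indicator (box l' v') x * r (g x))))"
            using lv(1) by (intro Bochner_Integration.integral_cong) (auto simp: h_def indicator_def)
          also have "complex_of_real \<dots> = (LINT x|lborel. indicator hyp3 x *\<^sub>R ((1 / (x $ 3) ^ 3) *\<^sub>R complex_of_real (indicator (box l' v') x * r (g x))))"
            by (subst integral_complex_of_real[symmetric]) (simp add: scaleR_conv_of_real)
          also have "\<dots> = (LINT x|hyp_measure. complex_of_real (indicator (box l' v') x * r (g x)))"
            using m by (intro integral_hyp_measure[symmetric]) measurable
          also have "\<dots> = 0" unfolding integral_complex_of_real box0[OF lv(2)[OF False] r] by simp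
          finally show ?thesis by simp
        qed
      qed
      from AE_zero_if_box_integrals_zero[OF hint hbox] show ?thesis
        by eventually_elim (auto simp: h_def hyp3_iff)
    qed
    then have "AE x in lborel. \<forall>N. x \<in> hyp3 \<longrightarrow> x \<in> B N \<longrightarrow> r (g x) = 0" unfolding AE_all_countable by blast
    then have "AE x in lborel. x \<in> hyp3 \<longrightarrow> r (g x) = 0" by eventually_elim (use cover in blast)
    then have "AE x in restrict_space lborel hyp3. r (g x) = 0" by (subst AE_restrict_space_iff) auto
    then show ?thesis unfolding hyp_measure_def
      by (subst AE_density) (auto intro!: measurable_restrict_space1)
  qed
  have "AE x in hyp_measure. g x = 0"
    using zero[of Re] zero[of Im] by (auto elim!: eventually_elim2 simp: complex_eq_iff)
  then show ?thesis unfolding abs(1) abs_zero[symmetric]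
    using abs_eq_iff[OF abs(2) square_integrable_zero] by simp
qed

section \<open>The Green function\<close>

text \<open>
  \<open>sinh d\<close> as a function of \<open>c = cosh d\<close>.
\<close>

definition shc :: "real \<Rightarrow> real" where
  "shc c = sqrt (c\<^sup>2 - 1)"

lemma shc_facts:
  assumes "1 < c"
  shows "0 < shc c" "(shc c)\<^sup>2 = c\<^sup>2 - 1" "c\<^sup>2 \<noteq> 1" "shc c < c" "0 < c\<^sup>2 - 1"
proof -
  have c: "1 < c\<^sup>2" using assms by (simp add: one_less_power)
  then show "0 < shc c" "(shc c)\<^sup>2 = c\<^sup>2 - 1" "0 < c\<^sup>2 - 1" by (auto simp: shc_def)
  then show "shc c < c" by (intro power2_less_imp_less[of _ c]) (use assms in auto)
  show "c\<^sup>2 \<noteq> 1" using c by simp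
qed

lemma shc_mono: "1 \<le> c \<Longrightarrow> c \<le> d \<Longrightarrow> shc c \<le> shc d"
  by (simp add: shc_def power_mono)

lemma shc_1 [simp]: "shc 1 = 0" by (simp add: shc_def)

lemma shc_measurable [measurable]: "shc \<in> borel_measurable borel"
  unfolding shc_def[abs_def] by measurable

lemma shc_isCont [continuous_intros]: "isCont f x \<Longrightarrow> isCont (\<lambda>x. shc (f x)) x"
  unfolding shc_def by (intro continuous_intros)

lemma shc_continuous_on [continuous_intros]: "continuous_on S shc"
  unfolding shc_def[abs_def] by (intro continuous_intros)

lemma radial_borel_iff: "f \<in> borel_measurable radial_measure \<longleftrightarrow> f \<in> borel_measurable borel"
  by (simp add: measurable_cong_sets[OF sets_radial_measure refl])

lemma radial_measure_integrable_iff: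
  assumes [measurable]: "F \<in> borel_measurable borel"
  shows "integrable radial_measure F \<longleftrightarrow> set_integrable lborel {1<..} (\<lambda>c. 4 * pi * shc c * F c)"
    and "(LINT c|radial_measure. F c) = (LBINT c:{1<..}. 4 * pi * shc c * F c)"
proof -
  have eq: "(4 * pi * sqrt (c\<^sup>2 - 1) * indicator {1..} c) *\<^sub>R F c = indicator {1<..} c *\<^sub>R (4 * pi * shc c * F c)" for c :: real
    by (cases "c = 1") (auto simp: indicator_def shc_def)
  have nn: "AE c in lborel. 0 \<le> 4 * pi * sqrt (c\<^sup>2 - 1) * indicator {1..} c"
  proof (intro AE_I2)
    fix c :: real
    have "0 \<le> c\<^sup>2 - 1" if "1 \<le> c" using that by (simp add: one_le_power)
    then show "0 \<le> 4 * pi * sqrt (c\<^sup>2 - 1) * indicator {1..} c" by (auto simp: indicator_def)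
  qed
  have m: "F \<in> borel_measurable lborel" "(\<lambda>c. 4 * pi * sqrt (c\<^sup>2 - 1) * indicator {1..} c) \<in> borel_measurable lborel"
    by measurable
  show "integrable radial_measure F \<longleftrightarrow> set_integrable lborel {1<..} (\<lambda>c. 4 * pi * shc c * F c)"
    unfolding radial_measure_def set_integrable_def eq[symmetric] by (rule integrable_density[OF m nn])
  show "(LINT c|radial_measure. F c) = (LBINT c:{1<..}. 4 * pi * shc c * F c)"
    unfolding radial_measure_def set_lebesgue_integral_def eq[symmetric] by (rule integral_density[OF m nn])
qed

lemma AE_radial_gt_1: "AE c in radial_measure. 1 < c"
proof -
  have "AE c in lborel. c \<noteq> (1::real)" by (rule AE_lborel_singleton)
  then have "AE c in lborel. 0 < ennreal (4 * pi * sqrt (c\<^sup>2 - 1) * indicator {1..} c) \<longrightarrow> (1::real) < c"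
    by eventually_elim (auto simp: indicator_def split: if_splits)
  then show ?thesis unfolding radial_measure_def by (subst AE_density) auto
qed

lemma DERIV_shc: assumes "1 < c" shows "DERIV shc c :> c / shc c"
proof -
  have "DERIV (\<lambda>c::real. c\<^sup>2 - 1) c :> 2 * c" by (auto intro!: derivative_eq_intros)
  from DERIV_chain2[OF DERIV_real_sqrt[OF shc_facts(5)[OF assms]] this]
  have "DERIV (\<lambda>c. sqrt (c\<^sup>2 - 1)) c :> inverse (sqrt (c\<^sup>2 - 1)) / 2 * (2 * c)" .
  then show ?thesis unfolding shc_def[abs_def] by (rule DERIV_cong) (simp add: inverse_eq_divide)
qed

lemma AE_hyp_cosh_gt_1:
  assumes x: "x \<in> hyp3" shows "AE y in hyp_measure. 1 < hyp_cosh x y"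
proof -
  have "AE c in distr hyp_measure borel (hyp_cosh x). 1 < c" unfolding distr_hyp_cosh[OF x] by (rule AE_radial_gt_1)
  then show ?thesis by (subst (asm) AE_distr_iff) auto
qed

text \<open>
  \<open>exp (- k d) / sinh d\<close> as a function of \<open>c = cosh d\<close>, where \<open>c + shc c = exp d\<close>.  The next two
  functions are its first and second derivatives, the second one expressed through the radial
  Helmholtz equation.
\<close>

definition green :: "real \<Rightarrow> real \<Rightarrow> real" where
  "green k c = (c + shc c) powr (- k) / shc c"

definition green' :: "real \<Rightarrow> real \<Rightarrow> real" where
  "green' k c = - ((k * shc c + c) * (c + shc c) powr (- k) / shc c ^ 3)"

definition green'' :: "real \<Rightarrow> real \<Rightarrow> real" where
  "green'' k c = ((k\<^sup>2 - 1) * green k c - 3 * c * green' k c) / (c\<^sup>2 - 1)"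

text \<open>
  The radial operator \<open>(k\<^sup>2 - 1) - \<Delta>\<close> applied to \<open>c \<mapsto> green k (c + e)\<close>.  The shift removes the
  singularity at \<open>c = 1\<close> at the price of this smooth right-hand side in place of a point mass.
\<close>

definition rho :: "real \<Rightarrow> real \<Rightarrow> real \<Rightarrow> real" where
  "rho k e c = (k\<^sup>2 - 1) * green k (c + e) - ((c\<^sup>2 - 1) * green'' k (c + e) + 3 * c * green' k (c + e))"

lemma green_measurable [measurable]: "green k \<in> borel_measurable borel"
  unfolding green_def[abs_def] by measurable

lemma shift_green_measurable: "(\<lambda>c. green k (c + e)) \<in> borel_measurable borel"
  by measurable

lemma rho_measurable [measurable]: "rho k e \<in> borel_measurable borel"
  unfolding rho_def[abs_def] green''_def green'_def by measurable

context
  fixes k :: real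
  assumes k: "1 < k"
begin

lemma green_pos: "1 < c \<Longrightarrow> 0 < green k c"
  using shc_facts[of c] by (auto simp: green_def intro!: divide_pos_pos)

lemma green'_neg: "1 < c \<Longrightarrow> green' k c < 0"
proof -
  assume c: "1 < c"
  have "0 < (k * shc c + c) * (c + shc c) powr (- k)"
    using shc_facts[OF c] k c by (intro mult_pos_pos add_pos_pos) auto
  then have "0 < (k * shc c + c) * (c + shc c) powr (- k) / shc c ^ 3"
    using shc_facts[OF c] by (intro divide_pos_pos) auto
  then show ?thesis by (simp add: green'_def)
qed

lemma green_ode: "1 < c \<Longrightarrow> (c\<^sup>2 - 1) * green'' k c + 3 * c * green' k c = (k\<^sup>2 - 1) * green k c"
  using shc_facts[of c] by (simp add: green''_def)

lemma green''_pos: "1 < c \<Longrightarrow> 0 < green'' k c"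
proof -
  assume c: "1 < c"
  have "0 < (k\<^sup>2 - 1) * green k c" using k green_pos[OF c] by (intro mult_pos_pos) (auto simp: one_less_power)
  moreover have "0 < - (3 * c * green' k c)" using c green'_neg[OF c] by (simp add: mult_pos_neg)
  ultimately show ?thesis unfolding green''_def using shc_facts[OF c] by (intro divide_pos_pos) auto
qed

lemma DERIV_decay:
  assumes "1 < c"
  shows "DERIV (\<lambda>c. (c + shc c) powr (- k)) c :> - k * (c + shc c) powr (- k) / shc c"
proof -
  let ?s = "shc c"
  have pos: "0 < c + ?s" using shc_facts[OF assms] assms by (intro add_pos_pos) auto
  have "DERIV (\<lambda>c. c + shc c) c :> 1 + c / ?s"
    by (intro DERIV_add DERIV_ident DERIV_shc assms)
  from DERIV_chain2[OF has_real_derivative_powr[OF pos] this]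
  have "DERIV (\<lambda>c. (c + shc c) powr (- k)) c :> - k * (c + ?s) powr (- k - 1) * (1 + c / ?s)" .
  moreover have "- k * (c + ?s) powr (- k - 1) * (1 + c / ?s) = - k * (c + ?s) powr (- k) / ?s"
  proof -
    have "(c + ?s) powr (- k - 1) = (c + ?s) powr (- k) / (c + ?s)" using pos by (simp add: powr_diff)
    moreover have "1 + c / ?s = (c + ?s) / ?s" using shc_facts[OF assms] by (simp add: field_simps)
    ultimately show ?thesis using pos by simp
  qed
  ultimately show ?thesis by simp
qed

lemma DERIV_green: assumes c: "1 < c" shows "DERIV (green k) c :> green' k c"
proof -
  let ?s = "shc c"
  have s: "?s \<noteq> 0" using shc_facts(1)[OF c] by simp
  have D: "DERIV (\<lambda>c. (c + shc c) powr (- k) / shc c) c :>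
    ((- k * (c + ?s) powr (- k) / ?s) * ?s - (c + ?s) powr (- k) * (c / ?s)) / (?s * ?s)"
    using s by (intro DERIV_divide DERIV_decay DERIV_shc c)
  have id: "((- k * E / s) * s - E * (c / s)) / (s * s) = - ((k * s + c) * E / s ^ 3)" if "s \<noteq> 0" for s E :: real
    using that by (simp add: field_simps power3_eq_cube)
  show ?thesis unfolding green_def[abs_def] green'_def by (rule DERIV_cong[OF D id[OF s]])
qed

lemma DERIV_green': assumes c: "1 < c" shows "DERIV (green' k) c :> green'' k c"
proof -
  let ?s = "shc c"
  let ?E = "(c + ?s) powr (- k)"
  have s: "?s \<noteq> 0" "?s\<^sup>2 = c\<^sup>2 - 1" using shc_facts(1)[OF c] shc_facts(2)[OF c] by simp_all
  have "DERIV (\<lambda>c. (k * shc c + c) * (c + shc c) powr (- k)) c :>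
      (k * (c / ?s) + 1) * ?E + (- k * ?E / ?s) * (k * ?s + c)"
    by (intro DERIV_mult DERIV_add DERIV_cmult DERIV_ident DERIV_decay DERIV_shc c)
  moreover have "DERIV (\<lambda>c. shc c ^ 3) c :> 3 * ?s\<^sup>2 * (c / ?s)"
    by (rule DERIV_cong[OF DERIV_power[OF DERIV_shc[OF c], of 3]]) simp
  ultimately have D: "DERIV (\<lambda>c. - ((k * shc c + c) * (c + shc c) powr (- k) / shc c ^ 3)) c :>
      - ((((k * (c / ?s) + 1) * ?E + (- k * ?E / ?s) * (k * ?s + c)) * ?s ^ 3
      - ((k * ?s + c) * ?E) * (3 * ?s\<^sup>2 * (c / ?s))) / (?s ^ 3 * ?s ^ 3))"
    using s by (intro DERIV_minus DERIV_divide) auto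
  have id: "- ((((k * (c / s) + 1) * E + (- k * E / s) * (k * s + c)) * s ^ 3
      - ((k * s + c) * E) * (3 * s\<^sup>2 * (c / s))) / (s ^ 3 * s ^ 3))
      = ((k\<^sup>2 - 1) * (E / s) - 3 * c * - ((k * s + c) * E / s ^ 3)) / s\<^sup>2" if "s \<noteq> 0" for s E :: real
    using that by (simp add: divide_simps) (simp add: eval_nat_numeral algebra_simps)
  show ?thesis
    unfolding green'_def[abs_def] green''_def green_def s(2)[symmetric] by (rule DERIV_cong[OF D id[OF s(1)]])
qed

text \<open>
  Divergence form: \<open>(c\<^sup>2 - 1) p' + 3 c p\<close>, the Laplacian of a radial function with derivative \<open>p\<close>, is the
  derivative of the flux \<open>shc c ^ 3 * p c\<close> through the sphere, divided by \<open>shc c\<close>.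
\<close>

lemma DERIV_flux:
  assumes c: "1 < c" and p: "DERIV p (c::real) :> q"
  shows "DERIV (\<lambda>c. shc c ^ 3 * p c) c :> shc c * ((c\<^sup>2 - 1) * q + 3 * c * p c)"
proof -
  let ?s = "shc c"
  have s: "?s \<noteq> 0" "?s\<^sup>2 = c\<^sup>2 - 1" using shc_facts(1)[OF c] shc_facts(2)[OF c] by simp_all
  have D: "DERIV (\<lambda>c. shc c ^ 3 * p c) c :> 3 * ?s\<^sup>2 * (c / ?s) * p c + q * ?s ^ 3"
    by (rule DERIV_cong[OF DERIV_mult[OF DERIV_power[OF DERIV_shc[OF c], of 3] p]]) simp
  have id: "3 * s\<^sup>2 * (c / s) * y + q * s ^ 3 = s * (s\<^sup>2 * q + 3 * c * y)" if "s \<noteq> 0" for s y :: real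
    using that by (simp add: eval_nat_numeral algebra_simps)
  show ?thesis unfolding s(2)[symmetric] by (rule DERIV_cong[OF D id[OF s(1)]])
qed

lemma flux_green_eq: "1 < c \<Longrightarrow> shc c ^ 3 * green' k c = - ((k * shc c + c) * (c + shc c) powr (- k))"
  using shc_facts(1)[of c] by (simp add: green'_def)

lemma flux_green_at_1: "((\<lambda>c. shc c ^ 3 * green' k c) \<longlongrightarrow> - 1) (at_right 1)"
proof -
  have "isCont (\<lambda>c. - ((k * shc c + c) * (c + shc c) powr (- k))) 1"
    by (intro continuous_intros) auto
  then have "((\<lambda>c. - ((k * shc c + c) * (c + shc c) powr (- k))) \<longlongrightarrow> - 1) (at_right 1)"
    unfolding isCont_def by (simp add: filterlim_at_split)
  moreover have "eventually (\<lambda>c. - ((k * shc c + c) * (c + shc c) powr (- k)) = shc c ^ 3 * green' k c) (at_right 1)"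
    unfolding eventually_at_right_field using flux_green_eq by (intro exI[of _ 2]) auto
  ultimately show ?thesis by (rule Lim_transform_eventually)
qed

lemma flux_green_at_top: "((\<lambda>c. shc c ^ 3 * green' k c) \<longlongrightarrow> 0) at_top"
proof (rule Lim_null_comparison)
  show "((\<lambda>c::real. (k + 1) * c powr (1 - k)) \<longlongrightarrow> 0) at_top"
    using k by (intro tendsto_mult_right_zero tendsto_neg_powr filterlim_ident) auto
  show "eventually (\<lambda>c. norm (shc c ^ 3 * green' k c) \<le> (k + 1) * c powr (1 - k)) at_top"
  proof (rule eventually_mono[OF eventually_gt_at_top[of 1]])
    fix c :: real assume c: "1 < c"
    let ?s = "shc c"
    have s: "0 < ?s" "?s < c" using shc_facts(1)[OF c] shc_facts(4)[OF c] .
    have "(c + ?s) powr (- k) \<le> c powr (- k)"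
      using s c k by (intro powr_mono2') auto
    moreover have "k * ?s + c \<le> (k + 1) * c" using s k by (simp add: algebra_simps)
    ultimately have "(k * ?s + c) * (c + ?s) powr (- k) \<le> ((k + 1) * c) * c powr (- k)"
      using k c s by (intro mult_mono) auto
    also have "\<dots> = (k + 1) * c powr (1 - k)"
      using c powr_add[of c 1 "- k"] by simp
    finally have "(k * ?s + c) * (c + ?s) powr (- k) \<le> (k + 1) * c powr (1 - k)" .
    moreover have "0 \<le> (k * ?s + c) * (c + ?s) powr (- k)"
      using k c s by (intro mult_nonneg_nonneg add_nonneg_nonneg) auto
    ultimately show "norm (?s ^ 3 * green' k c) \<le> (k + 1) * c powr (1 - k)"
      unfolding flux_green_eq[OF c] by simp
  qed
qed

lemma green_continuous: "1 < c \<Longrightarrow> isCont (green k) c"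
  using DERIV_green DERIV_isCont by blast

lemma green'_continuous: "1 < c \<Longrightarrow> isCont (green' k) c"
  using DERIV_green' DERIV_isCont by blast

lemma green''_continuous: "1 < c \<Longrightarrow> isCont (green'' k) c"
  unfolding green''_def[abs_def] using shc_facts(3)[of c]
  by (intro continuous_intros green_continuous green'_continuous) auto

lemma k2: "0 < k\<^sup>2 - 1" using k by (simp add: one_less_power)

text \<open>
  By the Helmholtz equation the integrand is a multiple of the derivative of the flux, which runs
  from \<open>- 1\<close> at \<open>c = 1\<close> to 0 at infinity.
\<close>

theorem green_integral:
  shows "integrable radial_measure (green k)" "(LINT c|radial_measure. green k c) = 4 * pi / (k\<^sup>2 - 1)"
proof -
  let ?f = "\<lambda>c. shc c * ((k\<^sup>2 - 1) * green k c)"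
  let ?F = "\<lambda>c. shc c ^ 3 * green' k c"
  have D: "DERIV ?F c :> ?f c" if "ereal 1 < ereal c" for c
    using DERIV_flux[OF _ DERIV_green', of c] green_ode[of c] that by simp
  have f: "isCont ?f c" if "ereal 1 < ereal c" for c
    using that by (intro continuous_intros green_continuous) simp
  have nn: "AE c in lborel. ereal 1 < ereal c \<longrightarrow> ereal c < \<infinity> \<longrightarrow> 0 \<le> ?f c"
    using green_pos k2 shc_facts(1) by (intro AE_I2) (auto intro!: mult_nonneg_nonneg less_imp_le)
  have A: "((?F \<circ> real_of_ereal) \<longlongrightarrow> - 1) (at_right (ereal 1))"
    unfolding ereal_tendsto_simps by (rule flux_green_at_1)
  have B: "((?F \<circ> real_of_ereal) \<longlongrightarrow> 0) (at_left \<infinity>)"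
    unfolding ereal_tendsto_simps by (rule flux_green_at_top)
  have e: "einterval (ereal 1) \<infinity> = {1<..}" by (auto simp: einterval_def)
  have I: "set_integrable lborel {1<..} ?f" "(LBINT c:{1<..}. ?f c) = 1"
    using interval_integral_FTC_nonneg[of "ereal 1" \<infinity> ?F ?f, OF _ D f nn A B]
    by (simp_all add: e interval_lebesgue_integral_def)
  have eq: "4 * pi * shc c * green k c = (4 * pi / (k\<^sup>2 - 1)) * ?f c" for c
    using k2 by simp
  show "integrable radial_measure (green k)"
    unfolding radial_measure_integrable_iff(1)[OF green_measurable] eq by (intro set_integrable_mult_right I)
  show "(LINT c|radial_measure. green k c) = 4 * pi / (k\<^sup>2 - 1)"
    unfolding radial_measure_integrable_iff(2)[OF green_measurable] eq set_integral_mult_right I(2) by simp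
qed

lemma green_antimono: "1 < c \<Longrightarrow> c \<le> d \<Longrightarrow> green k d \<le> green k c"
  by (rule DERIV_nonpos_imp_nonincreasing[of c d "green k"])
     (auto intro!: exI[of _ "green' k _"] DERIV_green less_imp_le[OF green'_neg])

subsection \<open>The shifted Green function\<close>

context
  fixes e :: real
  assumes e: "0 < e"
begin

lemma DERIV_shift_green: "1 \<le> c \<Longrightarrow> DERIV (\<lambda>c. green k (c + e)) c :> green' k (c + e)"
  using DERIV_green[of "c + e"] e by (simp add: DERIV_shift)

lemma DERIV_shift_green': "1 \<le> c \<Longrightarrow> DERIV (\<lambda>c. green' k (c + e)) c :> green'' k (c + e)"
  using DERIV_green'[of "c + e"] e by (simp add: DERIV_shift)

text \<open>
  With \<open>d = c + e\<close> the Helmholtz equation at \<open>d\<close> gives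
  \<open>rho k e c = e ((d + c) green'' + 3 green')\<close>, and \<open>d green'' + 3 green' = ((k\<^sup>2 - 1) green + green'') / d\<close> is
  positive.
\<close>

lemma rho_nonneg: assumes c: "1 \<le> c" shows "0 \<le> rho k e c"
proof -
  define d where "d = c + e"
  have d: "1 < d" using c e by (simp add: d_def)
  have ode: "(d\<^sup>2 - 1) * green'' k d + 3 * d * green' k d = (k\<^sup>2 - 1) * green k d" by (rule green_ode[OF d])
  have "rho k e c = (d\<^sup>2 - c\<^sup>2) * green'' k d + 3 * e * green' k d"
    unfolding rho_def d_def[symmetric] ode[symmetric] by (simp add: d_def algebra_simps)
  also have "\<dots> = e * ((d * green'' k d + 3 * green' k d) + c * green'' k d)"
    by (simp add: d_def power2_eq_square algebra_simps)
  finally have eq: "rho k e c = e * ((d * green'' k d + 3 * green' k d) + c * green'' k d)" .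
  have "d * (d * green'' k d + 3 * green' k d) = (k\<^sup>2 - 1) * green k d + green'' k d"
    using ode by (simp add: power2_eq_square algebra_simps)
  also have "\<dots> > 0" using k2 green_pos[OF d] green''_pos[OF d] by (intro add_pos_pos mult_pos_pos)
  finally have pos: "0 < d * green'' k d + 3 * green' k d" using d by (simp add: zero_less_mult_iff)
  have "0 \<le> c * green'' k d" using c green''_pos[OF d] by simp
  then show ?thesis unfolding eq by (intro mult_nonneg_nonneg[OF less_imp_le[OF e]] add_nonneg_nonneg[OF less_imp_le[OF pos]])
qed

lemma shift_green_integrable: "integrable radial_measure (\<lambda>c. green k (c + e))"
proof (rule Bochner_Integration.integrable_bound[OF green_integral(1)])
  show "AE c in radial_measure. norm (green k (c + e)) \<le> norm (green k c)"
    using AE_radial_gt_1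
  proof eventually_elim
    case (elim c)
    then show ?case using green_antimono[of c "c + e"] green_pos[of "c + e"] green_pos[of c] e by simp
  qed
qed (simp add: radial_borel_iff)

lemma shift_flux_at_top: "((\<lambda>c. shc c ^ 3 * green' k (c + e)) \<longlongrightarrow> 0) at_top"
proof (rule Lim_null_comparison)
  have "filterlim (\<lambda>c. c + e) at_top at_top" by (rule filterlim_at_top_mono[OF filterlim_ident]) (use e in \<open>auto intro!: always_eventually\<close>)
  then show "((\<lambda>c. norm (shc (c + e) ^ 3 * green' k (c + e))) \<longlongrightarrow> 0) at_top"
    by (intro tendsto_norm_zero filterlim_compose[OF flux_green_at_top])
  show "eventually (\<lambda>c. norm (shc c ^ 3 * green' k (c + e)) \<le> norm (shc (c + e) ^ 3 * green' k (c + e))) at_top"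
  proof (rule eventually_mono[OF eventually_gt_at_top[of 1]])
    fix c :: real assume c: "1 < c"
    show "norm (shc c ^ 3 * green' k (c + e)) \<le> norm (shc (c + e) ^ 3 * green' k (c + e))"
      using shc_mono[of c "c + e"] shc_facts(1)[OF c] c e
      by (auto simp: abs_mult power_abs intro!: mult_right_mono power_mono)
  qed
qed

text \<open>
  Integrating the divergence form over \<open>c > a\<close> leaves the mass of the shifted Green function and the
  flux at \<open>a\<close>.
\<close>

lemma rho_tail:
  assumes a: "1 \<le> a"
  shows "set_integrable lborel {a<..} (\<lambda>c. shc c * rho k e c)"
    and "(LBINT c:{a<..}. shc c * rho k e c)
      = (LBINT c:{a<..}. shc c * ((k\<^sup>2 - 1) * green k (c + e))) + shc a ^ 3 * green' k (a + e)"
proof -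
  define f where "f c = shc c * ((k\<^sup>2 - 1) * green k (c + e))" for c
  define K :: "real \<Rightarrow> real" where "K c = (LBINT y=a..c. f y)" for c
  define W where "W c = shc c ^ 3 * green' k (c + e)" for c
  have fc: "continuous_on {a..b} f" for b
    unfolding f_def using a e by (intro continuous_intros continuous_at_imp_continuous_on ballI isCont_o2[OF _ green_continuous] ) auto
  have fi: "set_integrable lborel {1<..} f"
  proof -
    have "set_integrable lborel {1<..} (\<lambda>c. ((k\<^sup>2 - 1) / (4 * pi)) * (4 * pi * shc c * green k (c + e)))"
      using shift_green_integrable radial_measure_integrable_iff(1)[OF shift_green_measurable]
      by (intro set_integrable_mult_right) simp
    moreover have "((k\<^sup>2 - 1) / (4 * pi)) * (4 * pi * shc c * green k (c + e)) = f c" for c by (simp add: f_def)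
    ultimately show ?thesis by simp
  qed
  have fia: "set_integrable lborel {a<..} f" by (rule set_integrable_subset[OF fi]) (use a in auto)
  have DK0: "(K has_vector_derivative f c) (at c within {a..b})" if "a \<le> c" "c \<le> b" for b c
    unfolding K_def by (rule interval_integral_FTC2[OF _ _ fc]) (use that in auto)
  have DK: "DERIV K c :> f c" if "a < c" for c
  proof -
    have "(K has_vector_derivative f c) (at c within {a..c + 1})" using that by (intro DK0) auto
    then have "(K has_vector_derivative f c) (at c)"
      using that by (subst (asm) at_within_interior) auto
    then show ?thesis by (simp add: has_real_derivative_iff_has_vector_derivative)
  qed
  have K0: "(K \<longlongrightarrow> 0) (at_right a)"
  proof -
    have "continuous (at a within {a..a + 1}) K"
      using has_vector_derivative_continuous[OF DK0[of a "a + 1"]] by simp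
    moreover have "K a = 0" by (simp add: K_def)
    ultimately show ?thesis by (simp add: continuous_within at_within_Icc_at_right)
  qed
  have Ktop: "(K \<longlongrightarrow> (LBINT c:{a<..}. f c)) at_top"
  proof -
    have "((\<lambda>y. LINT x|lborel. indicator {..y} x *\<^sub>R (indicator {a<..} x *\<^sub>R f x)) \<longlongrightarrow> (LINT x|lborel. indicator {a<..} x *\<^sub>R f x)) at_top"
      using fia by (intro tendsto_integral_at_top) (auto simp: set_integrable_def)
    moreover have "eventually (\<lambda>y. (LINT x|lborel. indicator {..y} x *\<^sub>R (indicator {a<..} x *\<^sub>R f x)) = K y) at_top"
    proof (rule eventually_mono[OF eventually_gt_at_top[of a]])
      fix y assume "a < y"
      then have "K y = (LBINT x:{a<..y}. f x)" by (simp add: K_def interval_integral_Ioc)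
      then show "(LINT x|lborel. indicator {..y} x *\<^sub>R (indicator {a<..} x *\<^sub>R f x)) = K y"
        unfolding set_lebesgue_integral_def by (simp add: indicator_def) (intro Bochner_Integration.integral_cong, auto)
    qed
    ultimately show ?thesis unfolding set_lebesgue_integral_def by (rule Lim_transform_eventually)
  qed
  have DW: "DERIV W c :> shc c * ((c\<^sup>2 - 1) * green'' k (c + e) + 3 * c * green' k (c + e))" if "a < c" for c
    unfolding W_def using a that by (intro DERIV_flux DERIV_shift_green') auto
  have Wa: "(W \<longlongrightarrow> shc a ^ 3 * green' k (a + e)) (at_right a)"
  proof -
    have "isCont W a" unfolding W_def using a e
      by (intro continuous_intros isCont_o2[OF _ green'_continuous]) auto
    then show ?thesis unfolding W_def isCont_def by (rule tendsto_within_subset) auto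
  qed
  have Wtop: "(W \<longlongrightarrow> 0) at_top" unfolding W_def by (rule shift_flux_at_top)
  let ?F = "\<lambda>c. K c - W c" and ?g = "\<lambda>c. shc c * rho k e c"
  have D: "DERIV ?F c :> ?g c" if "ereal a < ereal c" for c
  proof -
    have "?g c = f c - shc c * ((c\<^sup>2 - 1) * green'' k (c + e) + 3 * c * green' k (c + e))"
      by (simp add: f_def rho_def right_diff_distrib)
    then show ?thesis using that by (simp only: ereal_less(1)) (auto intro!: DERIV_diff DK DW)
  qed
  have g: "isCont ?g c" if "ereal a < ereal c" for c
    unfolding rho_def using that a e
    by (intro continuous_intros isCont_o2[OF _ green'_continuous] isCont_o2[OF _ green_continuous] isCont_o2[OF _ green''_continuous]) auto
  have nn: "AE c in lborel. ereal a < ereal c \<longrightarrow> ereal c < \<infinity> \<longrightarrow> 0 \<le> ?g c"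
    using rho_nonneg shc_facts(1) a by (intro AE_I2 impI mult_nonneg_nonneg) (auto simp: less_imp_le)
  have A: "((?F \<circ> real_of_ereal) \<longlongrightarrow> 0 - shc a ^ 3 * green' k (a + e)) (at_right (ereal a))"
    unfolding ereal_tendsto_simps by (intro tendsto_diff K0 Wa)
  have B: "((?F \<circ> real_of_ereal) \<longlongrightarrow> (LBINT c:{a<..}. f c) - 0) (at_left \<infinity>)"
    unfolding ereal_tendsto_simps by (intro tendsto_diff Ktop Wtop)
  have ei: "einterval (ereal a) \<infinity> = {a<..}" by (auto simp: einterval_def)
  note R = interval_integral_FTC_nonneg[of "ereal a" \<infinity> ?F ?g, OF _ D g nn A B]
  show "set_integrable lborel {a<..} ?g" using R(1) by (simp add: ei)
  show "(LBINT c:{a<..}. ?g c) = (LBINT c:{a<..}. shc c * ((k\<^sup>2 - 1) * green k (c + e))) + shc a ^ 3 * green' k (a + e)"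
    using R(2) by (simp add: ei interval_lebesgue_integral_def f_def)
qed

lemma rho_integrable: "integrable radial_measure (rho k e)"
proof -
  have "set_integrable lborel {1<..} (\<lambda>c. 4 * pi * (shc c * rho k e c))"
    by (intro set_integrable_mult_right rho_tail) simp
  then show ?thesis unfolding radial_measure_integrable_iff(1)[OF rho_measurable] by (simp add: mult.assoc)
qed

lemma rho_mass: "(LINT c|radial_measure. rho k e c) = (k\<^sup>2 - 1) * (LINT c|radial_measure. green k (c + e))"
proof -
  have "4 * pi * shc c * rho k e c = 4 * pi * (shc c * rho k e c)" for c by simp
  then have "(LINT c|radial_measure. rho k e c) = 4 * pi * (LBINT c:{1<..}. shc c * rho k e c)"
    unfolding radial_measure_integrable_iff(2)[OF rho_measurable] by (simp only: set_integral_mult_right)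
  also have "(LBINT c:{1<..}. shc c * rho k e c) = (LBINT c:{1<..}. shc c * ((k\<^sup>2 - 1) * green k (c + e)))"
    using rho_tail(2)[of 1] by simp
  also have "\<dots> = (LBINT c:{1<..}. ((k\<^sup>2 - 1) / (4 * pi)) * (4 * pi * shc c * green k (c + e)))"
    by (simp add: mult_ac)
  also have "\<dots> = (k\<^sup>2 - 1) / (4 * pi) * (LINT c|radial_measure. green k (c + e))"
    unfolding radial_measure_integrable_iff(2)[OF shift_green_measurable] by (simp only: set_integral_mult_right)
  finally show ?thesis by simp
qed

end

lemma shift_green_mass_limit:
  assumes en: "\<And>n. 0 < en n" "en \<longlonglongrightarrow> 0"
  shows "(\<lambda>n. radial_mass (\<lambda>c. green k c - green k (c + en n))) \<longlonglongrightarrow> 0"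
proof -
  have "(\<lambda>n. LINT c|radial_measure. \<bar>green k c - green k (c + en n)\<bar>) \<longlonglongrightarrow> (LINT c|radial_measure. 0)"
  proof (rule integral_dominated_convergence)
    show "integrable radial_measure (green k)" by (rule green_integral)
    show "AE c in radial_measure. (\<lambda>n. \<bar>green k c - green k (c + en n)\<bar>) \<longlonglongrightarrow> 0"
      using AE_radial_gt_1
    proof eventually_elim
      case (elim c)
      have "(\<lambda>n. c + en n) \<longlonglongrightarrow> c" using tendsto_add[OF tendsto_const en(2), of c] by simp
      then have "(\<lambda>n. green k (c + en n)) \<longlonglongrightarrow> green k (c + 0)"
        using isCont_tendsto_compose[OF green_continuous[OF elim]] by simp
      then have "(\<lambda>n. \<bar>green k c - green k (c + en n)\<bar>) \<longlonglongrightarrow> \<bar>green k c - green k (c + 0)\<bar>" by (intro tendsto_intros)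
      then show ?case by simp
    qed
    show "AE c in radial_measure. norm \<bar>green k c - green k (c + en n)\<bar> \<le> green k c" for n
      using AE_radial_gt_1
    proof eventually_elim
      case (elim c)
      then show ?case using green_antimono[of c "c + en n"] green_pos[of "c + en n"] green_pos[of c] en(1)[of n] by simp
    qed
  qed (simp_all add: radial_borel_iff)
  then show ?thesis by simp
qed

lemma rho_mass_limit:
  assumes en: "\<And>n. 0 < en n" "en \<longlonglongrightarrow> 0"
  shows "(\<lambda>n. LINT c|radial_measure. rho k (en n) c) \<longlonglongrightarrow> 4 * pi"
proof -
  have "(LINT c|radial_measure. green k (c + en n)) = 4 * pi / (k\<^sup>2 - 1) - radial_mass (\<lambda>c. green k c - green k (c + en n))" for n
  proof -
    have "radial_mass (\<lambda>c. green k c - green k (c + en n)) = (LINT c|radial_measure. green k c - green k (c + en n))"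
    proof (rule integral_cong_AE)
      show "AE c in radial_measure. \<bar>green k c - green k (c + en n)\<bar> = green k c - green k (c + en n)"
        using AE_radial_gt_1
        by eventually_elim (use green_antimono en(1)[of n] in auto)
    qed (simp_all add: radial_borel_iff)
    then show ?thesis using green_integral shift_green_integrable[OF en(1)] by simp
  qed
  moreover have "(\<lambda>n. 4 * pi / (k\<^sup>2 - 1) - radial_mass (\<lambda>c. green k c - green k (c + en n))) \<longlonglongrightarrow> 4 * pi / (k\<^sup>2 - 1) - 0"
    by (intro tendsto_intros shift_green_mass_limit en)
  ultimately have "(\<lambda>n. LINT c|radial_measure. green k (c + en n)) \<longlonglongrightarrow> 4 * pi / (k\<^sup>2 - 1)" by simp
  then have "(\<lambda>n. (k\<^sup>2 - 1) * (LINT c|radial_measure. green k (c + en n))) \<longlonglongrightarrow> (k\<^sup>2 - 1) * (4 * pi / (k\<^sup>2 - 1))"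
    by (rule tendsto_mult_left)
  then show ?thesis using rho_mass[OF en(1)] k2 by simp
qed

text \<open>
  In \<open>rho_tail\<close> the integral on the right is at most its value for \<open>e = 0\<close>, and this value is cancelled by
  the flux of \<open>green k\<close> at \<open>a\<close>.  What is left is the change of the flux under the shift.
\<close>

lemma rho_tail_limit:
  assumes en: "\<And>n. 0 < en n" "en \<longlonglongrightarrow> 0" and a: "1 < a"
  shows "(\<lambda>n. LINT c|radial_measure. indicator {a<..} c * rho k (en n) c) \<longlonglongrightarrow> 0"
proof (rule tendsto_sandwich)
  let ?s = "\<lambda>c::real. shc c"
  have eq: "(LINT c|radial_measure. indicator {a<..} c * rho k (en n) c) = 4 * pi * (LBINT c:{a<..}. ?s c * rho k (en n) c)" for n
  proof -
    have m: "(\<lambda>c. indicator {a<..} c * rho k (en n) c) \<in> borel_measurable borel"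
      using rho_measurable by measurable
    show ?thesis
      unfolding radial_measure_integrable_iff(2)[OF m] set_lebesgue_integral_def integral_mult_right_zero[symmetric]
      using a by (intro Bochner_Integration.integral_cong) (auto simp: indicator_def)
  qed
  have fl: "(LBINT c:{a<..}. ?s c * ((k\<^sup>2 - 1) * green k c)) = - (?s a ^ 3 * green' k a)"
    and fli: "set_integrable lborel {a<..} (\<lambda>c. ?s c * ((k\<^sup>2 - 1) * green k c))"
  proof -
    let ?f = "\<lambda>c. ?s c * ((k\<^sup>2 - 1) * green k c)" and ?F = "\<lambda>c. ?s c ^ 3 * green' k c"
    have D: "DERIV ?F c :> ?f c" if "ereal a < ereal c" for c
      using DERIV_flux[OF _ DERIV_green', of c] green_ode[of c] that a by simp
    have f: "isCont ?f c" if "ereal a < ereal c" for c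
      using that a by (intro continuous_intros green_continuous) simp
    have nn: "AE c in lborel. ereal a < ereal c \<longrightarrow> ereal c < \<infinity> \<longrightarrow> 0 \<le> ?f c"
      using green_pos k2 shc_facts(1) a by (intro AE_I2) (auto intro!: mult_nonneg_nonneg less_imp_le)
    have A: "((?F \<circ> real_of_ereal) \<longlongrightarrow> ?F a) (at_right (ereal a))"
    proof -
      have "isCont ?F a" using a by (intro continuous_intros green'_continuous)
      then have "(?F \<longlongrightarrow> ?F a) (at_right a)" unfolding isCont_def by (rule tendsto_within_subset) auto
      then show ?thesis unfolding ereal_tendsto_simps .
    qed
    have B: "((?F \<circ> real_of_ereal) \<longlongrightarrow> 0) (at_left \<infinity>)"
      unfolding ereal_tendsto_simps by (rule flux_green_at_top)
    have e: "einterval (ereal a) \<infinity> = {a<..}" by (auto simp: einterval_def)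
    note R = interval_integral_FTC_nonneg[of "ereal a" \<infinity> ?F ?f, OF _ D f nn A B]
    show "set_integrable lborel {a<..} ?f" using R(1) by (simp add: e)
    show "(LBINT c:{a<..}. ?f c) = - ?F a" using R(2) by (simp add: e interval_lebesgue_integral_def)
  qed
  show "eventually (\<lambda>n. (LINT c|radial_measure. indicator {a<..} c * rho k (en n) c) \<le> 4 * pi * (?s a ^ 3 * green' k (a + en n) - ?s a ^ 3 * green' k a)) sequentially"
  proof (intro always_eventually allI)
    fix n
    have "(LBINT c:{a<..}. ?s c * ((k\<^sup>2 - 1) * green k (c + en n))) \<le> (LBINT c:{a<..}. ?s c * ((k\<^sup>2 - 1) * green k c))"
    proof -
      have le: "?s c * ((k\<^sup>2 - 1) * green k (c + en n)) \<le> ?s c * ((k\<^sup>2 - 1) * green k c)"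
        and nn: "0 \<le> ?s c * ((k\<^sup>2 - 1) * green k (c + en n))" if "a < c" for c
        using that a k2 shc_facts(1)[of c] green_antimono[of c "c + en n"] green_pos[of "c + en n"] en(1)[of n]
        by (auto intro!: mult_left_mono mult_nonneg_nonneg)
      show ?thesis
        unfolding set_lebesgue_integral_def
      proof (rule integral_mono)
        show i: "integrable lborel (\<lambda>c. indicator {a<..} c *\<^sub>R (?s c * ((k\<^sup>2 - 1) * green k c)))"
          using fli by (simp add: set_integrable_def)
        show "integrable lborel (\<lambda>c. indicator {a<..} c *\<^sub>R (?s c * ((k\<^sup>2 - 1) * green k (c + en n))))"
          by (rule Bochner_Integration.integrable_bound[OF i])
             (use le nn in \<open>auto simp: indicator_def intro!: AE_I2 order_trans[OF _ abs_ge_self]\<close>)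
        show "indicator {a<..} c *\<^sub>R (?s c * ((k\<^sup>2 - 1) * green k (c + en n))) \<le> indicator {a<..} c *\<^sub>R (?s c * ((k\<^sup>2 - 1) * green k c))" for c
          using le[of c] by (simp add: indicator_def)
      qed
    qed
    then have "(LBINT c:{a<..}. ?s c * rho k (en n) c) \<le> ?s a ^ 3 * green' k (a + en n) - ?s a ^ 3 * green' k a"
      using rho_tail(2)[OF en(1), of a n] a fl by simp
    then show "(LINT c|radial_measure. indicator {a<..} c * rho k (en n) c) \<le> 4 * pi * (?s a ^ 3 * green' k (a + en n) - ?s a ^ 3 * green' k a)"
      unfolding eq by (intro mult_left_mono) auto
  qed
  show "eventually (\<lambda>n. 0 \<le> (LINT c|radial_measure. indicator {a<..} c * rho k (en n) c)) sequentially"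
    using rho_nonneg[OF en(1)] a by (intro always_eventually allI integral_nonneg_AE AE_I2) (auto simp: indicator_def)
  have "(\<lambda>n. a + en n) \<longlonglongrightarrow> a" using tendsto_add[OF tendsto_const en(2), of a] by simp
  then have "(\<lambda>n. green' k (a + en n)) \<longlonglongrightarrow> green' k (a + 0)"
    using isCont_tendsto_compose[OF green'_continuous[OF a]] by simp
  then have "(\<lambda>n. 4 * pi * (?s a ^ 3 * green' k (a + en n) - ?s a ^ 3 * green' k a)) \<longlonglongrightarrow> 4 * pi * (?s a ^ 3 * green' k (a + 0) - ?s a ^ 3 * green' k a)"
    by (intro tendsto_intros)
  then show "(\<lambda>n. 4 * pi * (?s a ^ 3 * green' k (a + en n) - ?s a ^ 3 * green' k a)) \<longlonglongrightarrow> 0" by simp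
qed simp

end

section \<open>The Green function inverts the Helmholtz operator\<close>

definition helmholtz :: "real \<Rightarrow> (real ^ 3 \<Rightarrow> complex) \<Rightarrow> real ^ 3 \<Rightarrow> complex" where
  "helmholtz l f x = of_real l * f x - hyp_laplacian f x"

lemma helmholtz_square_integrable: "f \<in> test_functions \<Longrightarrow> square_integrable (helmholtz l f)"
  unfolding helmholtz_def[abs_def]
  by (intro square_integrable_diff square_integrable_scale test_function_square_integrable test_function_laplacian_square_integrable)

lemma test_functionE:
  assumes "f \<in> test_functions"
  obtains K where "smooth_on hyp3 f" "compact K" "K \<subseteq> hyp3" "\<And>x. x \<notin> K \<Longrightarrow> f x = 0"
  using assms unfolding test_functions_def by blast

lemma helmholtz_continuous: "f \<in> test_functions \<Longrightarrow> continuous_on hyp3 (helmholtz l f)"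
  unfolding helmholtz_def[abs_def]
  by (erule test_functionE) (intro continuous_intros laplacian_continuous smooth_on_continuous)

lemma bounded_of_compact_support:
  assumes "continuous_on hyp3 f" "compact K" "K \<subseteq> hyp3" "\<And>x. x \<notin> K \<Longrightarrow> f x = (0::complex)"
  obtains B where "0 \<le> B" "\<And>x. norm (f x) \<le> B"
proof -
  have "bounded (f ` K)" by (intro compact_imp_bounded compact_continuous_image continuous_on_subset[OF assms(1)] assms(2,3))
  then obtain B where B: "\<And>x. x \<in> K \<Longrightarrow> norm (f x) \<le> B" unfolding bounded_iff by auto
  have "norm (f x) \<le> max B 0" for x
    using order_trans[OF B[of x] max.cobounded1[of B 0]] assms(4)[of x] by (cases "x \<in> K") auto
  then show ?thesis using that[of "max B 0"] by simp
qed

lemma helmholtz_bounded: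
  assumes "f \<in> test_functions" obtains B where "0 \<le> B" "\<And>x. norm (helmholtz l f x) \<le> B"
proof -
  obtain K where K: "smooth_on hyp3 f" "compact K" "K \<subseteq> hyp3" "\<And>x. x \<notin> K \<Longrightarrow> f x = 0"
    using test_functionE[OF assms] by metis
  show ?thesis
    by (rule bounded_of_compact_support[OF helmholtz_continuous[OF assms, of l] K(2,3)])
       (use that laplacian_zero_outside[OF K(2,4)] K(4) in \<open>auto simp: helmholtz_def\<close>)
qed

text \<open>
  Symmetry moves the Laplacian from \<open>f\<close> to the radial function, where it is an ordinary differential
  operator in \<open>c\<close>.
\<close>

lemma radial_green_identity:
  assumes a: "a \<in> hyp3" and f: "f \<in> test_functions" and e: "(\<lambda>x. \<phi> (hyp_cosh a x)) \<in> elem hyp3"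
    and \<phi>: "\<And>c. 1 \<le> c \<Longrightarrow> DERIV \<phi> c :> \<phi>1 c" and \<phi>1: "\<And>c. 1 \<le> c \<Longrightarrow> DERIV \<phi>1 c :> \<phi>2 c"
  shows "(LINT x|hyp_measure. complex_of_real (\<phi> (hyp_cosh a x)) * helmholtz l f x)
    = (LINT x|hyp_measure. complex_of_real (l * \<phi> (hyp_cosh a x)
         - (((hyp_cosh a x)\<^sup>2 - 1) * \<phi>2 (hyp_cosh a x) + 3 * hyp_cosh a x * \<phi>1 (hyp_cosh a x))) * f x)"
proof -
  obtain K where K: "smooth_on hyp3 f" "compact K" "K \<subseteq> hyp3" "\<And>x. x \<notin> K \<Longrightarrow> f x = 0"
    using test_functionE[OF f] by metis
  let ?v = "\<lambda>x. complex_of_real (\<phi> (hyp_cosh a x))"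
  have sv: "smooth_on hyp3 ?v" by (rule smooth_on_of_real[OF e])
  have cv: "continuous_on hyp3 ?v" "continuous_on hyp3 f"
    by (intro smooth_on_continuous sv K)+
  have i1: "integrable hyp_measure (\<lambda>x. ?v x * f x)"
    by (rule integrable_hyp_compact_support[OF _ K(2,3)]) (auto intro!: continuous_on_mult cv K)
  have i2: "integrable hyp_measure (\<lambda>x. ?v x * hyp_laplacian f x)"
    by (rule integrable_hyp_compact_support[OF _ K(2,3)])
       (auto intro!: continuous_on_mult cv laplacian_continuous K laplacian_zero_outside[OF K(2,4)])
  have i3: "integrable hyp_measure (\<lambda>x. hyp_laplacian ?v x * f x)"
    by (rule integrable_hyp_compact_support[OF _ K(2,3)])
       (auto intro!: continuous_on_mult cv laplacian_continuous sv K)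
  have "(LINT x|hyp_measure. ?v x * helmholtz l f x) = (LINT x|hyp_measure. of_real l * (?v x * f x) - ?v x * hyp_laplacian f x)"
    by (intro Bochner_Integration.integral_cong) (simp_all add: helmholtz_def algebra_simps)
  also have "\<dots> = of_real l * (LINT x|hyp_measure. ?v x * f x) - (LINT x|hyp_measure. ?v x * hyp_laplacian f x)"
    using i1 i2 by simp
  also have "(LINT x|hyp_measure. ?v x * hyp_laplacian f x) = (LINT x|hyp_measure. hyp_laplacian ?v x * f x)"
    by (rule laplacian_symmetric[OF f e])
  also have "of_real l * (LINT x|hyp_measure. ?v x * f x) - (LINT x|hyp_measure. hyp_laplacian ?v x * f x)
      = (LINT x|hyp_measure. of_real l * (?v x * f x) - hyp_laplacian ?v x * f x)"
    using i1 i3 by simp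
  also have "\<dots> = (LINT x|hyp_measure. complex_of_real (l * \<phi> (hyp_cosh a x)
         - (((hyp_cosh a x)\<^sup>2 - 1) * \<phi>2 (hyp_cosh a x) + 3 * hyp_cosh a x * \<phi>1 (hyp_cosh a x))) * f x)"
  proof (intro Bochner_Integration.integral_cong refl)
    fix x assume "x \<in> space hyp_measure"
    then have x: "x \<in> hyp3" by simp
    show "of_real l * (?v x * f x) - hyp_laplacian ?v x * f x = complex_of_real (l * \<phi> (hyp_cosh a x)
         - (((hyp_cosh a x)\<^sup>2 - 1) * \<phi>2 (hyp_cosh a x) + 3 * hyp_cosh a x * \<phi>1 (hyp_cosh a x))) * f x"
      by (subst hyp_laplacian_radial[OF a x \<phi> \<phi>1]) (simp_all add: algebra_simps)
  qed
  finally show ?thesis .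
qed

lemma shc_powr: "1 < c \<Longrightarrow> shc c = (c\<^sup>2 - 1) powr (1 / 2)"
  using shc_facts(5)[of c] by (simp add: shc_def powr_half_sqrt)

lemma shift_green_elem:
  assumes a: "a \<in> hyp3" and e: "0 < e"
  shows "(\<lambda>x. green k (hyp_cosh a x + e)) \<in> elem hyp3"
proof -
  let ?c = "\<lambda>x. hyp_cosh a x + e"
  have gt: "1 < ?c x" if "x \<in> hyp3" for x using hyp_cosh_ge_1[OF a that] e by simp
  have c: "?c \<in> elem hyp3" by (intro elem.add elem.const hyp_cosh_elem a)
  have s: "(\<lambda>x. shc (?c x)) \<in> elem hyp3"
  proof (rule elem.cong)
    show "(\<lambda>x. ((?c x)\<^sup>2 - 1) powr (1 / 2)) \<in> elem hyp3"
      by (intro elem.powr elem_diff elem_power c elem.const) (rule shc_facts(5)[OF gt])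
  qed (rule shc_powr[OF gt])
  have pos: "0 < ?c x + shc (?c x)" if "x \<in> hyp3" for x
    using gt[OF that] shc_facts(1)[OF gt[OF that]] by linarith
  show ?thesis
    unfolding green_def
    by (intro elem_divide elem.powr elem.add c s) (rule pos shc_facts(1)[OF gt], assumption)+
qed

text \<open>
  Points with small \<open>hyp_cosh x y\<close> are close in the Euclidean metric, because \<open>y\<^sub>3\<close> is at most
  \<open>x\<^sub>3 + \<bar>x - y\<bar>\<close>.
\<close>

lemma near_if_hyp_cosh_small:
  assumes x: "x \<in> hyp3" and d: "0 < d"
  obtains a where "1 < a" "\<And>y. y \<in> hyp3 \<Longrightarrow> hyp_cosh x y \<le> a \<Longrightarrow> norm (x - y) < d"
proof
  define p where "p = x $ 3"
  have p: "0 < p" using x by (simp add: p_def hyp3_iff)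
  \<comment> \<open>If \<open>c \<le> a\<close> and \<open>r \<ge> d\<close>, the bound \<open>y\<^sub>3 \<le> p + r\<close> gives \<open>2 r\<^sup>2 (p + d) \<le> d\<^sup>2 (p + r) \<le> r\<^sup>2 (p + d)\<close>.\<close>
  define a where "a = 1 + d\<^sup>2 / (4 * p * (p + d))"
  show "1 < a" using p d by (simp add: a_def)
  fix y assume y: "y \<in> hyp3" and c: "hyp_cosh x y \<le> a"
  define r where "r = norm (x - y)"
  show "norm (x - y) < d"
  proof (rule ccontr)
    assume "\<not> norm (x - y) < d"
    then have r: "d \<le> r" by (simp add: r_def)
    have y3: "0 < y $ 3" using y by (simp add: hyp3_iff)
    have yle: "y $ 3 \<le> p + r" using component_le_norm_cart[of "x - y" 3] by (simp add: p_def r_def)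
    have "r\<^sup>2 / (2 * p * y $ 3) \<le> d\<^sup>2 / (4 * p * (p + d))"
      using c by (simp add: hyp_cosh_def a_def p_def r_def)
    then have "r\<^sup>2 \<le> d\<^sup>2 / (4 * p * (p + d)) * (2 * p * y $ 3)" using p y3 by (simp add: pos_divide_le_eq)
    also have "\<dots> \<le> d\<^sup>2 / (4 * p * (p + d)) * (2 * p * (p + r))"
      using p d yle by (intro mult_left_mono) auto
    also have "\<dots> = d\<^sup>2 * (p + r) / (2 * (p + d))"
    proof -
      have eq: "x / (4 * p * y) * (2 * p * z) = x * z / (2 * y)" if "y \<noteq> 0" for x y z :: real
        using p that by (simp add: divide_simps)
      show ?thesis by (rule eq) (use p d in simp)
    qed
    finally have "r\<^sup>2 * (2 * (p + d)) \<le> d\<^sup>2 * (p + r)" using p d by (simp add: pos_le_divide_eq)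
    moreover have "d\<^sup>2 * (p + r) \<le> r\<^sup>2 * (p + d)"
    proof -
      have "d\<^sup>2 \<le> r\<^sup>2" using r d by (intro power_mono) auto
      then have "d\<^sup>2 * p \<le> r\<^sup>2 * p" using p by (intro mult_right_mono) auto
      moreover have "d\<^sup>2 * r \<le> r\<^sup>2 * d" using r d mult_left_mono[of d r "d * r"] by (simp add: power2_eq_square mult_ac)
      ultimately show ?thesis by (simp add: distrib_left)
    qed
    moreover have "0 < r\<^sup>2 * (p + d)" using r d p by (intro mult_pos_pos) auto
    ultimately show False by (simp add: distrib_left)
  qed
qed

definition eps :: "nat \<Rightarrow> real" where "eps n = 1 / real (Suc n)"

lemma eps: "0 < eps n" "eps \<longlonglongrightarrow> 0"
  unfolding eps_def[abs_def] by (simp, rule LIMSEQ_Suc[OF lim_1_over_n])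

lemma radial_apply_of_real: "radial_apply q f x = (LINT y|hyp_measure. complex_of_real (q (hyp_cosh x y)) * f y)"
  by (simp add: radial_apply_def scaleR_conv_of_real)

context
  fixes k :: real
  assumes k: "1 < k"
begin

lemma shift_green_helmholtz:
  assumes e: "0 < e" and f: "f \<in> test_functions" and x: "x \<in> hyp3"
  shows "radial_apply (\<lambda>c. green k (c + e)) (helmholtz (k\<^sup>2 - 1) f) x = radial_apply (rho k e) f x"
  unfolding radial_apply_of_real rho_def
  by (rule radial_green_identity[OF x f shift_green_elem[OF x e] DERIV_shift_green[OF k e] DERIV_shift_green'[OF k e]])

text \<open>
  The kernels \<open>rho k e\<close> are nonnegative, their masses tend to \<open>4 \<pi>\<close>, and their masses away from the
  diagonal tend to 0.
\<close>

lemma rho_approximate_identity: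
  fixes f :: "real ^ 3 \<Rightarrow> complex"
  assumes en: "\<And>n. 0 < en n" "en \<longlonglongrightarrow> 0" and x: "x \<in> hyp3"
    and f: "continuous_on hyp3 f" "\<And>y. norm (f y) \<le> B"
  shows "(\<lambda>n. radial_apply (rho k (en n)) f x) \<longlonglongrightarrow> complex_of_real (4 * pi) * f x"
proof -
  have [measurable]: "f \<in> borel_measurable hyp_measure" by (rule borel_measurable_continuous_hyp3[OF f(1)])
  have B0: "0 \<le> B" using f(2)[of x] norm_ge_zero order_trans by blast
  let ?r = "\<lambda>n y. rho k (en n) (hyp_cosh x y)"
  have ri: "integrable hyp_measure (?r n)" for n
    using rho_integrable[OF k en(1)] by (simp add: integrable_radial_iff[OF x])
  have rm: "(LINT y|hyp_measure. ?r n y) = (LINT c|radial_measure. rho k (en n) c)" for n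
    by (rule integral_radial[OF x]) simp
  have rf: "integrable hyp_measure (\<lambda>y. complex_of_real (?r n y) * f y)" for n
  proof (rule Bochner_Integration.integrable_bound)
    show "integrable hyp_measure (\<lambda>y. B * ?r n y)" using ri by simp
    show "AE y in hyp_measure. norm (complex_of_real (?r n y) * f y) \<le> norm (B * ?r n y)"
      using f(2) B0 by (intro AE_I2) (simp add: norm_mult abs_mult mult.commute mult_right_mono)
  qed measurable
  have rc: "integrable hyp_measure (\<lambda>y. complex_of_real (?r n y) * f x)" for n using ri by simp
  define I where "I n = (LINT y|hyp_measure. ?r n y)" for n
  have Ilim: "I \<longlonglongrightarrow> 4 * pi" unfolding I_def[abs_def] rm by (rule rho_mass_limit[OF k en])
  have diff: "radial_apply (rho k (en n)) f x - complex_of_real (I n) * f x = (LINT y|hyp_measure. complex_of_real (?r n y) * (f y - f x))" for n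
  proof -
    have "complex_of_real (I n) * f x = (LINT y|hyp_measure. complex_of_real (?r n y) * f x)"
      by (simp add: I_def)
    then show ?thesis unfolding radial_apply_of_real right_diff_distrib using rf rc by simp
  qed
  have "(\<lambda>n. radial_apply (rho k (en n)) f x - complex_of_real (I n) * f x) \<longlonglongrightarrow> 0"
  proof (rule tendstoI)
    fix \<eta> :: real assume \<eta>: "0 < \<eta>"
    have "0 < \<eta> / (8 * pi + 2)" using \<eta> pi_gt_zero by (intro divide_pos_pos add_pos_pos mult_pos_pos) auto
    then obtain d where d: "0 < d" "\<And>y. y \<in> hyp3 \<Longrightarrow> dist y x < d \<Longrightarrow> dist (f y) (f x) < \<eta> / (8 * pi + 2)"
      using f(1) x unfolding continuous_on_iff by metis
    obtain a where a: "1 < a" "\<And>y. y \<in> hyp3 \<Longrightarrow> hyp_cosh x y \<le> a \<Longrightarrow> norm (x - y) < d"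
      by (rule near_if_hyp_cosh_small[OF x d(1)]) blast
    let ?t = "\<lambda>n. LINT c|radial_measure. indicator {a<..} c * rho k (en n) c"
    have bound: "norm (radial_apply (rho k (en n)) f x - complex_of_real (I n) * f x) \<le> \<eta> / (8 * pi + 2) * I n + 2 * B * ?t n" for n
    proof -
      have ti: "integrable radial_measure (\<lambda>c. indicator {a<..} c * rho k (en n) c)"
        using integrable_mult_indicator[OF _ rho_integrable[OF k en(1)], of "{a<..}" n] by simp
      have tm: "(\<lambda>c. indicator {a<..} c * rho k (en n) c) \<in> borel_measurable borel" by measurable
      have ti': "integrable hyp_measure (\<lambda>y. indicator {a<..} (hyp_cosh x y) * ?r n y)"
        using ti unfolding integrable_radial_iff[OF x tm, symmetric] .
      have "norm (LINT y|hyp_measure. complex_of_real (?r n y) * (f y - f x))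
         \<le> (LINT y|hyp_measure. \<eta> / (8 * pi + 2) * ?r n y + 2 * B * (indicator {a<..} (hyp_cosh x y) * ?r n y))"
      proof (rule Bochner_Integration.integral_norm_bound_integral)
        show "integrable hyp_measure (\<lambda>y. complex_of_real (?r n y) * (f y - f x))"
          unfolding right_diff_distrib using rf rc by simp
        show "integrable hyp_measure (\<lambda>y. \<eta> / (8 * pi + 2) * ?r n y + 2 * B * (indicator {a<..} (hyp_cosh x y) * ?r n y))"
          using ri ti' by simp
        fix y assume "y \<in> space hyp_measure"
        then have y: "y \<in> hyp3" by simp
        have r0: "0 \<le> ?r n y" by (rule rho_nonneg[OF k en(1) hyp_cosh_ge_1[OF x y]])
        have "norm (f y - f x) \<le> \<eta> / (8 * pi + 2) + 2 * B * indicator {a<..} (hyp_cosh x y)"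
        proof (cases "hyp_cosh x y \<le> a")
          case True
          then show ?thesis using d(2)[OF y] a(2)[OF y True] by (simp add: dist_norm norm_minus_commute)
        next
          case False
          have "norm (f y - f x) \<le> 2 * B" using norm_triangle_ineq4[of "f y" "f x"] f(2)[of y] f(2)[of x] by linarith
          then show ?thesis using False \<open>0 < \<eta> / (8 * pi + 2)\<close> by simp
        qed
        then have le: "?r n y * norm (f y - f x) \<le> ?r n y * (\<eta> / (8 * pi + 2) + 2 * B * indicator {a<..} (hyp_cosh x y))"
          using r0 by (rule mult_left_mono)
        have "norm (complex_of_real (?r n y) * (f y - f x)) = ?r n y * norm (f y - f x)"
          using r0 by (simp add: norm_mult)
        also note le
        finally show "norm (complex_of_real (?r n y) * (f y - f x)) \<le> \<eta> / (8 * pi + 2) * ?r n y + 2 * B * (indicator {a<..} (hyp_cosh x y) * ?r n y)"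
          by (simp add: algebra_simps)
      qed
      also have "\<dots> = \<eta> / (8 * pi + 2) * I n + 2 * B * (LINT y|hyp_measure. indicator {a<..} (hyp_cosh x y) * ?r n y)"
        using ri ti' by (simp add: I_def)
      also have "(LINT y|hyp_measure. indicator {a<..} (hyp_cosh x y) * ?r n y) = ?t n"
        by (rule integral_radial[OF x tm])
      finally show ?thesis unfolding diff .
    qed
    have "(\<lambda>n. \<eta> / (8 * pi + 2) * I n + 2 * B * ?t n) \<longlonglongrightarrow> \<eta> / (8 * pi + 2) * (4 * pi) + 2 * B * 0"
      by (intro tendsto_intros Ilim rho_tail_limit[OF k en a(1)])
    moreover have "\<eta> / (8 * pi + 2) * (4 * pi) + 2 * B * 0 < \<eta>"
    proof -
      have p: "0 < 8 * pi + 2" "4 * pi < 8 * pi + 2" using pi_gt_zero by linarith+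
      show ?thesis using mult_strict_left_mono[OF p(2) \<eta>] p(1) by (simp only: times_divide_eq_left mult_zero_right add_0_right pos_divide_less_eq)
    qed
    ultimately have "eventually (\<lambda>n. \<eta> / (8 * pi + 2) * I n + 2 * B * ?t n < \<eta>) sequentially"
      by (rule order_tendstoD(2))
    then show "eventually (\<lambda>n. dist (radial_apply (rho k (en n)) f x - complex_of_real (I n) * f x) 0 < \<eta>) sequentially"
    proof eventually_elim
      case (elim n)
      show ?case using le_less_trans[OF bound elim] by (simp add: dist_norm)
    qed
  qed
  moreover have "(\<lambda>n. complex_of_real (I n) * f x) \<longlonglongrightarrow> complex_of_real (4 * pi) * f x"
    by (intro tendsto_intros Ilim)
  ultimately have "(\<lambda>n. (radial_apply (rho k (en n)) f x - complex_of_real (I n) * f x) + complex_of_real (I n) * f x) \<longlonglongrightarrow> 0 + complex_of_real (4 * pi) * f x"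
    by (rule tendsto_add)
  then show ?thesis by simp
qed

text \<open>
  The identity \<open>shift_green_helmholtz\<close> in the limit \<open>e \<longlonglongrightarrow> 0\<close>: the shifted Green functions are dominated
  by the Green function, and \<open>rho k e\<close> is an approximate identity.
\<close>

theorem green_representation:
  assumes f: "f \<in> test_functions" and x: "x \<in> hyp3"
  shows "radial_apply (green k) (helmholtz (k\<^sup>2 - 1) f) x = complex_of_real (4 * pi) * f x"
proof -
  let ?h = "helmholtz (k\<^sup>2 - 1) f"
  obtain K where K: "smooth_on hyp3 f" "compact K" "K \<subseteq> hyp3" "\<And>x. x \<notin> K \<Longrightarrow> f x = 0"
    using test_functionE[OF f] by metis
  obtain Bf where Bf: "0 \<le> Bf" "\<And>y. norm (f y) \<le> Bf"
    using bounded_of_compact_support[OF smooth_on_continuous[OF K(1)] K(2,3,4)] by blast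
  obtain B where B: "0 \<le> B" "\<And>y. norm (?h y) \<le> B" by (rule helmholtz_bounded[OF f]) blast
  have [measurable]: "?h \<in> borel_measurable hyp_measure"
    by (rule borel_measurable_continuous_hyp3[OF helmholtz_continuous[OF f]])
  note AE1 = AE_hyp_cosh_gt_1[OF x]
  have "(\<lambda>n. LINT y|hyp_measure. green k (hyp_cosh x y + eps n) *\<^sub>R ?h y) \<longlonglongrightarrow> (LINT y|hyp_measure. green k (hyp_cosh x y) *\<^sub>R ?h y)"
  proof (rule integral_dominated_convergence)
    show "integrable hyp_measure (\<lambda>y. B * green k (hyp_cosh x y))"
      using green_integral(1)[OF k] by (simp add: integrable_radial_iff[OF x])
    show "AE y in hyp_measure. (\<lambda>n. green k (hyp_cosh x y + eps n) *\<^sub>R ?h y) \<longlonglongrightarrow> green k (hyp_cosh x y) *\<^sub>R ?h y"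
      using AE1
    proof eventually_elim
      case (elim y)
      have "(\<lambda>n. hyp_cosh x y + eps n) \<longlonglongrightarrow> hyp_cosh x y" using tendsto_add[OF tendsto_const eps(2), of "hyp_cosh x y"] by simp
      then have "(\<lambda>n. green k (hyp_cosh x y + eps n)) \<longlonglongrightarrow> green k (hyp_cosh x y)"
        by (rule isCont_tendsto_compose[OF green_continuous[OF k elim]])
      then show ?case by (intro tendsto_intros)
    qed
    show "AE y in hyp_measure. norm (green k (hyp_cosh x y + eps n) *\<^sub>R ?h y) \<le> B * green k (hyp_cosh x y)" for n
      using AE1
    proof eventually_elim
      case (elim y)
      have "green k (hyp_cosh x y + eps n) \<le> green k (hyp_cosh x y)" "0 \<le> green k (hyp_cosh x y + eps n)"
        using green_antimono[OF k elim, of "hyp_cosh x y + eps n"] green_pos[OF k, of "hyp_cosh x y + eps n"] elim eps(1)[of n] by auto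
      then show ?case using B by (simp add: mult.commute[of B]) (intro mult_mono, auto)
    qed
  qed measurable
  moreover have "(LINT y|hyp_measure. green k (hyp_cosh x y + eps n) *\<^sub>R ?h y) = radial_apply (rho k (eps n)) f x" for n
    using shift_green_helmholtz[OF eps(1) f x] by (simp add: radial_apply_def)
  ultimately have "(\<lambda>n. radial_apply (rho k (eps n)) f x) \<longlonglongrightarrow> radial_apply (green k) ?h x"
    by (simp add: radial_apply_def)
  moreover have "(\<lambda>n. radial_apply (rho k (eps n)) f x) \<longlonglongrightarrow> complex_of_real (4 * pi) * f x"
    by (rule rho_approximate_identity[OF eps x smooth_on_continuous[OF K(1)] Bf(2)])
  ultimately show ?thesis by (rule LIMSEQ_unique)
qed

end

section \<open>Essential self-adjointness\<close>

text \<open>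
  Smooth, supported in \<open>c \<le> n + 1\<close>, and increasing to 1 with \<open>n\<close>.  The factor \<open>exp 1\<close> normalises the
  limit, as \<open>bump 1 1 = exp (- 1)\<close>.
\<close>

definition cutoff :: "nat \<Rightarrow> real \<Rightarrow> real" where
  "cutoff n c = exp 1 * bump 1 (1 - c / real (Suc n))"

definition cutoff' :: "nat \<Rightarrow> real \<Rightarrow> real" where
  "cutoff' n c = - (exp 1 * bump ([:0, 0, 1:] * (1 - pderiv 1)) (1 - c / real (Suc n)) / real (Suc n))"

definition cutoff'' :: "nat \<Rightarrow> real \<Rightarrow> real" where
  "cutoff'' n c = exp 1 * bump ([:0, 0, 1:] * ([:0, 0, 1:] * (1 - pderiv 1) - pderiv ([:0, 0, 1:] * (1 - pderiv 1)))) (1 - c / real (Suc n)) / (real (Suc n))\<^sup>2"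

lemma bump_measurable [measurable]: "bump p \<in> borel_measurable borel"
  by (intro borel_measurable_continuous_onI bump_continuous)

lemma cutoff_measurable [measurable]: "cutoff n \<in> borel_measurable borel" "cutoff' n \<in> borel_measurable borel" "cutoff'' n \<in> borel_measurable borel"
  unfolding cutoff_def[abs_def] cutoff'_def[abs_def] cutoff''_def[abs_def] by measurable

lemma green'_measurable [measurable]: "green' k \<in> borel_measurable borel"
  unfolding green'_def[abs_def] by measurable

lemma DERIV_bump_scaled:
  "DERIV (\<lambda>c. bump p (1 - c / real (Suc n))) c :> - (bump ([:0, 0, 1:] * (p - pderiv p)) (1 - c / real (Suc n)) / real (Suc n))"
proof -
  have "DERIV (\<lambda>c. 1 - c / real (Suc n)) c :> 0 - 1 / real (Suc n)"
    by (intro DERIV_diff DERIV_const DERIV_cdivide DERIV_ident)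
  from DERIV_chain2[OF bump_DERIV this] show ?thesis by (rule DERIV_cong) simp
qed

lemma DERIV_cutoff: "DERIV (cutoff n) c :> cutoff' n c"
  unfolding cutoff_def[abs_def] cutoff'_def
  by (rule DERIV_cong[OF DERIV_cmult[OF DERIV_bump_scaled]]) simp

lemma DERIV_cutoff': "DERIV (cutoff' n) c :> cutoff'' n c"
  unfolding cutoff''_def cutoff'_def[abs_def]
  by (rule DERIV_cong[OF DERIV_minus[OF DERIV_cdivide[OF DERIV_cmult[OF DERIV_bump_scaled]]]]) (simp add: power2_eq_square)

lemma bump_nonpos: "x \<le> 0 \<Longrightarrow> bump p x = 0"
  by (simp add: bump_def)

text \<open>
  Since \<open>c\<close> is at most \<open>n + 1\<close> on the support, each derivative of the cutoff gains a factor \<open>1 / c\<close>,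
  uniformly in \<open>n\<close>.
\<close>

lemma cutoff_bounds:
  obtains M where "0 \<le> M" "\<And>n c. 1 \<le> c \<Longrightarrow> \<bar>cutoff n c\<bar> \<le> M" "\<And>n c. 1 \<le> c \<Longrightarrow> c * \<bar>cutoff' n c\<bar> \<le> M"
    "\<And>n c. 1 \<le> c \<Longrightarrow> c\<^sup>2 * \<bar>cutoff'' n c\<bar> \<le> M"
proof -
  have bd: "\<exists>B\<ge>0. \<forall>x\<le>1. \<bar>bump p x\<bar> \<le> B" for p
  proof -
    obtain B where B: "\<forall>x\<le>1. \<bar>bump p x\<bar> \<le> B" using bump_bounded_below by blast
    then have "0 \<le> B" by (metis abs_ge_zero order_trans order_refl)
    then show ?thesis using B by blast
  qed
  have main: "(c / real (Suc n)) ^ j * \<bar>bump p (1 - c / real (Suc n))\<bar> \<le> B"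
    if "1 \<le> c" "0 \<le> B" "\<forall>x\<le>1. \<bar>bump p x\<bar> \<le> B" for c n j p B
  proof (cases "c / real (Suc n) \<le> 1")
    case True
    have "(c / real (Suc n)) ^ j * \<bar>bump p (1 - c / real (Suc n))\<bar> \<le> 1 * B"
      using that True by (intro mult_mono power_le_one) auto
    then show ?thesis by simp
  next
    case False
    then show ?thesis using that by (simp add: bump_nonpos)
  qed
  let ?p1 = "[:0, 0, 1:] * (1 - pderiv 1) :: real poly"
  let ?p2 = "[:0, 0, 1:] * (?p1 - pderiv ?p1) :: real poly"
  obtain B0 where B0: "0 \<le> B0" "\<forall>x\<le>1. \<bar>bump 1 x\<bar> \<le> B0" using bd by blast
  obtain B1 where B1: "0 \<le> B1" "\<forall>x\<le>1. \<bar>bump ?p1 x\<bar> \<le> B1" using bd by blast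
  obtain B2 where B2: "0 \<le> B2" "\<forall>x\<le>1. \<bar>bump ?p2 x\<bar> \<le> B2" using bd by blast
  define M where "M = exp 1 * (B0 + B1 + B2)"
  have M: "exp 1 * B0 \<le> M" "exp 1 * B1 \<le> M" "exp 1 * B2 \<le> M"
    unfolding M_def using B0 B1 B2 by (auto intro!: mult_left_mono)
  show ?thesis
  proof (rule that[of M])
    show "0 \<le> M" unfolding M_def using B0 B1 B2 by simp
    fix n :: nat and c :: real assume c: "1 \<le> c"
    have "\<bar>cutoff n c\<bar> = exp 1 * ((c / real (Suc n)) ^ 0 * \<bar>bump 1 (1 - c / real (Suc n))\<bar>)"
      by (simp add: cutoff_def abs_mult del: of_nat_Suc)
    also have "\<dots> \<le> exp 1 * B0" by (intro mult_left_mono main c B0) simp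
    finally show "\<bar>cutoff n c\<bar> \<le> M" using M by linarith
    have "c * \<bar>cutoff' n c\<bar> = exp 1 * ((c / real (Suc n)) ^ 1 * \<bar>bump ?p1 (1 - c / real (Suc n))\<bar>)"
      by (simp only: cutoff'_def abs_mult abs_minus_cancel abs_divide abs_exp_cancel abs_of_nat power_one_right times_divide_eq_left times_divide_eq_right mult_ac)
    also have "\<dots> \<le> exp 1 * B1" by (intro mult_left_mono main c B1) simp
    finally show "c * \<bar>cutoff' n c\<bar> \<le> M" using M by linarith
    have "c\<^sup>2 * \<bar>cutoff'' n c\<bar> = exp 1 * ((c / real (Suc n)) ^ 2 * \<bar>bump ?p2 (1 - c / real (Suc n))\<bar>)"
      by (simp only: cutoff''_def power_divide abs_mult abs_divide abs_exp_cancel abs_of_nat abs_power2 times_divide_eq_left times_divide_eq_right mult_ac)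
    also have "\<dots> \<le> exp 1 * B2" by (intro mult_left_mono main c B2) simp
    finally show "c\<^sup>2 * \<bar>cutoff'' n c\<bar> \<le> M" using M by linarith
  qed
qed

lemma cutoff_zero: "real (Suc n) \<le> c \<Longrightarrow> cutoff n c = 0"
  by (simp add: cutoff_def bump_nonpos del: of_nat_Suc)

lemma scaled_arg_limit: "(\<lambda>n. 1 - c / real (Suc n)) \<longlonglongrightarrow> (1::real)"
proof -
  have "(\<lambda>n. c * (1 / real (Suc n))) \<longlonglongrightarrow> c * 0"
    by (intro tendsto_intros LIMSEQ_Suc[OF lim_1_over_n])
  then have "(\<lambda>n. 1 - c * (1 / real (Suc n))) \<longlonglongrightarrow> 1 - c * 0" by (rule tendsto_diff[OF tendsto_const])
  then show ?thesis by (simp only: mult_zero_right diff_zero times_divide_eq_right mult_1_right)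
qed

lemma bump_scaled_limit: "(\<lambda>n. bump p (1 - c / real (Suc n))) \<longlonglongrightarrow> bump p 1"
  by (rule isCont_tendsto_compose[OF DERIV_isCont[OF bump_DERIV] scaled_arg_limit])

lemma cutoff_limits:
  "(\<lambda>n. cutoff n c) \<longlonglongrightarrow> 1" "(\<lambda>n. cutoff' n c) \<longlonglongrightarrow> 0" "(\<lambda>n. cutoff'' n c) \<longlonglongrightarrow> 0"
proof -
  have inv: "(\<lambda>n. 1 / real (Suc n)) \<longlonglongrightarrow> 0" by (rule LIMSEQ_Suc[OF lim_1_over_n])
  have "(\<lambda>n. cutoff n c) \<longlonglongrightarrow> exp 1 * bump 1 1"
    unfolding cutoff_def by (intro tendsto_intros bump_scaled_limit)
  moreover have "exp 1 * bump 1 1 = (1::real)" by (simp add: bump_def exp_minus)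
  ultimately show "(\<lambda>n. cutoff n c) \<longlonglongrightarrow> 1" by simp
  have "(\<lambda>n. - (exp 1 * bump p (1 - c / real (Suc n)) * (1 / real (Suc n)))) \<longlonglongrightarrow> - (exp 1 * bump p 1 * 0)" for p
    by (intro tendsto_intros bump_scaled_limit inv)
  then show "(\<lambda>n. cutoff' n c) \<longlonglongrightarrow> 0" unfolding cutoff'_def by simp
  have "(\<lambda>n. exp 1 * bump p (1 - c / real (Suc n)) * (1 / real (Suc n))\<^sup>2) \<longlonglongrightarrow> exp 1 * bump p 1 * 0\<^sup>2" for p
    by (intro tendsto_intros bump_scaled_limit inv)
  then show "(\<lambda>n. cutoff'' n c) \<longlonglongrightarrow> 0" unfolding cutoff''_def by (simp add: power_divide)
qed

lemma integral_zero_if_orthogonal: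
  assumes g: "square_integrable g" and h: "square_integrable (\<lambda>x. complex_of_real (h x))"
    and o1: "abs_hyp_L2 g \<bullet> abs_hyp_L2 (\<lambda>x. complex_of_real (h x)) = 0"
    and o2: "abs_hyp_L2 g \<bullet> abs_hyp_L2 (\<lambda>x. \<i> * complex_of_real (h x)) = 0"
    and i: "integrable hyp_measure (\<lambda>x. complex_of_real (h x) * g x)"
  shows "(LINT x|hyp_measure. complex_of_real (h x) * g x) = 0"
proof (rule complex_eqI)
  have "Re (LINT x|hyp_measure. complex_of_real (h x) * g x) = (LINT x|hyp_measure. Re (complex_of_real (h x) * g x))"
    by (rule integral_Re[OF i, symmetric])
  also have "\<dots> = (LINT x|hyp_measure. g x \<bullet> complex_of_real (h x))"
    by (intro Bochner_Integration.integral_cong) (simp_all add: inner_complex_def mult.commute)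
  finally show "Re (LINT x|hyp_measure. complex_of_real (h x) * g x) = Re 0" using o1 abs_inner[OF g h] by simp
  have "Im (LINT x|hyp_measure. complex_of_real (h x) * g x) = (LINT x|hyp_measure. Im (complex_of_real (h x) * g x))"
    by (rule integral_Im[OF i, symmetric])
  also have "\<dots> = (LINT x|hyp_measure. g x \<bullet> (\<i> * complex_of_real (h x)))"
    by (intro Bochner_Integration.integral_cong) (simp_all add: inner_complex_def mult.commute)
  finally show "Im (LINT x|hyp_measure. complex_of_real (h x) * g x) = Im 0"
    using o2 abs_inner[OF g square_integrable_scale[OF h, of \<i>]] by simp
qed

lemma helmholtz_lincomb:
  assumes f: "f \<in> test_functions" and g: "g \<in> test_functions" and x: "x \<in> hyp3"
  shows "helmholtz l (\<lambda>x. a * f x + b * g x) x = a * helmholtz l f x + b * helmholtz l g x"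
proof -
  have "smooth_on hyp3 f" "smooth_on hyp3 g" using f g by (auto simp: test_functions_def)
  then show ?thesis unfolding helmholtz_def by (simp add: hyp_laplacian_lincomb x algebra_simps)
qed

lemma hyp_laplacian_cong:
  assumes x: "x \<in> hyp3" and eq: "\<And>y. y \<in> hyp3 \<Longrightarrow> f y = g y"
  shows "hyp_laplacian f x = hyp_laplacian g x"
proof -
  have p: "pderiv_at i f y = pderiv_at i g y" if "y \<in> hyp3" for i y
    by (rule pderiv_at_cong[OF open_hyp3 that eq])
  have "pderiv_at i (\<lambda>y. of_real (1 / y $ 3) * pderiv_at i f y) x = pderiv_at i (\<lambda>y. of_real (1 / y $ 3) * pderiv_at i g y) x" for i
    by (rule pderiv_at_cong[OF open_hyp3 x]) (simp add: p)
  then show ?thesis by (simp add: hyp_laplacian_def)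
qed

lemma square_integrable_cong:
  assumes "square_integrable f" "\<And>x. x \<in> hyp3 \<Longrightarrow> g x = f x"
  shows "square_integrable g"
proof -
  have "(g \<in> borel_measurable hyp_measure) = (f \<in> borel_measurable hyp_measure)"
    by (rule measurable_cong) (simp add: assms(2))
  moreover have "integrable hyp_measure (\<lambda>x. (norm (g x))\<^sup>2) = integrable hyp_measure (\<lambda>x. (norm (f x))\<^sup>2)"
    by (rule Bochner_Integration.integrable_cong[OF refl]) (simp add: assms(2))
  ultimately show ?thesis using assms(1) by (simp add: square_integrable_def)
qed

context
  fixes k :: real
  assumes k: "1 < k"
begin

text \<open>
  Since \<open>- green' / green = (k shc c + c) / (c\<^sup>2 - 1)\<close> decays like \<open>1 / c\<close>.  The shift by \<open>e\<close> keeps the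
  denominator away from 0.
\<close>

lemma weighted_green'_bound:
  assumes e: "0 < e" obtains C where "0 \<le> C" "\<And>c. 1 \<le> c \<Longrightarrow> c * \<bar>green' k (c + e)\<bar> \<le> C * green k (c + e)"
proof -
  define D where "D = (1 + e)\<^sup>2 - 1"
  have D: "0 < D" using e shc_facts(5)[of "1 + e"] by (simp add: D_def)
  have main: "c * \<bar>green' k (c + e)\<bar> \<le> ((k + 1) * (1 + 1 / D)) * green k (c + e)" if c: "1 \<le> c" for c
  proof -
    define d where "d = c + e"
    have d: "1 < d" "1 + e \<le> d" "c \<le> d" using c e by (auto simp: d_def)
    note s = shc_facts[OF d(1)]
    have g: "0 < green k d" by (rule green_pos[OF k d(1)])
    have "D \<le> d\<^sup>2 - 1" unfolding D_def using d e by (simp add: power_mono)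
    then have "D + 1 \<le> d\<^sup>2" by simp
    have "d * (k * shc d + d) \<le> d * (k * d + d)" using s d k by (intro mult_left_mono add_right_mono) auto
    also have "\<dots> = (k + 1) * d\<^sup>2" by (simp add: power2_eq_square algebra_simps)
    also have "\<dots> \<le> (k + 1) * ((1 + 1 / D) * (d\<^sup>2 - 1))"
    proof (intro mult_left_mono)
      have "1 \<le> (d\<^sup>2 - 1) / D" using D \<open>D \<le> d\<^sup>2 - 1\<close> by simp
      then show "d\<^sup>2 \<le> (1 + 1 / D) * (d\<^sup>2 - 1)" by (simp add: algebra_simps diff_divide_distrib)
    qed (use k in simp)
    finally have b: "d * (k * shc d + d) \<le> ((k + 1) * (1 + 1 / D)) * (shc d)\<^sup>2" by (simp add: s(2) mult.assoc)
    have "\<bar>green' k d\<bar> = - green' k d" using green'_neg[OF k d(1)] by simp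
    also have "\<dots> = green k d * ((k * shc d + d) / (shc d)\<^sup>2)"
      using s(1) by (simp add: green'_def green_def power3_eq_cube power2_eq_square mult_ac)
    finally have eq: "\<bar>green' k d\<bar> = green k d * ((k * shc d + d) / (shc d)\<^sup>2)" .
    have "c * \<bar>green' k d\<bar> \<le> d * \<bar>green' k d\<bar>" using d by (intro mult_right_mono) auto
    also have "\<dots> = green k d * (d * (k * shc d + d) / (shc d)\<^sup>2)" by (simp add: eq)
    also have "\<dots> \<le> green k d * ((k + 1) * (1 + 1 / D))"
      using b s(1) g by (intro mult_left_mono) (simp_all add: pos_divide_le_eq)
    finally show ?thesis by (simp add: d_def mult.commute)
  qed
  show ?thesis using that[of "(k + 1) * (1 + 1 / D)"] main k D by simp
qed

text \<open>
  The function \<open>x \<mapsto> green k (c(a, x) + e)\<close> is smooth but not a test function.  Multiplied by a cutoff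
  it is one, and \<open>(k\<^sup>2 - 1) - \<Delta>\<close> maps the product to \<open>L n (c(a, x))\<close>, where \<open>L n\<close> is dominated by an
  integrable function and converges to \<open>rho k e\<close>.  Hence \<open>rho k e (c(a, x))\<close> integrates to 0 against
  \<open>g\<close> for almost every \<open>a\<close>.
\<close>

lemma orthogonal_complement_rho:
  assumes g: "square_integrable g" and e: "0 < e"
    and orth: "\<And>f. f \<in> test_functions \<Longrightarrow> abs_hyp_L2 g \<bullet> abs_hyp_L2 (helmholtz (k\<^sup>2 - 1) f) = 0"
  shows "radial_op (rho k e) (abs_hyp_L2 g) = 0"
proof -
  let ?G = "\<lambda>c. green k (c + e)" and ?G1 = "\<lambda>c. green' k (c + e)" and ?G2 = "\<lambda>c. green'' k (c + e)"
  have gm: "g \<in> borel_measurable hyp_measure" using g by (rule square_integrable_measurable)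
  obtain M where M: "0 \<le> M" "\<And>n c. 1 \<le> c \<Longrightarrow> \<bar>cutoff n c\<bar> \<le> M" "\<And>n c. 1 \<le> c \<Longrightarrow> c * \<bar>cutoff' n c\<bar> \<le> M"
    "\<And>n c. 1 \<le> c \<Longrightarrow> c\<^sup>2 * \<bar>cutoff'' n c\<bar> \<le> M" by (rule cutoff_bounds) blast
  obtain C where C: "0 \<le> C" "\<And>c. 1 \<le> c \<Longrightarrow> c * \<bar>?G1 c\<bar> \<le> C * ?G c" by (rule weighted_green'_bound[OF e]) blast
  define \<phi> where "\<phi> n c = cutoff n c * ?G c" for n c
  define \<phi>1 where "\<phi>1 n c = cutoff' n c * ?G c + cutoff n c * ?G1 c" for n c
  define \<phi>2 where "\<phi>2 n c = (cutoff'' n c * ?G c + cutoff' n c * ?G1 c) + (cutoff' n c * ?G1 c + cutoff n c * ?G2 c)" for n c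
  have D1: "DERIV (\<phi> n) c :> \<phi>1 n c" if "1 \<le> c" for n c
    unfolding \<phi>_def[abs_def] \<phi>1_def
    by (rule DERIV_cong[OF DERIV_mult[OF DERIV_cutoff DERIV_shift_green[OF k e that]]]) (simp add: mult.commute)
  have D2: "DERIV (\<phi>1 n) c :> \<phi>2 n c" if "1 \<le> c" for n c
    unfolding \<phi>1_def[abs_def] \<phi>2_def
    by (rule DERIV_cong[OF DERIV_add[OF DERIV_mult[OF DERIV_cutoff' DERIV_shift_green[OF k e that]] DERIV_mult[OF DERIV_cutoff DERIV_shift_green'[OF k e that]]]])
       (simp add: algebra_simps)
  define L where "L n c = (k\<^sup>2 - 1) * \<phi> n c - ((c\<^sup>2 - 1) * \<phi>2 n c + 3 * c * \<phi>1 n c)" for n c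
  have Leq: "L n c = cutoff n c * rho k e c - 2 * ((c\<^sup>2 - 1) * cutoff' n c * ?G1 c) - (c\<^sup>2 - 1) * cutoff'' n c * ?G c - 3 * c * cutoff' n c * ?G c" for n c
    unfolding L_def \<phi>_def \<phi>1_def \<phi>2_def rho_def by (simp add: algebra_simps)
  define Dom where "Dom c = M * rho k e c + (2 * M * C + 4 * M) * ?G c" for c
  have Gpos: "0 < ?G c" if "1 \<le> c" for c using green_pos[OF k, of "c + e"] e that by simp
  have bound: "\<bar>L n c\<bar> \<le> Dom c" if c: "1 \<le> c" for n c
  proof -
    have cc: "0 \<le> c\<^sup>2 - 1" "c\<^sup>2 - 1 \<le> c\<^sup>2" using c by (auto simp: one_le_power)
    have a: "\<bar>cutoff n c * rho k e c\<bar> \<le> M * rho k e c"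
      using M(2)[OF c] rho_nonneg[OF k e c] by (simp add: abs_mult mult_right_mono)
    have "\<bar>(c\<^sup>2 - 1) * cutoff' n c * ?G1 c\<bar> \<le> c\<^sup>2 * \<bar>cutoff' n c\<bar> * \<bar>?G1 c\<bar>"
      using cc by (simp add: abs_mult mult_right_mono)
    also have "\<dots> = (c * \<bar>cutoff' n c\<bar>) * (c * \<bar>?G1 c\<bar>)" by (simp add: power2_eq_square)
    also have "\<dots> \<le> M * (C * ?G c)" using M(1) c by (intro mult_mono M(3) C(2)) auto
    finally have b: "\<bar>(c\<^sup>2 - 1) * cutoff' n c * ?G1 c\<bar> \<le> M * (C * ?G c)" .
    have "\<bar>(c\<^sup>2 - 1) * cutoff'' n c * ?G c\<bar> \<le> c\<^sup>2 * \<bar>cutoff'' n c\<bar> * \<bar>?G c\<bar>"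
      using cc by (simp add: abs_mult mult_right_mono)
    also have "\<dots> \<le> M * ?G c" using M(4)[OF c] Gpos[OF c] by (simp add: mult_right_mono)
    finally have d: "\<bar>(c\<^sup>2 - 1) * cutoff'' n c * ?G c\<bar> \<le> M * ?G c" .
    have "\<bar>3 * c * cutoff' n c * ?G c\<bar> = 3 * (c * \<bar>cutoff' n c\<bar> * ?G c)" using c Gpos[OF c] by (simp add: abs_mult)
    also have "\<dots> \<le> 3 * (M * ?G c)" using M(3)[OF c] Gpos[OF c] by (simp add: mult_right_mono)
    finally have f: "\<bar>3 * c * cutoff' n c * ?G c\<bar> \<le> 3 * (M * ?G c)" .
    have "\<bar>L n c\<bar> \<le> M * rho k e c + 2 * (M * (C * ?G c)) + M * ?G c + 3 * (M * ?G c)"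
      unfolding Leq using a b d f by linarith
    also have "\<dots> = Dom c" by (simp add: Dom_def algebra_simps)
    finally show ?thesis .
  qed
  have Dom: "integrable radial_measure Dom"
    unfolding Dom_def[abs_def] using rho_integrable[OF k e] shift_green_integrable[OF k e] by simp
  have Llim: "(\<lambda>n. L n c) \<longlonglongrightarrow> rho k e c" for c
  proof -
    have "(\<lambda>n. L n c) \<longlonglongrightarrow> 1 * rho k e c - 2 * ((c\<^sup>2 - 1) * 0 * ?G1 c) - (c\<^sup>2 - 1) * 0 * ?G c - 3 * c * 0 * ?G c"
      unfolding Leq by (intro tendsto_intros cutoff_limits)
    then show ?thesis by simp
  qed
  have [measurable]: "L n \<in> borel_measurable borel" for n
    unfolding Leq[abs_def] by measurable
  have orthL: "(LINT x|hyp_measure. complex_of_real (L n (hyp_cosh a x)) * g x) = 0"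
    if a: "a \<in> hyp3" and i: "integrable hyp_measure (\<lambda>x. complex_of_real (L n (hyp_cosh a x)) * g x)" for n a
  proof -
    define K where "K = {x \<in> hyp3. hyp_cosh a x \<le> real (Suc n)}"
    \<comment> \<open>Outside the half space the formula for \<open>hyp_cosh a x\<close> can take small values, so the extension by 0 is made explicit.\<close>
    define f where "f x = (if x \<in> hyp3 then \<phi> n (hyp_cosh a x) else 0)" for x
    have "(\<lambda>x. \<phi> n (hyp_cosh a x)) \<in> elem hyp3"
      unfolding \<phi>_def cutoff_def
      by (intro elem.mult elem.const elem.bump elem_diff elem_divide hyp_cosh_elem[OF a] shift_green_elem[OF a e]) (simp del: of_nat_Suc)
    then have "f \<in> elem hyp3" by (rule elem.cong) (simp add: f_def)
    moreover have "f x = 0" if "x \<notin> K" for x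
      using that cutoff_zero[of n "hyp_cosh a x"] by (auto simp: f_def K_def \<phi>_def simp del: of_nat_Suc)
    ultimately have test: "(\<lambda>x. complex_of_real (f x)) \<in> test_functions"
      using compact_hyp_cball[OF a, of "real (Suc n)"] by (intro elem_test_function[of _ K]) (auto simp: K_def)
    have lap: "helmholtz (k\<^sup>2 - 1) (\<lambda>x. complex_of_real (f x)) x = complex_of_real (L n (hyp_cosh a x))" if x: "x \<in> hyp3" for x
    proof -
      have "hyp_laplacian (\<lambda>x. complex_of_real (f x)) x = hyp_laplacian (\<lambda>x. complex_of_real (\<phi> n (hyp_cosh a x))) x"
        by (rule hyp_laplacian_cong[OF x]) (simp add: f_def)
      also have "\<dots> = complex_of_real (((hyp_cosh a x)\<^sup>2 - 1) * \<phi>2 n (hyp_cosh a x) + 3 * hyp_cosh a x * \<phi>1 n (hyp_cosh a x))"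
        by (rule hyp_laplacian_radial[OF a x D1 D2])
      finally show ?thesis unfolding helmholtz_def L_def using x by (simp add: f_def)
    qed
    \<comment> \<open>The multiples by \<open>z = 1\<close> and \<open>z = \<i>\<close> give the real and the imaginary part of the integral.\<close>
    have sc: "square_integrable (helmholtz (k\<^sup>2 - 1) (\<lambda>x. z * complex_of_real (f x) + 0 * complex_of_real (f x)))" for z
      by (intro helmholtz_square_integrable test_functions_lincomb test)
    have hz: "helmholtz (k\<^sup>2 - 1) (\<lambda>x. z * complex_of_real (f x) + 0 * complex_of_real (f x)) x = z * complex_of_real (L n (hyp_cosh a x))"
      if "x \<in> hyp3" for x z
      using helmholtz_lincomb[OF test test that, of "k\<^sup>2 - 1" z 0] lap[OF that] by simp
    have sL: "square_integrable (\<lambda>x. z * complex_of_real (L n (hyp_cosh a x)))" for z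
      by (rule square_integrable_cong[OF sc[of z] hz[symmetric]])
    have eq: "abs_hyp_L2 (\<lambda>x. z * complex_of_real (L n (hyp_cosh a x)))
       = abs_hyp_L2 (helmholtz (k\<^sup>2 - 1) (\<lambda>x. z * complex_of_real (f x) + 0 * complex_of_real (f x)))" for z
      unfolding abs_eq_iff[OF sL sc] by (rule AE_I2) (rule hz[symmetric], simp only: space_hyp_measure)
    have o: "abs_hyp_L2 g \<bullet> abs_hyp_L2 (\<lambda>x. z * complex_of_real (L n (hyp_cosh a x))) = 0" for z
      unfolding eq by (intro orth test_functions_lincomb test)
    show ?thesis
      using integral_zero_if_orthogonal[OF g _ _ o[of \<i>] i] sL[of 1] o[of 1] by simp
  qed
  have Dg: "AE a in hyp_measure. integrable hyp_measure (\<lambda>x. Dom (hyp_cosh a x) *\<^sub>R g x)"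
    by (rule schur_AE_integrable[OF Dom g])
  have "AE a in hyp_measure. radial_apply (rho k e) g a = 0"
    using Dg AE_hyp_measure_in
  proof eventually_elim
    case (elim a)
    have lim: "(\<lambda>n. LINT x|hyp_measure. complex_of_real (L n (hyp_cosh a x)) * g x) \<longlonglongrightarrow> (LINT x|hyp_measure. complex_of_real (rho k e (hyp_cosh a x)) * g x)"
      and int: "integrable hyp_measure (\<lambda>x. complex_of_real (L n (hyp_cosh a x)) * g x)" for n
    proof -
      have b: "AE x in hyp_measure. norm (complex_of_real (L n (hyp_cosh a x)) * g x) \<le> norm (Dom (hyp_cosh a x) *\<^sub>R g x)" for n
        using AE_hyp_measure_in
      proof eventually_elim
        case (elim x)
        have "\<bar>L n (hyp_cosh a x)\<bar> \<le> \<bar>Dom (hyp_cosh a x)\<bar>"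
          using bound[OF hyp_cosh_ge_1[OF \<open>a \<in> hyp3\<close> elim], of n] by linarith
        then show ?case by (simp add: norm_mult mult_right_mono)
      qed
      note [measurable] = gm
      show "integrable hyp_measure (\<lambda>x. complex_of_real (L n (hyp_cosh a x)) * g x)"
        by (rule Bochner_Integration.integrable_bound[OF elim(1) _ b]) measurable
      show "(\<lambda>n. LINT x|hyp_measure. complex_of_real (L n (hyp_cosh a x)) * g x) \<longlonglongrightarrow> (LINT x|hyp_measure. complex_of_real (rho k e (hyp_cosh a x)) * g x)"
      proof (rule integral_dominated_convergence[OF _ _ integrable_norm[OF elim(1)] _ b])
        show "AE x in hyp_measure. (\<lambda>n. complex_of_real (L n (hyp_cosh a x)) * g x) \<longlonglongrightarrow> complex_of_real (rho k e (hyp_cosh a x)) * g x"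
          by (intro AE_I2 tendsto_intros Llim)
      qed measurable
    qed
    show ?case
      using lim unfolding radial_apply_of_real orthL[OF elim(2) int] by (simp add: LIMSEQ_const_iff)
  qed
  then have "abs_hyp_L2 (radial_apply (rho k e) g) = abs_hyp_L2 (\<lambda>x. 0)"
    using abs_eq_iff[OF radial_apply_square_integrable[OF rho_integrable[OF k e] g] square_integrable_zero] by simp
  then show ?thesis by (simp add: radial_op_abs[OF rho_integrable[OF k e] g] abs_zero)
qed

lemma scaled_green_integrable: "integrable radial_measure (\<lambda>c. 1 / (4 * pi) * green k c)"
  using green_integral(1)[OF k] by simp

lemma radial_op_green_helmholtz:
  assumes f: "f \<in> test_functions"
  shows "radial_op (green k) (abs_hyp_L2 (helmholtz (k\<^sup>2 - 1) f)) = (4 * pi) *\<^sub>R abs_hyp_L2 f"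
proof -
  have sf: "square_integrable f" by (rule test_function_square_integrable[OF f])
  have sh: "square_integrable (helmholtz (k\<^sup>2 - 1) f)" by (rule helmholtz_square_integrable[OF f])
  have "AE x in hyp_measure. radial_apply (green k) (helmholtz (k\<^sup>2 - 1) f) x = complex_of_real (4 * pi) * f x"
    using AE_hyp_measure_in by eventually_elim (rule green_representation[OF k f])
  then show ?thesis
    unfolding radial_op_abs[OF green_integral(1)[OF k] sh] abs_scaleR[OF sf]
      abs_eq_iff[OF radial_apply_square_integrable[OF green_integral(1)[OF k] sh] square_integrable_scale[OF sf]] .
qed

text \<open>
  If \<open>u\<close> is orthogonal to the range, then for every test function \<open>f\<close> and every \<open>e\<close> it is orthogonal to
  the image of \<open>f\<close> under the kernel \<open>rho k e\<close>, which is the image of \<open>((k\<^sup>2 - 1) - \<Delta>) f\<close> under the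
  shifted Green function.  As \<open>e\<close> tends to 0 the latter converges in norm to \<open>4 \<pi> f\<close>.
\<close>

theorem helmholtz_range_dense: "closure {abs_hyp_L2 (helmholtz (k\<^sup>2 - 1) f) | f. f \<in> test_functions} = UNIV"
proof (rule dense_subspace_if_no_orthogonal)
  let ?M = "{abs_hyp_L2 (helmholtz (k\<^sup>2 - 1) f) | f. f \<in> test_functions}"
  have comb: "a *\<^sub>R abs_hyp_L2 (helmholtz (k\<^sup>2 - 1) f) + b *\<^sub>R abs_hyp_L2 (helmholtz (k\<^sup>2 - 1) h)
      = abs_hyp_L2 (helmholtz (k\<^sup>2 - 1) (\<lambda>x. complex_of_real a * f x + complex_of_real b * h x))"
    if "f \<in> test_functions" "h \<in> test_functions" for a b f h
  proof -
    note s = helmholtz_square_integrable[OF that(1), of "k\<^sup>2 - 1"] helmholtz_square_integrable[OF that(2), of "k\<^sup>2 - 1"]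
    have c: "square_integrable (helmholtz (k\<^sup>2 - 1) (\<lambda>x. complex_of_real a * f x + complex_of_real b * h x))"
      by (intro helmholtz_square_integrable test_functions_lincomb that)
    have l: "square_integrable (\<lambda>x. complex_of_real a * helmholtz (k\<^sup>2 - 1) f x + complex_of_real b * helmholtz (k\<^sup>2 - 1) h x)"
      by (intro square_integrable_add square_integrable_scale s)
    show ?thesis
      unfolding abs_scaleR[OF s(1)] abs_scaleR[OF s(2)] abs_add[OF square_integrable_scale[OF s(1)] square_integrable_scale[OF s(2)]] abs_eq_iff[OF l c]
      by (rule AE_I2) (simp add: helmholtz_lincomb[OF that])
  qed
  show "subspace ?M"
    unfolding subspace_def
  proof (intro conjI ballI allI)
    have "(\<lambda>x. 0) \<in> test_functions" using elem_test_function[OF elem.const[of 0], of "{}"] by simp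
    then have "0 *\<^sub>R abs_hyp_L2 (helmholtz (k\<^sup>2 - 1) (\<lambda>x. 0)) + 0 *\<^sub>R abs_hyp_L2 (helmholtz (k\<^sup>2 - 1) (\<lambda>x. 0)) \<in> ?M"
      using comb[of "\<lambda>x. 0" "\<lambda>x. 0" 0 0] test_functions_lincomb[of "\<lambda>x. 0" "\<lambda>x. 0" 0 0] by auto
    then show "0 \<in> ?M" by simp
    show "u + v \<in> ?M" if uv: "u \<in> ?M" "v \<in> ?M" for u v
    proof -
      obtain f h where fh: "u = abs_hyp_L2 (helmholtz (k\<^sup>2 - 1) f)" "f \<in> test_functions"
        "v = abs_hyp_L2 (helmholtz (k\<^sup>2 - 1) h)" "h \<in> test_functions" using uv by blast
      show ?thesis using comb[OF fh(2,4), of 1 1] test_functions_lincomb[OF fh(2,4), of 1 1] fh(1,3) by auto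
    qed
    show "r *\<^sub>R u \<in> ?M" if u: "u \<in> ?M" for r u
    proof -
      obtain f where fh: "u = abs_hyp_L2 (helmholtz (k\<^sup>2 - 1) f)" "f \<in> test_functions" using u by blast
      show ?thesis using comb[OF fh(2,2), of r 0] test_functions_lincomb[OF fh(2,2), of "complex_of_real r" 0] fh(1) by auto
    qed
  qed
  fix u assume orth: "\<And>m. m \<in> ?M \<Longrightarrow> u \<bullet> m = 0"
  obtain g where g: "u = abs_hyp_L2 g" "square_integrable g" by (rule hyp_L2_cases)
  show "u = 0"
  proof (rule test_functions_separate)
    fix f assume f: "f \<in> test_functions"
    note sf = test_function_square_integrable[OF f]
    note sh = helmholtz_square_integrable[OF f, of "k\<^sup>2 - 1"]
    let ?h = "abs_hyp_L2 (helmholtz (k\<^sup>2 - 1) f)"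
    let ?q = "\<lambda>n c. green k (c + eps n)"
    note qi = shift_green_integrable[OF k eps(1)]
    note gi = green_integral(1)[OF k]
    have z: "u \<bullet> radial_op (?q n) ?h = 0" for n
    proof -
      have "radial_op (rho k (eps n)) u = 0"
        unfolding g(1)
      proof (rule orthogonal_complement_rho[OF g(2) eps(1)])
        fix h assume "h \<in> test_functions"
        then have "abs_hyp_L2 (helmholtz (k\<^sup>2 - 1) h) \<in> ?M" by blast
        then show "abs_hyp_L2 g \<bullet> abs_hyp_L2 (helmholtz (k\<^sup>2 - 1) h) = 0" using orth g(1) by simp
      qed
      then have "u \<bullet> radial_op (rho k (eps n)) (abs_hyp_L2 f) = 0"
        by (simp add: radial_op_symmetric[OF rho_integrable[OF k eps(1)], symmetric])
      moreover have "radial_op (rho k (eps n)) (abs_hyp_L2 f) = radial_op (?q n) ?h"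
      proof -
        have "AE x in hyp_measure. radial_apply (rho k (eps n)) f x = radial_apply (?q n) (helmholtz (k\<^sup>2 - 1) f) x"
          using AE_hyp_measure_in by eventually_elim (rule shift_green_helmholtz[OF k eps(1) f, symmetric])
        then show ?thesis
          unfolding radial_op_abs[OF qi sh] radial_op_abs[OF rho_integrable[OF k eps(1)] sf]
            abs_eq_iff[OF radial_apply_square_integrable[OF rho_integrable[OF k eps(1)] sf] radial_apply_square_integrable[OF qi sh]] .
      qed
      ultimately show ?thesis by simp
    qed
    have "(\<lambda>n. radial_op (green k) - radial_op (?q n)) \<longlonglongrightarrow> 0"
    proof (rule Lim_null_comparison[OF always_eventually shift_green_mass_limit[OF k eps]], rule allI)
      show "norm (radial_op (green k) - radial_op (?q n)) \<le> radial_mass (\<lambda>c. green k c - ?q n c)" for n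
        unfolding radial_op_diff[OF gi qi] by (rule norm_radial_op) (use gi qi in simp)
    qed
    then have "(\<lambda>n. u \<bullet> (radial_op (green k) - radial_op (?q n)) ?h) \<longlonglongrightarrow> u \<bullet> blinfun_apply 0 ?h"
      by (intro tendsto_intros)
    then have "u \<bullet> radial_op (green k) ?h = 0"
      by (simp add: blinfun.diff_left inner_diff_right z LIMSEQ_const_iff)
    then show "u \<bullet> abs_hyp_L2 f = 0" by (simp add: radial_op_green_helmholtz[OF f])
  qed
qed

end

subsection \<open>The resolvent is a radial operator\<close>

definition green_op :: "real \<Rightarrow> hyp_L2 \<Rightarrow>\<^sub>L hyp_L2" where
  "green_op l = radial_op (\<lambda>c. 1 / (4 * pi) * green (sqrt (1 + l)) c)"

context
  fixes l :: real
  assumes l: "0 < l"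
begin

lemma green_op_kernel_integrable: "integrable radial_measure (\<lambda>c. 1 / (4 * pi) * green (sqrt (1 + l)) c)"
  using l by (intro scaled_green_integrable) simp

lemma green_op_helmholtz:
  assumes f: "f \<in> test_functions"
  shows "green_op l (abs_hyp_L2 (helmholtz l f)) = abs_hyp_L2 f"
proof -
  have k: "1 < sqrt (1 + l)" "(sqrt (1 + l))\<^sup>2 - 1 = l" using l by simp_all
  have "green_op l = (1 / (4 * pi)) *\<^sub>R radial_op (green (sqrt (1 + l)))"
    unfolding green_op_def by (rule radial_op_scaleR[OF green_integral(1)[OF k(1)]])
  then show ?thesis using radial_op_green_helmholtz[OF k(1) f] pi_gt_zero by (simp add: k(2) blinfun.scaleR_left)
qed

lemma helmholtz_range: "closure {abs_hyp_L2 (helmholtz l f) | f. f \<in> test_functions} = UNIV"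
  using helmholtz_range_dense[of "sqrt (1 + l)"] l by simp

lemma abs_helmholtz:
  assumes f: "f \<in> test_functions"
  shows "abs_hyp_L2 (helmholtz l f) = abs_hyp_L2 (\<lambda>x. - hyp_laplacian f x) + l *\<^sub>R abs_hyp_L2 f"
proof -
  note s = test_function_square_integrable[OF f] test_function_laplacian_square_integrable[OF f]
  show ?thesis
    unfolding abs_scaleR[OF s(1)] abs_add[OF square_integrable_uminus[OF s(2)] square_integrable_scale[OF s(1)]]
    by (rule arg_cong[of _ _ abs_hyp_L2]) (simp add: fun_eq_iff helmholtz_def)
qed

text \<open>
  On test functions \<open>green_op l\<close> inverts \<open>l - \<Delta>\<close>.  Continuity of \<open>green_op l\<close> extends this to the closure,
  and density of the range shows that the closure contains the whole graph.
\<close>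

theorem hyp_H_iff: "(f, g) \<in> hyp_H \<longleftrightarrow> green_op l (g + l *\<^sub>R f) = f"
proof
  assume "(f, g) \<in> hyp_H"
  then obtain s where s: "\<And>n. s n \<in> neg_laplacian_graph" "s \<longlonglongrightarrow> (f, g)"
    unfolding hyp_H_def closure_sequential by blast
  have eq: "green_op l (snd (s n) + l *\<^sub>R fst (s n)) = fst (s n)" for n
  proof -
    obtain h where "s n = (abs_hyp_L2 h, abs_hyp_L2 (\<lambda>x. - hyp_laplacian h x))" "h \<in> test_functions"
      using s(1)[of n] unfolding neg_laplacian_graph_def by blast
    then show ?thesis using green_op_helmholtz abs_helmholtz by simp
  qed
  have "(\<lambda>n. green_op l (snd (s n) + l *\<^sub>R fst (s n))) \<longlonglongrightarrow> green_op l (snd (f, g) + l *\<^sub>R fst (f, g))"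
    by (intro tendsto_intros s(2))
  moreover have "(\<lambda>n. fst (s n)) \<longlonglongrightarrow> fst (f, g)" by (intro tendsto_intros s(2))
  ultimately show "green_op l (g + l *\<^sub>R f) = f" unfolding eq using LIMSEQ_unique by fastforce
next
  assume f: "green_op l (g + l *\<^sub>R f) = f"
  let ?h = "g + l *\<^sub>R f"
  have "?h \<in> closure {abs_hyp_L2 (helmholtz l f) | f. f \<in> test_functions}" by (simp add: helmholtz_range)
  then obtain s where s: "\<And>n. s n \<in> {abs_hyp_L2 (helmholtz l f) | f. f \<in> test_functions}" "s \<longlonglongrightarrow> ?h"
    unfolding closure_sequential by blast
  have "(green_op l (s n), s n - l *\<^sub>R green_op l (s n)) \<in> neg_laplacian_graph" for n
  proof -
    obtain h where "s n = abs_hyp_L2 (helmholtz l h)" "h \<in> test_functions" using s(1)[of n] by blast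
    then show ?thesis unfolding neg_laplacian_graph_def using green_op_helmholtz abs_helmholtz by auto
  qed
  moreover have "(\<lambda>n. (green_op l (s n), s n - l *\<^sub>R green_op l (s n))) \<longlonglongrightarrow> (green_op l ?h, ?h - l *\<^sub>R green_op l ?h)"
    by (intro tendsto_intros s(2))
  ultimately have "(green_op l ?h, ?h - l *\<^sub>R green_op l ?h) \<in> hyp_H"
    unfolding hyp_H_def closure_sequential by (intro exI[of _ "\<lambda>n. (green_op l (s n), s n - l *\<^sub>R green_op l (s n))"] conjI allI)
  then show "(f, g) \<in> hyp_H" by (simp add: f)
qed

theorem op_inverse_hyp_H: "op_inverse (op_shift hyp_H l) = green_op l"
proof -
  have graph: "op_graph (green_op l) = (op_shift hyp_H l)\<inverse>"
  proof -
    have "(h, f) \<in> op_graph (green_op l) \<longleftrightarrow> (f, h) \<in> op_shift hyp_H l" for h f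
    proof -
      have "(f, h) \<in> op_shift hyp_H l \<longleftrightarrow> (f, h - l *\<^sub>R f) \<in> hyp_H"
        unfolding op_shift_def by (auto intro!: exI[of _ "h - l *\<^sub>R f"])
      then show ?thesis unfolding hyp_H_iff op_graph_def by auto
    qed
    then show ?thesis by (auto simp: converse_iff)
  qed
  show ?thesis
    unfolding op_inverse_def
  proof (rule the_equality)
    show "green_op l \<in> bounded_ops \<and> op_graph (green_op l) = (op_shift hyp_H l)\<inverse>"
      using graph radial_op_bounded_ops[OF green_op_kernel_integrable] by (simp add: green_op_def)
    fix R assume "R \<in> bounded_ops \<and> op_graph R = (op_shift hyp_H l)\<inverse>"
    then have "op_graph R = op_graph (green_op l)" using graph by simp
    then show "R = green_op l" unfolding op_graph_def by (intro blinfun_eqI) blast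
  qed
qed

theorem green_op_std_alg: "green_op l \<in> std_alg"
  unfolding green_op_def by (rule radial_op_std_alg[OF green_op_kernel_integrable])

end

section \<open>The heat kernel\<close>

text \<open>
  The error function up to normalisation.
\<close>

definition gauss :: "real \<Rightarrow> real" where
  "gauss x = (LBINT u=ereal 0..ereal x. exp (- u\<^sup>2))"

lemma DERIV_gauss: "DERIV gauss x :> exp (- x\<^sup>2)"
proof -
  let ?a = "min x 0 - 1" and ?b = "max x 0 + 1"
  have "((\<lambda>u. LBINT y=ereal 0..ereal u. exp (- y\<^sup>2)) has_vector_derivative exp (- x\<^sup>2)) (at x within {?a..?b})"
    by (rule interval_integral_FTC2) (auto intro!: continuous_intros)
  then have "((\<lambda>u. LBINT y=ereal 0..ereal u. exp (- y\<^sup>2)) has_vector_derivative exp (- x\<^sup>2)) (at x)"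
    by (subst (asm) at_within_interior) (auto simp: interior_atLeastAtMost_real)
  then show ?thesis unfolding gauss_def[abs_def] has_real_derivative_iff_has_vector_derivative by simp
qed

lemma gauss_minus: "gauss (- x) = - gauss x"
  unfolding gauss_def
  by (subst interval_integral_reflect) (simp, rule interval_integral_endpoints_reverse)

lemma gauss_0 [simp]: "gauss 0 = 0"
  using gauss_minus[of 0] by simp

lemma gauss_at_top: "(gauss \<longlongrightarrow> sqrt pi / 2) at_top"
proof -
  have h: "has_bochner_integral lborel (\<lambda>x. indicator {0..} x *\<^sub>R exp (- x\<^sup>2)) (sqrt pi / 2)" by (rule gaussian_moment_0)
  then have i: "set_integrable lborel {0..} (\<lambda>x::real. exp (- x\<^sup>2))" and eq: "(LBINT x:{0..}. exp (- x\<^sup>2)) = sqrt pi / 2"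
    unfolding set_integrable_def set_lebesgue_integral_def by (auto simp: has_bochner_integral_iff)
  have "((\<lambda>b. LBINT x:{0..b}. exp (- x\<^sup>2)) \<longlongrightarrow> sqrt pi / 2) at_top"
    unfolding eq[symmetric] by (rule tendsto_set_lebesgue_integral_at_top[OF _ i]) simp
  moreover have "eventually (\<lambda>b. (LBINT x:{0..b}. exp (- x\<^sup>2)) = gauss b) at_top"
    using eventually_ge_at_top[of 0] by eventually_elim (simp add: gauss_def interval_integral_Icc)
  ultimately show ?thesis by (rule Lim_transform_eventually)
qed

lemma gauss_at_bot: "(gauss \<longlongrightarrow> - (sqrt pi / 2)) at_bot"
proof -
  have "((\<lambda>x. - gauss (- x)) \<longlongrightarrow> - (sqrt pi / 2)) at_bot"
    by (intro tendsto_minus filterlim_compose[OF gauss_at_top] filterlim_uminus_at_top_at_bot)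
  then show ?thesis by (simp add: gauss_minus)
qed

lemma isCont_gauss [continuous_intros]: "isCont f x \<Longrightarrow> isCont (\<lambda>x. gauss (f x)) x"
  using isCont_o2[OF _ DERIV_isCont[OF DERIV_gauss]] by blast

text \<open>
  \<open>arcosh c\<close>, written so that \<open>exp (rad c) = c + shc c\<close>.
\<close>

definition rad :: "real \<Rightarrow> real" where
  "rad c = ln (c + shc c)"

lemma rad_measurable [measurable]: "rad \<in> borel_measurable borel"
  unfolding rad_def[abs_def] by measurable

lemma rad_1 [simp]: "rad 1 = 0" by (simp add: rad_def)

lemma rad_pos: "1 < c \<Longrightarrow> 0 < rad c"
  using shc_facts(1)[of c] by (simp add: rad_def)

lemma exp_rad: "1 < c \<Longrightarrow> exp (rad c) = c + shc c" "1 < c \<Longrightarrow> exp (- rad c) = c - shc c"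
proof -
  assume c: "1 < c"
  show e: "exp (rad c) = c + shc c" using shc_facts(1)[OF c] c by (simp add: rad_def)
  have "(c + shc c) * (c - shc c) = 1" using shc_facts(2)[OF c] by (simp add: power2_eq_square algebra_simps)
  then show "exp (- rad c) = c - shc c" using e by (simp add: exp_minus inverse_unique)
qed

lemma DERIV_rad: assumes c: "1 < c" shows "DERIV rad c :> 1 / shc c"
proof -
  have "DERIV (\<lambda>c. c + shc c) c :> 1 + c / shc c" by (intro DERIV_add DERIV_ident DERIV_shc c)
  from DERIV_chain2[OF DERIV_ln this] have "DERIV rad c :> inverse (c + shc c) * (1 + c / shc c)"
    unfolding rad_def[abs_def] using shc_facts(1)[OF c] c by simp
  moreover have "inverse (c + shc c) * (1 + c / shc c) = 1 / shc c"
    using shc_facts(1)[OF c] c by (simp add: divide_simps)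
  ultimately show ?thesis by simp
qed

lemma rad_at_top: "filterlim rad at_top at_top"
proof (rule filterlim_at_top_mono[OF ln_at_top])
  show "eventually (\<lambda>c. ln c \<le> rad c) at_top"
    using eventually_gt_at_top[of 1] by eventually_elim (use shc_facts(1) in \<open>simp add: rad_def add_pos_pos less_imp_le\<close>)
qed

lemma green_rad: "1 < c \<Longrightarrow> green k c = exp (- k * rad c) / shc c"
  using shc_facts(1)[of c] by (simp add: green_def rad_def powr_def)

text \<open>
  The spatial profile of the heat kernel; unlike \<open>heat t c\<close> itself it is monotone in \<open>t\<close>.
\<close>

definition gkern :: "real \<Rightarrow> real \<Rightarrow> real" where
  "gkern t c = rad c * exp (- ((rad c)\<^sup>2 / (4 * t))) / shc c"

definition heat :: "real \<Rightarrow> real \<Rightarrow> real" where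
  "heat t c = exp (- t) / (8 * (sqrt pi * sqrt t) ^ 3) * gkern t c"

lemma heat_measurable [measurable]: "gkern t \<in> borel_measurable borel" "heat t \<in> borel_measurable borel"
  unfolding heat_def[abs_def] gkern_def[abs_def] by measurable

lemma gkern_pos: "1 < c \<Longrightarrow> 0 < gkern t c"
  using rad_pos shc_facts(1) by (simp add: gkern_def)

lemma heat_pos: "1 < c \<Longrightarrow> 0 < t \<Longrightarrow> 0 < heat t c"
  using gkern_pos by (simp add: heat_def)

lemma gkern_mono: "1 < c \<Longrightarrow> 0 < s \<Longrightarrow> s \<le> t \<Longrightarrow> gkern s c \<le> gkern t c"
  unfolding gkern_def using rad_pos[of c] shc_facts(1)[of c]
  by (intro divide_right_mono mult_left_mono) (auto intro!: divide_left_mono)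

context
  fixes t w :: real
  assumes w: "0 < w" and t: "t = w\<^sup>2"
begin

text \<open>
  An antiderivative in \<open>c\<close> of \<open>r exp (- r\<^sup>2 / 4t)\<close> with \<open>r = rad c\<close>, found by integrating by parts in \<open>r\<close>
  (\<open>dc = sinh r dr\<close>) and completing the square in \<open>cosh r exp (- r\<^sup>2 / 4t)\<close>.
\<close>

definition mass_prim :: "real \<Rightarrow> real" where
  "mass_prim c = 2 * t * (w * exp t * (gauss (rad c / (2 * w) - w) + gauss (rad c / (2 * w) + w)) - shc c * exp (- ((rad c)\<^sup>2 / (4 * t))))"

lemma complete_square:
  "exp (- (r / (2 * w) - w)\<^sup>2) = exp (- t) * exp r * exp (- (r\<^sup>2 / (4 * t)))"
  "exp (- (r / (2 * w) + w)\<^sup>2) = exp (- t) * exp (- r) * exp (- (r\<^sup>2 / (4 * t)))"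
proof -
  have "- (r / (2 * w) - w)\<^sup>2 = - t + r + - (r\<^sup>2 / (4 * t))" "- (r / (2 * w) + w)\<^sup>2 = - t + - r + - (r\<^sup>2 / (4 * t))"
    using w by (simp_all add: t power2_eq_square divide_simps) (simp_all add: algebra_simps)
  then show "exp (- (r / (2 * w) - w)\<^sup>2) = exp (- t) * exp r * exp (- (r\<^sup>2 / (4 * t)))"
    "exp (- (r / (2 * w) + w)\<^sup>2) = exp (- t) * exp (- r) * exp (- (r\<^sup>2 / (4 * t)))"
    by (simp_all only: exp_add)
qed

lemma DERIV_mass_prim:
  assumes c: "1 < c" shows "DERIV mass_prim c :> rad c * exp (- ((rad c)\<^sup>2 / (4 * t)))"
proof -
  let ?E = "exp (- ((rad c)\<^sup>2 / (4 * t)))"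
  note s = shc_facts(1)[OF c]
  have t0: "0 < t" using w by (simp add: t)
  have Da: "DERIV (\<lambda>c. rad c / (2 * w) + b) c :> 1 / shc c / (2 * w) + 0" for b
    by (intro DERIV_add DERIV_cdivide DERIV_rad[OF c] DERIV_const)
  have Dg: "DERIV (\<lambda>c. gauss (rad c / (2 * w) + b)) c :> exp (- (rad c / (2 * w) + b)\<^sup>2) * (1 / shc c / (2 * w) + 0)" for b
    by (rule DERIV_chain2[OF DERIV_gauss Da])
  have De: "DERIV (\<lambda>c. exp (- ((rad c)\<^sup>2 / (4 * t)))) c :> ?E * - ((2 * (1 / shc c * rad c)) / (4 * t))"
  proof (rule DERIV_chain2[OF DERIV_exp])
    have "DERIV (\<lambda>c. (rad c)\<^sup>2) c :> 2 * (1 / shc c * rad c)"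
      by (rule DERIV_cong[OF DERIV_power[OF DERIV_rad[OF c], of 2]]) simp
    then show "DERIV (\<lambda>c. - ((rad c)\<^sup>2 / (4 * t))) c :> - (2 * (1 / shc c * rad c) / (4 * t))"
      by (intro DERIV_minus DERIV_cdivide)
  qed
  have D: "DERIV mass_prim c :> 2 * t * (w * exp t * (exp (- (rad c / (2 * w) + - w)\<^sup>2) * (1 / shc c / (2 * w) + 0) + exp (- (rad c / (2 * w) + w)\<^sup>2) * (1 / shc c / (2 * w) + 0))
      - (c / shc c * ?E + ?E * - (2 * (1 / shc c * rad c) / (4 * t)) * shc c))"
    unfolding mass_prim_def[abs_def] diff_conv_add_uminus[of _ w]
    by (intro DERIV_cmult DERIV_diff DERIV_add Dg DERIV_mult DERIV_shc[OF c] De)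
  have x: "exp t * (exp (- t) * y * z) = y * z" for y z :: real by (simp add: exp_minus)
  have alg: "2 * t * (w * (((c + s) * e) * (1 / s / (2 * w) + 0) + ((c - s) * e) * (1 / s / (2 * w) + 0)) - (c / s * e + e * - (2 * (1 / s * r) / (4 * t)) * s)) = r * e"
    if "s \<noteq> 0" for s r e :: real
    using that w t0 by (simp add: divide_simps) (simp add: algebra_simps)
  have "2 * t * (w * exp t * (exp (- (rad c / (2 * w) + - w)\<^sup>2) * (1 / shc c / (2 * w) + 0) + exp (- (rad c / (2 * w) + w)\<^sup>2) * (1 / shc c / (2 * w) + 0))
      - (c / shc c * ?E + ?E * - (2 * (1 / shc c * rad c) / (4 * t)) * shc c))
    = 2 * t * (w * ((exp t * exp (- (rad c / (2 * w) - w)\<^sup>2)) * (1 / shc c / (2 * w) + 0) + (exp t * exp (- (rad c / (2 * w) + w)\<^sup>2)) * (1 / shc c / (2 * w) + 0))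
      - (c / shc c * ?E + ?E * - (2 * (1 / shc c * rad c) / (4 * t)) * shc c))"
    by (simp only: diff_conv_add_uminus[symmetric] distrib_left mult.assoc)
  also have "\<dots> = rad c * ?E"
    unfolding complete_square x exp_rad[OF c] by (rule alg) (use s in simp)
  finally show ?thesis using D by simp
qed

lemma mass_prim_at_1: "(mass_prim \<longlongrightarrow> 0) (at_right 1)"
proof -
  have r1: "isCont rad 1" unfolding rad_def[abs_def] by (intro continuous_intros) auto
  have "isCont mass_prim 1"
    unfolding mass_prim_def[abs_def] using w by (intro continuous_intros r1) (auto simp: t)
  moreover have "mass_prim 1 = 0" using w by (simp add: mass_prim_def gauss_minus)
  ultimately show ?thesis unfolding isCont_def by (simp add: filterlim_at_split)
qed

lemma mass_prim_at_top: "(mass_prim \<longlongrightarrow> 2 * t * (w * exp t * sqrt pi)) at_top"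
proof -
  have a: "filterlim (\<lambda>c. b + (1 / (2 * w)) * rad c) at_top at_top" for b
    using w by (intro filterlim_tendsto_add_at_top[OF tendsto_const] filterlim_tendsto_pos_mult_at_top[OF tendsto_const] rad_at_top) auto
  have g: "((\<lambda>c. gauss (rad c / (2 * w) - w)) \<longlongrightarrow> sqrt pi / 2) at_top" "((\<lambda>c. gauss (rad c / (2 * w) + w)) \<longlongrightarrow> sqrt pi / 2) at_top"
    using filterlim_compose[OF gauss_at_top a[of "- w"]] filterlim_compose[OF gauss_at_top a[of w]] by (simp_all add: add.commute)
  have "((\<lambda>c. shc c * exp (- ((rad c)\<^sup>2 / (4 * t)))) \<longlongrightarrow> 0) at_top"
  proof (rule Lim_null_comparison)
    have "filterlim (\<lambda>x::real. x\<^sup>2) at_top at_top" by (rule filterlim_pow_at_top[OF _ filterlim_ident]) simp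
    from filterlim_compose[OF exp_at_bot filterlim_compose[OF filterlim_uminus_at_bot_at_top filterlim_compose[OF this a[of "- w"]]]]
    have "((\<lambda>c. exp (- (rad c / (2 * w) - w)\<^sup>2)) \<longlongrightarrow> 0) at_top" by (simp add: add.commute)
    then show "((\<lambda>c. exp t * exp (- (rad c / (2 * w) - w)\<^sup>2)) \<longlongrightarrow> 0) at_top" by (rule tendsto_mult_right_zero)
    show "eventually (\<lambda>c. norm (shc c * exp (- ((rad c)\<^sup>2 / (4 * t)))) \<le> exp t * exp (- (rad c / (2 * w) - w)\<^sup>2)) at_top"
      using eventually_gt_at_top[of 1]
    proof eventually_elim
      case (elim c)
      have "exp t * exp (- (rad c / (2 * w) - w)\<^sup>2) = (c + shc c) * exp (- ((rad c)\<^sup>2 / (4 * t)))"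
        unfolding complete_square exp_rad[OF elim] by (simp add: exp_minus)
      then show ?case using shc_facts(1)[OF elim] elim by simp
    qed
  qed
  then have "(mass_prim \<longlongrightarrow> 2 * t * (w * exp t * (sqrt pi / 2 + sqrt pi / 2) - 0)) at_top"
    unfolding mass_prim_def[abs_def] by (intro tendsto_intros g)
  then show ?thesis by simp
qed

lemma gkern_integral:
  "integrable radial_measure (gkern t)" "(LINT c|radial_measure. gkern t c) = 8 * (sqrt pi * w) ^ 3 * exp t"
proof -
  let ?f = "\<lambda>c. rad c * exp (- ((rad c)\<^sup>2 / (4 * t)))"
  have t0: "t \<noteq> 0" using w by (simp add: t)
  have f: "isCont ?f c" if "ereal 1 < ereal c" for c
    using t0 that DERIV_isCont[OF DERIV_rad] by (intro continuous_intros) auto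
  have nn: "AE c in lborel. ereal 1 < ereal c \<longrightarrow> ereal c < \<infinity> \<longrightarrow> 0 \<le> ?f c"
    using rad_pos by (intro AE_I2) (auto intro!: mult_nonneg_nonneg less_imp_le)
  have A: "((mass_prim \<circ> real_of_ereal) \<longlongrightarrow> 0) (at_right (ereal 1))"
    unfolding ereal_tendsto_simps by (rule mass_prim_at_1)
  have B: "((mass_prim \<circ> real_of_ereal) \<longlongrightarrow> 2 * t * (w * exp t * sqrt pi)) (at_left \<infinity>)"
    unfolding ereal_tendsto_simps by (rule mass_prim_at_top)
  have e: "einterval (ereal 1) \<infinity> = {1<..}" by (auto simp: einterval_def)
  have I: "set_integrable lborel {1<..} ?f" "(LBINT c:{1<..}. ?f c) = 2 * t * (w * exp t * sqrt pi)"
    using interval_integral_FTC_nonneg[of "ereal 1" \<infinity> mass_prim ?f, OF _ DERIV_mass_prim f nn A B]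
    by (simp_all add: e interval_lebesgue_integral_def)
  have eq: "indicator {1<..} c *\<^sub>R (4 * pi * shc c * gkern t c) = indicator {1<..} c *\<^sub>R (4 * pi * ?f c)" for c
    using shc_facts(1)[of c] by (auto simp: gkern_def indicator_def)
  show "integrable radial_measure (gkern t)"
    using set_integrable_mult_right[OF I(1), of "4 * pi"]
    unfolding radial_measure_integrable_iff(1)[OF heat_measurable(1)] set_integrable_def eq by simp
  have "(LINT c|radial_measure. gkern t c) = (LBINT c:{1<..}. 4 * pi * ?f c)"
    unfolding radial_measure_integrable_iff(2)[OF heat_measurable(1)] set_lebesgue_integral_def eq ..
  also have "\<dots> = 4 * pi * (2 * t * (w * exp t * sqrt pi))" unfolding set_integral_mult_right I(2) ..
  also have "\<dots> = 8 * (sqrt pi * w) ^ 3 * exp t"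
    by (simp add: t power_mult_distrib power3_eq_cube power2_eq_square)
  finally show "(LINT c|radial_measure. gkern t c) = 8 * (sqrt pi * w) ^ 3 * exp t" .
qed

end

theorem heat_mass:
  assumes t: "0 < t"
  shows "integrable radial_measure (gkern t)" "integrable radial_measure (heat t)" "radial_mass (heat t) = 1"
proof -
  have w: "0 < sqrt t" "t = (sqrt t)\<^sup>2" using t by simp_all
  note g = gkern_integral[OF w]
  show "integrable radial_measure (gkern t)" by (rule g(1))
  show "integrable radial_measure (heat t)" unfolding heat_def[abs_def] by (intro integrable_mult_right g(1))
  have "AE c in radial_measure. \<bar>heat t c\<bar> = heat t c"
    using AE_radial_gt_1 by eventually_elim (use heat_pos[OF _ t] in \<open>simp add: less_imp_le\<close>)
  then have "radial_mass (heat t) = (LINT c|radial_measure. heat t c)"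
    by (intro integral_cong_AE) (auto simp: radial_borel_iff)
  also have "\<dots> = exp (- t) / (8 * (sqrt pi * sqrt t) ^ 3) * (8 * (sqrt pi * sqrt t) ^ 3 * exp t)"
    unfolding heat_def by (simp add: g(2))
  also have "\<dots> = 1" using t by (simp add: exp_minus)
  finally show "radial_mass (heat t) = 1" .
qed

subsection \<open>The Laplace transform of the heat kernel\<close>

context
  fixes r k :: real
  assumes r: "0 < r" and k: "0 < k"
begin

text \<open>
  With \<open>A = r / (2 sqrt t) + k sqrt t\<close> and \<open>B = r / (2 sqrt t) - k sqrt t\<close> the function
  \<open>exp (- k\<^sup>2 t - r\<^sup>2 / 4t)\<close> equals both \<open>exp (k r) exp (- A\<^sup>2)\<close> and \<open>exp (- k r) exp (- B\<^sup>2)\<close>, and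
  \<open>A' + B' = - r t\<^sup>-\<^sup>3\<^sup>/\<^sup>2 / 2\<close>.
\<close>

definition laplace_prim :: "real \<Rightarrow> real" where
  "laplace_prim t = - 2 * (exp (k * r) * gauss (r / 2 / sqrt t + k * sqrt t) + exp (- (k * r)) * gauss (r / 2 / sqrt t + - k * sqrt t))"

lemma DERIV_laplace_prim:
  assumes t: "0 < t"
  shows "DERIV laplace_prim t :> r * exp (- (k\<^sup>2 * t) - r\<^sup>2 / (4 * t)) / sqrt t ^ 3"
proof -
  let ?w = "sqrt t"
  have w: "0 < ?w" "?w\<^sup>2 = t" using t by simp_all
  have Dw: "DERIV sqrt t :> 1 / (2 * ?w)"
    by (rule DERIV_cong[OF DERIV_real_sqrt[OF t]]) (simp add: inverse_eq_divide)
  have Da: "DERIV (\<lambda>t. r / 2 / sqrt t + b * sqrt t) t :> (0 * ?w - r / 2 * (1 / (2 * ?w))) / (?w * ?w) + b * (1 / (2 * ?w))" for b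
    using w by (intro DERIV_add DERIV_cmult DERIV_divide DERIV_const Dw) auto
  have Dg: "DERIV (\<lambda>t. gauss (r / 2 / sqrt t + b * sqrt t)) t :> exp (- (r / 2 / ?w + b * ?w)\<^sup>2) * ((0 * ?w - r / 2 * (1 / (2 * ?w))) / (?w * ?w) + b * (1 / (2 * ?w)))" for b
    by (rule DERIV_chain2[OF DERIV_gauss Da])
  have sq: "exp (b * r) * exp (- (r / 2 / ?w + b * ?w)\<^sup>2) = exp (- (b\<^sup>2 * t) - r\<^sup>2 / (4 * t))" for b
  proof -
    have id: "b * r + - (r / 2 / v + b * v)\<^sup>2 = - (b\<^sup>2 * v\<^sup>2) - r\<^sup>2 / (4 * v\<^sup>2)" if "v \<noteq> 0" for v :: real
      using that by (simp add: power2_eq_square divide_simps) (simp add: algebra_simps)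
    have "b * r + - (r / 2 / ?w + b * ?w)\<^sup>2 = - (b\<^sup>2 * t) - r\<^sup>2 / (4 * t)"
      using id[of ?w] w unfolding w(2) by simp
    then show ?thesis by (simp add: exp_add[symmetric])
  qed
  have D: "DERIV laplace_prim t :> - 2 * (exp (k * r) * (exp (- (r / 2 / ?w + k * ?w)\<^sup>2) * ((0 * ?w - r / 2 * (1 / (2 * ?w))) / (?w * ?w) + k * (1 / (2 * ?w))))
     + exp (- (k * r)) * (exp (- (r / 2 / ?w + - k * ?w)\<^sup>2) * ((0 * ?w - r / 2 * (1 / (2 * ?w))) / (?w * ?w) + - k * (1 / (2 * ?w)))))"
    unfolding laplace_prim_def[abs_def] by (intro DERIV_cmult DERIV_add Dg)
  have alg: "- 2 * (X * ((0 * v - r / 2 * (1 / (2 * v))) / (v * v) + k * (1 / (2 * v))) + X * ((0 * v - r / 2 * (1 / (2 * v))) / (v * v) + - k * (1 / (2 * v)))) = r * X / v ^ 3"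
    if "v \<noteq> 0" for v X :: real
    using that by (simp add: divide_simps power3_eq_cube) (simp add: algebra_simps)
  have s2: "exp (- (k * r)) * exp (- (r / 2 / ?w + - k * ?w)\<^sup>2) = exp (- (k\<^sup>2 * t) - r\<^sup>2 / (4 * t))"
    using sq[of "- k"] by simp
  show ?thesis
    by (rule DERIV_cong[OF D]) (unfold mult.assoc[symmetric, of "exp (k * r)"] mult.assoc[symmetric, of "exp (- (k * r))"] sq s2, rule alg, use w in simp)
qed

lemma sqrt_limits:
  assumes A: "0 < A"
  shows "filterlim (\<lambda>t. A / sqrt t) at_top (at_right 0)" "((\<lambda>t. A / sqrt t) \<longlongrightarrow> 0) at_top"
    "((\<lambda>t. b * sqrt t) \<longlongrightarrow> 0) (at_right 0)"
proof -
  have s0: "(sqrt \<longlongrightarrow> 0) (at_right 0)"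
    using isCont_real_sqrt[of 0] unfolding isCont_def by (simp add: filterlim_at_split)
  have "eventually (\<lambda>t. 0 < sqrt t) (at_right 0)"
    unfolding eventually_at_right_field by (auto intro!: exI[of _ 1])
  then have "filterlim (\<lambda>t. inverse (sqrt t)) at_top (at_right 0)" by (rule filterlim_inverse_at_top[OF s0])
  then have "filterlim (\<lambda>t. A * inverse (sqrt t)) at_top (at_right 0)"
    by (rule filterlim_tendsto_pos_mult_at_top[OF tendsto_const A])
  then show "filterlim (\<lambda>t. A / sqrt t) at_top (at_right 0)" by (simp add: divide_inverse)
  show "((\<lambda>t. A / sqrt t) \<longlongrightarrow> 0) at_top"
    by (rule tendsto_divide_0[OF tendsto_const filterlim_mono[OF sqrt_at_top at_top_le_at_infinity order_refl]])
  show "((\<lambda>t. b * sqrt t) \<longlongrightarrow> 0) (at_right 0)" by (rule tendsto_mult_right_zero[OF s0])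
qed

lemma laplace_prim_limits:
  "(laplace_prim \<longlongrightarrow> - sqrt pi * (exp (k * r) + exp (- (k * r)))) (at_right 0)"
  "(laplace_prim \<longlongrightarrow> - sqrt pi * (exp (k * r) - exp (- (k * r)))) at_top"
proof -
  have r2: "0 < r / 2" using r by simp
  have a: "filterlim (\<lambda>t. r / 2 / sqrt t + b * sqrt t) at_top (at_right 0)" for b
    unfolding add.commute[of "r / 2 / _"]
    by (rule filterlim_tendsto_add_at_top[OF sqrt_limits(3)[OF r2] sqrt_limits(1)[OF r2]])
  have ks: "filterlim (\<lambda>t. k * sqrt t) at_top at_top"
    by (rule filterlim_tendsto_pos_mult_at_top[OF tendsto_const k sqrt_at_top])
  have b: "filterlim (\<lambda>t. r / 2 / sqrt t + k * sqrt t) at_top at_top"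
    by (rule filterlim_tendsto_add_at_top[OF sqrt_limits(2)[OF r2] ks])
  have "filterlim (\<lambda>t. - (r / 2 / sqrt t) + k * sqrt t) at_top at_top"
    using tendsto_minus[OF sqrt_limits(2)[OF r2]] by (intro filterlim_tendsto_add_at_top[OF _ ks]) simp
  from filterlim_compose[OF filterlim_uminus_at_bot_at_top this]
  have c: "filterlim (\<lambda>t. r / 2 / sqrt t + - k * sqrt t) at_bot at_top" by simp
  have "(laplace_prim \<longlongrightarrow> - 2 * (exp (k * r) * (sqrt pi / 2) + exp (- (k * r)) * (sqrt pi / 2))) (at_right 0)"
    unfolding laplace_prim_def[abs_def] by (intro tendsto_intros filterlim_compose[OF gauss_at_top a])
  then show "(laplace_prim \<longlongrightarrow> - sqrt pi * (exp (k * r) + exp (- (k * r)))) (at_right 0)"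
    by (rule back_subst[of "\<lambda>x. (laplace_prim \<longlongrightarrow> x) (at_right 0)"]) (simp add: algebra_simps)
  have "(laplace_prim \<longlongrightarrow> - 2 * (exp (k * r) * (sqrt pi / 2) + exp (- (k * r)) * (- (sqrt pi / 2)))) at_top"
    unfolding laplace_prim_def[abs_def] by (intro tendsto_intros filterlim_compose[OF gauss_at_top b] filterlim_compose[OF gauss_at_bot c])
  then show "(laplace_prim \<longlongrightarrow> - sqrt pi * (exp (k * r) - exp (- (k * r)))) at_top"
    by (rule back_subst[of "\<lambda>x. (laplace_prim \<longlongrightarrow> x) at_top"]) (simp add: algebra_simps)
qed

lemma gaussian_laplace:
  "set_integrable lborel {0<..} (\<lambda>t. r * exp (- (k\<^sup>2 * t) - r\<^sup>2 / (4 * t)) / sqrt t ^ 3)"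
  "(LBINT t:{0<..}. r * exp (- (k\<^sup>2 * t) - r\<^sup>2 / (4 * t)) / sqrt t ^ 3) = 2 * sqrt pi * exp (- (k * r))"
proof -
  let ?f = "\<lambda>t. r * exp (- (k\<^sup>2 * t) - r\<^sup>2 / (4 * t)) / sqrt t ^ 3"
  have D: "DERIV laplace_prim t :> ?f t" if "ereal 0 < ereal t" for t using that DERIV_laplace_prim by simp
  have f: "isCont ?f t" if "ereal 0 < ereal t" for t
    using that by (intro continuous_intros) auto
  have nn: "AE t in lborel. ereal 0 < ereal t \<longrightarrow> ereal t < \<infinity> \<longrightarrow> 0 \<le> ?f t"
    using r by (intro AE_I2) auto
  have A: "((laplace_prim \<circ> real_of_ereal) \<longlongrightarrow> - sqrt pi * (exp (k * r) + exp (- (k * r)))) (at_right (ereal 0))"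
    unfolding ereal_tendsto_simps by (rule laplace_prim_limits)
  have B: "((laplace_prim \<circ> real_of_ereal) \<longlongrightarrow> - sqrt pi * (exp (k * r) - exp (- (k * r)))) (at_left \<infinity>)"
    unfolding ereal_tendsto_simps by (rule laplace_prim_limits)
  have e: "einterval (ereal 0) \<infinity> = {0<..}" by (auto simp: einterval_def)
  have lt: "ereal 0 < \<infinity>" by simp
  note F = interval_integral_FTC_nonneg[OF lt D f nn A B]
  show "set_integrable lborel {0<..} ?f" using F(1) unfolding e by simp
  have "(LBINT t:{0<..}. ?f t) = - sqrt pi * (exp (k * r) - exp (- (k * r))) - - sqrt pi * (exp (k * r) + exp (- (k * r)))"
    using F(2) unfolding interval_lebesgue_integral_def e by simp
  then show "(LBINT t:{0<..}. ?f t) = 2 * sqrt pi * exp (- (k * r))" by (simp add: algebra_simps)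
qed

end

lemma heat_laplace:
  assumes l: "0 < l" and c: "1 < c"
  shows "set_integrable lborel {0<..} (\<lambda>t. exp (- l * t) * heat t c)"
    and "(LBINT t:{0<..}. exp (- l * t) * heat t c) = 1 / (4 * pi) * green (sqrt (1 + l)) c"
proof -
  let ?k = "sqrt (1 + l)"
  let ?C = "1 / (8 * sqrt pi ^ 3 * shc c)"
  have k: "0 < ?k" using l by simp
  note g = gaussian_laplace[OF rad_pos[OF c] k]
  have eq: "exp (- l * t) * heat t c = ?C * (rad c * exp (- (?k\<^sup>2 * t) - (rad c)\<^sup>2 / (4 * t)) / sqrt t ^ 3)" for t
  proof -
    have "exp (- (?k\<^sup>2 * t) - (rad c)\<^sup>2 / (4 * t)) = exp (- l * t) * (exp (- t) * exp (- ((rad c)\<^sup>2 / (4 * t))))"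
      unfolding exp_add[symmetric] using l by (simp add: algebra_simps)
    then show ?thesis by (simp add: heat_def gkern_def power_mult_distrib mult_ac)
  qed
  show "set_integrable lborel {0<..} (\<lambda>t. exp (- l * t) * heat t c)"
    unfolding eq by (intro set_integrable_mult_right g)
  have "(LBINT t:{0<..}. exp (- l * t) * heat t c) = ?C * (2 * sqrt pi * exp (- (?k * rad c)))"
    unfolding eq set_integral_mult_right g(2) ..
  also have "\<dots> = 1 / (4 * pi) * green ?k c"
  proof -
    have "sqrt pi ^ 3 = pi * sqrt pi" by (simp add: power3_eq_cube)
    then show ?thesis using pi_gt_zero by (simp add: green_rad[OF c])
  qed
  finally show "(LBINT t:{0<..}. exp (- l * t) * heat t c) = 1 / (4 * pi) * green (sqrt (1 + l)) c" .
qed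

subsection \<open>The heat operators\<close>

definition heat_op :: "real \<Rightarrow> hyp_L2 \<Rightarrow>\<^sub>L hyp_L2" where
  "heat_op t = radial_op (heat t)"

lemma heat_op_contraction: "0 < t \<Longrightarrow> norm (heat_op t f) \<le> norm f"
  using order_trans[OF norm_blinfun mult_right_mono[OF norm_radial_op[OF heat_mass(2)] norm_ge_zero]]
  by (simp add: heat_op_def heat_mass(3))

text \<open>
  On \<open>[a, 4 a]\<close> all heat kernels are dominated by a multiple of \<open>gkern (4 * a)\<close>, so they depend
  continuously on \<open>t\<close> in \<open>L\<^sup>1\<close>, and Schur's test carries this over to the operator norm.
\<close>

lemma heat_op_continuous_Icc: assumes a: "0 < a" shows "continuous_on {a..4 * a} heat_op"
  unfolding continuous_on_sequentially
proof (intro allI ballI impI, elim conjE)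
  fix x :: "nat \<Rightarrow> real" and t assume t: "t \<in> {a..4 * a}" and x: "\<forall>n. x n \<in> {a..4 * a}" "x \<longlonglongrightarrow> t"
  have t0: "0 < t" and x0: "0 < x n" for n using a t x(1)[rule_format, of n] by auto
  let ?D = "1 / (8 * (sqrt pi * sqrt a) ^ 3)"
  have dom: "\<bar>heat s c\<bar> \<le> ?D * gkern (4 * a) c" if s: "s \<in> {a..4 * a}" and c: "1 < c" for s c
  proof -
    have s': "0 < s" "a \<le> s" "s \<le> 4 * a" using s a by auto
    have "heat s c \<le> ?D * gkern (4 * a) c"
      unfolding heat_def
    proof (rule mult_mono)
      have "(sqrt pi * sqrt a) ^ 3 \<le> (sqrt pi * sqrt s) ^ 3" using s' a by (intro power_mono mult_left_mono) auto
      then show "exp (- s) / (8 * (sqrt pi * sqrt s) ^ 3) \<le> ?D"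
        using s' a by (intro frac_le) auto
    qed (use gkern_mono[OF c s'(1) s'(3)] gkern_pos[OF c, of s] a in auto)
    then show ?thesis using heat_pos[OF c s'(1)] by simp
  qed
  have "(\<lambda>n. LINT c|radial_measure. \<bar>heat (x n) c - heat t c\<bar>) \<longlonglongrightarrow> (LINT c|radial_measure. 0)"
  proof (rule integral_dominated_convergence)
    show "integrable radial_measure (\<lambda>c. 2 * (?D * gkern (4 * a) c))"
      using heat_mass(1)[of "4 * a"] a by simp
    show "AE c in radial_measure. norm \<bar>heat (x n) c - heat t c\<bar> \<le> 2 * (?D * gkern (4 * a) c)" for n
      using AE_radial_gt_1
    proof eventually_elim
      case (elim c)
      show ?case using dom[OF x(1)[rule_format, of n] elim] dom[OF t elim] by simp
    qed
    show "AE c in radial_measure. (\<lambda>n. \<bar>heat (x n) c - heat t c\<bar>) \<longlonglongrightarrow> 0"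
      using AE_radial_gt_1
    proof eventually_elim
      case (elim c)
      have "isCont (\<lambda>s. heat s c) t"
        unfolding heat_def gkern_def using t0 shc_facts(1)[OF elim] by (intro continuous_intros) auto
      then have "(\<lambda>n. heat (x n) c) \<longlonglongrightarrow> heat t c" by (rule isCont_tendsto_compose[OF _ x(2)])
      then have "(\<lambda>n. \<bar>heat (x n) c - heat t c\<bar>) \<longlonglongrightarrow> \<bar>heat t c - heat t c\<bar>" by (intro tendsto_intros)
      then show "(\<lambda>n. \<bar>heat (x n) c - heat t c\<bar>) \<longlonglongrightarrow> 0" by simp
    qed
  qed (simp_all add: radial_borel_iff)
  then have m: "(\<lambda>n. radial_mass (\<lambda>c. heat (x n) c - heat t c)) \<longlonglongrightarrow> 0" by simp
  have "norm (heat_op (x n) - heat_op t) \<le> radial_mass (\<lambda>c. heat (x n) c - heat t c)" for n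
    unfolding heat_op_def radial_op_diff[OF heat_mass(2)[OF x0] heat_mass(2)[OF t0]]
    by (rule norm_radial_op) (use heat_mass(2)[OF x0] heat_mass(2)[OF t0] in simp)
  then have "(\<lambda>n. heat_op (x n) - heat_op t) \<longlonglongrightarrow> 0"
    by (intro Lim_null_comparison[OF always_eventually m]) simp
  then show "(heat_op \<circ> x) \<longlonglongrightarrow> heat_op t" unfolding o_def by (rule LIM_zero_cancel)
qed

lemma heat_op_continuous: "continuous_on {0<..} heat_op"
proof (rule continuous_at_imp_continuous_on, rule ballI)
  fix t :: real assume "t \<in> {0<..}"
  then have t: "0 < t" by simp
  have "continuous_on {t / 2..2 * t} heat_op" using heat_op_continuous_Icc[of "t / 2"] t by simp
  then show "isCont heat_op t"
    by (rule continuous_on_interior) (use t in \<open>auto simp: interior_atLeastAtMost_real\<close>)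
qed

lemma radial_op_inner_pair:
  assumes q: "integrable radial_measure q" and f: "square_integrable f" and g: "square_integrable g"
  shows "radial_op q (abs_hyp_L2 f) \<bullet> abs_hyp_L2 g
     = (LINT p|(hyp_measure \<Otimes>\<^sub>M hyp_measure). q (hyp_cosh (fst p) (snd p)) * (f (snd p) \<bullet> g (fst p)))"
  using hyp2.integral_fst'[OF radial_kernel_pair_integrable[OF q f g]] unfolding radial_op_inner[OF q f g]
  by (simp add: split_beta')

lemma AE_pair_hyp_cosh_gt_1: "AE p in (hyp_measure \<Otimes>\<^sub>M hyp_measure). 1 < hyp_cosh (fst p) (snd p)"
proof -
  have "AE x in hyp_measure. AE y in hyp_measure. 1 < hyp_cosh (fst (x, y)) (snd (x, y))"
  proof (rule AE_I2)
    fix x assume "x \<in> space hyp_measure"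
    then show "AE y in hyp_measure. 1 < hyp_cosh (fst (x, y)) (snd (x, y))" using AE_hyp_cosh_gt_1 by simp
  qed
  then show ?thesis by (intro hyp2.AE_pair_measure) auto
qed

text \<open>
  Fubini for the kernels.  The absolute value of the integrand integrates over \<open>t\<close> to the Green
  function times \<open>\<bar>f y \<bullet> g x\<bar>\<close>, which is integrable over pairs of points.
\<close>

theorem green_op_laplace:
  assumes l: "0 < l"
  shows "green_op l u \<bullet> v = (LBINT t:{0<..}. exp (- l * t) * (heat_op t u \<bullet> v))"
proof -
  obtain f where f: "u = abs_hyp_L2 f" "square_integrable f" by (rule hyp_L2_cases)
  obtain g where g: "v = abs_hyp_L2 g" "square_integrable g" by (rule hyp_L2_cases)
  have [measurable]: "f \<in> borel_measurable hyp_measure" "g \<in> borel_measurable hyp_measure"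
    using f g by (auto intro: square_integrable_measurable)
  let ?P = "hyp_measure \<Otimes>\<^sub>M hyp_measure"
  let ?c = "\<lambda>p. hyp_cosh (fst p) (snd p)"
  let ?J = "\<lambda>p. f (snd p) \<bullet> g (fst p)"
  let ?q = "\<lambda>c. 1 / (4 * pi) * green (sqrt (1 + l)) c"
  let ?h = "\<lambda>t c. indicator {0<..} t * (exp (- l * t) * heat t c)"
  interpret pl: pair_sigma_finite ?P lborel ..
  have qi: "integrable radial_measure ?q" by (rule green_op_kernel_integrable[OF l])
  have hi: "integrable lborel (\<lambda>t. ?h t c)" "(LINT t|lborel. ?h t c) = ?q c" if "1 < c" for c
    using heat_laplace[OF l that] by (simp_all add: set_integrable_def set_lebesgue_integral_def)
  have hn: "norm (?h t c * j) = ?h t c * \<bar>j\<bar>" if "1 < c" for t c j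
    using heat_pos[OF that, of t] by (cases "0 < t") (auto simp: abs_mult)
  have Qi: "integrable ?P (\<lambda>p. ?q (?c p) * ?J p)"
    using radial_kernel_pair_integrable[OF qi f(2) g(2)] by (simp add: split_beta')
  have [measurable]: "(\<lambda>(p, t). ?h t (?c p) * ?J p) \<in> borel_measurable (?P \<Otimes>\<^sub>M lborel)"
    unfolding heat_def gkern_def by measurable
  have I: "integrable (?P \<Otimes>\<^sub>M lborel) (\<lambda>(p, t). ?h t (?c p) * ?J p)"
  proof (rule pl.Fubini_integrable)
    show "integrable ?P (\<lambda>p. LINT t|lborel. norm (case (p, t) of (p, t) \<Rightarrow> ?h t (?c p) * ?J p))"
    proof (rule integrable_cong_AE_imp[OF integrable_norm[OF Qi]])
      show "AE p in ?P. norm (?q (?c p) * ?J p) = (LINT t|lborel. norm (case (p, t) of (p, t) \<Rightarrow> ?h t (?c p) * ?J p))"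
        using AE_pair_hyp_cosh_gt_1
      proof eventually_elim
        case (elim p)
        have "(LINT t|lborel. norm (case (p, t) of (p, t) \<Rightarrow> ?h t (?c p) * ?J p)) = (LINT t|lborel. ?h t (?c p) * \<bar>?J p\<bar>)"
          unfolding prod.case hn[OF elim] ..
        also have "\<dots> = ?q (?c p) * \<bar>?J p\<bar>" unfolding integral_mult_left_zero hi(2)[OF elim] ..
        also have "\<dots> = norm (?q (?c p) * ?J p)"
        proof -
          have "0 < green (sqrt (1 + l)) (?c p)" using l by (intro green_pos elim) simp
          then show ?thesis by (simp add: abs_mult)
        qed
        finally show ?case ..
      qed
    qed measurable
    show "AE p in ?P. integrable lborel (\<lambda>t. case (p, t) of (p, t) \<Rightarrow> ?h t (?c p) * ?J p)"
      using AE_pair_hyp_cosh_gt_1 by eventually_elim (simp only: prod.case, intro integrable_mult_left hi)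
  qed measurable
  have "green_op l u \<bullet> v = (LINT p|?P. ?q (?c p) * ?J p)"
    unfolding green_op_def f(1) g(1) by (rule radial_op_inner_pair[OF qi f(2) g(2)])
  also have "\<dots> = (LINT p|?P. LINT t|lborel. ?h t (?c p) * ?J p)"
  proof (rule integral_cong_AE)
    show "AE p in ?P. ?q (?c p) * ?J p = (LINT t|lborel. ?h t (?c p) * ?J p)"
      using AE_pair_hyp_cosh_gt_1 by eventually_elim (simp only: integral_mult_left_zero hi(2))
    show "(\<lambda>p. ?q (?c p) * ?J p) \<in> borel_measurable ?P" using Qi by (rule borel_measurable_integrable)
  qed measurable
  also have "\<dots> = (LINT t|lborel. LINT p|?P. ?h t (?c p) * ?J p)"
    by (rule pl.Fubini_integral[OF I, symmetric])
  also have "\<dots> = (LINT t|lborel. indicator {0<..} t *\<^sub>R (exp (- l * t) * (heat_op t u \<bullet> v)))"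
  proof (intro Bochner_Integration.integral_cong refl)
    fix t :: real
    show "(LINT p|?P. ?h t (?c p) * ?J p) = indicator {0<..} t *\<^sub>R (exp (- l * t) * (heat_op t u \<bullet> v))"
    proof (cases "0 < t")
      case True
      have "(LINT p|?P. ?h t (?c p) * ?J p) = (LINT p|?P. exp (- l * t) * (heat t (?c p) * ?J p))"
        using True by (simp add: mult.assoc)
      also have "\<dots> = exp (- l * t) * (heat_op t u \<bullet> v)"
        unfolding heat_op_def f(1) g(1) radial_op_inner_pair[OF heat_mass(2)[OF True] f(2) g(2)] by simp
      finally show ?thesis using True by simp
    qed simp
  qed
  finally show ?thesis by (simp add: set_lebesgue_integral_def)
qed

section \<open>The heat semigroup\<close>

text \<open>
  Immediate from \<open>hyp_H_iff\<close>, because both resolvents describe the same operator \<open>H\<close>.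
\<close>

lemma green_op_resolvent_identity:
  assumes l: "0 < l" and m: "0 < m"
  shows "green_op l f - green_op m f = (m - l) *\<^sub>R green_op l (green_op m f)"
proof -
  let ?u = "green_op m f"
  have "(?u, f - m *\<^sub>R ?u) \<in> hyp_H" unfolding hyp_H_iff[OF m] by simp
  then have "green_op l (f - m *\<^sub>R ?u + l *\<^sub>R ?u) = ?u" unfolding hyp_H_iff[OF l] .
  then have "green_op l f - m *\<^sub>R green_op l ?u + l *\<^sub>R green_op l ?u = ?u"
    by (simp add: blinfun.diff_right blinfun.add_right blinfun.scaleR_right)
  then show ?thesis by (simp add: algebra_simps)
qed

lemma green_op_range_dense:
  assumes l: "0 < l" shows "closure (range (green_op l)) = UNIV"
proof (rule dense_subspace_if_no_orthogonal)
  show "subspace (range (green_op l))"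
    using linear_subspace_image[OF bounded_linear.linear[OF blinfun.bounded_linear_right] subspace_UNIV] by simp
  fix u assume orth: "\<And>m. m \<in> range (green_op l) \<Longrightarrow> u \<bullet> m = 0"
  show "u = 0"
  proof (rule test_functions_separate)
    fix f assume "f \<in> test_functions"
    then have "abs_hyp_L2 f = green_op l (abs_hyp_L2 (helmholtz l f))" by (simp add: green_op_helmholtz[OF l])
    then show "u \<bullet> abs_hyp_L2 f = 0" using orth by simp
  qed
qed

interpretation heat: laplace_family heat_op green_op
proof
  show "norm (heat_op t f) \<le> norm f" if "0 < t" for t f by (rule heat_op_contraction[OF that])
  show "heat_op t f \<bullet> g = f \<bullet> heat_op t g" if "0 < t" for t f g
    unfolding heat_op_def by (rule radial_op_symmetric[OF heat_mass(2)[OF that]])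
  show "continuous_on {0<..} (\<lambda>t. heat_op t f \<bullet> g)" for f g
    by (intro continuous_intros heat_op_continuous)
  show "green_op l f \<bullet> g = (LBINT t:{0<..}. exp (- l * t) * (heat_op t f \<bullet> g))" if "0 < l" for l f g
    by (rule green_op_laplace[OF that])
  show "green_op l f - green_op m f = (m - l) *\<^sub>R green_op l (green_op m f)" if "0 < l" "0 < m" for l m f
    by (rule green_op_resolvent_identity[OF that])
  show "closure (range (green_op 1)) = UNIV" by (rule green_op_range_dense) simp
qed

text \<open>
  The generator is determined by the resolvent at 1, and so is \<open>- H\<close>.
\<close>

lemma heat_semigroup_generator: "heat.sg.gen f g \<longleftrightarrow> (f, g) \<in> op_uminus hyp_H"
proof -
  have "(f, g) \<in> op_uminus hyp_H \<longleftrightarrow> (f, - g) \<in> hyp_H"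
    unfolding op_uminus_def by (auto intro!: exI[of _ "- g"])
  then show ?thesis unfolding heat.gen_iff hyp_H_iff[OF zero_less_one] by simp
qed

lemma heat_c0_semigroup: "c0_semigroup heat.sg"
  unfolding c0_semigroup_def
proof (intro conjI allI impI)
  show "heat.sg t \<in> bounded_ops" for t
    unfolding heat.sg_def heat_op_def using radial_op_bounded_ops[OF heat_mass(2), of t]
    by (simp add: bounded_ops_def)
qed (rule heat.sg.zero heat.sg.add heat.sg.strong; assumption?)+

lemma c0_semigroup_strong: "c0_semigroup T \<Longrightarrow> strong_semigroup T"
  unfolding c0_semigroup_def strong_semigroup_def by blast

text \<open>
  Any semigroup competing in the definite description has generator \<open>- H\<close> and hence coincides
  with the heat semigroup.
\<close>

theorem op_exp_neg_hyp_H: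
  assumes t: "0 < t"
  shows "op_exp_neg hyp_H t = heat_op t"
  unfolding op_exp_neg_def
proof (rule the_equality)
  have gen: "generator heat.sg = op_uminus hyp_H"
    unfolding generator_def using heat_semigroup_generator by (auto simp: heat.sg.gen_def)
  have sgt: "heat.sg t = heat_op t" using t by (simp add: heat.sg_def)
  show "\<exists>T. c0_semigroup T \<and> generator T = op_uminus hyp_H \<and> heat_op t = T t"
    using heat_c0_semigroup gen sgt by auto
  fix A assume "\<exists>T. c0_semigroup T \<and> generator T = op_uminus hyp_H \<and> A = T t"
  then obtain T where T: "c0_semigroup T" "generator T = op_uminus hyp_H" "A = T t" by blast
  have S: "strong_semigroup T" by (rule c0_semigroup_strong[OF T(1)])
  have "T t = heat.sg t"
  proof (rule contraction_semigroup_unique[OF S heat.sg.strong_semigroup_axioms])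
    show "strong_semigroup.gen T f g \<longleftrightarrow> heat.sg.gen f g" for f g
      unfolding heat_semigroup_generator T(2)[symmetric] strong_semigroup.gen_def[OF S] generator_def by simp
    show "norm (heat.sg t f) \<le> norm f" if "0 \<le> t" for t f by (rule heat.sg_contraction)
    have "range (green_op 1) \<subseteq> {f. \<exists>g. heat.sg.gen f g}" using heat.gen_resolvent by blast
    then show "closure {f. \<exists>g. heat.sg.gen f g} = UNIV"
      using closure_mono green_op_range_dense[OF zero_less_one] by blast
  qed (use t in simp)
  then show "A = heat_op t" using T(3) sgt by simp
qed

theorem theorem44:
  fixes t lam :: real
  assumes "0 < lam" and "0 < t"
  shows "op_exp_neg hyp_H t \<in> std_alg \<and> op_inverse (op_shift hyp_H lam) \<in> std_alg"
proof
  show "op_exp_neg hyp_H t \<in> std_alg"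
    unfolding op_exp_neg_hyp_H[OF assms(2)] heat_op_def by (rule radial_op_std_alg[OF heat_mass(2)[OF assms(2)]])
  show "op_inverse (op_shift hyp_H lam) \<in> std_alg"
    unfolding op_inverse_hyp_H[OF assms(1)] by (rule green_op_std_alg[OF assms(1)])
qed

end
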